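(* Let $\mathcal{D}=\mathcal{D}^1\times\mathcal{D}^2$ be any product dyadic grid in $\mathbb{R}^n\times\mathbb{R}^m$. Let $1<p<\infty$, and let $W$ be a $d\times d$-matrix valued $\mathcal{D}$-dyadic biparameter $A_p$ weight on $\mathbb{R}^n\times\mathbb{R}^m$. Let $$S_{\mathcal{D},W}f(x):=\Big(\sum_{R\in\mathcal{D}}\sum_{\varepsilon\in\mathcal{E}}|W(x)^{1/p}f_R^{\varepsilon}|^2\frac{\mathbf{1}_R(x)}{|R|}\Big)^{1/2}.$$ Then $$\|S_{\mathcal{D},W}f\|_{L^p}\lesssim_{d,p,n,m}[W]_{A_p,\mathcal{D}}^{2\gamma(p)}\|f\|_{L^p(W)}\qquad\text{for all } f\in L^\infty_c(\mathbb{R}^{n+m};\mathbb{C}^d),$$ where $L^\infty_c$ denotes the compactly supported $L^\infty$ functions.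
   Context: $x\lesssim_{a,b}y$ means $x\le cy$ with a finite constant $c$ depending only on $a,b$. $p'=p/(p-1)$; $\gamma(p):=\frac1{p-1}$ if $1<p\le2$, $\gamma(p):=\frac12+\frac1{p(p-1)}$ if $p>2$. A dyadic grid in $\mathbb{R}$ is a collection $\bigcup_{k\in\mathbb{Z}}\mathcal{D}_k$ of left-closed right-open intervals, where each $\mathcal{D}_k$ partitions $\mathbb{R}$ into intervals of length $2^{-k}$ and each interval of $\mathcal{D}_k$ is the union of exactly two intervals of $\mathcal{D}_{k+1}$. A dyadic grid in $\mathbb{R}^n$ is the family of cubes $I_1\times\dots\times I_n$ with $I_i$ in the $i$-th of $n$ given dyadic grids in $\mathbb{R}$, all of the same length. $\mathcal{D}=\mathcal{D}^1\times\mathcal{D}^2$ is the family of rectangles $R_1\times R_2$, $R_i\in\mathcal{D}^i$. Haar functions: for an interval $I$ with right/left halves $I_\pm$, $h_I^0:=(\mathbf{1}_{I_+}-\mathbf{1}_{I_-})/\sqrt{|I|}$, $h_I^1:=\mathbf{1}_I/\sqrt{|I|}$; for a cube $Q=I_1\times\dots\times I_n$ and $\varepsilon\in\{0,1\}^n$, $h_Q^\varepsilon:=h_{I_1}^{\varepsilon_1}\otimes\dots\otimes h_{I_n}^{\varepsilon_n}$. $\mathcal{E}:=\mathcal{E}^1\times\mathcal{E}^2$ with $\mathcal{E}^1=\{0,1\}^n\setminus\{(1,\dots,1)\}$, $\mathcal{E}^2=\{0,1\}^m\setminus\{(1,\dots,1)\}$; for $R=R_1\times R_2$, $\varepsilon=(\varepsilon_1,\varepsilon_2)\in\mathcal{E}$,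 $h_R^\varepsilon:=h_{R_1}^{\varepsilon_1}\otimes h_{R_2}^{\varepsilon_2}$ and $f_R^\varepsilon:=\int f h_R^\varepsilon\in\mathbb{C}^d$. A $d\times d$-matrix valued weight is a locally integrable $M_d(\mathbb{C})$-valued function, positive definite a.e. $\|f\|_{L^p(W)}:=(\int|W^{1/p}f|^p)^{1/p}$. $[W]_{A_p,\mathcal{D}}:=\sup_{R\in\mathcal{D}}\frac1{|R|}\int_R\big(\frac1{|R|}\int_R|W(x)^{1/p}W(y)^{-1/p}|^{p'}dy\big)^{p/p'}dx$; $W$ is a $\mathcal{D}$-dyadic biparameter $A_p$ weight if this is finite. *)

theory Defs
  imports "HOL-Analysis.Analysis"
begin

subsection \<open>Powers of positive definite matrices\<close>

definition cadjoint :: "complex^'d^'d \<Rightarrow> complex^'d^'d"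
  where "cadjoint A = (\<chi> i j. cnj (A $ j $ i))"

definition posdef :: "complex^'d^'d \<Rightarrow> bool"
  where "posdef A \<longleftrightarrow> cadjoint A = A \<and>
    (\<forall>v. v \<noteq> 0 \<longrightarrow> 0 < Re (\<Sum>i\<in>UNIV. cnj (v $ i) * (A *v v) $ i))"

definition unitary_mat :: "complex^'d^'d \<Rightarrow> bool"
  where "unitary_mat U \<longleftrightarrow> cadjoint U ** U = mat 1 \<and> U ** cadjoint U = mat 1"

definition rdiag :: "('d \<Rightarrow> real) \<Rightarrow> complex^'d^'d"
  where "rdiag l = (\<chi> i j. if i = j then complex_of_real (l i) else 0)"

(* The functional calculus t |-> t^s. By the spectral theorem a decomposition exists for every
   positive definite A, and the result does not depend on it (lemma mat_powr_eq).
   For other A the value is unspecified. *)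
definition mat_powr :: "complex^'d^'d \<Rightarrow> real \<Rightarrow> complex^'d^'d"
  where "mat_powr A s = (THE B. \<exists>U l. unitary_mat U \<and> (\<forall>i. 0 < l i) \<and>
    A = U ** rdiag l ** cadjoint U \<and> B = U ** rdiag (\<lambda>i. l i powr s) ** cadjoint U)"

lemma rdiag_intertwine:
  fixes M :: "complex^'d^'d"
  assumes "M ** rdiag l = rdiag k ** M" "\<And>i. 0 < l i" "\<And>i. 0 < k i"
  shows "M ** rdiag (\<lambda>i. l i powr s) = rdiag (\<lambda>i. k i powr s) ** M"
proof -
  have R: "(M ** rdiag f) $ i $ j = M $ i $ j * of_real (f j)" for f :: "'d \<Rightarrow> real" and i j
    by (simp add: matrix_matrix_mult_def rdiag_def if_distrib cong: if_cong)
  have L: "(rdiag f ** M) $ i $ j = of_real (f i) * M $ i $ j" for f :: "'d \<Rightarrow> real" and i j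
    by (simp add: matrix_matrix_mult_def rdiag_def if_distrib[of "\<lambda>x. x * _"] cong: if_cong)
  have "M $ i $ j * of_real (l j) = of_real (k i) * M $ i $ j" for i j
    using R L assms(1) by metis
  then have "M $ i $ j = 0 \<or> l j = k i" for i j
    by (metis mult.commute mult_cancel_right of_real_eq_iff)
  then show ?thesis
    by (simp add: vec_eq_iff R L) (metis mult_zero_left mult_zero_right mult.commute)
qed

lemma mat_powr_eq:
  fixes U :: "complex^'d^'d"
  assumes U: "unitary_mat U" and l: "\<And>i. 0 < l i"
  shows "mat_powr (U ** rdiag l ** cadjoint U) s = U ** rdiag (\<lambda>i. l i powr s) ** cadjoint U"
  unfolding mat_powr_def
proof (rule the_equality)
  show "\<exists>V k. unitary_mat V \<and> (\<forall>i. 0 < k i) \<and>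
      U ** rdiag l ** cadjoint U = V ** rdiag k ** cadjoint V \<and>
      U ** rdiag (\<lambda>i. l i powr s) ** cadjoint U = V ** rdiag (\<lambda>i. k i powr s) ** cadjoint V"
    using assms by blast
next
  fix B
  assume "\<exists>V k. unitary_mat V \<and> (\<forall>i. 0 < k i) \<and>
      U ** rdiag l ** cadjoint U = V ** rdiag k ** cadjoint V \<and>
      B = V ** rdiag (\<lambda>i. k i powr s) ** cadjoint V"
  then obtain V k where V: "unitary_mat V" and k: "\<And>i. 0 < k i"
    and eq: "U ** rdiag l ** cadjoint U = V ** rdiag k ** cadjoint V"
    and B: "B = V ** rdiag (\<lambda>i. k i powr s) ** cadjoint V" by blast
  define M where "M = cadjoint V ** U"
  have UU: "cadjoint U ** U = mat 1" "U ** cadjoint U = mat 1"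
    and VV: "cadjoint V ** V = mat 1" "V ** cadjoint V = mat 1"
    using U V by (auto simp: unitary_mat_def)
  have "M ** rdiag l = cadjoint V ** (U ** rdiag l ** cadjoint U) ** U"
    by (simp add: M_def matrix_mul_assoc[symmetric] UU)
  also have "\<dots> = rdiag k ** M"
    by (simp add: eq M_def matrix_mul_assoc VV)
  finally have "M ** rdiag (\<lambda>i. l i powr s) = rdiag (\<lambda>i. k i powr s) ** M"
    using l k by (rule rdiag_intertwine)
  then have "V ** (M ** rdiag (\<lambda>i. l i powr s)) ** cadjoint U =
      V ** (rdiag (\<lambda>i. k i powr s) ** M) ** cadjoint U" by simp
  moreover have "V ** (M ** rdiag (\<lambda>i. l i powr s)) ** cadjoint U =
      U ** rdiag (\<lambda>i. l i powr s) ** cadjoint U"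
    by (simp add: M_def matrix_mul_assoc VV)
  moreover have "V ** (rdiag (\<lambda>i. k i powr s) ** M) ** cadjoint U = B"
    by (simp add: M_def B matrix_mul_assoc[symmetric] UU)
  ultimately show "B = U ** rdiag (\<lambda>i. l i powr s) ** cadjoint U" by simp
qed

definition opnorm :: "complex^'d^'d \<Rightarrow> real"
  where "opnorm A = onorm (\<lambda>v. A *v v)"

subsection \<open>Dyadic grids and Haar functions\<close>

definition dyadic_grid1 :: "real set set \<Rightarrow> bool"
  where "dyadic_grid1 G \<longleftrightarrow> (\<exists>D :: int \<Rightarrow> real set set. G = (\<Union>k. D k) \<and>
    (\<forall>k. partition_on UNIV (D k) \<and>
         (\<forall>I\<in>D k. \<exists>a. I = {a ..< a + 2 powi (- k)}) \<and>
         (\<forall>I\<in>D k. \<exists>J\<in>D (k + 1). \<exists>K\<in>D (k + 1). J \<noteq> K \<and> I = J \<union> K)))"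

definition dyadic_grid :: "(real^'n) set set \<Rightarrow> bool"
  where "dyadic_grid \<Q> \<longleftrightarrow> (\<exists>G :: 'n \<Rightarrow> real set set. (\<forall>i. dyadic_grid1 (G i)) \<and>
    \<Q> = {Q. \<exists>I. (\<forall>i. I i \<in> G i) \<and> (\<forall>i j. measure lborel (I i) = measure lborel (I j)) \<and>
               Q = {x. \<forall>i. x $ i \<in> I i}})"

(* the interval I_i of a nonempty cube Q = I_1 x ... x I_n *)
definition side :: "(real^'n) set \<Rightarrow> 'n \<Rightarrow> real set"
  where "side Q i = (\<lambda>x. x $ i) ` Q"

definition left_half :: "real set \<Rightarrow> real set"
  where "left_half I = {t \<in> I. t < (Inf I + Sup I) / 2}"

definition right_half :: "real set \<Rightarrow> real set"
  where "right_half I = {t \<in> I. (Inf I + Sup I) / 2 \<le> t}"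

(* Superscripts in {0,1} are Booleans: False is 0 (cancellative), True is 1. *)
definition haar1 :: "bool \<Rightarrow> real set \<Rightarrow> real \<Rightarrow> real"
  where "haar1 e I t =
    (if e then indicator I t else indicator (right_half I) t - indicator (left_half I) t)
      / sqrt (measure lborel I)"

definition haar_cube :: "('n \<Rightarrow> bool) \<Rightarrow> (real^'n) set \<Rightarrow> real^'n \<Rightarrow> real"
  where "haar_cube e Q x = (\<Prod>i\<in>UNIV. haar1 (e i) (side Q i) (x $ i))"

(* The rectangle R_1 x R_2 is encoded by the pair (R_1, R_2), so that the product grid is the
   set-theoretic product of the two grids; rect recovers the point set. *)
type_synonym ('n, 'm) rectangle = "(real^'n) set \<times> (real^'m) set"

definition rect :: "('n, 'm) rectangle \<Rightarrow> ((real^'n) \<times> (real^'m)) set"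
  where "rect R = fst R \<times> snd R"

type_synonym ('n, 'm) signature = "('n \<Rightarrow> bool) \<times> ('m \<Rightarrow> bool)"

definition signatures :: "('n, 'm) signature set"
  where "signatures = (UNIV - {\<lambda>_. True}) \<times> (UNIV - {\<lambda>_. True})"

definition haar :: "('n, 'm) signature \<Rightarrow> ('n, 'm) rectangle \<Rightarrow> (real^'n) \<times> (real^'m) \<Rightarrow> real"
  where "haar e R x = haar_cube (fst e) (fst R) (fst x) * haar_cube (snd e) (snd R) (snd x)"

definition haar_coeff ::
    "((real^'n) \<times> (real^'m) \<Rightarrow> complex^'d) \<Rightarrow> ('n, 'm) signature \<Rightarrow> ('n, 'm) rectangle \<Rightarrow> complex^'d"
  where "haar_coeff f e R = (\<integral>x. haar e R x *\<^sub>R f x \<partial>lebesgue)"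

subsection \<open>Weights, norms and the square function\<close>

(* only used with s > 0 *)
definition enn_powr :: "ennreal \<Rightarrow> real \<Rightarrow> ennreal"
  where "enn_powr x s = (if x = \<infinity> then \<infinity> else ennreal (enn2real x powr s))"

definition conj_exp :: "real \<Rightarrow> real"
  where "conj_exp p = p / (p - 1)"

definition gamma_exp :: "real \<Rightarrow> real"
  where "gamma_exp p = (if p \<le> 2 then 1 / (p - 1) else 1 / 2 + 1 / (p * (p - 1)))"

definition matrix_weight :: "('a::euclidean_space \<Rightarrow> complex^'d^'d) \<Rightarrow> bool"
  where "matrix_weight W \<longleftrightarrow>
    (\<forall>K. compact K \<longrightarrow> W absolutely_integrable_on K) \<and> (AE x in lebesgue. posdef (W x))"

definition Ap_const ::
    "real \<Rightarrow> ('n, 'm) rectangle set \<Rightarrow> ((real^'n) \<times> (real^'m) \<Rightarrow> complex^'d^'d) \<Rightarrow> ennreal"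
  where "Ap_const p \<D> W = (SUP R\<in>\<D>.
    (\<integral>\<^sup>+x\<in>rect R.
        enn_powr
          ((\<integral>\<^sup>+y\<in>rect R.
              ennreal (opnorm (mat_powr (W x) (1 / p) ** mat_powr (W y) (- (1 / p)))
                powr conj_exp p) \<partial>lebesgue) / emeasure lebesgue (rect R))
          (p / conj_exp p) \<partial>lebesgue) / emeasure lebesgue (rect R))"

definition Ap_weight ::
    "real \<Rightarrow> ('n, 'm) rectangle set \<Rightarrow> ((real^'n) \<times> (real^'m) \<Rightarrow> complex^'d^'d) \<Rightarrow> bool"
  where "Ap_weight p \<D> W \<longleftrightarrow> matrix_weight W \<and> Ap_const p \<D> W < \<infinity>"

definition Lp_norm :: "real \<Rightarrow> ('a::euclidean_space \<Rightarrow> ennreal) \<Rightarrow> ennreal"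
  where "Lp_norm p g = enn_powr (\<integral>\<^sup>+x. enn_powr (g x) p \<partial>lebesgue) (1 / p)"

definition weighted_Lp_norm ::
    "real \<Rightarrow> ('a::euclidean_space \<Rightarrow> complex^'d^'d) \<Rightarrow> ('a \<Rightarrow> complex^'d) \<Rightarrow> ennreal"
  where "weighted_Lp_norm p W f = Lp_norm p (\<lambda>x. ennreal (norm (mat_powr (W x) (1 / p) *v f x)))"

definition Linfty_c :: "('a::euclidean_space \<Rightarrow> complex^'d) set"
  where "Linfty_c = {f. f \<in> borel_measurable lebesgue \<and>
    (\<exists>B. AE x in lebesgue. norm (f x) \<le> B) \<and>
    (\<exists>K. compact K \<and> (AE x in lebesgue. x \<notin> K \<longrightarrow> f x = 0))}"

definition square_function ::
    "real \<Rightarrow> ('n, 'm) rectangle set \<Rightarrow> ((real^'n) \<times> (real^'m) \<Rightarrow> complex^'d^'d) \<Rightarrow>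
     ((real^'n) \<times> (real^'m) \<Rightarrow> complex^'d) \<Rightarrow> (real^'n) \<times> (real^'m) \<Rightarrow> ennreal"
  where "square_function p \<D> W f x =
    enn_powr
      (\<Sum>\<^sub>\<infinity>R\<in>\<D>. \<Sum>e\<in>signatures.
         ennreal ((norm (mat_powr (W x) (1 / p) *v haar_coeff f e R))\<^sup>2 * indicator (rect R) x
           / measure lebesgue (rect R)))
      (1 / 2)"

end

theory Submission
  imports Defs
begin

text \<open>
  The bound comes from applying a one-parameter square function estimate once in each variable. Fix
  \<open>x\<^sub>2\<close> and regard the partial Haar coefficients of \<open>f\<close> in the second variable as a family of
  functions of \<open>x\<^sub>1\<close>, indexed by the cubes through \<open>x\<^sub>2\<close> and the signatures. The estimate in \<open>x\<^sub>1\<close> for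
  this family, integrated in \<open>x\<^sub>2\<close>, followed by the estimate in \<open>x\<^sub>2\<close> for the single function \<open>f\<close> with
  \<open>x\<^sub>1\<close> fixed, bounds the square function (\<open>square_function_two_parameters\<close>). This is why the
  one-parameter estimate is proved for functions with values in \<open>l\<^sup>2(K)\<close>. Each application multiplies
  the \<open>p\<close>-th power of the norm by a multiple of \<open>A powr (p * gamma_exp p)\<close>, hence the exponent
  \<open>2 * gamma_exp p\<close>.

  That the slices of \<open>W\<close> are one-parameter weights with a constant at most \<open>2 powr (2 * p + 1)\<close> times
  the biparameter one (\<open>slices_factored_Ap\<close>) is seen by testing the weight condition on one vector
  at a time: an exceptional set of slices of positive measure would fill half of some cube, and then
  the test would already fail on a rectangle.

  For the one-parameter estimate (\<open>square_function_cube\<close>), Haar coefficients are dominated by mean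
  squares of martingale differences. A stopping process bounds their sum over all scales pointwise by
  the squared averages over a sparse family of cubes (\<open>sparse_domination\<close>). The matrix structure asks
  for a family that serves all directions simultaneously; it is obtained by stopping along finitely
  many vectors that span, up to a constant, the unit ball of the norm given by the average
  (\<open>almost_extremal_basis\<close>). The same kind of basis factors \<open>W(x) powr (1/p) * W(y) powr (-1/p)\<close> on
  each cube into \<open>d\<close> products of a function of \<open>x\<close> and a function of \<open>y\<close> (\<open>factored_Ap\<close>), after which
  all estimates are scalar.

  The exponent is the sum of three contributions. The functions of \<open>x\<close> have \<open>p\<close>-th
  powers with averages at most \<open>A\<close>. The part of a sparse cube outside the smaller ones keeps at least the proportion \<open>c / A\<close> of
  the weight and \<open>c / A powr (1/(p - 1))\<close> of the dual weight (\<open>large_subset_mass\<close>), so that the depth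
  in the sparse family is exponentially integrable. The second proportion enters a Carleson embedding
  (\<open>carleson_sum\<close>) once; for \<open>p > 2\<close> the first one enters with the power \<open>p/2 - 1\<close>
  (\<open>sparse_sum_large_exponent\<close>), while for \<open>p \<le> 2\<close> the cubes decouple at no cost. Altogether
  \<open>1 + max 0 (p/2 - 1) + 1/(p - 1) = p * gamma_exp p\<close>.
\<close>

section \<open>Linear algebra: pairings and almost extremal bases\<close>

text \<open>
  The bilinear pairing, without conjugation: rows of matrices act on vectors through it, and
  \<open>v*\<close> is its adjoint to \<open>*v\<close>.
\<close>

definition pairing :: "complex^'d \<Rightarrow> complex^'d \<Rightarrow> complex"
  where "pairing e v = (\<Sum>i\<in>UNIV. e $ i * v $ i)"

definition conj_vec :: "complex^'d \<Rightarrow> complex^'d"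
  where "conj_vec v = (\<chi> i. cnj (v $ i))"

lemma pairing_linear:
  "pairing (x + y) v = pairing x v + pairing y v" "pairing (c *s x) v = c * pairing x v"
  "pairing e (x + y) = pairing e x + pairing e y" "pairing e (c *s x) = c * pairing e x"
  "pairing (x - y) v = pairing x v - pairing y v" "pairing e (x - y) = pairing e x - pairing e y"
  "pairing e (r *\<^sub>R x) = r *\<^sub>R pairing e x" "pairing 0 v = 0" "pairing e 0 = 0"
  by (simp_all add: pairing_def algebra_simps sum.distrib sum_distrib_left sum_subtractf scaleR_sum_right)

lemma pairing_sum_left: "pairing (\<Sum>i\<in>A. x i) v = (\<Sum>i\<in>A. pairing (x i) v)"
  by (induction A rule: infinite_finite_induct) (auto simp: pairing_linear)

lemma norm_pairing_le: "norm (pairing e v) \<le> norm e * norm v"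
proof -
  have "norm (pairing e v) \<le> (\<Sum>i\<in>UNIV. \<bar>norm (e$i)\<bar> * \<bar>norm (v$i)\<bar>)"
    unfolding pairing_def by (rule order_trans[OF norm_sum]) (simp add: norm_mult)
  also have "\<dots> \<le> norm e * norm v"
    unfolding norm_vec_def by (rule L2_set_mult_ineq)
  finally show ?thesis .
qed

lemma norm_smult_vec: "norm (c *s (x::complex^'d)) = norm c * norm x"
  by (simp add: norm_vec_def norm_mult L2_set_def power_mult_distrib sum_distrib_left[symmetric]
      real_sqrt_mult)

lemma norm_conj_vec [simp]: "norm (conj_vec v) = norm v"
  by (simp add: norm_vec_def conj_vec_def L2_set_def)

lemma norm_vec_squared: "(norm (v::complex^'d))\<^sup>2 = (\<Sum>i\<in>UNIV. (norm (v$i))\<^sup>2)"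
  by (simp add: norm_vec_def L2_set_def sum_nonneg)

lemma pairing_conj_vec: "pairing (conj_vec v) v = of_real ((norm v)\<^sup>2)"
  by (simp add: norm_vec_squared pairing_def conj_vec_def complex_norm_square[symmetric] mult.commute)

lemma pairing_vector_matrix: "pairing (e v* M) v = pairing e (M *v v)"
proof -
  have "pairing (e v* M) v = (\<Sum>j\<in>UNIV. \<Sum>i\<in>UNIV. M$i$j * e$i * v$j)"
    by (simp add: pairing_def vector_matrix_mult_def sum_distrib_right sum_distrib_left mult_ac)
  also have "\<dots> = (\<Sum>i\<in>UNIV. \<Sum>j\<in>UNIV. M$i$j * e$i * v$j)"
    by (rule sum.swap)
  finally show ?thesis
    by (simp add: pairing_def matrix_vector_mult_def sum_distrib_left mult_ac)
qed

lemma vector_matrix_component: "(e v* M) $ i = pairing e (column i M)"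
  by (simp add: pairing_def vector_matrix_mult_def column_def mult.commute)

lemma matrix_vector_component: "(M *v v) $ i = pairing (row i M) v"
  by (simp add: pairing_def matrix_vector_mult_def row_def)

lemma vector_matrix_sum_rows: "x v* U = (\<Sum>i\<in>UNIV. x $ i *s row i U)"
  by (simp add: vec_eq_iff vector_matrix_mult_def row_def mult.commute)

lemma vector_matrix_axis: "axis k 1 v* M = row k M"
  by (simp add: vec_eq_iff vector_matrix_mult_def row_def axis_def if_distrib[of "\<lambda>x. x * _"] cong: if_cong)

text \<open>
  An almost maximal volume argument. Among the matrices whose rows lie in the unit ball of \<open>N\<close>, one
  whose determinant is at least half of the supremum has, by Cramer's rule, coordinate functionals
  of size at most 2 with respect to \<open>N\<close>. Settling for half of the supremum leaves an open set of
  choices, so the matrix can be taken from any prescribed dense set.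
\<close>

lemma almost_extremal_basis:
  fixes N :: "complex^'d \<Rightarrow> real" and X :: "(complex^'d^'d) set"
  assumes cont: "continuous_on UNIV N" and hom: "\<And>c x. N (c *s x) = norm c * N x"
    and pos: "\<And>x. x \<noteq> 0 \<Longrightarrow> 0 < N x"
    and dense: "\<And>S. open S \<Longrightarrow> S \<noteq> {} \<Longrightarrow> \<exists>U\<in>X. U \<in> S"
  obtains U U' where "U \<in> X" "U ** U' = mat 1" "U' ** U = mat 1"
    "\<And>i. N (row i U) \<le> 1" "\<And>e i. norm ((e v* U') $ i) \<le> 2 * N e"
proof -
  have Nz: "N 0 = 0" using hom[of 0 0] by simp
  obtain c0 where c0: "c0 > 0" "\<And>x. c0 * norm x \<le> N x"
  proof -
    have "compact (sphere (0::complex^'d) 1)" by simp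
    moreover have "axis undefined 1 \<in> sphere (0::complex^'d) 1" by simp
    ultimately obtain z where z: "z \<in> sphere 0 1" "\<And>y. y \<in> sphere 0 1 \<Longrightarrow> N z \<le> N y"
      using continuous_attains_inf[of "sphere 0 1" N] cont continuous_on_subset by blast
    have "N z > 0" using z by (intro pos) auto
    moreover have "N z * norm x \<le> N x" for x
    proof (cases "x = 0")
      case False
      define u where "u = complex_of_real (1 / norm x) *s x"
      have "norm u = 1" using False by (simp add: u_def norm_smult_vec norm_divide)
      then have "N z \<le> N u" using z by auto
      also have "\<dots> = N x / norm x" by (simp add: u_def hom norm_divide)
      finally show ?thesis using False by (simp add: field_simps)
    qed (simp add: Nz)
    ultimately show ?thesis using that by blast
  qed
  define A where "A = {U::complex^'d^'d. \<forall>i. N (row i U) < 1}"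
  have cr: "continuous_on UNIV (\<lambda>U::complex^'d^'d. N (row i U))" for i
    by (rule continuous_on_compose2[OF cont]) (auto simp: row_def vec_lambda_eta intro!: continuous_intros)
  have A_eq: "A = (\<Inter>i. {U. N (row i U) < 1})" by (auto simp: A_def)
  have openA: "open A"
    unfolding A_eq by (intro open_INT ballI) (auto intro!: open_Collect_less cr continuous_intros)
  have det_cont: "continuous_on UNIV (\<lambda>U::complex^'d^'d. norm (det U))"
    unfolding det_def by (intro continuous_intros)
  define s where "s = (SUP U\<in>A. norm (det U))"
  have bdd: "bdd_above ((\<lambda>U. norm (det U)) ` A)"
  proof -
    have "norm (det U) \<le> (\<Sum>p\<in>{p. p permutes (UNIV::'d set)}. (1 / c0) ^ CARD('d))" if "U \<in> A" for U
    proof -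
      have entry: "norm (U$i$j) \<le> 1 / c0" for i j
      proof -
        have "norm (U$i$j) \<le> norm (row i U)"
          by (simp add: row_def vec_lambda_eta Finite_Cartesian_Product.norm_nth_le)
        also have "\<dots> \<le> N (row i U) / c0" using c0 by (simp add: field_simps mult.commute)
        also have "\<dots> \<le> 1 / c0" using that c0(1) by (intro divide_right_mono) (auto simp: A_def less_imp_le)
        finally show ?thesis .
      qed
      have "norm (det U) \<le> (\<Sum>p\<in>{p. p permutes (UNIV::'d set)}.
          norm (of_int (sign p) * (\<Prod>i\<in>UNIV. U$i$p i)))"
        unfolding det_def by (rule norm_sum)
      also have "\<dots> \<le> (\<Sum>p\<in>{p. p permutes (UNIV::'d set)}. (1 / c0) ^ CARD('d))"
      proof (rule sum_mono)
        fix p :: "'d \<Rightarrow> 'd"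
        have "norm (of_int (sign p) * (\<Prod>i\<in>UNIV. U$i$p i)) = (\<Prod>i\<in>UNIV. norm (U$i$p i))"
          by (simp add: norm_mult prod_norm sign_def)
        also have "\<dots> \<le> (\<Prod>i\<in>(UNIV::'d set). 1 / c0)"
          by (intro prod_mono) (auto intro: entry)
        finally show "norm (of_int (sign p) * (\<Prod>i\<in>UNIV. U$i$p i)) \<le> (1 / c0) ^ CARD('d)" by simp
      qed
      finally show ?thesis .
    qed
    then show ?thesis by (auto simp: bdd_above_def)
  qed
  have s_upper: "norm (det U) \<le> s" if "U \<in> A" for U
    unfolding s_def using bdd that by (rule cSUP_upper2) simp
  have s_pos: "s > 0"
  proof -
    define m where "m = 1 + Max (range (\<lambda>i::'d. N (axis i 1)))"
    have m: "N (axis i 1) < m" for i :: 'd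
      unfolding m_def by (rule le_less_trans[of _ "Max (range (\<lambda>i::'d. N (axis i 1)))"]) auto
    have m0: "m > 0" using m[of undefined] pos[of "axis undefined 1"] by (simp add: axis_eq_0_iff)
    define U :: "complex^'d^'d" where "U = (\<chi> i. of_real (1 / m) *s axis i 1)"
    have "row i U = of_real (1 / m) *s axis i 1" for i by (simp add: U_def row_def vec_eq_iff)
    then have "U \<in> A" using m m0 by (simp add: A_def hom norm_divide)
    moreover have "det U = (\<Prod>i\<in>UNIV. U $ i $ i)"
      by (rule det_diagonal) (simp add: U_def axis_def)
    then have "det U \<noteq> 0" using m0 by (simp add: U_def axis_def)
    ultimately show ?thesis using s_upper[of U] by (meson less_le_trans zero_less_norm_iff)
  qed
  have "\<exists>U\<in>A. s / 2 < norm (det U)"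
  proof (rule ccontr)
    assume "\<not> ?thesis"
    moreover have "A \<noteq> {}"
    proof -
      have "(0::complex^'d^'d) \<in> A"
        by (auto simp: A_def row_def Nz zero_vec_def[symmetric] vec_lambda_eta)
      then show ?thesis by blast
    qed
    ultimately have "s \<le> s / 2"
      unfolding s_def by (intro cSUP_least) (auto simp: s_def not_less)
    then show False using s_pos by simp
  qed
  then have ne: "A \<inter> {U. s / 2 < norm (det U)} \<noteq> {}" by blast
  have "open (A \<inter> {U. s / 2 < norm (det U)})"
    by (intro open_Int openA open_Collect_less det_cont continuous_intros)
  then obtain U where U: "U \<in> X" "U \<in> A" "s / 2 < norm (det U)"
    using dense[OF _ ne] by auto
  have "det U \<noteq> 0" using U(3) s_pos by auto
  then obtain U' where U': "U ** U' = mat 1" "U' ** U = mat 1"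
    unfolding invertible_det_nz[symmetric] invertible_def by blast
  have "norm ((e v* U') $ k) \<le> 2 * N e" for e k
  proof -
    define x where "x = e v* U'"
    have ex: "e = (\<Sum>i\<in>UNIV. x $ i *s row i U)"
      by (simp add: vector_matrix_sum_rows[symmetric] x_def vector_matrix_mul_assoc U' vector_matrix_mul_rid)
    have less: "norm (x $ k) \<le> 2 * t" if t: "N e < t" for t
    proof -
      have t0: "t > 0" using t c0(2)[of e] c0(1) by (smt (verit) norm_ge_zero zero_le_mult_iff)
      define r where "r = of_real (1 / t) *s e"
      define M :: "complex^'d^'d" where "M = (\<chi> i. if i = k then r else row i U)"
      have "N (row i M) < 1" for i
        using U(2) t t0 by (auto simp: M_def row_def vec_lambda_eta r_def hom norm_divide A_def)
      then have "M \<in> A" by (simp add: A_def)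
      then have "norm (det M) < 2 * norm (det U)" using s_upper U(3) by fastforce
      moreover have "det M = of_real (1 / t) * (x $ k * det U)"
      proof -
        have rs: "r = (\<Sum>i\<in>UNIV. (of_real (1 / t) *s x) $ i *s row i U)"
          unfolding r_def by (subst ex) (simp add: vec_eq_iff sum_distrib_left mult.assoc)
        have "det M = (of_real (1 / t) *s x) $ k * det U"
          unfolding M_def rs by (rule cramer_lemma_transpose)
        then show ?thesis by simp
      qed
      ultimately have "norm (x $ k) / t * norm (det U) < 2 * norm (det U)"
        using t0 by (simp add: norm_mult norm_divide)
      then have "norm (x $ k) / t < 2" by (rule mult_right_less_imp_less) simp
      then show ?thesis using t0 by (simp add: field_simps)
    qed
    have "norm (x $ k) / 2 \<le> N e"
      by (rule dense_ge) (use less in \<open>auto simp: field_simps\<close>)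
    then show ?thesis by (simp add: x_def)
  qed
  moreover have "N (row i U) \<le> 1" for i using U(2) by (simp add: A_def less_imp_le)
  ultimately show ?thesis using that U(1) U' by blast
qed

section \<open>Power means and Hoelder's inequality\<close>

text \<open>
  Young's inequality for \<open>f / A powr (1/q)\<close> and \<open>g / B powr (1/p)\<close>, integrated. Since \<open>A\<close> and \<open>B\<close> may
  vanish, it is first used with slightly larger bounds.
\<close>

lemma nn_integral_Hoelder:
  fixes f g :: "'a \<Rightarrow> real" and p q A B :: real
  assumes pq: "1 < p" "1 < q" "1/q + 1/p = 1"
    and [measurable]: "f \<in> borel_measurable M" "g \<in> borel_measurable M"
    and nn: "\<And>x. 0 \<le> f x" "\<And>x. 0 \<le> g x" "0 \<le> A" "0 \<le> B"
    and f: "(\<integral>\<^sup>+x. ennreal (f x powr q) \<partial>M) \<le> ennreal A"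
    and g: "(\<integral>\<^sup>+x. ennreal (g x powr p) \<partial>M) \<le> ennreal B"
  shows "(\<integral>\<^sup>+x. ennreal (f x * g x) \<partial>M) \<le> ennreal (A powr (1/q) * B powr (1/p))"
proof -
  have pos: "(\<integral>\<^sup>+x. ennreal (f x * g x) \<partial>M) \<le> ennreal (a powr (1/q) * b powr (1/p))"
    if ab: "A < a" "B < b" for a b
  proof -
    define s t where "s = a powr (1/q)" and "t = b powr (1/p)"
    have ab0: "a > 0" "b > 0" using ab nn by auto
    have st: "s > 0" "t > 0" "s powr q = a" "t powr p = b"
      using ab nn pq by (auto simp: s_def t_def powr_powr)
    have "(\<integral>\<^sup>+x. ennreal (f x * g x) \<partial>M)
        \<le> (\<integral>\<^sup>+x. ennreal (s * t / (q * a)) * ennreal (f x powr q)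
              + ennreal (s * t / (p * b)) * ennreal (g x powr p) \<partial>M)"
    proof (rule nn_integral_mono)
      fix x
      have "(f x / s) * (g x / t) \<le> (f x / s) powr q / q + (g x / t) powr p / p"
        using pq nn st by (intro Youngs_inequality) auto
      then have "f x * g x \<le> s * t * ((f x / s) powr q / q + (g x / t) powr p / p)"
        using st by (simp add: field_simps)
      also have "\<dots> = s * t / (q * a) * f x powr q + s * t / (p * b) * g x powr p"
        using st nn ab0 pq by (simp add: powr_divide field_simps)
      finally show "ennreal (f x * g x) \<le> ennreal (s * t / (q * a)) * ennreal (f x powr q)
              + ennreal (s * t / (p * b)) * ennreal (g x powr p)"
        using st nn ab0 pq by (simp add: ennreal_mult[symmetric] ennreal_plus[symmetric] ennreal_leI del: ennreal_plus)
    qed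
    also have "\<dots> = ennreal (s * t / (q * a)) * (\<integral>\<^sup>+x. ennreal (f x powr q) \<partial>M)
        + ennreal (s * t / (p * b)) * (\<integral>\<^sup>+x. ennreal (g x powr p) \<partial>M)"
      by (simp add: nn_integral_add nn_integral_cmult)
    also have "\<dots> \<le> ennreal (s * t / (q * a)) * ennreal a + ennreal (s * t / (p * b)) * ennreal b"
      using f g ab by (intro add_mono mult_left_mono order_trans[OF f] order_trans[OF g] ennreal_leI) auto
    also have "\<dots> = ennreal (s * t * (1/q + 1/p))"
      using ab0 st pq by (simp add: ennreal_mult[symmetric] ennreal_plus[symmetric] field_simps del: ennreal_plus)
    finally show ?thesis using pq by (simp add: s_def t_def)
  qed
  show ?thesis
  proof (rule tendsto_lowerbound[where F = "at_right 0"])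
    show "((\<lambda>e. ennreal ((A + e) powr (1/q) * (B + e) powr (1/p)))
        \<longlongrightarrow> ennreal (A powr (1/q) * B powr (1/p))) (at_right 0)"
      by (rule tendsto_ennrealI) (use pq nn in \<open>auto intro!: tendsto_eq_intros simp: eventually_at_filter\<close>)
    show "\<forall>\<^sub>F e in at_right 0. (\<integral>\<^sup>+x. ennreal (f x * g x) \<partial>M)
        \<le> ennreal ((A + e) powr (1/q) * (B + e) powr (1/p))"
      using pos by (auto simp: eventually_at_filter)
  qed simp
qed

lemma sum_powr_le:
  fixes a :: "'i \<Rightarrow> real"
  assumes "finite I" "I \<noteq> {}" "0 < p" "\<And>i. i \<in> I \<Longrightarrow> 0 \<le> a i"
  shows "(\<Sum>i\<in>I. a i) powr p \<le> real (card I) powr p * (\<Sum>i\<in>I. a i powr p)"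
proof -
  define m where "m = Max (a ` I)"
  have m: "m \<in> a ` I" "\<And>i. i \<in> I \<Longrightarrow> a i \<le> m" unfolding m_def using assms by auto
  have m0: "0 \<le> m" using m assms by auto
  have "(\<Sum>i\<in>I. a i) \<le> real (card I) * m" using sum_bounded_above[of I a m] m by simp
  then have "(\<Sum>i\<in>I. a i) powr p \<le> (real (card I) * m) powr p"
    using assms by (intro powr_mono2) (auto intro: sum_nonneg)
  also have "\<dots> = real (card I) powr p * m powr p" using m0 by (simp add: powr_mult)
  also have "m powr p \<le> (\<Sum>i\<in>I. a i powr p)"
    using m(1) assms by (auto intro!: member_le_sum)
  finally show ?thesis by (simp add: mult_left_mono)
qed

section \<open>Trees of cubes and conditional oscillations\<close>

text \<open>
  Levels are counted from a coarsest level 0 downwards; a grid with integer levels gives one such tree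
  for each starting level.
\<close>

locale cube_tree =
  fixes M :: "'a measure" and D :: "nat \<Rightarrow> 'a set set" and B :: real
  assumes space_M: "space M = UNIV"
    and cube_sets: "Q \<in> D k \<Longrightarrow> Q \<in> sets M"
    and cube_finite: "Q \<in> D k \<Longrightarrow> emeasure M Q < \<infinity>"
    and cube_pos: "Q \<in> D k \<Longrightarrow> 0 < measure M Q"
    and partition: "partition_on UNIV (D k)"
    and countable_D: "countable (D k)"
    and children_finite: "Q \<in> D k \<Longrightarrow> finite {P \<in> D (Suc k). P \<subseteq> Q}"
    and children_cover: "Q \<in> D k \<Longrightarrow> \<Union>{P \<in> D (Suc k). P \<subseteq> Q} = Q"
    and doubling: "P \<in> D (Suc k) \<Longrightarrow> Q \<in> D k \<Longrightarrow> P \<subseteq> Q \<Longrightarrow> measure M Q \<le> B * measure M P"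
    and B_ge_1: "1 \<le> B"
begin

definition cube :: "nat \<Rightarrow> 'a \<Rightarrow> 'a set"
  where "cube k x = (THE Q. Q \<in> D k \<and> x \<in> Q)"

definition children :: "nat \<Rightarrow> 'a set \<Rightarrow> 'a set set"
  where "children k Q = {P \<in> D (Suc k). P \<subseteq> Q}"

definition descendants :: "nat \<Rightarrow> nat \<Rightarrow> 'a set \<Rightarrow> 'a set set"
  where "descendants n k Q = (\<Union>j\<le>n. {P \<in> D (k + j). P \<subseteq> Q})"

lemma disjoint_D: "P \<in> D k \<Longrightarrow> Q \<in> D k \<Longrightarrow> x \<in> P \<Longrightarrow> x \<in> Q \<Longrightarrow> P = Q"
  using partition[of k] by (auto simp: partition_on_def disjoint_def)

lemma cube_nonempty: "Q \<in> D k \<Longrightarrow> Q \<noteq> {}"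
  using cube_pos[of Q k] by auto

lemma ex_cube: "\<exists>Q\<in>D k. x \<in> Q"
  using partition[of k] by (auto simp: partition_on_def)

lemma cube_eq: "Q \<in> D k \<Longrightarrow> x \<in> Q \<Longrightarrow> cube k x = Q"
  unfolding cube_def by (rule the_equality) (use disjoint_D in blast)+

lemma cube_in: "cube k x \<in> D k" "x \<in> cube k x"
  using ex_cube[of k x] cube_eq by fastforce+

lemma children_disjoint: "disjoint (children k Q)"
  unfolding disjoint_def children_def by (auto dest: disjoint_D)

lemma children_D: "P \<in> children k Q \<Longrightarrow> P \<in> D (Suc k)" "P \<in> children k Q \<Longrightarrow> P \<subseteq> Q"
  by (auto simp: children_def)

lemma finite_children: "Q \<in> D k \<Longrightarrow> finite (children k Q)"
  unfolding children_def by (rule children_finite)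

lemma Union_children: "Q \<in> D k \<Longrightarrow> \<Union>(children k Q) = Q"
  unfolding children_def by (rule children_cover)

lemma parent:
  assumes "P \<in> D (k + j)" "x \<in> P" shows "P \<subseteq> cube k x"
  using assms
proof (induction j arbitrary: P)
  case 0
  then show ?case using cube_eq[of P k x] by simp
next
  case (Suc j)
  have "cube (k + j) x \<subseteq> cube k x" by (rule Suc.IH[OF cube_in])
  moreover obtain P' where "P' \<in> children (k + j) (cube (k + j) x)" "x \<in> P'"
    using Union_children[OF cube_in(1)[of "k + j" x]] cube_in(2)[of x "k + j"] by (metis UnionE)
  then have "P \<subseteq> cube (k + j) x"
    using Suc.prems disjoint_D[of P "Suc (k+j)" P' x] by (simp add: children_def)
  ultimately show ?case by blast
qed

lemma laminar:
  assumes "P \<in> D i" "Q \<in> D j" "P \<inter> Q \<noteq> {}" shows "P \<subseteq> Q \<or> Q \<subseteq> P"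
proof -
  obtain x where x: "x \<in> P" "x \<in> Q" using assms by blast
  show ?thesis
  proof (cases "i \<le> j")
    case True
    then have "Q \<subseteq> cube i x" using parent[of Q i "j - i" x] assms x by simp
    then show ?thesis using cube_eq[of P i x] assms x by simp
  next
    case False
    then have "P \<subseteq> cube j x" using parent[of P j "i - j" x] assms x by simp
    then show ?thesis using cube_eq[of Q j x] assms x by simp
  qed
qed

lemma finite_descendants: assumes "Q \<in> D k" shows "finite (descendants n k Q)"
proof -
  have "finite {P \<in> D (k + j). P \<subseteq> Q}" for j
  proof (induction j)
    case 0
    have "{P \<in> D (k + 0). P \<subseteq> Q} \<subseteq> {Q}"
      using assms disjoint_D cube_nonempty by fastforce
    then show ?case by (rule finite_subset) simp
  next
    case (Suc j)
    have "{P \<in> D (k + Suc j). P \<subseteq> Q} \<subseteq> \<Union>(children (k + j) ` {P \<in> D (k + j). P \<subseteq> Q})"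
    proof
      fix P assume P: "P \<in> {P \<in> D (k + Suc j). P \<subseteq> Q}"
      then obtain x where x: "x \<in> P" using cube_nonempty by blast
      have "P \<subseteq> cube (k + j) x" using parent[of P "k + j" 1 x] P x by simp
      moreover have "cube (k + j) x \<subseteq> Q"
        using parent[of "cube (k + j) x" k j x] cube_in cube_eq[OF assms, of x] P x by blast
      ultimately show "P \<in> \<Union>(children (k + j) ` {P \<in> D (k + j). P \<subseteq> Q})"
        using P cube_in(1)[of "k + j" x] by (auto simp: children_def)
    qed
    moreover have "finite (\<Union>(children (k + j) ` {P \<in> D (k + j). P \<subseteq> Q}))"
      using Suc finite_children by blast
    ultimately show ?case by (rule finite_subset)
  qed
  then show ?thesis by (simp add: descendants_def)
qed

lemma measure_children: assumes "Q \<in> D k" shows "(\<Sum>P\<in>children k Q. measure M P) = measure M Q"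
proof -
  have "measure M (\<Union>(children k Q)) = (\<Sum>P\<in>children k Q. measure M P)"
    using finite_children[OF assms] children_disjoint
    by (intro measure_Union') (auto simp: pairwise_def disjoint_def fmeasurable_def disjnt_def
        intro: cube_sets[OF children_D(1)] cube_finite[OF children_D(1), simplified])
  then show ?thesis using Union_children[OF assms] by simp
qed

lemma set_integral_children:
  fixes g :: "'a \<Rightarrow> 'b::{banach,second_countable_topology}"
  assumes "Q \<in> D k" "set_integrable M Q g"
  shows "(\<Sum>P\<in>children k Q. (LINT x:P|M. g x)) = (LINT x:Q|M. g x)"
proof -
  have "(LINT x:(\<Union>P\<in>children k Q. P)|M. g x) = (\<Sum>P\<in>children k Q. (LINT x:P|M. g x))"
  proof (rule set_integral_finite_Union)
    show "disjoint_family_on (\<lambda>P. P) (children k Q)"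
      using children_disjoint by (auto simp: disjoint_family_on_def disjoint_def)
    show "set_integrable M P g" if "P \<in> children k Q" for P
      by (rule set_integrable_subset[OF assms(2)]) (use that children_D cube_sets in auto)
  qed (use assms finite_children children_D cube_sets in auto)
  then show ?thesis using Union_children[OF assms(1)] by simp
qed

end

lemma weighted_variance:
  fixes z :: "'i \<Rightarrow> 'b::real_inner" and w :: "'i \<Rightarrow> real"
  assumes "W = (\<Sum>i\<in>I. w i)" "W *\<^sub>R c = (\<Sum>i\<in>I. w i *\<^sub>R z i)"
  shows "(\<Sum>i\<in>I. w i * (norm (z i - c))\<^sup>2) = (\<Sum>i\<in>I. w i * (norm (z i))\<^sup>2) - W * (norm c)\<^sup>2"
proof -
  have "(\<Sum>i\<in>I. w i * (norm (z i - c))\<^sup>2)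
      = (\<Sum>i\<in>I. w i * (norm (z i))\<^sup>2 - 2 * ((w i *\<^sub>R z i) \<bullet> c) + w i * (norm c)\<^sup>2)"
    by (intro sum.cong refl) (simp add: power2_norm_eq_inner algebra_simps inner_commute)
  also have "\<dots> = (\<Sum>i\<in>I. w i * (norm (z i))\<^sup>2) - 2 * ((\<Sum>i\<in>I. w i *\<^sub>R z i) \<bullet> c) + W * (norm c)\<^sup>2"
    by (simp add: sum.distrib sum_subtractf sum_distrib_left sum_distrib_right inner_sum_left assms(1))
  also have "(\<Sum>i\<in>I. w i *\<^sub>R z i) \<bullet> c = W * (norm c)\<^sup>2"
    by (simp add: assms(2)[symmetric] power2_norm_eq_inner)
  finally show ?thesis by simp
qed

lemma L2_set_cmult_complex: "L2_set (\<lambda>k. norm (c * z k :: complex)) K = norm c * L2_set (\<lambda>k. norm (z k)) K"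
  by (simp add: L2_set_def norm_mult power_mult_distrib sum_distrib_left[symmetric] real_sqrt_mult)

lemma L2_set_integral_le:
  fixes z :: "'k \<Rightarrow> 'a \<Rightarrow> complex"
  assumes "\<And>k. k \<in> K \<Longrightarrow> integrable M (z k)" "finite K"
    and int: "integrable M (\<lambda>x. L2_set (\<lambda>k. norm (z k x)) K)"
  shows "L2_set (\<lambda>k. norm (integral\<^sup>L M (z k))) K \<le> (\<integral>x. L2_set (\<lambda>k. norm (z k x)) K \<partial>M)"
proof -
  define c where "c k = integral\<^sup>L M (z k)" for k
  define l where "l = L2_set (\<lambda>k. norm (c k)) K"
  have l0: "0 \<le> l" by (simp add: l_def)
  have "complex_of_real (l\<^sup>2) = (\<Sum>k\<in>K. cnj (c k) * c k)"
    by (simp add: l_def L2_set_def sum_nonneg complex_norm_square mult.commute del: of_real_power)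
  also have "\<dots> = (\<integral>x. (\<Sum>k\<in>K. cnj (c k) * z k x) \<partial>M)"
    using assms by (subst Bochner_Integration.integral_sum) (auto simp: c_def)
  finally have "l\<^sup>2 = norm (\<integral>x. (\<Sum>k\<in>K. cnj (c k) * z k x) \<partial>M)"
    by (metis abs_of_nonneg norm_of_real zero_le_power2)
  also have "\<dots> \<le> (\<integral>x. norm (\<Sum>k\<in>K. cnj (c k) * z k x) \<partial>M)"
    by (rule integral_norm_bound)
  also have "\<dots> \<le> (\<integral>x. l * L2_set (\<lambda>k. norm (z k x)) K \<partial>M)"
  proof (rule integral_mono)
    show "integrable M (\<lambda>x. norm (\<Sum>k\<in>K. cnj (c k) * z k x))" using assms by auto
    show "integrable M (\<lambda>x. l * L2_set (\<lambda>k. norm (z k x)) K)" using int by simp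
    fix x
    have "norm (\<Sum>k\<in>K. cnj (c k) * z k x) \<le> (\<Sum>k\<in>K. \<bar>norm (c k)\<bar> * \<bar>norm (z k x)\<bar>)"
      by (rule order_trans[OF norm_sum]) (simp add: norm_mult)
    also have "\<dots> \<le> l * L2_set (\<lambda>k. norm (z k x)) K" unfolding l_def by (rule L2_set_mult_ineq)
    finally show "norm (\<Sum>k\<in>K. cnj (c k) * z k x) \<le> l * L2_set (\<lambda>k. norm (z k x)) K" .
  qed
  also have "\<dots> = l * (\<integral>x. L2_set (\<lambda>k. norm (z k x)) K \<partial>M)" by simp
  finally have "l * l \<le> l * (\<integral>x. L2_set (\<lambda>k. norm (z k x)) K \<partial>M)" by (simp add: power2_eq_square)
  moreover have "0 \<le> (\<integral>x. L2_set (\<lambda>k. norm (z k x)) K \<partial>M)" by (intro Bochner_Integration.integral_nonneg) simp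
  ultimately have "l \<le> (\<integral>x. L2_set (\<lambda>k. norm (z k x)) K \<partial>M)"
    using l0 by (cases "l = 0") auto
  then show ?thesis by (simp add: l_def c_def)
qed

text \<open>
  The index set \<open>K\<close> carries the second parameter: later \<open>F \<kappa>\<close> is a partial Haar coefficient in the
  other variable, and all quantities are taken in \<open>l\<^sup>2(K)\<close>.
\<close>

locale cube_tree_family = cube_tree M D B
  for M :: "'a measure" and D :: "nat \<Rightarrow> 'a set set" and B :: real +
  fixes K :: "'k set" and F :: "'k \<Rightarrow> 'a \<Rightarrow> complex^'d"
  assumes finite_K: "finite K"
    and F_integrable: "\<kappa> \<in> K \<Longrightarrow> Q \<in> D k \<Longrightarrow> set_integrable M Q (F \<kappa>)"
begin

definition avg :: "'a set \<Rightarrow> 'k \<Rightarrow> complex^'d"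
  where "avg Q \<kappa> = (1 / measure M Q) *\<^sub>R (LINT x:Q|M. F \<kappa> x)"

text \<open>
  The mean square over \<open>Q\<close> of the martingale difference between the levels \<open>k\<close> and \<open>k + 1\<close>, in the
  direction \<open>e\<close>. It is constant on \<open>Q\<close>, unlike the difference itself, so that a stopping process sees
  it one level before the difference is realized.
\<close>

definition osc :: "nat \<Rightarrow> 'a set \<Rightarrow> complex^'d \<Rightarrow> real"
  where "osc k Q e = (\<Sum>\<kappa>\<in>K. \<Sum>P\<in>children k Q.
    measure M P / measure M Q * (norm (pairing e (avg P \<kappa> - avg Q \<kappa>)))\<^sup>2)"

definition mass :: "'a set \<Rightarrow> complex^'d \<Rightarrow> real"
  where "mass Q e = (LINT x:Q|M. L2_set (\<lambda>\<kappa>. norm (pairing e (F \<kappa> x))) K)"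

definition avg_sq :: "'a set \<Rightarrow> complex^'d \<Rightarrow> real"
  where "avg_sq Q e = (\<Sum>\<kappa>\<in>K. (norm (pairing e (avg Q \<kappa>)))\<^sup>2)"

abbreviation osc_sum :: "nat \<Rightarrow> nat \<Rightarrow> 'a \<Rightarrow> complex^'d \<Rightarrow> real"
  where "osc_sum n k x e \<equiv> (\<Sum>l<n. osc (k + l) (cube (k + l) x) e)"

lemma bounded_linear_pairing: "bounded_linear (pairing (e::complex^'d))"
  by (rule bounded_linear_intro[of _ "norm e"])
    (auto simp: pairing_linear intro: order_trans[OF norm_pairing_le] eq_refl mult.commute)

lemma pairing_integrable:
  assumes "\<kappa> \<in> K" "Q \<in> D k" shows "set_integrable M Q (\<lambda>x. pairing e (F \<kappa> x))"
  using integrable_bounded_linear[OF bounded_linear_pairing F_integrable[OF assms, unfolded set_integrable_def]]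
  by (simp add: set_integrable_def pairing_linear)

lemma L2_integrable:
  assumes "Q \<in> D k" shows "set_integrable M Q (\<lambda>x. L2_set (\<lambda>\<kappa>. norm (pairing e (F \<kappa> x))) K)"
proof -
  have int: "integrable M (\<lambda>x. \<Sum>\<kappa>\<in>K. norm (indicator Q x *\<^sub>R pairing e (F \<kappa> x)))"
    using pairing_integrable[OF _ assms] unfolding set_integrable_def
    by (intro Bochner_Integration.integrable_sum integrable_norm) blast
  have eq: "L2_set (\<lambda>\<kappa>. norm (indicator Q x *\<^sub>R pairing e (F \<kappa> x))) K
      = indicator Q x *\<^sub>R L2_set (\<lambda>\<kappa>. norm (pairing e (F \<kappa> x))) K" for x
    by (auto simp: indicator_def L2_set_def)
  have meas: "(\<lambda>x. norm (indicator Q x *\<^sub>R pairing e (F \<kappa> x))) \<in> borel_measurable M" if "\<kappa> \<in> K" for \<kappa>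
    using pairing_integrable[OF that assms] by (auto simp: set_integrable_def simp del: norm_scaleR)
  have "integrable M (\<lambda>x. L2_set (\<lambda>\<kappa>. norm (indicator Q x *\<^sub>R pairing e (F \<kappa> x))) K)"
  proof (rule Bochner_Integration.integrable_bound[OF int])
    show "(\<lambda>x. L2_set (\<lambda>\<kappa>. norm (indicator Q x *\<^sub>R pairing e (F \<kappa> x))) K) \<in> borel_measurable M"
      unfolding L2_set_def
      by (rule borel_measurable_continuous_on[where f = sqrt])
        (intro continuous_on_real_sqrt continuous_on_id borel_measurable_sum borel_measurable_power meas | assumption)+
    show "AE x in M. norm (L2_set (\<lambda>\<kappa>. norm (indicator Q x *\<^sub>R pairing e (F \<kappa> x))) K)
        \<le> norm (\<Sum>\<kappa>\<in>K. norm (indicator Q x *\<^sub>R pairing e (F \<kappa> x)))"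
      by (intro AE_I2) (simp add: sum_nonneg L2_set_le_sum del: norm_scaleR)
  qed
  then show ?thesis by (simp only: set_integrable_def eq)
qed

lemma mass_nonneg: "0 \<le> mass Q e"
  unfolding mass_def set_lebesgue_integral_def by (intro Bochner_Integration.integral_nonneg) simp

lemma mass_children: "Q \<in> D k \<Longrightarrow> (\<Sum>P\<in>children k Q. mass P e) = mass Q e"
  unfolding mass_def by (rule set_integral_children) (auto intro: L2_integrable)

lemma mass_mono: "P \<in> children k Q \<Longrightarrow> Q \<in> D k \<Longrightarrow> mass P e \<le> mass Q e"
  using mass_children[of Q k e] by (metis finite_children mass_nonneg member_le_sum)

text \<open>
  Minkowski's integral inequality in \<open>l\<^sup>2(K)\<close>.
\<close>

lemma avg_sq_le: assumes "Q \<in> D k" shows "measure M Q * sqrt (avg_sq Q e) \<le> mass Q e"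
proof -
  have m: "0 < measure M Q" using assms by (rule cube_pos)
  have "pairing e (avg Q \<kappa>) = (1 / measure M Q) *\<^sub>R (\<integral>x. indicator Q x *\<^sub>R pairing e (F \<kappa> x) \<partial>M)"
    if "\<kappa> \<in> K" for \<kappa>
    using integral_bounded_linear[OF bounded_linear_pairing F_integrable[OF that assms, unfolded set_integrable_def], of e]
    by (simp add: avg_def set_lebesgue_integral_def pairing_linear)
  then have "norm (pairing e (avg Q \<kappa>)) = (1 / measure M Q) * norm (\<integral>x. indicator Q x *\<^sub>R pairing e (F \<kappa> x) \<partial>M)"
    if "\<kappa> \<in> K" for \<kappa> using that m by simp
  then have "avg_sq Q e = (\<Sum>\<kappa>\<in>K. ((1 / measure M Q) * norm (\<integral>x. indicator Q x *\<^sub>R pairing e (F \<kappa> x) \<partial>M))\<^sup>2)"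
    by (simp add: avg_sq_def)
  then have "measure M Q * sqrt (avg_sq Q e) = L2_set (\<lambda>\<kappa>. norm (\<integral>x. indicator Q x *\<^sub>R pairing e (F \<kappa> x) \<partial>M)) K"
    using m by (simp add: L2_set_def power_mult_distrib power_divide sum_divide_distrib[symmetric] real_sqrt_divide)
  also have "\<dots> \<le> (\<integral>x. L2_set (\<lambda>\<kappa>. norm (indicator Q x *\<^sub>R pairing e (F \<kappa> x))) K \<partial>M)"
  proof (rule L2_set_integral_le)
    show "integrable M (\<lambda>x. L2_set (\<lambda>\<kappa>. norm (indicator Q x *\<^sub>R pairing e (F \<kappa> x))) K)"
      using L2_integrable[OF assms, of e, unfolded set_integrable_def]
      by (rule arg_cong[where f = "integrable M", THEN iffD1, rotated]) (auto simp: indicator_def L2_set_def fun_eq_iff)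
  qed (use pairing_integrable[OF _ assms] finite_K in \<open>auto simp: set_integrable_def\<close>)
  also have "\<dots> = mass Q e"
    unfolding mass_def set_lebesgue_integral_def
    by (intro Bochner_Integration.integral_cong) (auto simp: indicator_def L2_set_def)
  finally show ?thesis .
qed

lemma avg_children: assumes "Q \<in> D k" "\<kappa> \<in> K"
  shows "measure M Q *\<^sub>R avg Q \<kappa> = (\<Sum>P\<in>children k Q. measure M P *\<^sub>R avg P \<kappa>)"
proof -
  have "measure M P *\<^sub>R avg P \<kappa> = (LINT x:P|M. F \<kappa> x)" if "P \<in> children k Q" for P
    using cube_pos[OF children_D(1)[OF that]] by (simp add: avg_def)
  moreover have "measure M Q *\<^sub>R avg Q \<kappa> = (LINT x:Q|M. F \<kappa> x)"
    using cube_pos[OF assms(1)] by (simp add: avg_def)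
  ultimately show ?thesis
    using set_integral_children[OF assms(1) F_integrable[OF assms(2,1)]] by simp
qed

text \<open>
  Orthogonality of martingale differences: the oscillation is the energy that the averages gain in
  passing to the children, so it telescopes along the tree.
\<close>

lemma osc_energy: assumes "Q \<in> D k"
  shows "measure M Q * osc k Q e = (\<Sum>P\<in>children k Q. measure M P * avg_sq P e) - measure M Q * avg_sq Q e"
proof -
  have m: "measure M Q \<noteq> 0" using cube_pos[OF assms] by simp
  have "measure M Q * osc k Q e
      = (\<Sum>\<kappa>\<in>K. \<Sum>P\<in>children k Q. measure M P * (norm (pairing e (avg P \<kappa>) - pairing e (avg Q \<kappa>)))\<^sup>2)"
    using m by (simp add: osc_def sum_distrib_left pairing_linear)
  also have "\<dots> = (\<Sum>\<kappa>\<in>K. (\<Sum>P\<in>children k Q. measure M P * (norm (pairing e (avg P \<kappa>)))\<^sup>2)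
      - measure M Q * (norm (pairing e (avg Q \<kappa>)))\<^sup>2)"
  proof (intro sum.cong refl weighted_variance)
    fix \<kappa> assume k: "\<kappa> \<in> K"
    have "measure M Q *\<^sub>R pairing e (avg Q \<kappa>) = pairing e (measure M Q *\<^sub>R avg Q \<kappa>)"
      by (simp add: pairing_linear)
    also have "\<dots> = (\<Sum>P\<in>children k Q. pairing e (measure M P *\<^sub>R avg P \<kappa>))"
      unfolding avg_children[OF assms k]
      by (rule linear_sum) (rule bounded_linear.linear[OF bounded_linear_pairing])
    finally show "measure M Q *\<^sub>R pairing e (avg Q \<kappa>) = (\<Sum>P\<in>children k Q. measure M P *\<^sub>R pairing e (avg P \<kappa>))"
      by (simp add: pairing_linear)
  qed (simp add: measure_children[OF assms])
  also have "\<dots> = (\<Sum>P\<in>children k Q. \<Sum>\<kappa>\<in>K. measure M P * (norm (pairing e (avg P \<kappa>)))\<^sup>2)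
      - measure M Q * avg_sq Q e"
    by (subst sum.swap) (simp add: sum_subtractf avg_sq_def sum_distrib_left)
  finally show ?thesis by (simp add: avg_sq_def sum_distrib_left)
qed

lemma osc_nonneg: "0 \<le> osc k Q e"
  by (simp add: osc_def sum_nonneg)

lemma avg_sq_nonneg: "0 \<le> avg_sq Q e"
  by (simp add: avg_sq_def sum_nonneg)

lemma avg_sq_bound:
  assumes "Q \<in> D k" "mass Q e \<le> c * measure M Q"
  shows "avg_sq Q e \<le> c\<^sup>2" "measure M Q * avg_sq Q e \<le> c * mass Q e"
proof -
  have m: "0 < measure M Q" using assms(1) by (rule cube_pos)
  have s: "measure M Q * sqrt (avg_sq Q e) \<le> mass Q e" using assms(1) by (rule avg_sq_le)
  then have "measure M Q * sqrt (avg_sq Q e) \<le> measure M Q * c" using assms(2) by (simp add: mult.commute)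
  then have c: "sqrt (avg_sq Q e) \<le> c" using m by simp
  have a: "(sqrt (avg_sq Q e))\<^sup>2 = avg_sq Q e" using avg_sq_nonneg by simp
  show "avg_sq Q e \<le> c\<^sup>2" using power_mono[OF c, of 2] a avg_sq_nonneg by simp
  have "measure M Q * avg_sq Q e = sqrt (avg_sq Q e) * (measure M Q * sqrt (avg_sq Q e))"
    using a by (simp add: power2_eq_square)
  also have "\<dots> \<le> c * mass Q e"
    using c s avg_sq_nonneg m by (intro mult_mono) (auto intro: order_trans[of 0 "sqrt (avg_sq Q e)"])
  finally show "measure M Q * avg_sq Q e \<le> c * mass Q e" .
qed

lemma osc_comb:
  "osc k Q (\<Sum>i\<in>(UNIV::'i::finite set). c i *s u i) \<le> real CARD('i) * (\<Sum>i\<in>UNIV. (norm (c i))\<^sup>2 * osc k Q (u i))"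
proof -
  have *: "(norm (pairing (\<Sum>i\<in>(UNIV::'i set). c i *s u i) v))\<^sup>2
      \<le> real CARD('i) * (\<Sum>i\<in>UNIV. (norm (c i))\<^sup>2 * (norm (pairing (u i) v))\<^sup>2)" for v
  proof -
    have "norm (pairing (\<Sum>i\<in>(UNIV::'i set). c i *s u i) v) \<le> (\<Sum>i\<in>UNIV. norm (c i) * norm (pairing (u i) v))"
      by (simp add: pairing_sum_left pairing_linear) (rule order_trans[OF norm_sum], simp add: norm_mult)
    then have "(norm (pairing (\<Sum>i\<in>(UNIV::'i set). c i *s u i) v))\<^sup>2
        \<le> (\<Sum>i\<in>UNIV. norm (c i) * norm (pairing (u i) v))\<^sup>2"
      by (intro power_mono) auto
    also have "\<dots> \<le> real CARD('i) * (\<Sum>i\<in>UNIV. (norm (c i) * norm (pairing (u i) v))\<^sup>2)"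
      using Cauchy_Schwarz_ineq_sum[of "\<lambda>_. 1" "\<lambda>i. norm (c i) * norm (pairing (u i) v)" "UNIV::'i set"] by simp
    finally show ?thesis by (simp add: power_mult_distrib)
  qed
  have "osc k Q (\<Sum>i\<in>(UNIV::'i set). c i *s u i) \<le> (\<Sum>\<kappa>\<in>K. \<Sum>P\<in>children k Q. measure M P / measure M Q *
      (real CARD('i) * (\<Sum>i\<in>UNIV. (norm (c i))\<^sup>2 * (norm (pairing (u i) (avg P \<kappa> - avg Q \<kappa>)))\<^sup>2)))"
    unfolding osc_def by (intro sum_mono mult_left_mono *) auto
  also have "\<dots> = real CARD('i) * (\<Sum>\<kappa>\<in>K. \<Sum>P\<in>children k Q. \<Sum>i\<in>UNIV. (norm (c i))\<^sup>2 *
      (measure M P / measure M Q * (norm (pairing (u i) (avg P \<kappa> - avg Q \<kappa>)))\<^sup>2))"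
    by (simp add: sum_distrib_left mult_ac)
  also have "(\<Sum>\<kappa>\<in>K. \<Sum>P\<in>children k Q. \<Sum>i\<in>UNIV. (norm (c i))\<^sup>2 *
      (measure M P / measure M Q * (norm (pairing (u i) (avg P \<kappa> - avg Q \<kappa>)))\<^sup>2))
    = (\<Sum>i\<in>UNIV. (norm (c i))\<^sup>2 * osc k Q (u i))"
    unfolding osc_def sum_distrib_left
    by (rule trans[OF sum.cong[OF refl sum.swap] sum.swap])
  finally show ?thesis .
qed

end

section \<open>Sparse domination of conditional oscillations\<close>

lemma sum_UNION_le_sum:
  fixes f :: "'a \<Rightarrow> real"
  assumes "finite I" "\<And>i. i \<in> I \<Longrightarrow> finite (A i)" "\<And>x. 0 \<le> f x"
  shows "(\<Sum>x\<in>\<Union>(A ` I). f x) \<le> (\<Sum>i\<in>I. \<Sum>x\<in>A i. f x)"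
  using assms(1,2)
proof (induction I)
  case (insert i I)
  have "(\<Sum>x\<in>\<Union>(A ` insert i I). f x) \<le> (\<Sum>x\<in>A i. f x) + (\<Sum>x\<in>\<Union>(A ` I). f x)"
    using insert.hyps insert.prems sum_Un[of "A i" "\<Union>(A ` I)" f] sum_nonneg[of "A i \<inter> \<Union>(A ` I)" f] assms(3) by simp
  then show ?case using insert by fastforce
qed simp

context cube_tree_family
begin

lemma osc_sum_Suc:
  assumes "Q \<in> D k" "x \<in> Q"
  shows "osc_sum (Suc j) k x e = osc k Q e + osc_sum j (Suc k) x e"
  using cube_eq[OF assms] by (simp only: sum.lessThan_Suc_shift) simp

lemma osc_sum_split: "j \<le> n \<Longrightarrow> osc_sum n k x e = osc_sum j k x e + osc_sum (n - j) (k + j) x e"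
proof -
  assume "j \<le> n"
  then have "osc_sum n k x e = (\<Sum>l\<in>{..<j} \<union> {j..<n}. osc (k + l) (cube (k + l) x) e)"
    by (simp add: ivl_disj_un)
  also have "\<dots> = osc_sum j k x e + (\<Sum>l\<in>{j..<n}. osc (k + l) (cube (k + l) x) e)"
    by (intro sum.union_disjoint) auto
  also have "(\<Sum>l\<in>{j..<n}. osc (k + l) (cube (k + l) x) e) = osc_sum (n - j) (k + j) x e"
    using sum.shift_bounds_nat_ivl[of "\<lambda>l. osc (k + l) (cube (k + l) x) e" 0 j "n - j"] \<open>j \<le> n\<close>
    by (simp add: atLeast0LessThan algebra_simps)
  finally show ?thesis .
qed

text \<open>
  The process stops at a cube on which some mass exceeds \<open>\<mu>\<close> times the measure, or some oscillation
  accumulated so far, starting from \<open>\<alpha>\<close>, exceeds \<open>L\<close>. The measure of the stopped cubes is bounded by a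
  potential. In its second sum the oscillation added to \<open>\<alpha>\<close> is compensated by the energy in \<open>avg_sq\<close>
  (\<open>osc_energy\<close>), so that the sum of the potentials of the children is the potential of \<open>Q\<close>. Its
  terms are nonnegative as long as the masses are at most \<open>B * \<mu>\<close> times the measure, which holds for
  the children of every cube at which the process goes on, by doubling.
\<close>

lemma stopping_cubes:
  fixes u :: "'i::finite \<Rightarrow> complex^'d" and \<mu> L :: real and \<alpha> :: "'i \<Rightarrow> real"
  assumes \<mu>: "0 < \<mu>" and L: "0 < L" and Q: "Q \<in> D k"
    and "\<And>i. mass Q (u i) \<le> B * \<mu> * measure M Q"
    and "\<And>i. 0 \<le> \<alpha> i" "\<And>i. \<alpha> i \<le> L + (B * \<mu>)\<^sup>2"
  shows "\<exists>\<P>. finite \<P> \<and> disjoint \<P> \<and>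
    (\<forall>P\<in>\<P>. P \<subseteq> Q \<and> (\<exists>j\<le>n. P \<in> D (k + j) \<and>
        (\<forall>x\<in>P. \<forall>i. \<alpha> i + osc_sum j k x (u i) \<le> L + (B * \<mu>)\<^sup>2))) \<and>
    (\<Sum>P\<in>\<P>. measure M P) \<le> (\<Sum>i\<in>UNIV. mass Q (u i)) / \<mu> +
      (\<Sum>i\<in>UNIV. \<alpha> i * measure M Q + B * \<mu> * mass Q (u i) - measure M Q * avg_sq Q (u i)) / L \<and>
    (\<forall>x\<in>Q - \<Union>\<P>. \<forall>i. \<alpha> i + osc_sum n k x (u i) \<le> L)"
  using assms(3-)
proof (induction n arbitrary: k Q \<alpha>)
  note B_ge_1 [simp]
  let ?\<Phi> = "\<lambda>Q \<alpha>. (\<Sum>i\<in>UNIV. mass Q (u i)) / \<mu> +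
      (\<Sum>i\<in>UNIV. \<alpha> i * measure M Q + B * \<mu> * mass Q (u i) - measure M Q * avg_sq Q (u i)) / L"
  have terms: "0 \<le> \<alpha> i * measure M Q" "0 \<le> B * \<mu> * mass Q (u i) - measure M Q * avg_sq Q (u i)"
    if "Q \<in> D k" "mass Q (u i) \<le> B * \<mu> * measure M Q" "0 \<le> \<alpha> i" for k Q \<alpha> i
    using avg_sq_bound(2)[OF that(1,2)] that(3) by auto
  have nonneg: "0 \<le> ?\<Phi> Q \<alpha>"
    if "Q \<in> D k" "\<And>i. mass Q (u i) \<le> B * \<mu> * measure M Q" "\<And>i. 0 \<le> \<alpha> i" for k Q \<alpha>
    using terms[where \<alpha> = \<alpha>, OF that(1) that(2) that(3)] \<mu> L mass_nonneg
    by (intro add_nonneg_nonneg divide_nonneg_nonneg sum_nonneg) (auto simp: add_diff_eq[symmetric] simp del: add_diff_eq)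
  \<comment> \<open>A cube at which the process stops at once is paid for by the potential.\<close>
  have stop: "measure M Q \<le> ?\<Phi> Q \<alpha>"
    if Q: "Q \<in> D k" "\<And>i. mass Q (u i) \<le> B * \<mu> * measure M Q" "\<And>i. 0 \<le> \<alpha> i"
      and bad: "\<mu> * measure M Q < mass Q (u i) \<or> L < \<alpha> i" for k Q \<alpha> i
    using bad
  proof
    assume "\<mu> * measure M Q < mass Q (u i)"
    then have "measure M Q \<le> mass Q (u i) / \<mu>" using \<mu> by (simp add: field_simps)
    also have "\<dots> \<le> (\<Sum>i\<in>UNIV. mass Q (u i)) / \<mu>"
      using \<mu> mass_nonneg by (intro divide_right_mono member_le_sum) auto
    also have "\<dots> \<le> ?\<Phi> Q \<alpha>"
      using terms[where \<alpha> = \<alpha>, OF Q(1) Q(2) Q(3)] L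
      by (intro add_increasing2 divide_nonneg_nonneg sum_nonneg) (auto simp: add_diff_eq[symmetric] simp del: add_diff_eq)
    finally show ?thesis .
  next
    assume "L < \<alpha> i"
    then have "measure M Q \<le> \<alpha> i * measure M Q / L"
      using L by (simp add: field_simps mult_right_mono)
    also have "\<dots> \<le> (\<Sum>i\<in>UNIV. \<alpha> i * measure M Q) / L"
      using L Q(3) by (intro divide_right_mono member_le_sum) auto
    also have "\<dots> \<le> (\<Sum>i\<in>UNIV. \<alpha> i * measure M Q + B * \<mu> * mass Q (u i) - measure M Q * avg_sq Q (u i)) / L"
      using L terms(2)[where \<alpha> = \<alpha>, OF Q(1) Q(2) Q(3)] by (intro divide_right_mono sum_mono) auto
    also have "\<dots> \<le> ?\<Phi> Q \<alpha>"
      using \<mu> mass_nonneg by (intro add_increasing divide_nonneg_nonneg sum_nonneg) auto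
    finally show ?thesis .
  qed
  {
    case (0 k Q \<alpha>)
    show ?case
    proof (cases "\<exists>i. L < \<alpha> i")
      case True
      then show ?thesis using 0 stop[where \<alpha> = \<alpha>, OF 0(1) 0(2) 0(3)]
        by (intro exI[of _ "{Q}"]) (auto simp: disjoint_def)
    next
      case False
      then show ?thesis using nonneg[where \<alpha> = \<alpha>, OF 0(1) 0(2) 0(3)]
        by (intro exI[of _ "{}"]) (auto simp: not_less)
    qed
  next
    case (Suc n k Q \<alpha>)
    note Q = Suc.prems
    show ?case
    proof (cases "\<exists>i. \<mu> * measure M Q < mass Q (u i) \<or> L < \<alpha> i")
      case True
      then show ?thesis using Q stop[where \<alpha> = \<alpha>, OF Q(1) Q(2) Q(3)]
        by (intro exI[of _ "{Q}"]) (auto simp: disjoint_def intro!: exI[of _ 0])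
    next
      case False
      then have good: "mass Q (u i) \<le> \<mu> * measure M Q" "\<alpha> i \<le> L" for i by (auto simp: not_less)
      define \<beta> where "\<beta> i = \<alpha> i + osc k Q (u i)" for i
      have mP: "mass P (u i) \<le> B * \<mu> * measure M P" if "P \<in> children k Q" for P i
      proof -
        have "mass P (u i) \<le> \<mu> * measure M Q" using mass_mono[OF that Q(1)] good order_trans by blast
        also have "\<dots> \<le> \<mu> * (B * measure M P)"
          using \<mu> doubling[OF children_D(1)[OF that] Q(1) children_D(2)[OF that]] by (intro mult_left_mono) auto
        finally show ?thesis by (simp add: mult_ac)
      qed
      have \<beta>: "0 \<le> \<beta> i" "\<beta> i \<le> L + (B * \<mu>)\<^sup>2" for i
      proof -
        show "0 \<le> \<beta> i" using Q(3) osc_nonneg by (simp add: \<beta>_def)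
        have "measure M Q * osc k Q (u i) \<le> (\<Sum>P\<in>children k Q. measure M P * avg_sq P (u i))"
          unfolding osc_energy[OF Q(1)] using avg_sq_nonneg by simp
        also have "\<dots> \<le> (\<Sum>P\<in>children k Q. measure M P * (B * \<mu>)\<^sup>2)"
          by (intro sum_mono mult_left_mono avg_sq_bound(1)[OF children_D(1) mP]) auto
        also have "\<dots> = measure M Q * (B * \<mu>)\<^sup>2"
          by (simp add: sum_distrib_right[symmetric] measure_children[OF Q(1)])
        finally have "osc k Q (u i) \<le> (B * \<mu>)\<^sup>2" using cube_pos[OF Q(1)] by simp
        then show "\<beta> i \<le> L + (B * \<mu>)\<^sup>2" using good(2)[of i] by (simp add: \<beta>_def)
      qed
      define ok where "ok P \<P> \<longleftrightarrow> finite \<P> \<and> disjoint \<P> \<and>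
        (\<forall>P'\<in>\<P>. P' \<subseteq> P \<and> (\<exists>j\<le>n. P' \<in> D (Suc k + j) \<and>
            (\<forall>x\<in>P'. \<forall>i. \<beta> i + osc_sum j (Suc k) x (u i) \<le> L + (B * \<mu>)\<^sup>2))) \<and>
        (\<Sum>P'\<in>\<P>. measure M P') \<le> ?\<Phi> P \<beta> \<and>
        (\<forall>x\<in>P - \<Union>\<P>. \<forall>i. \<beta> i + osc_sum n (Suc k) x (u i) \<le> L)" for P \<P>
      have "\<forall>P\<in>children k Q. \<exists>\<P>. ok P \<P>"
        unfolding ok_def by (intro ballI Suc.IH mP \<beta> children_D(1))
      then obtain \<R> where R: "\<forall>P\<in>children k Q. ok P (\<R> P)"
        using bchoice by blast
      have fin: "finite (\<R> P)" and disj: "disjoint (\<R> P)"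
        and meas: "(\<Sum>P'\<in>\<R> P. measure M P') \<le> ?\<Phi> P \<beta>"
        if "P \<in> children k Q" for P
        using bspec[OF R that] unfolding ok_def by simp_all
      have sub: "P' \<subseteq> P" and lev: "\<exists>j\<le>n. P' \<in> D (Suc k + j) \<and>
            (\<forall>x\<in>P'. \<forall>i. \<beta> i + osc_sum j (Suc k) x (u i) \<le> L + (B * \<mu>)\<^sup>2)"
        if "P \<in> children k Q" "P' \<in> \<R> P" for P P'
        using bspec[OF R that(1)] that(2) unfolding ok_def by blast+
      have rest: "\<beta> i + osc_sum n (Suc k) x (u i) \<le> L"
        if "P \<in> children k Q" "x \<in> P - \<Union>(\<R> P)" for P x i
        using bspec[OF R that(1)] that(2) unfolding ok_def by blast
      define \<P> where "\<P> = \<Union>(\<R> ` children k Q)"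
      have "finite \<P>" using fin finite_children[OF Q(1)] by (auto simp: \<P>_def)
      moreover have "disjoint \<P>"
      proof (rule disjointI)
        fix S T assume ST: "S \<in> \<P>" "T \<in> \<P>" "S \<noteq> T"
        then obtain P P' where P: "P \<in> children k Q" "S \<in> \<R> P" "P' \<in> children k Q" "T \<in> \<R> P'"
          by (auto simp: \<P>_def)
        show "S \<inter> T = {}"
        proof (cases "P = P'")
          case True
          then show ?thesis using disj[OF P(1)] P ST(3) by (auto simp: disjoint_def)
        next
          case False
          then have "P \<inter> P' = {}" using children_disjoint P by (auto simp: disjoint_def)
          then show ?thesis using sub[OF P(1,2)] sub[OF P(3,4)] by blast
        qed
      qed
      moreover have "P' \<subseteq> Q \<and> (\<exists>j\<le>Suc n. P' \<in> D (k + j) \<and>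
        (\<forall>x\<in>P'. \<forall>i. \<alpha> i + osc_sum j k x (u i) \<le> L + (B * \<mu>)\<^sup>2))" if "P' \<in> \<P>" for P'
      proof -
        obtain P where P: "P \<in> children k Q" "P' \<in> \<R> P" using \<open>P' \<in> \<P>\<close> by (auto simp: \<P>_def)
        then have sQ: "P' \<subseteq> Q" using sub children_D(2) by blast
        obtain j where j: "j \<le> n" "P' \<in> D (Suc k + j)"
          "\<And>x i. x \<in> P' \<Longrightarrow> \<beta> i + osc_sum j (Suc k) x (u i) \<le> L + (B * \<mu>)\<^sup>2"
          using lev[OF P] by blast
        have "\<alpha> i + osc_sum (Suc j) k x (u i) \<le> L + (B * \<mu>)\<^sup>2" if "x \<in> P'" for x i
          using j(3)[OF that, of i] that sQ by (subst osc_sum_Suc[OF Q(1)]) (auto simp: \<beta>_def)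
        then show ?thesis using j sQ by (intro conjI exI[of _ "Suc j"]) auto
      qed
      moreover have "(\<Sum>P\<in>\<P>. measure M P) \<le> ?\<Phi> Q \<alpha>"
      proof -
        have "(\<Sum>P\<in>\<P>. measure M P) \<le> (\<Sum>P\<in>children k Q. \<Sum>P'\<in>\<R> P. measure M P')"
          unfolding \<P>_def using finite_children[OF Q(1)] fin by (intro sum_UNION_le_sum) auto
        also have "\<dots> \<le> (\<Sum>P\<in>children k Q. ?\<Phi> P \<beta>)" by (intro sum_mono meas)
        also have "\<dots> = (\<Sum>i\<in>UNIV. \<Sum>P\<in>children k Q. mass P (u i)) / \<mu> +
            (\<Sum>i\<in>UNIV. \<Sum>P\<in>children k Q. \<beta> i * measure M P + B * \<mu> * mass P (u i) - measure M P * avg_sq P (u i)) / L"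
          unfolding sum.distrib sum_divide_distrib[symmetric]
          by (intro arg_cong2[where f = "(+)"] arg_cong2[where f = "(/)"] refl sum.swap)
        also have "\<dots> = ?\<Phi> Q \<alpha>"
        proof -
          have "(\<Sum>P\<in>children k Q. \<beta> i * measure M P + B * \<mu> * mass P (u i) - measure M P * avg_sq P (u i))
              = \<alpha> i * measure M Q + B * \<mu> * mass Q (u i) - measure M Q * avg_sq Q (u i)" for i
          proof -
            have "(\<Sum>P\<in>children k Q. \<beta> i * measure M P + B * \<mu> * mass P (u i) - measure M P * avg_sq P (u i))
              = \<beta> i * measure M Q + B * \<mu> * mass Q (u i) - (\<Sum>P\<in>children k Q. measure M P * avg_sq P (u i))"
              by (simp add: sum.distrib sum_subtractf sum_distrib_left[symmetric] measure_children[OF Q(1)]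
                mass_children[OF Q(1)])
            then show ?thesis
              using osc_energy[OF Q(1), of "u i"] by (simp add: \<beta>_def algebra_simps)
          qed
          then show ?thesis by (simp add: mass_children[OF Q(1)])
        qed
        finally show ?thesis .
      qed
      moreover have "\<alpha> i + osc_sum (Suc n) k x (u i) \<le> L" if x: "x \<in> Q - \<Union>\<P>" for x i
      proof -
        obtain P where P: "P \<in> children k Q" "x \<in> P" using x Union_children[OF Q(1)] by blast
        then have "x \<in> P - \<Union>(\<R> P)" using x by (auto simp: \<P>_def)
        from rest[OF P(1) this, of i] show ?thesis
          using x by (subst osc_sum_Suc[OF Q(1)]) (auto simp: \<beta>_def)
      qed
      ultimately show ?thesis by blast
    qed
  }
qed

end

text \<open>
  The bound \<open>L + (B * \<mu>)\<^sup>2\<close> for the accumulated oscillations with the thresholds \<open>\<mu> = 4 * d\<close> and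
  \<open>L = 16 * d\<^sup>2 * B\<close>, times the loss \<open>4 * d\<^sup>2\<close> of expanding a direction in a basis whose coordinate
  functionals are at most 2.
\<close>

definition domination_const :: "real \<Rightarrow> real \<Rightarrow> real"
  where "domination_const d B = 4 * d\<^sup>2 * (16 * d\<^sup>2 * B + (B * (4 * d))\<^sup>2)"

context cube_tree
begin

definition sparse :: "'a set set \<Rightarrow> bool"
  where "sparse S \<longleftrightarrow> (\<forall>Q\<in>S. measure M (\<Union>{P\<in>S. P \<subset> Q}) \<le> measure M Q / 2)"

lemma descendants_shift: "j \<le> n \<Longrightarrow> P \<subseteq> Q \<Longrightarrow> descendants (n - j) (k + j) P \<subseteq> descendants n k Q"
proof
  fix R assume *: "j \<le> n" "P \<subseteq> Q" "R \<in> descendants (n - j) (k + j) P"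
  then obtain i where "i \<le> n - j" "R \<in> D (k + j + i)" "R \<subseteq> P" by (auto simp: descendants_def)
  then show "R \<in> descendants n k Q" using *
    by (auto simp: descendants_def add.assoc intro!: bexI[of _ "j + i"])
qed

lemma descendants_D: "P \<in> descendants n k Q \<Longrightarrow> \<exists>j. P \<in> D j \<and> P \<subseteq> Q"
  by (auto simp: descendants_def)

end

context cube_tree_family
begin

lemma mass_hom: "mass Q (c *s e) = norm c * mass Q e"
  unfolding mass_def pairing_linear(2) L2_set_cmult_complex by (rule set_integral_mult_right)

lemma mass_add_le:
  assumes "Q \<in> D k" shows "mass Q (e + e') \<le> mass Q e + mass Q e'"
proof -
  have "L2_set (\<lambda>\<kappa>. norm (pairing (e + e') (F \<kappa> x))) K
      \<le> L2_set (\<lambda>\<kappa>. norm (pairing e (F \<kappa> x))) K + L2_set (\<lambda>\<kappa>. norm (pairing e' (F \<kappa> x))) K" for x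
    by (rule order_trans[OF L2_set_mono L2_set_triangle_ineq]) (auto simp: pairing_linear norm_triangle_ineq)
  then have "mass Q (e + e') \<le> (LINT x:Q|M. L2_set (\<lambda>\<kappa>. norm (pairing e (F \<kappa> x))) K
      + L2_set (\<lambda>\<kappa>. norm (pairing e' (F \<kappa> x))) K)"
    unfolding mass_def
    by (intro set_integral_mono L2_integrable[OF assms] set_integral_add(1)) blast
  also have "\<dots> = mass Q e + mass Q e'"
    unfolding mass_def by (intro set_integral_add(2) L2_integrable[OF assms])
  finally show ?thesis .
qed

lemma continuous_mass:
  assumes "Q \<in> D k" shows "continuous_on UNIV (mass Q)"
proof -
  define c where "c = (\<Sum>i\<in>UNIV. mass Q (axis i 1))"
  have sum_le: "mass Q (\<Sum>i\<in>I. f i) \<le> (\<Sum>i\<in>I. mass Q (f i))" for I and f :: "'d \<Rightarrow> complex^'d"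
  proof (induction I rule: infinite_finite_induct)
    case (insert i I)
    then show ?case using mass_add_le[OF assms, of "f i" "\<Sum>i\<in>I. f i"] by simp
  qed (auto simp: mass_def pairing_linear L2_set_def)
  have bound: "mass Q e \<le> c * norm e" for e
  proof -
    have "mass Q e = mass Q (\<Sum>i\<in>UNIV. e $ i *s axis i 1)"
      by (simp add: basis_expansion)
    also have "\<dots> \<le> (\<Sum>i\<in>UNIV. norm (e $ i) * mass Q (axis i 1))"
      by (rule order_trans[OF sum_le]) (simp add: mass_hom)
    also have "\<dots> \<le> (\<Sum>i\<in>UNIV. norm e * mass Q (axis i 1))"
      by (intro sum_mono mult_right_mono Finite_Cartesian_Product.norm_nth_le mass_nonneg)
    finally show ?thesis by (simp add: c_def sum_distrib_left mult.commute)
  qed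
  have "\<bar>mass Q x - mass Q y\<bar> \<le> c * norm (x - y)" for x y
    using mass_add_le[OF assms, of "x - y" y] mass_add_le[OF assms, of "y - x" x]
      bound[of "x - y"] bound[of "y - x"] by (simp add: norm_minus_commute)
  then have "c-lipschitz_on UNIV (mass Q)"
    by (intro lipschitz_onI) (auto simp: dist_norm c_def intro!: sum_nonneg mass_nonneg)
  then show ?thesis by (rule lipschitz_on_continuous_on)
qed

text \<open>
  The reference vectors \<open>u\<close> are chosen almost extremal for the (slightly perturbed) norm
  \<open>e \<mapsto> mass Q e / |Q|\<close>, so that one stopping process controls all directions \<open>e\<close> at once.
\<close>

lemma sparse_domination_perturbed:
  assumes \<delta>: "0 < \<delta>"
  shows "Q \<in> D k \<Longrightarrow> \<exists>S. S \<subseteq> descendants n k Q \<and> Q \<in> S \<and> sparse S \<and>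
    (\<forall>x\<in>Q. \<forall>e. osc_sum n k x e
      \<le> domination_const (real CARD('d)) B * (\<Sum>P\<in>{P\<in>S. x \<in> P}. (mass P e / measure M P + \<delta> * norm e)\<^sup>2))"
proof (induction n arbitrary: k Q rule: less_induct)
  case (less n k Q)
  note Q = less.prems
  have m: "0 < measure M Q" using Q by (rule cube_pos)
  define d where "d = real CARD('d)"
  have d: "d \<ge> 1" by (simp add: d_def Suc_leI)
  define N where "N P e = mass P e / measure M P + \<delta> * norm e" for P and e :: "complex^'d"
  have N0: "0 \<le> N P e" for P e using \<delta> mass_nonneg by (simp add: N_def)
  have N_cont: "continuous_on UNIV (N Q)"
    unfolding N_def using m by (intro continuous_intros continuous_mass[OF Q]) auto
  have N_hom: "N Q (c *s x) = norm c * N Q x" for c x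
    by (simp add: N_def mass_hom norm_smult_vec algebra_simps)
  have N_pos: "0 < N Q x" if "x \<noteq> 0" for x
    using \<delta> that mass_nonneg[of Q x] m by (auto simp: N_def intro!: add_nonneg_pos)
  obtain U U' :: "complex^'d^'d" where U: "U' ** U = mat 1" "\<And>i. N Q (row i U) \<le> 1"
      "\<And>e i. norm ((e v* U') $ i) \<le> 2 * N Q e"
  proof (rule almost_extremal_basis[of "N Q" UNIV, OF N_cont N_hom N_pos])
    show "\<exists>U\<in>UNIV. U \<in> S" if "S \<noteq> {}" for S :: "(complex^'d^'d) set" using that by auto
  next
    fix U U' :: "complex^'d^'d"
    assume "U' ** U = mat 1" "\<And>i. N Q (row i U) \<le> 1" "\<And>e i. norm ((e v* U') $ i) \<le> 2 * N Q e"
    then show thesis by (rule that)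
  qed
  define u where "u i = row i U" for i
  \<comment> \<open>With these thresholds each of the two terms that bound the stopped cubes is at most \<open>|Q| / 4\<close>.\<close>
  define \<mu> L where "\<mu> = 4 * d" and "L = 16 * d\<^sup>2 * B"
  have \<mu>L: "0 < \<mu>" "0 < L" using d B_ge_1 by (auto simp: \<mu>_def L_def)
  have mass_u: "mass Q (u i) \<le> measure M Q" for i
    using U(2)[of i] m \<delta> by (simp add: N_def u_def field_simps) (smt (verit) mult_nonneg_nonneg norm_ge_zero)
  have "mass Q (u i) \<le> B * \<mu> * measure M Q" for i
  proof -
    have "1 * 1 \<le> B * \<mu>" using B_ge_1 d by (intro mult_mono) (auto simp: \<mu>_def)
    then have "1 * measure M Q \<le> B * \<mu> * measure M Q" using m by (intro mult_right_mono) auto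
    then show ?thesis using mass_u[of i] by simp
  qed
  note mass_bound = this
  have L0: "0 \<le> L + (B * \<mu>)\<^sup>2" using \<mu>L by simp
  obtain \<P> where fin: "finite \<P>" and disj: "disjoint \<P>"
    and P0: "\<forall>P\<in>\<P>. P \<subseteq> Q \<and> (\<exists>j\<le>n. P \<in> D (k + j) \<and>
        (\<forall>x\<in>P. \<forall>i. 0 + osc_sum j k x (u i) \<le> L + (B * \<mu>)\<^sup>2))"
    and meas0: "(\<Sum>P\<in>\<P>. measure M P) \<le> (\<Sum>i\<in>UNIV. mass Q (u i)) / \<mu> +
      (\<Sum>i\<in>UNIV. 0 * measure M Q + B * \<mu> * mass Q (u i) - measure M Q * avg_sq Q (u i)) / L"
    and rest0: "\<forall>x\<in>Q - \<Union>\<P>. \<forall>i. 0 + osc_sum n k x (u i) \<le> L"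
    using stopping_cubes[where u = u and \<alpha> = "\<lambda>_. 0" and n = n, OF \<mu>L Q mass_bound order_refl L0]
    by (elim exE conjE) (rule that)
  have sub: "P \<subseteq> Q" if "P \<in> \<P>" for P using P0 that by blast
  have lev: "\<exists>j\<le>n. P \<in> D (k + j) \<and> (\<forall>x\<in>P. \<forall>i. osc_sum j k x (u i) \<le> L + (B * \<mu>)\<^sup>2)"
    if "P \<in> \<P>" for P using bspec[OF P0 that] unfolding add_0_left by (rule conjunct2)
  have meas: "(\<Sum>P\<in>\<P>. measure M P) \<le> (\<Sum>i\<in>UNIV. mass Q (u i)) / \<mu> +
      (\<Sum>i\<in>UNIV. B * \<mu> * mass Q (u i) - measure M Q * avg_sq Q (u i)) / L"
    using meas0 unfolding mult_zero_left add_0_left .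
  have rest: "osc_sum n k x (u i) \<le> L" if "x \<in> Q - \<Union>\<P>" for x i
    using bspec[OF rest0 that] unfolding add_0_left by (rule spec)
  have half: "(\<Sum>P\<in>\<P>. measure M P) \<le> measure M Q / 2"
  proof -
    have "(\<Sum>i\<in>UNIV. mass Q (u i)) / \<mu> \<le> (\<Sum>i\<in>(UNIV::'d set). measure M Q) / \<mu>"
      using \<mu>L by (intro divide_right_mono sum_mono mass_u) auto
    also have "\<dots> = measure M Q / 4" using d by (simp add: \<mu>_def d_def)
    finally have 1: "(\<Sum>i\<in>UNIV. mass Q (u i)) / \<mu> \<le> measure M Q / 4" .
    have "(\<Sum>i\<in>UNIV. B * \<mu> * mass Q (u i) - measure M Q * avg_sq Q (u i)) / L
        \<le> (\<Sum>i\<in>(UNIV::'d set). B * \<mu> * measure M Q) / L"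
    proof (intro divide_right_mono sum_mono)
      fix i :: 'd
      have "B * \<mu> * mass Q (u i) \<le> B * \<mu> * measure M Q"
        using \<mu>L B_ge_1 by (intro mult_left_mono mass_u) auto
      then show "B * \<mu> * mass Q (u i) - measure M Q * avg_sq Q (u i) \<le> B * \<mu> * measure M Q"
        using m avg_sq_nonneg[of Q "u i"] by (smt (verit) mult_nonneg_nonneg)
    qed (use \<mu>L in auto)
    also have "\<dots> = measure M Q / 4"
      using d B_ge_1 by (simp add: \<mu>_def L_def d_def field_simps power2_eq_square)
    finally show ?thesis using 1 meas by linarith
  qed
  have small: "P \<in> \<P> \<Longrightarrow> P \<noteq> Q" for P
  proof
    assume "P \<in> \<P>" "P = Q"
    then have "measure M Q \<le> (\<Sum>P\<in>\<P>. measure M P)" using fin by (auto intro!: member_le_sum)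
    then show False using half m by simp
  qed
  define ok where "ok P j S \<longleftrightarrow> j \<le> n \<and> P \<in> D (k + j) \<and>
      (\<forall>x\<in>P. \<forall>i. osc_sum j k x (u i) \<le> L + (B * \<mu>)\<^sup>2) \<and>
      S \<subseteq> descendants (n - j) (k + j) P \<and> P \<in> S \<and> sparse S \<and>
      (\<forall>x\<in>P. \<forall>e. osc_sum (n - j) (k + j) x e \<le> domination_const (real CARD('d)) B * (\<Sum>P\<in>{P\<in>S. x \<in> P}. (N P e)\<^sup>2))"
    for P j S
  have "\<exists>j S. ok P j S" if P: "P \<in> \<P>" for P
  proof -
    obtain j where j: "j \<le> n" "P \<in> D (k + j)" "\<forall>x\<in>P. \<forall>i. osc_sum j k x (u i) \<le> L + (B * \<mu>)\<^sup>2"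
      using lev[OF P] by blast
    have "j \<noteq> 0"
    proof
      assume "j = 0"
      then have "P = Q" using j(2) Q sub[OF P] cube_nonempty[of P k] disjoint_D[of P k Q] by auto
      then show False using small[OF P] by simp
    qed
    then have "n - j < n" using j(1) by simp
    from less.IH[OF this j(2), folded N_def] obtain S where
      "S \<subseteq> descendants (n - j) (k + j) P \<and> P \<in> S \<and> sparse S \<and>
      (\<forall>x\<in>P. \<forall>e. osc_sum (n - j) (k + j) x e \<le> domination_const (real CARD('d)) B * (\<Sum>P\<in>{P\<in>S. x \<in> P}. (N P e)\<^sup>2))" ..
    with j have "ok P j S" unfolding ok_def by blast
    then show ?thesis by blast
  qed
  then obtain j \<S> where ok: "\<And>P. P \<in> \<P> \<Longrightarrow> ok P (j P) (\<S> P)" by metis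
  have j: "j P \<le> n" "P \<in> D (k + j P)"
    and SS: "\<S> P \<subseteq> descendants (n - j P) (k + j P) P" "P \<in> \<S> P" "sparse (\<S> P)" if "P \<in> \<P>" for P
    using ok[OF that] unfolding ok_def by simp_all
  have top: "osc_sum (j P) k x (u i) \<le> L + (B * \<mu>)\<^sup>2" if "P \<in> \<P>" "x \<in> P" for P x i
    using ok[OF that(1)] that(2) unfolding ok_def by blast
  have low: "osc_sum (n - j P) (k + j P) x e \<le> domination_const (real CARD('d)) B * (\<Sum>P'\<in>{P'\<in>\<S> P. x \<in> P'}. (N P' e)\<^sup>2)"
    if "P \<in> \<P>" "x \<in> P" for P x e
    using ok[OF that(1)] that(2) unfolding ok_def by blast
  define S where "S = insert Q (\<Union>(\<S> ` \<P>))"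
  have SP: "\<exists>i. R \<in> D i \<and> R \<subseteq> P" if "P \<in> \<P>" "R \<in> \<S> P" for P R
    using SS(1)[OF that(1)] that(2) descendants_D by blast
  have S_desc: "S \<subseteq> descendants n k Q"
  proof
    fix R assume "R \<in> S"
    then consider "R = Q" | P where "P \<in> \<P>" "R \<in> \<S> P" by (auto simp: S_def)
    then show "R \<in> descendants n k Q"
    proof cases
      case 1
      then show ?thesis using Q by (auto simp: descendants_def intro!: bexI[of _ 0])
    next
      case 2
      then show ?thesis using SS(1)[OF 2(1)] descendants_shift[OF j(1)[OF 2(1)] sub[OF 2(1)]] by blast
    qed
  qed
  have "sparse S"
    unfolding sparse_def
  proof
    fix R assume "R \<in> S"
    then consider "R = Q" | P where "P \<in> \<P>" "R \<in> \<S> P" by (auto simp: S_def)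
    then show "measure M (\<Union>{P\<in>S. P \<subset> R}) \<le> measure M R / 2"
    proof cases
      case 1
      have fm: "P \<in> fmeasurable M" if "P \<in> \<P>" for P
        using cube_sets[OF j(2)[OF that]] cube_finite[OF j(2)[OF that]] by (simp add: fmeasurable_def)
      have "\<Union>{P\<in>S. P \<subset> R} = \<Union>\<P>"
      proof
        show "\<Union>{P\<in>S. P \<subset> R} \<subseteq> \<Union>\<P>" using SP 1 by (fastforce simp: S_def)
        show "\<Union>\<P> \<subseteq> \<Union>{P\<in>S. P \<subset> R}"
        proof (rule Union_mono, rule subsetI)
          fix P assume "P \<in> \<P>"
          then show "P \<in> {P \<in> S. P \<subset> R}"
            using SS(2)[of P] sub[of P] small[of P] 1 by (auto simp: S_def)
        qed
      qed
      moreover have "measure M (\<Union>\<P>) \<le> (\<Sum>P\<in>\<P>. measure M P)"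
        using measure_UNION_le[OF fin, of "\<lambda>P. P" M] fm by (auto simp: fmeasurable_def)
      ultimately show ?thesis using half 1 by simp
    next
      case 2
      have "{P'\<in>S. P' \<subset> R} = {P'\<in>\<S> P. P' \<subset> R}"
      proof
        show "{P'\<in>\<S> P. P' \<subset> R} \<subseteq> {P'\<in>S. P' \<subset> R}" using 2 by (auto simp: S_def)
        show "{P'\<in>S. P' \<subset> R} \<subseteq> {P'\<in>\<S> P. P' \<subset> R}"
        proof
          fix P' assume "P' \<in> {P'\<in>S. P' \<subset> R}"
          then have P': "P' \<in> S" "P' \<subset> R" by auto
          have RP: "R \<subseteq> P" using SP[OF 2] by blast
          have "P' \<noteq> Q" using P' RP sub[OF 2(1)] by blast
          then obtain P2 where P2: "P2 \<in> \<P>" "P' \<in> \<S> P2" using P' by (auto simp: S_def)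
          obtain i where i: "P' \<in> D i" "P' \<subseteq> P2" using SP[OF P2] by blast
          have "P' \<noteq> {}" using cube_nonempty[OF i(1)] .
          then have "P2 \<inter> P \<noteq> {}" using i(2) P'(2) RP by blast
          then have "P2 = P" using disj P2(1) 2(1) by (auto simp: disjoint_def)
          then show "P' \<in> {P'\<in>\<S> P. P' \<subset> R}" using P2 P' by simp
        qed
      qed
      then show ?thesis using SS(3)[OF 2(1)] 2(2) by (simp add: sparse_def)
    qed
  qed
  moreover have "osc_sum n k x e \<le> domination_const (real CARD('d)) B * (\<Sum>P\<in>{P\<in>S. x \<in> P}. (N P e)\<^sup>2)"
    if x: "x \<in> Q" for x e
  proof -
    define c where "c = e v* U'"
    have e: "e = (\<Sum>i\<in>UNIV. c $ i *s u i)"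
      by (simp add: u_def vector_matrix_sum_rows[symmetric] c_def vector_matrix_mul_assoc U(1))
    have finS: "finite S" using S_desc finite_descendants[OF Q] finite_subset by blast
    have finSx: "finite {P\<in>S. x \<in> P}" using finS by simp
    have QS: "Q \<in> S" "\<And>P. P \<in> \<P> \<Longrightarrow> \<S> P \<subseteq> S" by (auto simp: S_def)
    have part: "osc_sum l k x e \<le> domination_const (real CARD('d)) B * (N Q e)\<^sup>2"
      if "\<And>i. osc_sum l k x (u i) \<le> L + (B * \<mu>)\<^sup>2" for l
    proof -
      have "osc_sum l k x e \<le> (\<Sum>r<l. d * (\<Sum>i\<in>UNIV. (norm (c $ i))\<^sup>2 * osc (k + r) (cube (k + r) x) (u i)))"
        unfolding d_def by (subst e) (intro sum_mono osc_comb)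
      also have "\<dots> \<le> (\<Sum>r<l. d * (\<Sum>i\<in>UNIV. (2 * N Q e)\<^sup>2 * osc (k + r) (cube (k + r) x) (u i)))"
        using U(3)[of e] d unfolding c_def
        by (intro sum_mono mult_left_mono mult_right_mono power_mono osc_nonneg) auto
      also have "\<dots> = d * (2 * N Q e)\<^sup>2 * (\<Sum>r<l. \<Sum>i\<in>UNIV. osc (k + r) (cube (k + r) x) (u i))"
        by (simp add: sum_distrib_left mult_ac)
      also have "(\<Sum>r<l. \<Sum>i\<in>UNIV. osc (k + r) (cube (k + r) x) (u i)) = (\<Sum>i\<in>UNIV. osc_sum l k x (u i))"
        by (rule sum.swap)
      also have "\<dots> \<le> (\<Sum>i\<in>(UNIV::'d set). L + (B * \<mu>)\<^sup>2)" by (intro sum_mono that)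
      also have "\<dots> = d * (L + (B * \<mu>)\<^sup>2)" by (simp add: d_def)
      finally have "osc_sum l k x e \<le> d * (2 * N Q e)\<^sup>2 * (d * (L + (B * \<mu>)\<^sup>2))"
        using d by (simp add: mult_left_mono)
      also have "\<dots> = domination_const (real CARD('d)) B * (N Q e)\<^sup>2"
        by (simp add: domination_const_def L_def \<mu>_def d_def power2_eq_square algebra_simps)
      finally show ?thesis .
    qed
    have dc: "0 \<le> domination_const (real CARD('d)) B" using B_ge_1 by (simp add: domination_const_def)
    show ?thesis
    proof (cases "x \<in> \<Union>\<P>")
      case False
      have "osc_sum n k x (u i) \<le> L + (B * \<mu>)\<^sup>2" for i
        using rest[of x i] x False by (auto intro: add_increasing2)
      then have "osc_sum n k x e \<le> domination_const (real CARD('d)) B * (N Q e)\<^sup>2" by (rule part)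
      also have "\<dots> \<le> domination_const (real CARD('d)) B * (\<Sum>P\<in>{P\<in>S. x \<in> P}. (N P e)\<^sup>2)"
        using finSx QS x dc by (intro mult_left_mono member_le_sum) auto
      finally show ?thesis .
    next
      case True
      then obtain P where P: "P \<in> \<P>" "x \<in> P" by blast
      have "osc_sum n k x e = osc_sum (j P) k x e + osc_sum (n - j P) (k + j P) x e"
        by (rule osc_sum_split[OF j(1)[OF P(1)]])
      also have "\<dots> \<le> domination_const (real CARD('d)) B * (N Q e)\<^sup>2 + domination_const (real CARD('d)) B * (\<Sum>P'\<in>{P'\<in>\<S> P. x \<in> P'}. (N P' e)\<^sup>2)"
        by (intro add_mono part low P top)
      also have "\<dots> = domination_const (real CARD('d)) B * (\<Sum>P'\<in>insert Q {P'\<in>\<S> P. x \<in> P'}. (N P' e)\<^sup>2)"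
      proof -
        have "Q \<notin> \<S> P" using SP[OF P(1), of Q] sub[OF P(1)] small[OF P(1)] by auto
        moreover have "finite (\<S> P)" using P(1) by (intro finite_subset[OF _ finS]) (auto simp: S_def)
        ultimately show ?thesis by (simp add: algebra_simps)
      qed
      also have "\<dots> \<le> domination_const (real CARD('d)) B * (\<Sum>P\<in>{P\<in>S. x \<in> P}. (N P e)\<^sup>2)"
        using finSx QS(1) QS(2)[OF P(1)] x dc by (intro mult_left_mono sum_mono2) auto
      finally show ?thesis .
    qed
  qed
  ultimately show ?case using S_desc unfolding N_def S_def by blast
qed

text \<open>
  There are only finitely many candidates for \<open>S\<close>, so one of them works for arbitrarily small
  perturbations, and hence also without perturbation.
\<close>

proposition sparse_domination:
  assumes Q: "Q \<in> D k"
  obtains S where "S \<subseteq> descendants n k Q" "Q \<in> S" "sparse S"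
    "\<And>x e. x \<in> Q \<Longrightarrow>
      osc_sum n k x e \<le> domination_const (real CARD('d)) B * (\<Sum>P\<in>{P\<in>S. x \<in> P}. (mass P e / measure M P)\<^sup>2)"
proof -
  define good where "good S \<delta> \<longleftrightarrow> S \<subseteq> descendants n k Q \<and> Q \<in> S \<and> sparse S \<and>
    (\<forall>x\<in>Q. \<forall>e. osc_sum n k x e
      \<le> domination_const (real CARD('d)) B * (\<Sum>P\<in>{P\<in>S. x \<in> P}. (mass P e / measure M P + \<delta> * norm e)\<^sup>2))" for S \<delta>
  have dc: "0 \<le> domination_const (real CARD('d)) B" using B_ge_1 by (simp add: domination_const_def)
  have ex: "\<exists>S. good S (1 / real (Suc m))" for m
    unfolding good_def by (rule sparse_domination_perturbed[OF _ Q]) simp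
  then obtain f where f: "\<And>m. good (f m) (1 / real (Suc m))" by metis
  have fin: "finite (Pow (descendants n k Q))" using finite_descendants[OF Q] by simp
  have "range f \<subseteq> Pow (descendants n k Q)" using f by (auto simp: good_def)
  then have "finite (range f)" using fin finite_subset by blast
  then obtain m0 where inf: "infinite {m. f m = f m0}"
    using pigeonhole_infinite[of UNIV f] by auto
  define S where "S = f m0"
  have S: "S \<subseteq> descendants n k Q" "Q \<in> S" "sparse S" using f[of m0] by (auto simp: S_def good_def)
  have "osc_sum n k x e \<le> domination_const (real CARD('d)) B * (\<Sum>P\<in>{P\<in>S. x \<in> P}. (mass P e / measure M P)\<^sup>2)"
    if x: "x \<in> Q" for x e
  proof (rule tendsto_lowerbound[where F = "at_right 0"])
    show "((\<lambda>\<delta>. domination_const (real CARD('d)) B * (\<Sum>P\<in>{P\<in>S. x \<in> P}. (mass P e / measure M P + \<delta> * norm e)\<^sup>2))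
      \<longlongrightarrow> domination_const (real CARD('d)) B * (\<Sum>P\<in>{P\<in>S. x \<in> P}. (mass P e / measure M P)\<^sup>2)) (at_right 0)"
      by (auto intro!: tendsto_eq_intros)
    have "osc_sum n k x e \<le> domination_const (real CARD('d)) B * (\<Sum>P\<in>{P\<in>S. x \<in> P}. (mass P e / measure M P + \<delta> * norm e)\<^sup>2)"
      if \<delta>: "0 < \<delta>" for \<delta>
    proof -
      obtain m1 where m1: "1 / real (Suc m1) < \<delta>" using \<delta> nat_approx_posE by blast
      obtain m where m: "f m = f m0" "m1 \<le> m"
        using inf by (auto simp: infinite_nat_iff_unbounded_le)
      have le: "1 / real (Suc m) \<le> \<delta>"
        using m(2) m1 by (intro order_trans[OF _ less_imp_le[OF m1]] divide_left_mono) auto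
      have "osc_sum n k x e \<le> domination_const (real CARD('d)) B * (\<Sum>P\<in>{P\<in>S. x \<in> P}. (mass P e / measure M P + 1 / real (Suc m) * norm e)\<^sup>2)"
        using f[of m] x m(1) by (simp add: good_def S_def)
      also have "\<dots> \<le> domination_const (real CARD('d)) B * (\<Sum>P\<in>{P\<in>S. x \<in> P}. (mass P e / measure M P + \<delta> * norm e)\<^sup>2)"
        using le dc mass_nonneg
        by (intro mult_left_mono sum_mono power_mono add_mono order_refl mult_right_mono add_nonneg_nonneg
            divide_nonneg_nonneg mult_nonneg_nonneg) auto
      finally show ?thesis .
    qed
    then show "\<forall>\<^sub>F \<delta> in at_right 0. osc_sum n k x e
        \<le> domination_const (real CARD('d)) B * (\<Sum>P\<in>{P\<in>S. x \<in> P}. (mass P e / measure M P + \<delta> * norm e)\<^sup>2)"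
      by (simp add: eventually_at_filter)
  qed simp
  then show ?thesis using that S by blast
qed

end

section \<open>Layers of a sparse family\<close>

text \<open>
  The sum of the geometric series with ratio \<open>(1 + \<kappa> / 2) powr (- s)\<close> is of order \<open>1 / \<kappa>\<close>; the power
  of \<open>1 / \<kappa>\<close> determines the final exponent of the weight constant.
\<close>

lemma one_minus_powr_bound:
  fixes s \<kappa> :: real
  assumes "0 < s" "0 < \<kappa>" "\<kappa> \<le> 1"
  shows "(1 + \<kappa> / 2) powr (- s) < 1" "1 / (1 - (1 + \<kappa> / 2) powr (- s)) \<le> (4 + s) / (s * \<kappa>)"
proof -
  have l: "\<kappa> / 4 \<le> ln (1 + \<kappa> / 2)"
  proof -
    have "\<kappa> / 2 - (\<kappa> / 2)\<^sup>2 \<le> ln (1 + \<kappa> / 2)"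
      using assms by (intro ln_one_plus_pos_lower_bound) auto
    moreover have "(\<kappa> / 2)\<^sup>2 \<le> \<kappa> / 4"
      using assms by (simp add: power2_eq_square field_simps)
    ultimately show ?thesis by simp
  qed
  define x where "x = s * \<kappa> / 4"
  have x: "0 < x" "x \<le> s / 4" using assms by (auto simp: x_def)
  have "(1 + \<kappa> / 2) powr (- s) = exp (- (s * ln (1 + \<kappa> / 2)))"
    using assms by (simp add: powr_def)
  also have "\<dots> \<le> exp (- x)"
    using mult_left_mono[OF l, of s] assms by (simp add: x_def)
  also have "\<dots> = 1 / exp x" by (simp add: exp_minus inverse_eq_divide)
  also have "\<dots> \<le> 1 / (1 + x)" using x exp_ge_add_one_self[of x] by (intro divide_left_mono) auto
  finally have *: "(1 + \<kappa> / 2) powr (- s) \<le> 1 / (1 + x)" .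
  also have "\<dots> < 1" using x by simp
  finally show lt: "(1 + \<kappa> / 2) powr (- s) < 1" .
  have "x / (1 + s / 4) \<le> x / (1 + x)" using x assms by (intro divide_left_mono) auto
  also have "\<dots> = 1 - 1 / (1 + x)" using x by (simp add: field_simps)
  also have "\<dots> \<le> 1 - (1 + \<kappa> / 2) powr (- s)" using * by simp
  finally have "1 / (1 - (1 + \<kappa> / 2) powr (- s)) \<le> 1 / (x / (1 + s / 4))"
    using x assms lt by (intro divide_left_mono mult_pos_pos) (auto simp: divide_pos_pos)
  also have "\<dots> = (4 + s) / (s * \<kappa>)" using assms by (simp add: x_def field_simps)
  finally show "1 / (1 - (1 + \<kappa> / 2) powr (- s)) \<le> (4 + s) / (s * \<kappa>)" .
qed

lemma sum_inj_geometric_le: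
  fixes t :: real
  assumes "finite A" "inj_on f A" "0 \<le> t" "t < 1"
  shows "(\<Sum>a\<in>A. t ^ f a) \<le> 1 / (1 - t)"
proof -
  have "(\<Sum>a\<in>A. t ^ f a) = (\<Sum>j\<in>f ` A. t ^ j)"
    using assms by (simp add: sum.reindex)
  also have "\<dots> \<le> (\<Sum>j. t ^ j)"
    using assms by (intro sum_le_suminf summable_geometric) auto
  also have "\<dots> = 1 / (1 - t)" using assms by (intro suminf_geometric) auto
  finally show ?thesis .
qed

lemma sum_Hoelder:
  fixes f g :: "'a \<Rightarrow> real"
  assumes "1 < p" "1 < q" "1/q + 1/p = 1" "finite A"
    and nn: "\<And>a. a \<in> A \<Longrightarrow> 0 \<le> f a" "\<And>a. a \<in> A \<Longrightarrow> 0 \<le> g a"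
  shows "(\<Sum>a\<in>A. f a * g a) \<le> (\<Sum>a\<in>A. f a powr q) powr (1/q) * (\<Sum>a\<in>A. g a powr p) powr (1/p)"
proof -
  have eq: "(\<integral>\<^sup>+a. ennreal (h a) \<partial>count_space A) = ennreal (\<Sum>a\<in>A. h a)"
    if "\<And>a. a \<in> A \<Longrightarrow> 0 \<le> h a" for h
    using assms(4) that by (simp add: nn_integral_count_space_finite)
  have "(\<integral>\<^sup>+a. ennreal (\<bar>f a\<bar> * \<bar>g a\<bar>) \<partial>count_space A)
      \<le> ennreal ((\<Sum>a\<in>A. f a powr q) powr (1/q) * (\<Sum>a\<in>A. g a powr p) powr (1/p))"
  proof (rule nn_integral_Hoelder[OF assms(1-3)])
    show "(\<integral>\<^sup>+a. ennreal (\<bar>f a\<bar> powr q) \<partial>count_space A) \<le> ennreal (\<Sum>a\<in>A. f a powr q)"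
      by (subst eq) (use nn in \<open>auto intro!: sum.cong eq_refl arg_cong[where f = ennreal]\<close>)
    show "(\<integral>\<^sup>+a. ennreal (\<bar>g a\<bar> powr p) \<partial>count_space A) \<le> ennreal (\<Sum>a\<in>A. g a powr p)"
      by (subst eq) (use nn in \<open>auto intro!: sum.cong eq_refl arg_cong[where f = ennreal]\<close>)
  qed (auto intro: sum_nonneg)
  moreover have "(\<Sum>a\<in>A. \<bar>f a\<bar> * \<bar>g a\<bar>) = (\<Sum>a\<in>A. f a * g a)"
    using nn by (intro sum.cong) auto
  ultimately show ?thesis by (simp add: eq ennreal_le_iff)
qed

locale sparse_family = cube_tree M D B
  for M :: "'a measure" and D :: "nat \<Rightarrow> 'a set set" and B :: real +
  fixes S :: "'a set set"
  assumes finite_S: "finite S" and S_cubes: "Q \<in> S \<Longrightarrow> \<exists>k. Q \<in> D k"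
begin

definition core :: "'a set \<Rightarrow> 'a set"
  where "core Q = Q - \<Union>{P\<in>S. P \<subset> Q}"

text \<open>
  The depth of \<open>y\<close> below \<open>Q\<close> in the family; the core of \<open>Q\<close> consists of its points of depth 0.
\<close>

definition layer :: "'a set \<Rightarrow> 'a \<Rightarrow> nat"
  where "layer Q y = card {P\<in>S. y \<in> P \<and> P \<subset> Q}"

lemma S_sets [measurable]: "Q \<in> S \<Longrightarrow> Q \<in> sets M"
  using S_cubes cube_sets by blast

lemma S_laminar: "P \<in> S \<Longrightarrow> Q \<in> S \<Longrightarrow> P \<inter> Q \<noteq> {} \<Longrightarrow> P \<subseteq> Q \<or> Q \<subseteq> P"
  using S_cubes laminar by metis

lemma core_sets [measurable]: "Q \<in> S \<Longrightarrow> core Q \<in> sets M"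
  unfolding core_def using finite_S by (intro sets.Diff sets.finite_Union) auto

lemma layer_measurable [measurable]: "layer Q \<in> measurable M (count_space UNIV)"
proof -
  have eq: "layer Q = (\<lambda>y. \<Sum>P\<in>{P\<in>S. P \<subset> Q}. if y \<in> P then 1 else 0)"
  proof
    fix y
    have "layer Q y = card {P\<in>{P\<in>S. P \<subset> Q}. y \<in> P}"
      unfolding layer_def by (rule arg_cong[where f = card]) auto
    also have "\<dots> = (\<Sum>P\<in>{P\<in>S. P \<subset> Q}. if y \<in> P then 1 else 0)"
      using finite_S by (simp add: sum.If_cases Int_def)
    finally show "layer Q y = (\<Sum>P\<in>{P\<in>S. P \<subset> Q}. if y \<in> P then 1 else 0)" .
  qed
  show ?thesis
    unfolding eq by (intro measurable_sum_nat measurable_If) (auto simp: space_M)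
qed

lemma layer_inj: "inj_on (\<lambda>Q. layer Q y) {Q\<in>S. y \<in> Q}"
proof (rule inj_onI)
  fix P Q assume PQ: "P \<in> {Q\<in>S. y \<in> Q}" "Q \<in> {Q\<in>S. y \<in> Q}" "layer P y = layer Q y"
  have less: "layer P y < layer Q y" if "P \<in> {Q\<in>S. y \<in> Q}" "P \<subset> Q" for P Q
    unfolding layer_def using finite_S that by (intro psubset_card_mono) auto
  have "P \<subseteq> Q \<or> Q \<subseteq> P" using S_laminar[of P Q] PQ by blast
  then show "P = Q" using less[of P Q] less[of Q P] PQ by (auto simp: psubset_eq)
qed

text \<open>
  The cubes through \<open>y\<close> form a chain, along which the depths of \<open>y\<close> are distinct.
\<close>

lemma layer_geometric:
  assumes "0 < s" "0 < \<kappa>" "\<kappa> \<le> 1"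
  shows "(\<Sum>Q\<in>{Q\<in>S. y \<in> Q}. (1 + \<kappa> / 2) powr (- s * real (layer Q y))) \<le> (4 + s) / (s * \<kappa>)"
proof -
  define t where "t = (1 + \<kappa> / 2) powr (- s)"
  have "(1 + \<kappa> / 2) powr (- s * real (layer Q y)) = t ^ layer Q y" for Q
    using assms by (simp add: t_def powr_powr powr_realpow[symmetric])
  then have "(\<Sum>Q\<in>{Q\<in>S. y \<in> Q}. (1 + \<kappa> / 2) powr (- s * real (layer Q y))) \<le> 1 / (1 - t)"
    using finite_S layer_inj one_minus_powr_bound(1)[OF assms]
    by (simp only:) (rule sum_inj_geometric_le, auto simp: t_def)
  also have "\<dots> \<le> (4 + s) / (s * \<kappa>)" unfolding t_def by (rule one_minus_powr_bound(2)[OF assms])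
  finally show ?thesis .
qed

text \<open>
  If each core carries a fixed proportion of the mass, the mass of the \<open>j\<close>-th layer decays
  geometrically; the exponential integrability of the layer index is the form in which this is used.
\<close>

lemma layer_exponential:
  assumes \<nu>: "sets \<nu> = sets M" and \<kappa>: "0 < \<kappa>" "\<kappa> \<le> 1"
    and fin: "\<And>P. P \<in> S \<Longrightarrow> P \<subseteq> Q0 \<Longrightarrow> emeasure \<nu> P < \<infinity>"
    and core: "\<And>P. P \<in> S \<Longrightarrow> P \<subseteq> Q0 \<Longrightarrow> ennreal \<kappa> * emeasure \<nu> P \<le> emeasure \<nu> (core P)"
  shows "Q \<in> S \<Longrightarrow> Q \<subseteq> Q0 \<Longrightarrow>
    (\<integral>\<^sup>+y\<in>Q. ennreal ((1 + \<kappa> / 2) ^ layer Q y) \<partial>\<nu>) \<le> 2 * emeasure \<nu> Q"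
proof (induction "card {P\<in>S. P \<subset> Q}" arbitrary: Q rule: less_induct)
  case (less Q)
  note Q = less.prems
  define \<theta> where "\<theta> = 1 + \<kappa> / 2"
  have \<theta>: "1 \<le> \<theta>" using \<kappa> by (simp add: \<theta>_def)
  have [measurable_cong]: "sets \<nu> = sets M" by (rule \<nu>)
  have [measurable]: "layer P \<in> measurable \<nu> (count_space UNIV)" for P
    using layer_measurable measurable_cong_sets[OF \<nu> refl] by blast
  define \<P> where "\<P> = {P\<in>S. P \<subset> Q \<and> (\<forall>P'\<in>S. P \<subset> P' \<longrightarrow> \<not> P' \<subset> Q)}"
  have finP: "finite \<P>" using finite_S by (simp add: \<P>_def)
  have PS: "P \<in> S" "P \<subset> Q" if "P \<in> \<P>" for P using that by (auto simp: \<P>_def)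
  have max: "\<exists>P'\<in>\<P>. P \<subseteq> P'" if "P \<in> S" "P \<subset> Q" for P
  proof -
    have "finite {P'\<in>S. P' \<subset> Q}" "P \<in> {P'\<in>S. P' \<subset> Q}" using finite_S that by auto
    from finite_has_maximal2[OF this]
    obtain m where m: "m \<in> {P'\<in>S. P' \<subset> Q}" "P \<subseteq> m" "\<forall>b\<in>{P'\<in>S. P' \<subset> Q}. m \<subseteq> b \<longrightarrow> m = b"
      by (elim bexE conjE) (rule that)
    have "\<not> P' \<subset> Q" if "P' \<in> S" "m \<subset> P'" for P'
      using m(3) that by auto
    then have "m \<in> \<P>" using m(1) by (simp add: \<P>_def)
    then show ?thesis using m(2) by blast
  qed
  have disj: "P \<inter> P' = {}" if "P \<in> \<P>" "P' \<in> \<P>" "P \<noteq> P'" for P P'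
  proof (rule ccontr)
    assume "P \<inter> P' \<noteq> {}"
    then have "P \<subset> P' \<or> P' \<subset> P" using S_laminar[of P P'] PS that by blast
    then show False using that by (auto simp: \<P>_def)
  qed
  have U: "\<Union>\<P> = \<Union>{P\<in>S. P \<subset> Q}"
  proof
    show "\<Union>\<P> \<subseteq> \<Union>{P\<in>S. P \<subset> Q}" using PS by blast
    show "\<Union>{P\<in>S. P \<subset> Q} \<subseteq> \<Union>\<P>" using max by blast
  qed
  have split: "Q = core Q \<union> \<Union>\<P>" using PS unfolding core_def U by blast
  have decomp: "(\<integral>\<^sup>+y\<in>Q. f y \<partial>\<nu>) = (\<integral>\<^sup>+y\<in>core Q. f y \<partial>\<nu>) + (\<Sum>P\<in>\<P>. \<integral>\<^sup>+y\<in>P. f y \<partial>\<nu>)"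
    if [measurable]: "f \<in> borel_measurable \<nu>" for f
  proof -
    have ind: "f y * indicator Q y = f y * indicator (core Q) y + (\<Sum>P\<in>\<P>. f y * indicator P y)" for y
    proof (cases "y \<in> \<Union>\<P>")
      case True
      then obtain P where P: "P \<in> \<P>" "y \<in> P" by blast
      have "(\<Sum>P'\<in>\<P>. f y * indicator P' y) = (\<Sum>P'\<in>\<P>. if P' = P then f y else 0)"
        using disj P by (intro sum.cong) (auto simp: indicator_def)
      also have "\<dots> = f y" using finP P by simp
      moreover have "y \<notin> core Q" using True by (simp add: core_def U)
      moreover have "y \<in> Q" using P PS by blast
      ultimately show ?thesis by simp
    next
      case False
      then have "y \<in> Q \<longleftrightarrow> y \<in> core Q" by (auto simp: core_def U)
      moreover have "(\<Sum>P'\<in>\<P>. f y * indicator P' y) = 0" using False by (auto intro!: sum.neutral)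
      ultimately show ?thesis by (simp add: indicator_def)
    qed
    have [measurable]: "core Q \<in> sets \<nu>" "\<And>P. P \<in> \<P> \<Longrightarrow> P \<in> sets \<nu>" using Q PS \<nu> by auto
    show ?thesis
      unfolding ind by (subst nn_integral_add) (auto simp: nn_integral_sum)
  qed
  have on_core: "layer Q y = 0" if "y \<in> core Q" for y
    using that finite_S by (auto simp: layer_def core_def card_eq_0_iff)
  have on_P: "layer Q y = Suc (layer P y)" if "P \<in> \<P>" "y \<in> P" for P y
  proof -
    have "{P'\<in>S. y \<in> P' \<and> P' \<subset> Q} = insert P {P'\<in>S. y \<in> P' \<and> P' \<subset> P}"
    proof
      show "{P'\<in>S. y \<in> P' \<and> P' \<subset> Q} \<subseteq> insert P {P'\<in>S. y \<in> P' \<and> P' \<subset> P}"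
      proof
        fix P' assume P': "P' \<in> {P'\<in>S. y \<in> P' \<and> P' \<subset> Q}"
        then have "P' \<subseteq> P \<or> P \<subseteq> P'" using S_laminar[of P' P] PS that by blast
        moreover have "\<not> P \<subset> P'" using that P' by (auto simp: \<P>_def)
        ultimately show "P' \<in> insert P {P'\<in>S. y \<in> P' \<and> P' \<subset> P}" using P' by blast
      qed
      show "insert P {P'\<in>S. y \<in> P' \<and> P' \<subset> P} \<subseteq> {P'\<in>S. y \<in> P' \<and> P' \<subset> Q}"
        using PS[OF that(1)] that(2) by blast
    qed
    then show ?thesis using finite_S by (simp add: layer_def)
  qed
  have IH: "(\<integral>\<^sup>+y\<in>P. ennreal (\<theta> ^ layer P y) \<partial>\<nu>) \<le> 2 * emeasure \<nu> P" if P: "P \<in> \<P>" for P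
    unfolding \<theta>_def
  proof (rule less.hyps)
    show "card {P'\<in>S. P' \<subset> P} < card {P\<in>S. P \<subset> Q}"
      using finite_S PS[OF P] by (intro psubset_card_mono) auto
  qed (use PS[OF P] Q in auto)
  define w a where "w = measure \<nu> Q" and "a = measure \<nu> (core Q)"
  have mQ: "Q \<in> sets \<nu>" "core Q \<in> sets \<nu>" using Q \<nu> by auto
  have finQ: "emeasure \<nu> Q < \<infinity>" using fin Q by simp
  have fm: "A \<in> sets \<nu> \<Longrightarrow> A \<subseteq> Q \<Longrightarrow> emeasure \<nu> A = ennreal (measure \<nu> A)" for A
    using finQ emeasure_mono[of A Q \<nu>] mQ by (intro emeasure_eq_ennreal_measure) (auto simp: top_unique)
  have w: "emeasure \<nu> Q = ennreal w" "emeasure \<nu> (core Q) = ennreal a"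
    unfolding w_def a_def using mQ by (auto intro!: fm simp: core_def)
  have aw: "\<kappa> * w \<le> a"
    using core[OF Q] \<kappa> by (simp add: w ennreal_mult[symmetric] w_def a_def)
  have m_sum: "(\<Sum>P\<in>\<P>. measure \<nu> P) = w - a"
  proof -
    have "emeasure \<nu> Q = emeasure \<nu> (core Q) + (\<Sum>P\<in>\<P>. emeasure \<nu> P)"
      using decomp[of "\<lambda>_. 1"] mQ PS \<nu> by (simp add: nn_integral_indicator)
    also have "(\<Sum>P\<in>\<P>. emeasure \<nu> P) = (\<Sum>P\<in>\<P>. ennreal (measure \<nu> P))"
      using PS \<nu> by (intro sum.cong fm) auto
    finally have "ennreal w = ennreal (a + (\<Sum>P\<in>\<P>. measure \<nu> P))"
      by (simp add: w ennreal_plus[symmetric] a_def sum_nonneg del: ennreal_plus)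
    moreover have "0 \<le> w" "0 \<le> a + (\<Sum>P\<in>\<P>. measure \<nu> P)" by (auto simp: w_def a_def sum_nonneg)
    ultimately have "w = a + (\<Sum>P\<in>\<P>. measure \<nu> P)" using ennreal_inj by blast
    then show ?thesis by simp
  qed
  have "(\<integral>\<^sup>+y\<in>Q. ennreal (\<theta> ^ layer Q y) \<partial>\<nu>)
      = (\<integral>\<^sup>+y\<in>core Q. ennreal (\<theta> ^ layer Q y) \<partial>\<nu>) + (\<Sum>P\<in>\<P>. \<integral>\<^sup>+y\<in>P. ennreal (\<theta> ^ layer Q y) \<partial>\<nu>)"
    by (rule decomp) measurable
  also have "(\<integral>\<^sup>+y\<in>core Q. ennreal (\<theta> ^ layer Q y) \<partial>\<nu>) = (\<integral>\<^sup>+y. indicator (core Q) y \<partial>\<nu>)"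
    using on_core by (intro nn_integral_cong) (auto simp: indicator_def)
  also have "\<dots> = ennreal a" using mQ by (simp add: w)
  also have "(\<Sum>P\<in>\<P>. \<integral>\<^sup>+y\<in>P. ennreal (\<theta> ^ layer Q y) \<partial>\<nu>) \<le> (\<Sum>P\<in>\<P>. ennreal (\<theta> * (2 * measure \<nu> P)))"
  proof (rule sum_mono)
    fix P assume P: "P \<in> \<P>"
    have [measurable]: "P \<in> sets \<nu>" using PS[OF P] \<nu> by auto
    have "(\<integral>\<^sup>+y\<in>P. ennreal (\<theta> ^ layer Q y) \<partial>\<nu>) = (\<integral>\<^sup>+y. ennreal \<theta> * (ennreal (\<theta> ^ layer P y) * indicator P y) \<partial>\<nu>)"
      using on_P[OF P] \<theta> by (intro nn_integral_cong) (auto simp: indicator_def ennreal_mult)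
    also have "\<dots> = ennreal \<theta> * (\<integral>\<^sup>+y\<in>P. ennreal (\<theta> ^ layer P y) \<partial>\<nu>)"
      by (rule nn_integral_cmult) measurable
    also have "\<dots> \<le> ennreal \<theta> * (2 * emeasure \<nu> P)" by (intro mult_left_mono IH P) simp
    also have "\<dots> = ennreal (\<theta> * (2 * measure \<nu> P))"
      using PS[OF P] \<nu> \<theta> fm[of P] by (simp add: ennreal_mult)
    finally show "(\<integral>\<^sup>+y\<in>P. ennreal (\<theta> ^ layer Q y) \<partial>\<nu>) \<le> ennreal (\<theta> * (2 * measure \<nu> P))" .
  qed
  also have "(\<Sum>P\<in>\<P>. ennreal (\<theta> * (2 * measure \<nu> P))) = ennreal (\<theta> * (2 * (w - a)))"
    using \<theta> by (simp add: sum_distrib_left[symmetric] m_sum)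
  also have "ennreal a + ennreal (\<theta> * (2 * (w - a))) = ennreal (a + \<theta> * (2 * (w - a)))"
    using \<theta> m_sum[symmetric] by (intro ennreal_plus[symmetric]) (auto simp: a_def sum_nonneg)
  also have "\<dots> \<le> ennreal (2 * w)"
  proof (rule ennreal_leI)
    have "a + \<theta> * (2 * (w - a)) = 2 * w + (\<kappa> * w - a) - \<kappa> * a" by (simp add: \<theta>_def algebra_simps)
    moreover have "0 \<le> \<kappa> * a" using \<kappa> by (simp add: a_def)
    ultimately show "a + \<theta> * (2 * (w - a)) \<le> 2 * w" using aw by linarith
  qed
  also have "\<dots> = 2 * emeasure \<nu> Q" by (simp add: w ennreal_mult w_def)
  finally show ?case by (simp add: \<theta>_def add_left_mono)
qed

end

section \<open>Estimates for sparse sums\<close>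

lemma powr_sum_subadditive:
  fixes c :: "'a \<Rightarrow> real"
  assumes "finite A" "\<And>x. x \<in> A \<Longrightarrow> 0 \<le> c x" "0 < r" "r \<le> 1"
  shows "(\<Sum>x\<in>A. c x) powr r \<le> (\<Sum>x\<in>A. c x powr r)"
proof (cases "(\<Sum>x\<in>A. c x) = 0")
  case True
  then show ?thesis by (simp add: sum_nonneg)
next
  case False
  define s where "s = (\<Sum>x\<in>A. c x)"
  have s: "0 < s" using False assms by (simp add: s_def order_less_le sum_nonneg)
  have "1 = (\<Sum>x\<in>A. c x / s)" using s by (simp add: s_def sum_divide_distrib[symmetric])
  also have "\<dots> \<le> (\<Sum>x\<in>A. (c x / s) powr r)"
  proof (rule sum_mono)
    fix x assume x: "x \<in> A"
    have "c x \<le> s" unfolding s_def using assms x by (intro member_le_sum) auto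
    then have "(c x / s) powr 1 \<le> (c x / s) powr r"
      using s assms x by (intro powr_mono') auto
    then show "c x / s \<le> (c x / s) powr r" using s assms(2)[OF x] by simp
  qed
  also have "\<dots> = (\<Sum>x\<in>A. c x powr r) / s powr r"
    using s assms by (simp add: powr_divide sum_divide_distrib)
  finally show ?thesis using s by (simp add: s_def[symmetric] field_simps)
qed

context sparse_family
begin

lemma layer_weighted_integral:
  fixes a :: "'a \<Rightarrow> real"
  assumes \<kappa>: "0 < \<kappa>" "\<kappa> \<le> 1" and [measurable]: "a \<in> borel_measurable M" and Q: "Q \<in> S"
    and a_int: "(\<integral>\<^sup>+x\<in>Q. ennreal (a x powr p) \<partial>M) \<le> ennreal c"
    and core: "\<And>P. P \<in> S \<Longrightarrow> P \<subseteq> Q \<Longrightarrow>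
      ennreal \<kappa> * (\<integral>\<^sup>+x\<in>P. ennreal (a x powr p) \<partial>M) \<le> (\<integral>\<^sup>+x\<in>core P. ennreal (a x powr p) \<partial>M)"
  shows "(\<integral>\<^sup>+x. ennreal (a x powr p) * (ennreal ((1 + \<kappa> / 2) ^ layer Q x) * indicator Q x) \<partial>M) \<le> ennreal (2 * c)"
proof -
  have [measurable]: "Q \<in> sets M" using Q by auto
  define \<nu> where "\<nu> = density M (\<lambda>y. ennreal (a y powr p))"
  have em: "emeasure \<nu> A = (\<integral>\<^sup>+y\<in>A. ennreal (a y powr p) \<partial>M)" if "A \<in> sets M" for A
    using that by (simp add: \<nu>_def emeasure_density)
  have "(\<integral>\<^sup>+y\<in>Q. ennreal ((1 + \<kappa> / 2) ^ layer Q y) \<partial>\<nu>) \<le> 2 * emeasure \<nu> Q"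
  proof (rule layer_exponential[where Q0 = Q])
    fix P assume P: "P \<in> S" "P \<subseteq> Q"
    have "emeasure \<nu> P \<le> emeasure \<nu> Q" using P by (intro emeasure_mono) (auto simp: \<nu>_def)
    also have "\<dots> \<le> ennreal c" using a_int by (simp add: em)
    finally show "emeasure \<nu> P < \<infinity>" by (simp add: le_less_trans)
    show "ennreal \<kappa> * emeasure \<nu> P \<le> emeasure \<nu> (core P)"
      using core[OF P] P by (simp add: em)
  qed (use \<kappa> Q in \<open>auto simp: \<nu>_def\<close>)
  also have "\<dots> \<le> 2 * ennreal c"
    using a_int by (simp add: em mult_left_mono)
  also have "\<dots> = ennreal (2 * c)" by (cases "0 \<le> c") (auto simp: ennreal_mult ennreal_neg)
  finally show ?thesis by (simp add: \<nu>_def nn_integral_density)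
qed

text \<open>
  A Carleson embedding without maximal functions: Hoelder's inequality with the weight
  \<open>\<theta> ^ layer\<close> moves a geometric decay in the layer index onto \<open>g\<close>, where it is summed over the chain
  of cubes that contain a given point. The loss is one power of \<open>1 / \<kappa>\<close>.
\<close>

lemma carleson_sum:
  fixes b :: "'a set \<Rightarrow> 'a \<Rightarrow> real" and T :: "'a set \<Rightarrow> real"
  assumes p: "1 < p" and q: "q = p / (p - 1)" and \<kappa>: "0 < \<kappa>" "\<kappa> \<le> 1"
    and [measurable]: "g \<in> borel_measurable M" "\<And>Q. b Q \<in> borel_measurable M"
    and nn: "\<And>y. 0 \<le> g y" "\<And>Q y. 0 \<le> b Q y" "\<And>Q. 0 \<le> T Q"
    and b_int: "\<And>Q. Q \<in> S \<Longrightarrow> (\<integral>\<^sup>+y\<in>Q. ennreal (b Q y powr q) \<partial>M) \<le> ennreal (measure M Q)"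
    and core: "\<And>P Q. Q \<in> S \<Longrightarrow> P \<in> S \<Longrightarrow> P \<subseteq> Q \<Longrightarrow>
      ennreal \<kappa> * (\<integral>\<^sup>+y\<in>P. ennreal (b Q y powr q) \<partial>M) \<le> (\<integral>\<^sup>+y\<in>core P. ennreal (b Q y powr q) \<partial>M)"
    and T: "\<And>Q. Q \<in> S \<Longrightarrow> ennreal (measure M Q * T Q) \<le> (\<integral>\<^sup>+y\<in>Q. ennreal (b Q y * g y) \<partial>M)"
  shows "(\<Sum>Q\<in>S. ennreal (measure M Q * T Q powr p))
    \<le> ennreal (2 powr (p - 1) * ((3 + p) / ((p - 1) * \<kappa>))) * (\<integral>\<^sup>+y\<in>\<Union>S. ennreal (g y powr p) \<partial>M)"
proof -
  define \<theta> where "\<theta> = 1 + \<kappa> / 2"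
  have \<theta>: "1 \<le> \<theta>" using \<kappa> by (simp add: \<theta>_def)
  have q': "1 < q" "1 / q + 1 / p = 1" "p / q = p - 1" "1 / q = (p - 1) / p" using p by (auto simp: q field_simps)
  define c where "c = (3 + p) / ((p - 1) * \<kappa>)"
  have c: "0 < c" using p \<kappa> by (simp add: c_def)
  have US [measurable]: "\<Union>S \<in> sets M" using finite_S by (intro sets.finite_Union) auto
  show ?thesis
    unfolding c_def[symmetric]
  proof (cases "(\<integral>\<^sup>+y\<in>\<Union>S. ennreal (g y powr p) \<partial>M) = \<infinity>")
    case True
    have "0 < 2 powr (p - 1) * c" using c by simp
    then have "ennreal (2 powr (p - 1) * c) * (\<integral>\<^sup>+y\<in>\<Union>S. ennreal (g y powr p) \<partial>M) = \<infinity>"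
      unfolding True using c by (simp add: ennreal_mult_top)
    then show "(\<Sum>Q\<in>S. ennreal (measure M Q * T Q powr p))
        \<le> ennreal (2 powr (p - 1) * c) * (\<integral>\<^sup>+y\<in>\<Union>S. ennreal (g y powr p) \<partial>M)" by simp
  next
    case False
    define r where "r Q y = \<theta> powr (- (p - 1) * real (layer Q y))" for Q y
    define G where "G Q = (\<integral>\<^sup>+y\<in>Q. ennreal (g y powr p * r Q y) \<partial>M)" for Q
    have r1: "r Q y \<le> 1" for Q y
      using powr_mono[of "- (p - 1) * real (layer Q y)" 0 \<theta>] \<theta> p by (simp add: r_def mult_nonpos_nonneg)
    have G_fin: "G Q < \<infinity>" if "Q \<in> S" for Q
    proof -
      have "G Q \<le> (\<integral>\<^sup>+y\<in>\<Union>S. ennreal (g y powr p) \<partial>M)"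
        unfolding G_def using that r1
        by (intro nn_integral_mono) (auto simp: indicator_def mult_left_le intro!: ennreal_leI)
      then show ?thesis using False by (auto simp: less_top[symmetric] top_unique)
    qed
    have one: "ennreal (measure M Q * T Q powr p) \<le> ennreal (2 powr (p - 1)) * G Q" if Q: "Q \<in> S" for Q
    proof -
      have m: "0 < measure M Q" using S_cubes[OF Q] cube_pos by blast
      have [measurable]: "Q \<in> sets M" using Q by auto
      have exp_int: "(\<integral>\<^sup>+y. ennreal (b Q y powr q) * (ennreal (\<theta> ^ layer Q y) * indicator Q y) \<partial>M)
          \<le> ennreal (2 * measure M Q)"
        unfolding \<theta>_def by (rule layer_weighted_integral[OF \<kappa> _ Q b_int[OF Q] core[OF Q]]) auto
      define f where "f y = indicator Q y * (b Q y * \<theta> powr (real (layer Q y) / q))" for y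
      define h where "h y = indicator Q y * (g y * \<theta> powr (- real (layer Q y) / q))" for y
      obtain Gq where Gq: "G Q = ennreal Gq" "0 \<le> Gq" using G_fin[OF Q] by (cases "G Q") auto
      have "(\<integral>\<^sup>+y. ennreal (f y * h y) \<partial>M) \<le> ennreal ((2 * measure M Q) powr (1/q) * Gq powr (1/p))"
      proof (rule nn_integral_Hoelder[OF p q'(1,2)])
        have "(\<integral>\<^sup>+y. ennreal (f y powr q) \<partial>M)
            = (\<integral>\<^sup>+y. ennreal (b Q y powr q) * (ennreal (\<theta> ^ layer Q y) * indicator Q y) \<partial>M)"
          using \<theta> nn q' p by (intro nn_integral_cong)
            (auto simp: f_def indicator_def powr_mult powr_powr powr_realpow ennreal_mult)
        then show "(\<integral>\<^sup>+y. ennreal (f y powr q) \<partial>M) \<le> ennreal (2 * measure M Q)" using exp_int by simp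
        have "(\<integral>\<^sup>+y. ennreal (h y powr p) \<partial>M) = G Q"
          unfolding G_def
        proof (intro nn_integral_cong)
          fix y
          have "(g y * \<theta> powr (- real (layer Q y) / q)) powr p = g y powr p * r Q y"
          proof -
            have "- real (layer Q y) / q * p = - real (layer Q y) * (p / q)" by simp
            also have "\<dots> = - (p - 1) * real (layer Q y)" unfolding q'(3) by (simp add: algebra_simps)
            finally show ?thesis using \<theta> nn by (simp add: powr_mult powr_powr r_def del: mult_minus_left)
          qed
          then show "ennreal (h y powr p) = ennreal (g y powr p * r Q y) * indicator Q y"
            using p by (auto simp: h_def indicator_def)
        qed
        then show "(\<integral>\<^sup>+y. ennreal (h y powr p) \<partial>M) \<le> ennreal Gq" using Gq by simp
      qed (use \<theta> nn m Gq in \<open>auto simp: f_def h_def\<close>)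
      moreover have "ennreal (f y * h y) = ennreal (b Q y * g y) * indicator Q y" for y
      proof -
        have "\<theta> powr (real (layer Q y) / q) * \<theta> powr (- real (layer Q y) / q) = 1"
          using \<theta> by (simp add: powr_add[symmetric])
        then have "b Q y * g y * (\<theta> powr (real (layer Q y) / q) * \<theta> powr (- real (layer Q y) / q)) = b Q y * g y"
          by simp
        moreover have "f y * h y = b Q y * g y * (\<theta> powr (real (layer Q y) / q) * \<theta> powr (- real (layer Q y) / q))"
          if "y \<in> Q"
          using that by (simp add: f_def h_def)
        ultimately have "f y * h y = b Q y * g y" if "y \<in> Q" using that by (simp only:)
        then show ?thesis by (cases "y \<in> Q") (simp_all, simp add: f_def)
      qed
      ultimately have "ennreal (measure M Q * T Q) \<le> ennreal ((2 * measure M Q) powr (1/q) * Gq powr (1/p))"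
        using T[OF Q] by (simp add: order_trans)
      then have le: "measure M Q * T Q \<le> (2 * measure M Q) powr (1/q) * Gq powr (1/p)"
        by (simp add: ennreal_le_iff)
      have "(measure M Q * T Q) powr p \<le> ((2 * measure M Q) powr (1/q) * Gq powr (1/p)) powr p"
        using le m nn p by (intro powr_mono2) auto
      also have "\<dots> = (2 * measure M Q) powr (p - 1) * Gq"
        using m Gq p q'(4) by (simp add: powr_mult powr_powr)
      also have "\<dots> = 2 powr (p - 1) * (measure M Q powr p / measure M Q) * Gq"
        using m by (simp add: powr_mult powr_diff)
      finally have "measure M Q powr p * T Q powr p \<le> measure M Q powr p * (2 powr (p - 1) / measure M Q * Gq)"
        using m nn by (simp add: powr_mult mult_ac)
      then have "T Q powr p \<le> 2 powr (p - 1) / measure M Q * Gq"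
        by (rule mult_left_le_imp_le) (use m in simp)
      then have "measure M Q * T Q powr p \<le> 2 powr (p - 1) * Gq" using m by (simp add: field_simps)
      then show ?thesis using Gq by (simp add: ennreal_mult[symmetric] ennreal_leI)
    qed
    have "(\<Sum>Q\<in>S. ennreal (measure M Q * T Q powr p)) \<le> (\<Sum>Q\<in>S. ennreal (2 powr (p - 1)) * G Q)"
      by (intro sum_mono one)
    also have "\<dots> = ennreal (2 powr (p - 1)) * (\<integral>\<^sup>+y. (\<Sum>Q\<in>S. ennreal (g y powr p * r Q y) * indicator Q y) \<partial>M)"
      unfolding G_def sum_distrib_left[symmetric]
      by (subst nn_integral_sum) (auto simp: r_def)
    also have "\<dots> \<le> ennreal (2 powr (p - 1)) *
        (\<integral>\<^sup>+y. ennreal c * (ennreal (g y powr p) * indicator (\<Union>S) y) \<partial>M)"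
    proof (intro mult_left_mono nn_integral_mono)
      fix y
      have "(\<Sum>Q\<in>S. ennreal (g y powr p * r Q y) * indicator Q y)
          = (\<Sum>Q\<in>S. if y \<in> Q then ennreal (g y powr p * r Q y) else 0)"
        by (intro sum.cong) (auto simp: indicator_def)
      also have "\<dots> = (\<Sum>Q\<in>{Q\<in>S. y \<in> Q}. ennreal (g y powr p * r Q y))"
        by (rule sum.inter_filter[OF finite_S, symmetric])
      also have "\<dots> = ennreal (\<Sum>Q\<in>{Q\<in>S. y \<in> Q}. g y powr p * r Q y)"
        by (intro sum_ennreal) (auto simp: r_def)
      also have "(\<Sum>Q\<in>{Q\<in>S. y \<in> Q}. g y powr p * r Q y) = g y powr p * (\<Sum>Q\<in>{Q\<in>S. y \<in> Q}. r Q y)"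
        by (simp add: sum_distrib_left)
      also have "ennreal (g y powr p * (\<Sum>Q\<in>{Q\<in>S. y \<in> Q}. r Q y))
          \<le> ennreal c * (ennreal (g y powr p) * indicator (\<Union>S) y)"
      proof (cases "y \<in> \<Union>S")
        case True
        have "(\<Sum>Q\<in>{Q\<in>S. y \<in> Q}. r Q y) \<le> (4 + (p - 1)) / ((p - 1) * \<kappa>)"
          unfolding r_def \<theta>_def using p by (intro layer_geometric \<kappa>) auto
        then have "(\<Sum>Q\<in>{Q\<in>S. y \<in> Q}. r Q y) \<le> c" by (simp add: c_def add.commute)
        then have "g y powr p * (\<Sum>Q\<in>{Q\<in>S. y \<in> Q}. r Q y) \<le> c * g y powr p"
          by (subst mult.commute) (intro mult_right_mono, auto)
        then have "ennreal (g y powr p * (\<Sum>Q\<in>{Q\<in>S. y \<in> Q}. r Q y)) \<le> ennreal (c * g y powr p)"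
          by (rule ennreal_leI)
        also have "\<dots> = ennreal c * (ennreal (g y powr p) * indicator (\<Union>S) y)"
          using True c by (simp add: ennreal_mult)
        finally show ?thesis .
      next
        case False
        then have e: "{Q\<in>S. y \<in> Q} = {}" by auto
        show ?thesis unfolding e by simp
      qed
      finally show "(\<Sum>Q\<in>S. ennreal (g y powr p * r Q y) * indicator Q y)
          \<le> ennreal c * (ennreal (g y powr p) * indicator (\<Union>S) y)" .
    qed auto
    also have "\<dots> = ennreal (2 powr (p - 1) * c) * (\<integral>\<^sup>+y\<in>\<Union>S. ennreal (g y powr p) \<partial>M)"
      using c by (subst nn_integral_cmult) (auto simp: ennreal_mult mult.assoc)
    finally show "(\<Sum>Q\<in>S. ennreal (measure M Q * T Q powr p))
        \<le> ennreal (2 powr (p - 1) * c) * (\<integral>\<^sup>+y\<in>\<Union>S. ennreal (g y powr p) \<partial>M)" .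
  qed
qed

text \<open>
  For \<open>p \<le> 2\<close> the power \<open>p/2\<close> is subadditive and can be taken inside the sum over the cubes.
\<close>

lemma sparse_sum_small_exponent:
  fixes a :: "'a set \<Rightarrow> 'i::finite \<Rightarrow> 'a \<Rightarrow> real" and T :: "'a set \<Rightarrow> 'i \<Rightarrow> real"
  assumes p: "1 < p" "p \<le> 2" and Kn: "0 \<le> K"
    and [measurable]: "\<And>Q i. a Q i \<in> borel_measurable M"
    and nn: "\<And>Q i x. 0 \<le> a Q i x" "\<And>Q i. 0 \<le> T Q i"
    and a_int: "\<And>Q i. Q \<in> S \<Longrightarrow> (\<integral>\<^sup>+x\<in>Q. ennreal (a Q i x powr p) \<partial>M) \<le> ennreal (K * measure M Q)"
  shows "(\<integral>\<^sup>+x. ennreal ((\<Sum>Q\<in>{Q\<in>S. x \<in> Q}. (\<Sum>i\<in>UNIV. a Q i x * T Q i)\<^sup>2) powr (p/2)) \<partial>M)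
    \<le> ennreal (real CARD('i) powr p * K) * (\<Sum>i\<in>UNIV. \<Sum>Q\<in>S. ennreal (measure M Q * T Q i powr p))"
proof -
  define d where "d = real CARD('i)"
  have "(\<integral>\<^sup>+x. ennreal ((\<Sum>Q\<in>{Q\<in>S. x \<in> Q}. (\<Sum>i\<in>UNIV. a Q i x * T Q i)\<^sup>2) powr (p/2)) \<partial>M)
      \<le> (\<integral>\<^sup>+x. (\<Sum>Q\<in>S. \<Sum>i\<in>UNIV. ennreal (d powr p * T Q i powr p) * (ennreal (a Q i x powr p) * indicator Q x)) \<partial>M)"
  proof (rule nn_integral_mono)
    fix x
    have "(\<Sum>Q\<in>{Q\<in>S. x \<in> Q}. (\<Sum>i\<in>UNIV. a Q i x * T Q i)\<^sup>2) powr (p/2)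
        \<le> (\<Sum>Q\<in>{Q\<in>S. x \<in> Q}. ((\<Sum>i\<in>UNIV. a Q i x * T Q i)\<^sup>2) powr (p/2))"
      using finite_S p by (intro powr_sum_subadditive) auto
    also have "\<dots> = (\<Sum>Q\<in>{Q\<in>S. x \<in> Q}. (\<Sum>i\<in>UNIV. a Q i x * T Q i) powr p)"
    proof (intro sum.cong refl)
      fix Q
      have "0 \<le> (\<Sum>i\<in>UNIV. a Q i x * T Q i)" using nn by (intro sum_nonneg) auto
      then show "((\<Sum>i\<in>UNIV. a Q i x * T Q i)\<^sup>2) powr (p/2) = (\<Sum>i\<in>UNIV. a Q i x * T Q i) powr p"
        by (cases "(\<Sum>i\<in>UNIV. a Q i x * T Q i) = 0")
          (auto simp: powr_powr simp flip: powr_numeral)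
    qed
    also have "\<dots> \<le> (\<Sum>Q\<in>{Q\<in>S. x \<in> Q}. \<Sum>i\<in>UNIV. d powr p * T Q i powr p * a Q i x powr p)"
    proof (rule sum_mono)
      fix Q
      have "(\<Sum>i\<in>UNIV. a Q i x * T Q i) powr p \<le> d powr p * (\<Sum>i\<in>UNIV. (a Q i x * T Q i) powr p)"
        unfolding d_def using nn p by (intro sum_powr_le) auto
      then show "(\<Sum>i\<in>UNIV. a Q i x * T Q i) powr p \<le> (\<Sum>i\<in>UNIV. d powr p * T Q i powr p * a Q i x powr p)"
        using nn by (simp add: powr_mult sum_distrib_left mult_ac)
    qed
    finally have "ennreal ((\<Sum>Q\<in>{Q\<in>S. x \<in> Q}. (\<Sum>i\<in>UNIV. a Q i x * T Q i)\<^sup>2) powr (p/2))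
        \<le> ennreal (\<Sum>Q\<in>{Q\<in>S. x \<in> Q}. \<Sum>i\<in>UNIV. d powr p * T Q i powr p * a Q i x powr p)"
      by (rule ennreal_leI)
    also have "\<dots> = (\<Sum>Q\<in>{Q\<in>S. x \<in> Q}. \<Sum>i\<in>UNIV. ennreal (d powr p * T Q i powr p * a Q i x powr p))"
      by (simp add: sum_ennreal sum_nonneg)
    also have "\<dots> = (\<Sum>Q\<in>S. if x \<in> Q then \<Sum>i\<in>UNIV. ennreal (d powr p * T Q i powr p * a Q i x powr p) else 0)"
      by (rule sum.inter_filter[OF finite_S])
    also have "\<dots> = (\<Sum>Q\<in>S. \<Sum>i\<in>UNIV. ennreal (d powr p * T Q i powr p) * (ennreal (a Q i x powr p) * indicator Q x))"
      by (intro sum.cong refl) (auto simp: indicator_def ennreal_mult simp del: sum_ennreal)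
    finally show "ennreal ((\<Sum>Q\<in>{Q\<in>S. x \<in> Q}. (\<Sum>i\<in>UNIV. a Q i x * T Q i)\<^sup>2) powr (p/2))
        \<le> (\<Sum>Q\<in>S. \<Sum>i\<in>UNIV. ennreal (d powr p * T Q i powr p) * (ennreal (a Q i x powr p) * indicator Q x))" .
  qed
  also have "\<dots> = (\<Sum>Q\<in>S. \<Sum>i\<in>UNIV. ennreal (d powr p * T Q i powr p) * (\<integral>\<^sup>+x\<in>Q. ennreal (a Q i x powr p) \<partial>M))"
    by (subst nn_integral_sum, (measurable; fail), intro sum.cong refl, subst nn_integral_sum)
      (auto simp: nn_integral_cmult)
  also have "\<dots> \<le> (\<Sum>Q\<in>S. \<Sum>i\<in>UNIV. ennreal (d powr p * T Q i powr p) * ennreal (K * measure M Q))"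
    by (intro sum_mono mult_left_mono a_int) auto
  also have "\<dots> = (\<Sum>Q\<in>S. \<Sum>i\<in>UNIV. ennreal (d powr p * K) * ennreal (measure M Q * T Q i powr p))"
    using Kn by (intro sum.cong refl) (simp add: ennreal_mult[symmetric] mult_ac)
  also have "\<dots> = ennreal (d powr p * K) * (\<Sum>i\<in>UNIV. \<Sum>Q\<in>S. ennreal (measure M Q * T Q i powr p))"
    by (subst sum.swap) (simp only: sum_distrib_left)
  finally show ?thesis by (simp only: d_def)
qed

text \<open>
  For \<open>p > 2\<close> the cubes are decoupled by Hoelder's inequality with exponents \<open>p/2\<close> and \<open>p/(p - 2)\<close>,
  after inserting \<open>\<theta>\<close> to a multiple of the depth and its inverse. The negative powers form a geometric
  series, which costs \<open>1 / \<kappa>\<close> to the power \<open>p/2 - 1\<close>; the positive ones are absorbed by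
  \<open>layer_weighted_integral\<close>.
\<close>

lemma sparse_sum_large_exponent:
  fixes a :: "'a set \<Rightarrow> 'i::finite \<Rightarrow> 'a \<Rightarrow> real" and T :: "'a set \<Rightarrow> 'i \<Rightarrow> real"
  assumes p: "2 < p" and Kn: "0 \<le> K" and \<kappa>: "0 < \<kappa>" "\<kappa> \<le> 1"
    and [measurable]: "\<And>Q i. a Q i \<in> borel_measurable M"
    and nn: "\<And>Q i x. 0 \<le> a Q i x" "\<And>Q i. 0 \<le> T Q i"
    and a_int: "\<And>Q i. Q \<in> S \<Longrightarrow> (\<integral>\<^sup>+x\<in>Q. ennreal (a Q i x powr p) \<partial>M) \<le> ennreal (K * measure M Q)"
    and core: "\<And>P Q i. Q \<in> S \<Longrightarrow> P \<in> S \<Longrightarrow> P \<subseteq> Q \<Longrightarrow>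
      ennreal \<kappa> * (\<integral>\<^sup>+x\<in>P. ennreal (a Q i x powr p) \<partial>M) \<le> (\<integral>\<^sup>+x\<in>core P. ennreal (a Q i x powr p) \<partial>M)"
  shows "(\<integral>\<^sup>+x. ennreal ((\<Sum>Q\<in>{Q\<in>S. x \<in> Q}. (\<Sum>i\<in>UNIV. a Q i x * T Q i)\<^sup>2) powr (p/2)) \<partial>M)
    \<le> ennreal (real CARD('i) powr p * (2 * K) * ((2 * p - 3) / \<kappa>) powr (p/2 - 1))
        * (\<Sum>i\<in>UNIV. \<Sum>Q\<in>S. ennreal (measure M Q * T Q i powr p))"
proof -
  define d where "d = real CARD('i)"
  define \<theta> where "\<theta> = 1 + \<kappa> / 2"
  have \<theta>: "1 \<le> \<theta>" using \<kappa> by (simp add: \<theta>_def)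
  \<comment> \<open>The exponent of the depth weight after Hoelder's inequality: \<open>2/p\<close> times \<open>p/(p - 2)\<close>.\<close>
  define s where "s = 2 / (p - 2)"
  have s: "0 < s" "(4 + s) / (s * \<kappa>) = (2 * p - 3) / \<kappa>" using p \<kappa> by (auto simp: s_def field_simps)
  define H where "H = ((2 * p - 3) / \<kappa>) powr (p/2 - 1)"
  have H: "0 \<le> H" by (simp add: H_def)
  have single: "(\<Sum>Q\<in>{Q\<in>S. x \<in> Q}. (a Q i x * T Q i)\<^sup>2) powr (p/2)
      \<le> H * (\<Sum>Q\<in>{Q\<in>S. x \<in> Q}. T Q i powr p * (a Q i x powr p * \<theta> ^ layer Q x))" for x i
  proof -
    define A where "A = {Q\<in>S. x \<in> Q}"
    have finA: "finite A" using finite_S by (simp add: A_def)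
    define c where "c Q = a Q i x * T Q i" for Q
    have c: "0 \<le> c Q" for Q using nn by (simp add: c_def)
    define r where "r = p / (p - 2)"
    have r: "1 < p/2" "1 < r" "1 / (p/2) + 1 / r = 1" using p by (auto simp: r_def field_simps)
    have "(\<Sum>Q\<in>A. (c Q)\<^sup>2) = (\<Sum>Q\<in>A. ((c Q)\<^sup>2 * \<theta> powr (2 * layer Q x / p)) * \<theta> powr (- 2 * layer Q x / p))"
    proof (intro sum.cong refl)
      fix Q
      have "\<theta> powr (2 * layer Q x / p) * \<theta> powr (- 2 * layer Q x / p) = 1"
        using \<theta> by (simp add: powr_add[symmetric])
      then show "(c Q)\<^sup>2 = ((c Q)\<^sup>2 * \<theta> powr (2 * layer Q x / p)) * \<theta> powr (- 2 * layer Q x / p)"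
        by (simp only: mult.assoc mult_1_right)
    qed
    also have "\<dots> \<le> (\<Sum>Q\<in>A. ((c Q)\<^sup>2 * \<theta> powr (2 * layer Q x / p)) powr (p/2)) powr (1 / (p/2))
        * (\<Sum>Q\<in>A. (\<theta> powr (- 2 * layer Q x / p)) powr r) powr (1 / r)"
      using \<theta> finA by (intro sum_Hoelder r) auto
    also have "(\<Sum>Q\<in>A. ((c Q)\<^sup>2 * \<theta> powr (2 * layer Q x / p)) powr (p/2)) = (\<Sum>Q\<in>A. c Q powr p * \<theta> ^ layer Q x)"
    proof (intro sum.cong refl)
      fix Q
      have "(c Q)\<^sup>2 powr (p/2) = c Q powr p"
        using c[of Q] by (cases "c Q = 0") (auto simp: powr_powr simp flip: powr_numeral)
      moreover have "(\<theta> powr (2 * layer Q x / p)) powr (p/2) = \<theta> ^ layer Q x"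
        using \<theta> p by (simp add: powr_powr powr_realpow)
      ultimately show "((c Q)\<^sup>2 * \<theta> powr (2 * layer Q x / p)) powr (p/2) = c Q powr p * \<theta> ^ layer Q x"
        by (simp add: powr_mult)
    qed
    also have "(\<Sum>Q\<in>A. (\<theta> powr (- 2 * layer Q x / p)) powr r) = (\<Sum>Q\<in>A. \<theta> powr (- s * real (layer Q x)))"
      using p by (intro sum.cong refl) (simp add: powr_powr r_def s_def)
    finally have le: "(\<Sum>Q\<in>A. (c Q)\<^sup>2) \<le> (\<Sum>Q\<in>A. c Q powr p * \<theta> ^ layer Q x) powr (1 / (p/2))
        * (\<Sum>Q\<in>A. \<theta> powr (- s * real (layer Q x))) powr (1 / r)" .
    define X Y where "X = (\<Sum>Q\<in>A. c Q powr p * \<theta> ^ layer Q x)" and "Y = (\<Sum>Q\<in>A. \<theta> powr (- s * real (layer Q x)))"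
    have XY: "0 \<le> X" "0 \<le> Y" using \<theta> by (auto simp: X_def Y_def intro!: sum_nonneg)
    have Y: "Y \<le> (2 * p - 3) / \<kappa>"
      unfolding Y_def A_def \<theta>_def s(2)[symmetric] by (rule layer_geometric[OF s(1) \<kappa>])
    have "(\<Sum>Q\<in>A. (c Q)\<^sup>2) powr (p/2) \<le> (X powr (1 / (p/2)) * Y powr (1 / r)) powr (p/2)"
      using le p by (intro powr_mono2) (auto simp: X_def Y_def sum_nonneg)
    also have "\<dots> = X * Y powr (p/2 - 1)"
    proof -
      have "1 / r * (p / 2) = p/2 - 1" using p by (simp add: r_def field_simps)
      then show ?thesis using XY p by (simp add: powr_mult powr_powr)
    qed
    also have "\<dots> \<le> X * H"
      unfolding H_def using Y XY p by (intro mult_left_mono powr_mono2) auto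
    also have "X = (\<Sum>Q\<in>A. T Q i powr p * (a Q i x powr p * \<theta> ^ layer Q x))"
      unfolding X_def c_def using nn by (intro sum.cong refl) (simp add: powr_mult mult_ac)
    finally show ?thesis by (simp only: A_def c_def mult.commute[of _ H])
  qed
  have "(\<integral>\<^sup>+x. ennreal ((\<Sum>Q\<in>{Q\<in>S. x \<in> Q}. (\<Sum>i\<in>UNIV. a Q i x * T Q i)\<^sup>2) powr (p/2)) \<partial>M)
      \<le> (\<integral>\<^sup>+x. (\<Sum>i\<in>UNIV. \<Sum>Q\<in>S. ennreal (d powr p * H * T Q i powr p) *
          (ennreal (a Q i x powr p) * (ennreal (\<theta> ^ layer Q x) * indicator Q x))) \<partial>M)"
  proof (rule nn_integral_mono)
    fix x
    define Z where "Z i = (\<Sum>Q\<in>{Q\<in>S. x \<in> Q}. (a Q i x * T Q i)\<^sup>2)" for i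
    have Z: "0 \<le> Z i" for i by (auto simp: Z_def intro!: sum_nonneg)
    have "(\<Sum>Q\<in>{Q\<in>S. x \<in> Q}. (\<Sum>i\<in>UNIV. a Q i x * T Q i)\<^sup>2)
        \<le> (\<Sum>Q\<in>{Q\<in>S. x \<in> Q}. d * (\<Sum>i\<in>UNIV. (a Q i x * T Q i)\<^sup>2))"
      using Cauchy_Schwarz_ineq_sum[of "\<lambda>_. 1" _ "UNIV::'i set"] by (intro sum_mono) (simp add: d_def)
    also have "\<dots> = d * (\<Sum>i\<in>UNIV. Z i)"
      unfolding Z_def by (subst sum.swap) (simp only: sum_distrib_left)
    finally have "(\<Sum>Q\<in>{Q\<in>S. x \<in> Q}. (\<Sum>i\<in>UNIV. a Q i x * T Q i)\<^sup>2) powr (p/2) \<le> (d * (\<Sum>i\<in>UNIV. Z i)) powr (p/2)"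
      using p by (intro powr_mono2) (auto intro: sum_nonneg)
    also have "\<dots> = d powr (p/2) * (\<Sum>i\<in>UNIV. Z i) powr (p/2)"
      using Z by (simp add: powr_mult d_def sum_nonneg)
    also have "\<dots> \<le> d powr (p/2) * (d powr (p/2) * (\<Sum>i\<in>UNIV. Z i powr (p/2)))"
      unfolding d_def using Z p by (intro mult_left_mono sum_powr_le) auto
    also have "\<dots> = d powr p * (\<Sum>i\<in>UNIV. Z i powr (p/2))"
      by (simp add: mult.assoc[symmetric] powr_add[symmetric])
    also have "\<dots> \<le> d powr p * (\<Sum>i\<in>UNIV. H * (\<Sum>Q\<in>{Q\<in>S. x \<in> Q}. T Q i powr p * (a Q i x powr p * \<theta> ^ layer Q x)))"
      unfolding Z_def by (intro mult_left_mono sum_mono single) auto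
    also have "\<dots> = (\<Sum>i\<in>UNIV. \<Sum>Q\<in>{Q\<in>S. x \<in> Q}. d powr p * H * T Q i powr p * (a Q i x powr p * \<theta> ^ layer Q x))"
      by (simp add: sum_distrib_left mult_ac)
    finally have "ennreal ((\<Sum>Q\<in>{Q\<in>S. x \<in> Q}. (\<Sum>i\<in>UNIV. a Q i x * T Q i)\<^sup>2) powr (p/2))
        \<le> ennreal (\<Sum>i\<in>UNIV. \<Sum>Q\<in>{Q\<in>S. x \<in> Q}. d powr p * H * T Q i powr p * (a Q i x powr p * \<theta> ^ layer Q x))"
      by (rule ennreal_leI)
    also have "\<dots> = (\<Sum>i\<in>UNIV. \<Sum>Q\<in>{Q\<in>S. x \<in> Q}. ennreal (d powr p * H * T Q i powr p * (a Q i x powr p * \<theta> ^ layer Q x)))"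
      using \<theta> H by (simp add: sum_ennreal sum_nonneg)
    also have "\<dots> = (\<Sum>i\<in>UNIV. \<Sum>Q\<in>S. if x \<in> Q then ennreal (d powr p * H * T Q i powr p * (a Q i x powr p * \<theta> ^ layer Q x)) else 0)"
      by (intro sum.cong[OF refl] sum.inter_filter[OF finite_S])
    also have "\<dots> = (\<Sum>i\<in>UNIV. \<Sum>Q\<in>S. ennreal (d powr p * H * T Q i powr p) *
          (ennreal (a Q i x powr p) * (ennreal (\<theta> ^ layer Q x) * indicator Q x)))"
      using \<theta> H by (intro sum.cong refl) (auto simp: indicator_def ennreal_mult)
    finally show "ennreal ((\<Sum>Q\<in>{Q\<in>S. x \<in> Q}. (\<Sum>i\<in>UNIV. a Q i x * T Q i)\<^sup>2) powr (p/2))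
        \<le> (\<Sum>i\<in>UNIV. \<Sum>Q\<in>S. ennreal (d powr p * H * T Q i powr p) *
          (ennreal (a Q i x powr p) * (ennreal (\<theta> ^ layer Q x) * indicator Q x)))" .
  qed
  also have "\<dots> = (\<Sum>i\<in>UNIV. \<Sum>Q\<in>S. ennreal (d powr p * H * T Q i powr p) *
      (\<integral>\<^sup>+x. ennreal (a Q i x powr p) * (ennreal (\<theta> ^ layer Q x) * indicator Q x) \<partial>M))"
    by (subst nn_integral_sum, (measurable; fail), intro sum.cong refl, subst nn_integral_sum)
      (auto simp: nn_integral_cmult)
  also have "\<dots> \<le> (\<Sum>i\<in>UNIV. \<Sum>Q\<in>S. ennreal (d powr p * H * T Q i powr p) * ennreal (2 * (K * measure M Q)))"
    unfolding \<theta>_def by (intro sum_mono mult_left_mono layer_weighted_integral \<kappa> a_int core) auto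
  also have "\<dots> = (\<Sum>i\<in>UNIV. \<Sum>Q\<in>S. ennreal (d powr p * (2 * K) * H) * ennreal (measure M Q * T Q i powr p))"
    using Kn H by (intro sum.cong refl) (simp add: ennreal_mult[symmetric] mult_ac)
  also have "\<dots> = ennreal (d powr p * (2 * K) * H) * (\<Sum>i\<in>UNIV. \<Sum>Q\<in>S. ennreal (measure M Q * T Q i powr p))"
    by (simp only: sum_distrib_left)
  finally show ?thesis by (simp only: d_def H_def)
qed

end

section \<open>Factored matrix weights on a tree\<close>

text \<open>
  The rows of \<open>U\<close> and the columns of its inverse split \<open>V x ** Vi y\<close> into \<open>d\<close> products of a function
  of \<open>x\<close> and a function of \<open>y\<close>, with separate control in \<open>L\<^sup>p\<close> and in the dual exponent. For an \<open>A\<^sub>p\<close>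
  weight, \<open>U\<close> is a basis adapted to the averaged dual norm on \<open>Q\<close>, as for reducing operators.
\<close>

definition factored_Ap ::
    "'a measure \<Rightarrow> real \<Rightarrow> real \<Rightarrow> ('a \<Rightarrow> complex^'d^'d) \<Rightarrow> ('a \<Rightarrow> complex^'d^'d) \<Rightarrow> 'a set \<Rightarrow> bool"
  where "factored_Ap M p A V Vi Q \<longleftrightarrow> (\<exists>U U' :: complex^'d^'d. U ** U' = mat 1 \<and> U' ** U = mat 1 \<and>
    (\<forall>i. (\<integral>\<^sup>+y\<in>Q. ennreal (norm (row i U v* Vi y) powr conj_exp p) \<partial>M) \<le> ennreal (measure M Q)) \<and>
    (\<forall>i. (\<integral>\<^sup>+x\<in>Q. ennreal (norm (V x *v column i U') powr p) \<partial>M) \<le> ennreal (A * measure M Q)))"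

lemma conj_exp_props:
  assumes "1 < p"
  shows "1 < conj_exp p" "1 / conj_exp p + 1 / p = 1" "conj_exp p / p = 1 / (p - 1)" "p / conj_exp p = p - 1"
  using assms by (auto simp: conj_exp_def field_simps)

lemma row_matrix_mult: "row i (U ** M) = row i U v* M"
  by (simp add: vec_eq_iff row_def vector_matrix_mult_def matrix_matrix_mult_def mult.commute)

lemma norm_sum_smult_le:
  fixes u :: "'i \<Rightarrow> complex^'d"
  shows "norm (\<Sum>i\<in>I. c i *s u i) \<le> (\<Sum>i\<in>I. norm (c i) * norm (u i))"
  by (rule order_trans[OF norm_sum]) (simp add: norm_smult_vec)

text \<open>
  Insert \<open>U' ** U\<close> between \<open>X\<close> and \<open>Y\<close>.
\<close>

lemma factored_product_bound:
  fixes U :: "complex^'d^'d"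
  assumes "U' ** U = mat 1"
  shows "norm ((z v* X) v* Y) \<le> norm z * (\<Sum>i\<in>UNIV. norm (X *v column i U') * norm (row i U v* Y))"
proof -
  have "(z v* X) v* Y = ((z v* X) v* U') v* (U ** Y)"
    by (simp add: vector_matrix_mul_assoc matrix_mul_assoc[symmetric]) (simp add: matrix_mul_assoc assms)
  also have "\<dots> = (\<Sum>i\<in>UNIV. ((z v* X) v* U') $ i *s (row i U v* Y))"
    by (simp add: vector_matrix_sum_rows row_matrix_mult)
  also have "norm \<dots> \<le> (\<Sum>i\<in>UNIV. norm (((z v* X) v* U') $ i) * norm (row i U v* Y))"
    by (rule norm_sum_smult_le)
  also have "\<dots> \<le> (\<Sum>i\<in>UNIV. (norm z * norm (X *v column i U')) * norm (row i U v* Y))"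
    by (intro sum_mono mult_right_mono)
      (auto simp: vector_matrix_component pairing_vector_matrix norm_pairing_le)
  finally show ?thesis by (simp add: sum_distrib_left mult.assoc)
qed

lemma row_change_bound:
  fixes U :: "complex^'d^'d"
  assumes "U' ** U = mat 1" "Vx ** Vx' = mat 1" "Vx' ** Vx = mat 1"
  shows "norm (u v* Y) \<le> norm (u v* Vx') * (\<Sum>i\<in>UNIV. norm (Vx *v column i U') * norm (row i U v* Y))"
  using factored_product_bound[OF assms(1), of "u v* Vx'" Vx Y]
  by (simp add: vector_matrix_mul_assoc assms vector_matrix_mul_rid)

lemma column_change_bound:
  fixes U :: "complex^'d^'d"
  assumes "U' ** U = mat 1" "Vy' ** Vy = mat 1"
  shows "norm (X *v \<psi>) \<le> norm (Vy *v \<psi>) * (\<Sum>i\<in>UNIV. norm (row i U v* Vy') * norm (X *v column i U'))"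
proof (cases "X *v \<psi> = 0")
  case False
  define z where "z = conj_vec (X *v \<psi>)"
  have X: "X *v \<psi> = (X ** Vy') *v (Vy *v \<psi>)"
    by (simp add: matrix_vector_mul_assoc matrix_mul_assoc[symmetric] assms)
  have "(norm (X *v \<psi>))\<^sup>2 = norm (pairing z (X *v \<psi>))"
    by (simp add: z_def pairing_conj_vec norm_power)
  also have "pairing z (X *v \<psi>) = pairing ((z v* X) v* Vy') (Vy *v \<psi>)"
    by (simp only: pairing_vector_matrix vector_matrix_mul_assoc X)
  also have "norm \<dots> \<le> norm ((z v* X) v* Vy') * norm (Vy *v \<psi>)" by (rule norm_pairing_le)
  also have "\<dots> \<le> (norm z * (\<Sum>i\<in>UNIV. norm (X *v column i U') * norm (row i U v* Vy'))) * norm (Vy *v \<psi>)"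
    by (intro mult_right_mono factored_product_bound assms) auto
  finally have "norm (X *v \<psi>) * norm (X *v \<psi>) \<le> norm (X *v \<psi>) *
      (norm (Vy *v \<psi>) * (\<Sum>i\<in>UNIV. norm (row i U v* Vy') * norm (X *v column i U')))"
    by (simp add: power2_eq_square z_def mult_ac)
  then show ?thesis using False by simp
qed (simp add: sum_nonneg)

text \<open>
  A weight that changes by at most a factor \<open>\<Sum>i. \<alpha> i x * \<beta> i y\<close> between two points charges every
  large subset: by Chebyshev's inequality a quarter of \<open>P\<close> lies in \<open>E\<close> and has all \<open>\<alpha> i x\<close> bounded,
  and each such \<open>x\<close> alone controls the average of the weight over \<open>P\<close>.
\<close>

lemma large_subset_mass:
  fixes \<alpha> \<beta> :: "'i::finite \<Rightarrow> 'a \<Rightarrow> real" and \<omega> :: "'a \<Rightarrow> real"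
  assumes r: "0 < r" "0 < s" and A: "0 < A1" "0 < A2"
    and [measurable]: "P \<in> sets M" "E \<in> sets M" "\<omega> \<in> borel_measurable M"
      "\<And>i. \<alpha> i \<in> borel_measurable M" "\<And>i. \<beta> i \<in> borel_measurable M"
    and P: "0 < measure M P" "emeasure M P < \<infinity>" and E: "E \<subseteq> P" "measure M P / 2 \<le> measure M E"
    and nn: "\<And>x. 0 \<le> \<omega> x" "\<And>i x. 0 \<le> \<alpha> i x" "\<And>i x. 0 \<le> \<beta> i x"
    and change: "\<And>x y. \<omega> y \<le> \<omega> x * (\<Sum>i\<in>UNIV. \<alpha> i x * \<beta> i y)"
    and \<alpha>: "\<And>i. (\<integral>\<^sup>+x\<in>P. ennreal (\<alpha> i x powr s) \<partial>M) \<le> ennreal (A1 * measure M P)"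
    and \<beta>: "\<And>i. (\<integral>\<^sup>+y\<in>P. ennreal (\<beta> i y powr r) \<partial>M) \<le> ennreal (A2 * measure M P)"
  shows "ennreal (1 / (4 * real CARD('i) powr (r + 1) * (4 * real CARD('i) * A1) powr (r / s) * A2))
      * (\<integral>\<^sup>+y\<in>P. ennreal (\<omega> y powr r) \<partial>M) \<le> (\<integral>\<^sup>+y\<in>E. ennreal (\<omega> y powr r) \<partial>M)"
proof -
  define d where "d = real CARD('i)"
  have d: "1 \<le> d" by (simp add: d_def Suc_leI)
  define m where "m = measure M P"
  have m: "0 < m" "emeasure M P = ennreal m"
    using P by (auto simp: m_def emeasure_eq_ennreal_measure top.not_eq_extremum)
  have fmP: "P \<in> fmeasurable M" using P by (simp add: fmeasurable_def)
  have fm: "X \<in> fmeasurable M" if "X \<in> sets M" "X \<subseteq> P" for X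
    using fmeasurableI2[OF fmP that(2,1)] .
  define c where "c = (4 * d * A1) powr (1 / s)"
  have c: "0 < c" "c powr s = 4 * d * A1" using d A r by (auto simp: c_def powr_powr)
  define bad where "bad i = {x\<in>P. c < \<alpha> i x}" for i
  have bad_sets [measurable]: "bad i \<in> sets M" for i unfolding bad_def by measurable
  have bad: "measure M (bad i) \<le> m / (4 * d)" for i
  proof -
    have "ennreal (4 * d * A1) * emeasure M (bad i) = (\<integral>\<^sup>+x. ennreal (4 * d * A1) * indicator (bad i) x \<partial>M)"
      by (simp add: nn_integral_cmult_indicator)
    also have "\<dots> \<le> (\<integral>\<^sup>+x\<in>P. ennreal (\<alpha> i x powr s) \<partial>M)"
    proof (intro nn_integral_mono)
      fix x
      show "ennreal (4 * d * A1) * indicator (bad i) x \<le> ennreal (\<alpha> i x powr s) * indicator P x"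
      proof (cases "x \<in> bad i")
        case True
        then have "c powr s \<le> \<alpha> i x powr s" using c r by (intro powr_mono2) (auto simp: bad_def)
        then show ?thesis using True c by (auto simp: bad_def intro!: ennreal_leI)
      qed simp
    qed
    also have "\<dots> \<le> ennreal (A1 * m)" unfolding m_def by (rule \<alpha>)
    finally have "ennreal (4 * d * A1) * emeasure M (bad i) \<le> ennreal (A1 * m)" .
    moreover have "bad i \<in> fmeasurable M" by (rule fm[OF bad_sets]) (auto simp: bad_def)
    then have "emeasure M (bad i) = ennreal (measure M (bad i))" by (rule emeasure_eq_measure2)
    ultimately have "ennreal ((4 * d * A1) * measure M (bad i)) \<le> ennreal (A1 * m)"
      using d A ennreal_mult[of "4 * d * A1" "measure M (bad i)"] by simp
    then have "(4 * d * A1) * measure M (bad i) \<le> A1 * m"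
      using A m by (subst (asm) ennreal_le_iff) auto
    then have "A1 * (4 * d * measure M (bad i)) \<le> A1 * m" by (simp add: mult_ac)
    then show ?thesis using A d by (simp add: field_simps)
  qed
  define G where "G = E - (\<Union>i. bad i)"
  have [measurable]: "G \<in> sets M" unfolding G_def by measurable
  have GP: "G \<subseteq> E" "G \<subseteq> P" using E by (auto simp: G_def)
  have G: "m / 4 \<le> measure M G"
  proof -
    have "measure M (\<Union>i. bad i) \<le> (\<Sum>i\<in>UNIV. measure M (bad i))"
      by (rule measure_UNION_le) (auto intro!: bad_sets)
    also have "\<dots> \<le> (\<Sum>i\<in>(UNIV::'i set). m / (4 * d))" by (intro sum_mono bad)
    also have "\<dots> = m / 4" using d by (simp add: d_def)
    finally have "measure M (\<Union>i. bad i) \<le> m / 4" .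
    moreover have "measure M E \<le> measure M (G \<union> (\<Union>i. bad i))"
      using E(1) by (intro measure_mono_fmeasurable fm) (auto simp: G_def bad_def)
    moreover have "measure M (G \<union> (\<Union>i. bad i)) \<le> measure M G + measure M (\<Union>i. bad i)"
      by (rule measure_Un_le) auto
    ultimately show ?thesis using E(2) by (simp add: m_def)
  qed
  define N where "N = d powr (r + 1) * c powr r * A2 * m"
  have N: "0 < N" using d c A m by (simp add: N_def)
  have pt: "(\<integral>\<^sup>+y\<in>P. ennreal (\<omega> y powr r) \<partial>M) \<le> ennreal (\<omega> x powr r) * ennreal N" if x: "x \<in> G" for x
  proof -
    have \<alpha>c: "\<alpha> i x \<le> c" for i using x GP by (auto simp: G_def bad_def not_less)
    have "(\<integral>\<^sup>+y\<in>P. ennreal (\<omega> y powr r) \<partial>M)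
        \<le> (\<integral>\<^sup>+y. (\<Sum>i\<in>UNIV. ennreal (\<omega> x powr r * d powr r * c powr r) * (ennreal (\<beta> i y powr r) * indicator P y)) \<partial>M)"
    proof (intro nn_integral_mono)
      fix y
      have "\<omega> y \<le> \<omega> x * (\<Sum>i\<in>UNIV. c * \<beta> i y)"
        by (rule order_trans[OF change[of y x]]) (intro mult_left_mono sum_mono mult_right_mono \<alpha>c nn)
      then have "\<omega> y powr r \<le> (\<omega> x * (\<Sum>i\<in>UNIV. c * \<beta> i y)) powr r"
        using nn r by (intro powr_mono2) auto
      also have "\<dots> = \<omega> x powr r * (\<Sum>i\<in>UNIV. c * \<beta> i y) powr r"
        by (rule powr_mult)
      also have "\<dots> \<le> \<omega> x powr r * (d powr r * (\<Sum>i\<in>UNIV. (c * \<beta> i y) powr r))"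
        unfolding d_def using c r nn by (intro mult_left_mono sum_powr_le) auto
      also have "\<dots> = (\<Sum>i\<in>UNIV. \<omega> x powr r * d powr r * c powr r * \<beta> i y powr r)"
        by (simp add: powr_mult sum_distrib_left mult_ac)
      finally have "ennreal (\<omega> y powr r) \<le> ennreal (\<Sum>i\<in>UNIV. \<omega> x powr r * d powr r * c powr r * \<beta> i y powr r)"
        by (rule ennreal_leI)
      also have "\<dots> = (\<Sum>i\<in>UNIV. ennreal (\<omega> x powr r * d powr r * c powr r) * ennreal (\<beta> i y powr r))"
        by (subst sum_ennreal[symmetric]) (auto simp: ennreal_mult)
      finally show "ennreal (\<omega> y powr r) * indicator P y
          \<le> (\<Sum>i\<in>UNIV. ennreal (\<omega> x powr r * d powr r * c powr r) * (ennreal (\<beta> i y powr r) * indicator P y))"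
        by (cases "y \<in> P") auto
    qed
    also have "\<dots> = (\<Sum>i\<in>UNIV. ennreal (\<omega> x powr r * d powr r * c powr r) * (\<integral>\<^sup>+y\<in>P. ennreal (\<beta> i y powr r) \<partial>M))"
      by (subst nn_integral_sum) (auto simp: nn_integral_cmult)
    also have "\<dots> \<le> (\<Sum>i\<in>(UNIV::'i set). ennreal (\<omega> x powr r * d powr r * c powr r) * ennreal (A2 * m))"
      unfolding m_def by (intro sum_mono mult_left_mono \<beta>) auto
    also have "\<dots> = ennreal (d * (\<omega> x powr r * d powr r * c powr r * (A2 * m)))"
      using A m d by (simp add: ennreal_mult[symmetric] d_def ennreal_of_nat_eq_real_of_nat)
    also have "d * (\<omega> x powr r * d powr r * c powr r * (A2 * m)) = \<omega> x powr r * N"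
      using d by (simp add: N_def powr_add mult_ac)
    finally show ?thesis by (simp add: ennreal_mult N less_imp_le)
  qed
  define I where "I = (\<integral>\<^sup>+y\<in>P. ennreal (\<omega> y powr r) \<partial>M)"
  have "I * ennreal (m / 4) \<le> I * emeasure M G"
    unfolding emeasure_eq_measure2[OF fm[OF \<open>G \<in> sets M\<close> GP(2)]] using G by (intro mult_left_mono ennreal_leI) auto
  also have "\<dots> = (\<integral>\<^sup>+x. I * indicator G x \<partial>M)" by (simp add: nn_integral_cmult_indicator)
  also have "\<dots> \<le> (\<integral>\<^sup>+x. ennreal N * (ennreal (\<omega> x powr r) * indicator E x) \<partial>M)"
    unfolding I_def using pt GP by (intro nn_integral_mono) (auto simp: indicator_def mult.commute)
  also have "\<dots> = ennreal N * (\<integral>\<^sup>+x\<in>E. ennreal (\<omega> x powr r) \<partial>M)"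
    by (rule nn_integral_cmult) measurable
  finally have main: "I * ennreal (m / 4) \<le> ennreal N * (\<integral>\<^sup>+x\<in>E. ennreal (\<omega> x powr r) \<partial>M)" .
  have cr: "c powr r = (4 * d * A1) powr (r / s)" by (simp add: c_def powr_powr)
  have "ennreal (1 / (4 * d powr (r + 1) * (4 * d * A1) powr (r / s) * A2)) * I
      = ennreal (1 / N) * (I * ennreal (m / 4))"
  proof -
    have "1 / (4 * d powr (r + 1) * (4 * d * A1) powr (r / s) * A2) = 1 / N * (m / 4)"
      using m by (simp add: N_def cr)
    moreover have "ennreal (1 / N * (m / 4)) = ennreal (1 / N) * ennreal (m / 4)"
      using N m by (intro ennreal_mult) auto
    ultimately show ?thesis by (simp only: mult.assoc mult.commute[of I])
  qed
  also have "\<dots> \<le> ennreal (1 / N) * (ennreal N * (\<integral>\<^sup>+x\<in>E. ennreal (\<omega> x powr r) \<partial>M))"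
    using main by (rule mult_left_mono) simp
  also have "\<dots> = (\<integral>\<^sup>+x\<in>E. ennreal (\<omega> x powr r) \<partial>M)"
    using N by (simp add: mult.assoc[symmetric] ennreal_mult[symmetric])
  finally show ?thesis by (simp only: I_def d_def)
qed

lemma continuous_matrix_vector_left [continuous_intros]:
  "continuous_on UNIV (\<lambda>X::complex^'n^'m. X *v c)" "continuous_on UNIV (\<lambda>X::complex^'n^'m. u v* X)"
  unfolding matrix_vector_mult_def vector_matrix_mult_def by (intro continuous_intros)+

lemma measurable_matrix_vector [measurable]:
  assumes "V \<in> borel_measurable M"
  shows "(\<lambda>x. (V x :: complex^'n^'m) *v c) \<in> borel_measurable M" "(\<lambda>x. u v* (V x :: complex^'n^'m)) \<in> borel_measurable M"
  using borel_measurable_continuous_on[OF continuous_matrix_vector_left(1) assms]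
    borel_measurable_continuous_on[OF continuous_matrix_vector_left(2) assms] by auto

section \<open>The square function estimate on a tree\<close>

text \<open>
  The proportion in \<open>large_subset_mass\<close> without the weight constant. For conjugate exponents \<open>r\<close> and
  \<open>s\<close> one has \<open>r / s = r - 1\<close>, so one formula serves the weight and its dual.
\<close>

definition decay_const :: "real \<Rightarrow> real \<Rightarrow> real"
  where "decay_const d r = 1 / (4 * d powr (r + 1) * (4 * d) powr (r - 1))"

text \<open>
  The factors are the losses of the sparse domination, of the estimate for sparse sums, and of the
  Carleson embedding for each of the \<open>d\<close> components.
\<close>

definition tree_const :: "real \<Rightarrow> real \<Rightarrow> real \<Rightarrow> real"
  where "tree_const d B p = (d * domination_const d B) powr (p/2) *
    ((if p \<le> 2 then d powr p else d powr p * 2 * ((2 * p - 3) / decay_const d p) powr (p/2 - 1)) *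
     (d * (2 powr (p - 1) * ((3 + p) / ((p - 1) * decay_const d (conj_exp p))))))"

lemma gamma_exp_cases:
  assumes "1 < p"
  shows "p \<le> 2 \<Longrightarrow> p * gamma_exp p = 1 + 1 / (p - 1)"
    and "2 < p \<Longrightarrow> p * gamma_exp p = 1 + (p/2 - 1) + 1 / (p - 1)"
  using assms by (auto simp: gamma_exp_def field_simps)

context cube_tree_family
begin

text \<open>
  On a sparse cube \<open>P\<close> the factorization turns the average in the direction of a row of \<open>V x\<close> into
  \<open>\<Sum>i. a P i x * T P i\<close> with \<open>a\<close> whose \<open>p\<close>-th powers have averages at most \<open>A\<close>, where \<open>T\<close> averages the weighted function
  against the dual factors \<open>b\<close>. The cores keep the proportions \<open>\<kappa>2\<close>, of order \<open>1 / A\<close>, of the powers of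
  \<open>a\<close>, and \<open>\<kappa>1\<close>, of order \<open>A powr (- 1 / (p - 1))\<close>, of those of \<open>b\<close>; these are the rates in the two
  estimates for sparse sums and in the Carleson embedding.
\<close>

lemma square_function_cube:
  fixes V Vi :: "'a \<Rightarrow> complex^'d^'d"
  assumes p: "1 < p" and A: "1 \<le> A"
    and V [measurable]: "V \<in> borel_measurable M" "Vi \<in> borel_measurable M"
    and F_meas: "\<And>\<kappa>. \<kappa> \<in> K \<Longrightarrow> F \<kappa> \<in> borel_measurable M"
    and inv: "\<And>x. V x ** Vi x = mat 1" "\<And>x. Vi x ** V x = mat 1"
    and Ap: "\<And>k Q. Q \<in> D k \<Longrightarrow> factored_Ap M p A V Vi Q"
    and Q0: "Q0 \<in> D 0"
  shows "(\<integral>\<^sup>+x\<in>Q0. ennreal ((\<Sum>i\<in>UNIV. osc_sum n 0 x (row i (V x))) powr (p/2)) \<partial>M)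
    \<le> ennreal (tree_const (real CARD('d)) B p * A powr (p * gamma_exp p)) *
      (\<integral>\<^sup>+x\<in>Q0. ennreal (L2_set (\<lambda>\<kappa>. norm (V x *v F \<kappa> x)) K powr p) \<partial>M)"
proof -
  define d where "d = real CARD('d)"
  have d: "1 \<le> d" by (simp add: d_def Suc_leI)
  define q where "q = conj_exp p"
  have q: "1 < q" "1 / q + 1 / p = 1" "q / p = q - 1" "q / p = 1 / (p - 1)" "p / q = p - 1"
    using conj_exp_props[OF p] p by (auto simp: q_def conj_exp_def field_simps)
  define g where "g x = L2_set (\<lambda>\<kappa>. norm (V x *v F \<kappa> x)) K" for x
  have g0: "0 \<le> g x" for x by (simp add: g_def)
  have g_meas [measurable]: "g \<in> borel_measurable M"
  proof -
    have cont: "continuous_on UNIV (\<lambda>z::(complex^'d^'d) \<times> (complex^'d). norm (fst z *v snd z))"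
      unfolding matrix_vector_mult_def by (intro continuous_intros)
    have "(\<lambda>x. norm (fst (V x, F \<kappa> x) *v snd (V x, F \<kappa> x))) \<in> borel_measurable M" if "\<kappa> \<in> K" for \<kappa>
      by (rule borel_measurable_continuous_on[OF cont]) (use F_meas[OF that] V in measurable)
    then have "(\<lambda>x. \<Sum>\<kappa>\<in>K. (norm (V x *v F \<kappa> x))\<^sup>2) \<in> borel_measurable M"
      by (intro borel_measurable_sum borel_measurable_power) auto
    then show ?thesis
      unfolding g_def L2_set_def by (intro borel_measurable_continuous_on[where f = sqrt] continuous_intros)
  qed
  define \<Lambda> where "\<Lambda> = domination_const (real CARD('d)) B"
  have \<Lambda>: "0 < \<Lambda>"
  proof -
    have "0 < 16 * d\<^sup>2 * B" using d B_ge_1 by (intro mult_pos_pos) auto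
    then have "0 < 16 * d\<^sup>2 * B + (B * (4 * d))\<^sup>2" by (rule add_pos_nonneg) simp
    then show ?thesis using d by (auto simp: \<Lambda>_def domination_const_def d_def[symmetric] intro!: mult_pos_pos)
  qed
  have dc: "0 < decay_const d r" "decay_const d r \<le> 1" if "1 < r" for r
  proof -
    have "1 * 1 * 1 \<le> 4 * d powr (r + 1) * (4 * d) powr (r - 1)"
      using d that by (intro mult_mono ge_one_powr_ge_zero) (auto intro: order_trans[OF _ mult_left_mono, of _ "1::real"] ge_one_powr_ge_zero)
    then show "decay_const d r \<le> 1" by (simp add: decay_const_def)
    show "0 < decay_const d r" using d by (simp add: decay_const_def)
  qed
  define Cb where "Cb = 2 powr (p - 1) * ((3 + p) / ((p - 1) * decay_const d q))"
  define Ca where "Ca = (if p \<le> 2 then d powr p else d powr p * 2 * ((2 * p - 3) / decay_const d p) powr (p/2 - 1))"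
  have C0: "0 < Cb" "0 < Ca" using p d dc[OF p] dc[OF q(1)] by (auto simp: Cb_def Ca_def)
  define C where "C = (d * \<Lambda>) powr (p/2) * (Ca * (d * Cb))"
  have C: "0 < C" using C0 d \<Lambda> by (simp add: C_def)
  have C_eq: "C = tree_const d B p" by (simp add: C_def tree_const_def Ca_def Cb_def q_def \<Lambda>_def d_def)
  have Q0_sets [measurable]: "Q0 \<in> sets M" using Q0 by (rule cube_sets)
  show ?thesis
    unfolding d_def[symmetric] C_eq[symmetric] g_def[symmetric]
  proof (cases "(\<integral>\<^sup>+x\<in>Q0. ennreal (g x powr p) \<partial>M) = \<infinity>")
    case True
    have top: "ennreal c * \<infinity> = \<infinity>" if "0 < c" for c
      using that by (simp add: ennreal_mult_top)
    have "0 < C * A powr (p * gamma_exp p)" using C A by simp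
    from top[OF this] show "(\<integral>\<^sup>+x\<in>Q0. ennreal ((\<Sum>i\<in>UNIV. osc_sum n 0 x (row i (V x))) powr (p/2)) \<partial>M)
      \<le> ennreal (C * A powr (p * gamma_exp p)) * (\<integral>\<^sup>+x\<in>Q0. ennreal (g x powr p) \<partial>M)"
      unfolding True by (simp only: top_greatest infinity_ennreal_def)
  next
    case finG: False
    obtain S where S: "S \<subseteq> descendants n 0 Q0" "Q0 \<in> S" "sparse S"
      and dom: "\<And>x e. x \<in> Q0 \<Longrightarrow>
        osc_sum n 0 x e \<le> \<Lambda> * (\<Sum>P\<in>{P\<in>S. x \<in> P}. (mass P e / measure M P)\<^sup>2)"
    proof (rule sparse_domination[OF Q0, of n])
      fix S
      assume "S \<subseteq> descendants n 0 Q0" "Q0 \<in> S" "sparse S"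
        "\<And>x e. x \<in> Q0 \<Longrightarrow> osc_sum n 0 x e
          \<le> domination_const (real CARD('d)) B * (\<Sum>P\<in>{P\<in>S. x \<in> P}. (mass P e / measure M P)\<^sup>2)"
      then show thesis unfolding \<Lambda>_def[symmetric] by (rule that)
    qed
    have finS: "finite S" using S(1) finite_descendants[OF Q0] finite_subset by blast
    have SQ: "\<exists>k. P \<in> D k" "P \<subseteq> Q0" if "P \<in> S" for P using S(1) that descendants_D by blast+
    interpret sp: sparse_family M D B S
      by unfold_locales (use finS SQ in auto)
    define ok where "ok Q U U' \<longleftrightarrow> U ** U' = mat 1 \<and> U' ** U = mat 1 \<and>
      (\<forall>i. (\<integral>\<^sup>+y\<in>Q. ennreal (norm (row i U v* Vi y) powr q) \<partial>M) \<le> ennreal (measure M Q)) \<and>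
      (\<forall>i. (\<integral>\<^sup>+x\<in>Q. ennreal (norm (V x *v column i U') powr p) \<partial>M) \<le> ennreal (A * measure M Q))"
      for Q and U U' :: "complex^'d^'d"
    have "\<exists>U U'. ok Q U U'" if "Q \<in> S" for Q
      using SQ(1)[OF that] Ap unfolding factored_Ap_def ok_def q_def by blast
    then obtain U U' where ok: "\<And>Q. Q \<in> S \<Longrightarrow> ok Q (U Q) (U' Q)" by metis
    have UU: "U' Q ** U Q = mat 1"
      and b_int: "\<And>i. (\<integral>\<^sup>+y\<in>Q. ennreal (norm (row i (U Q) v* Vi y) powr q) \<partial>M) \<le> ennreal (measure M Q)"
      and a_int: "\<And>i. (\<integral>\<^sup>+x\<in>Q. ennreal (norm (V x *v column i (U' Q)) powr p) \<partial>M) \<le> ennreal (A * measure M Q)"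
      if "Q \<in> S" for Q
      using ok[OF that] unfolding ok_def by blast+
    have m: "0 < measure M P" "emeasure M P < \<infinity>" if "P \<in> S" for P
      using SQ(1)[OF that] cube_pos cube_finite by blast+
    have core_half: "measure M P / 2 \<le> measure M (sp.core P)" if P: "P \<in> S" for P
    proof -
      have fmP: "P \<in> fmeasurable M" using m[OF P] P by (auto simp: fmeasurable_def)
      have sub: "\<Union>{P'\<in>S. P' \<subset> P} \<subseteq> P" by blast
      have [measurable]: "\<Union>{P'\<in>S. P' \<subset> P} \<in> sets M" using finS by (intro sets.finite_Union) auto
      have "measure M (sp.core P) = measure M P - measure M (\<Union>{P'\<in>S. P' \<subset> P})"
        unfolding sp.core_def using fmP fmeasurableI2[OF fmP sub] sub by (intro measurable_measure_Diff) auto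
      then show ?thesis using S(3) P unfolding sparse_def by fastforce
    qed
    define \<kappa>1 \<kappa>2 where "\<kappa>1 = decay_const d q * A powr (- 1 / (p - 1))" and "\<kappa>2 = decay_const d p / A"
    have \<kappa>: "0 < \<kappa>1" "\<kappa>1 \<le> 1" "0 < \<kappa>2" "\<kappa>2 \<le> 1"
    proof -
      show "0 < \<kappa>1" "0 < \<kappa>2" using dc(1)[OF p] dc(1)[OF q(1)] A by (auto simp: \<kappa>1_def \<kappa>2_def)
      have "A powr (- 1 / (p - 1)) \<le> A powr 0" using A p by (intro powr_mono) auto
      then show "\<kappa>1 \<le> 1" using dc[OF q(1)] A by (auto simp: \<kappa>1_def intro!: mult_le_one)
      show "\<kappa>2 \<le> 1" using dc[OF p] A by (simp add: \<kappa>2_def)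
    qed
    have core_b: "ennreal \<kappa>1 * (\<integral>\<^sup>+y\<in>P. ennreal (norm (u v* Vi y) powr q) \<partial>M)
        \<le> (\<integral>\<^sup>+y\<in>sp.core P. ennreal (norm (u v* Vi y) powr q) \<partial>M)" if P: "P \<in> S" for P u
    proof -
      have "ennreal (1 / (4 * real CARD('d) powr (q + 1) * (4 * real CARD('d) * A) powr (q / p) * 1)) *
          (\<integral>\<^sup>+y\<in>P. ennreal (norm (u v* Vi y) powr q) \<partial>M)
        \<le> (\<integral>\<^sup>+y\<in>sp.core P. ennreal (norm (u v* Vi y) powr q) \<partial>M)"
      proof (rule large_subset_mass[where s = p and
            \<alpha> = "\<lambda>i x. norm (V x *v column i (U' P))" and \<beta> = "\<lambda>i y. norm (row i (U P) v* Vi y)"])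
        show "norm (u v* Vi y) \<le> norm (u v* Vi x) *
            (\<Sum>i\<in>UNIV. norm (V x *v column i (U' P)) * norm (row i (U P) v* Vi y))" for x y
          by (rule row_change_bound[OF UU[OF P] inv])
        show "sp.core P \<subseteq> P" by (auto simp: sp.core_def)
      qed (use p q A P m[OF P] core_half[OF P] a_int[OF P] b_int[OF P] in auto)
      also have "1 / (4 * real CARD('d) powr (q + 1) * (4 * real CARD('d) * A) powr (q / p) * 1) = \<kappa>1"
      proof -
        have "(4 * d * A) powr (q / p) = (4 * d) powr (q - 1) * A powr (1 / (p - 1))"
          unfolding powr_mult q(3)[symmetric] by (simp add: q(4))
        moreover have "A powr (- 1 / (p - 1)) = 1 / A powr (1 / (p - 1))"
          using powr_minus_divide[of A "1 / (p - 1)"] by simp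
        ultimately show ?thesis by (simp add: \<kappa>1_def decay_const_def d_def)
      qed
      finally show ?thesis .
    qed
    have core_a: "ennreal \<kappa>2 * (\<integral>\<^sup>+x\<in>P. ennreal (norm (V x *v \<psi>) powr p) \<partial>M)
        \<le> (\<integral>\<^sup>+x\<in>sp.core P. ennreal (norm (V x *v \<psi>) powr p) \<partial>M)" if P: "P \<in> S" for P \<psi>
    proof -
      have "ennreal (1 / (4 * real CARD('d) powr (p + 1) * (4 * real CARD('d) * 1) powr (p / q) * A)) *
          (\<integral>\<^sup>+x\<in>P. ennreal (norm (V x *v \<psi>) powr p) \<partial>M)
        \<le> (\<integral>\<^sup>+x\<in>sp.core P. ennreal (norm (V x *v \<psi>) powr p) \<partial>M)"
      proof (rule large_subset_mass[where s = q and
            \<alpha> = "\<lambda>i y. norm (row i (U P) v* Vi y)" and \<beta> = "\<lambda>i x. norm (V x *v column i (U' P))"])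
        show "norm (V y *v \<psi>) \<le> norm (V x *v \<psi>) *
            (\<Sum>i\<in>UNIV. norm (row i (U P) v* Vi x) * norm (V y *v column i (U' P)))" for x y
          by (rule column_change_bound[OF UU[OF P] inv(2)])
        show "sp.core P \<subseteq> P" by (auto simp: sp.core_def)
      qed (use p q A P m[OF P] core_half[OF P] a_int[OF P] b_int[OF P] in auto)
      also have "1 / (4 * real CARD('d) powr (p + 1) * (4 * real CARD('d) * 1) powr (p / q) * A) = \<kappa>2"
        by (simp add: \<kappa>2_def decay_const_def d_def q(5))
      finally show ?thesis .
    qed
    define a where "a P i x = norm (V x *v column i (U' P))" for P i x
    define b where "b P i y = norm (row i (U P) v* Vi y)" for P i y
    have ab_meas [measurable]: "a P i \<in> borel_measurable M" "b P i \<in> borel_measurable M" for P i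
      unfolding a_def b_def by measurable
    define T where "T P i = enn2real (\<integral>\<^sup>+y\<in>P. ennreal (b P i y * g y) \<partial>M) / measure M P" for P i
    have T0: "0 \<le> T P i" for P i by (simp add: T_def)
    have bg_fin: "(\<integral>\<^sup>+y\<in>P. ennreal (b P i y * g y) \<partial>M) < \<infinity>" if P: "P \<in> S" for P i
    proof -
      define G where "G = enn2real (\<integral>\<^sup>+x\<in>Q0. ennreal (g x powr p) \<partial>M)"
      have "(\<integral>\<^sup>+y. ennreal ((indicator P y * b P i y) * (indicator P y * g y)) \<partial>M)
          \<le> ennreal (measure M P powr (1/q) * G powr (1/p))"
      proof (rule nn_integral_Hoelder[OF p q(1,2)])
        have "(\<integral>\<^sup>+y. ennreal ((indicator P y * b P i y) powr q) \<partial>M) = (\<integral>\<^sup>+y\<in>P. ennreal (b P i y powr q) \<partial>M)"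
          using q(1) by (intro nn_integral_cong) (auto simp: indicator_def)
        then show "(\<integral>\<^sup>+y. ennreal ((indicator P y * b P i y) powr q) \<partial>M) \<le> ennreal (measure M P)"
          using b_int[OF P] by (simp add: b_def)
        have "(\<integral>\<^sup>+y. ennreal ((indicator P y * g y) powr p) \<partial>M) \<le> (\<integral>\<^sup>+y\<in>Q0. ennreal (g y powr p) \<partial>M)"
          using p SQ(2)[OF P] by (intro nn_integral_mono) (auto simp: indicator_def)
        also have "\<dots> = ennreal G" using finG by (simp add: G_def top.not_eq_extremum)
        finally show "(\<integral>\<^sup>+y. ennreal ((indicator P y * g y) powr p) \<partial>M) \<le> ennreal G" .
      qed (use P g0 in \<open>auto simp: G_def b_def\<close>)
      moreover have "(\<integral>\<^sup>+y. ennreal ((indicator P y * b P i y) * (indicator P y * g y)) \<partial>M)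
          = (\<integral>\<^sup>+y\<in>P. ennreal (b P i y * g y) \<partial>M)"
        by (intro nn_integral_cong) (auto simp: indicator_def)
      ultimately show ?thesis by (simp add: le_less_trans)
    qed
    have T_eq: "(\<integral>\<^sup>+y\<in>P. ennreal (b P i y * g y) \<partial>M) = ennreal (measure M P * T P i)" if P: "P \<in> S" for P i
      using bg_fin[OF P, of i] m(1)[OF P] by (simp add: T_def)
    have mass_le: "mass P (row k (V x)) / measure M P \<le> (\<Sum>i\<in>UNIV. a P i x * T P i)" if P: "P \<in> S" for P k x
    proof -
      obtain j where j: "P \<in> D j" using SQ(1)[OF P] by blast
      have [measurable]: "P \<in> sets M" using P by auto
      define e where "e = row k (V x)"
      have pt: "L2_set (\<lambda>\<kappa>. norm (pairing e (F \<kappa> y))) K \<le> (\<Sum>i\<in>UNIV. a P i x * (b P i y * g y))" for y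
      proof -
        have e: "pairing e (F \<kappa> y) = pairing (e v* Vi y) (V y *v F \<kappa> y)" for \<kappa>
          by (simp only: pairing_vector_matrix matrix_vector_mul_assoc inv matrix_vector_mul_lid)
        have "L2_set (\<lambda>\<kappa>. norm (pairing e (F \<kappa> y))) K \<le> L2_set (\<lambda>\<kappa>. norm (e v* Vi y) * norm (V y *v F \<kappa> y)) K"
          unfolding e by (intro L2_set_mono norm_pairing_le) auto
        also have "\<dots> = norm (e v* Vi y) * g y"
          unfolding g_def by (simp add: L2_set_def power_mult_distrib sum_distrib_left[symmetric] real_sqrt_mult)
        also have "norm (e v* Vi y) = norm ((axis k 1 v* V x) v* Vi y)"
          by (simp only: vector_matrix_axis e_def)
        also have "\<dots> * g y \<le> (norm (axis k (1::complex)) * (\<Sum>i\<in>UNIV. a P i x * b P i y)) * g y"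
          unfolding a_def b_def by (intro mult_right_mono factored_product_bound UU P g0)
        also have "\<dots> = (\<Sum>i\<in>UNIV. a P i x * (b P i y * g y))"
          by (simp add: sum_distrib_right mult.assoc)
        finally show ?thesis .
      qed
      have "ennreal (mass P e) = (\<integral>\<^sup>+y. ennreal (indicator P y *\<^sub>R L2_set (\<lambda>\<kappa>. norm (pairing e (F \<kappa> y))) K) \<partial>M)"
        unfolding mass_def set_lebesgue_integral_def
        by (rule nn_integral_eq_integral[symmetric])
          (use L2_integrable[OF j, of e] in \<open>auto simp: set_integrable_def\<close>)
      also have "\<dots> \<le> (\<integral>\<^sup>+y. (\<Sum>i\<in>UNIV. ennreal (a P i x) * (ennreal (b P i y * g y) * indicator P y)) \<partial>M)"
      proof (rule nn_integral_mono)
        fix y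
        have "ennreal (L2_set (\<lambda>\<kappa>. norm (pairing e (F \<kappa> y))) K) \<le> ennreal (\<Sum>i\<in>UNIV. a P i x * (b P i y * g y))"
          by (intro ennreal_leI pt)
        also have "\<dots> = (\<Sum>i\<in>UNIV. ennreal (a P i x) * ennreal (b P i y * g y))"
          using g0 by (subst sum_ennreal[symmetric]) (auto simp: ennreal_mult a_def b_def)
        finally show "ennreal (indicator P y *\<^sub>R L2_set (\<lambda>\<kappa>. norm (pairing e (F \<kappa> y))) K)
            \<le> (\<Sum>i\<in>UNIV. ennreal (a P i x) * (ennreal (b P i y * g y) * indicator P y))"
          by (cases "y \<in> P") auto
      qed
      also have "\<dots> = (\<Sum>i\<in>UNIV. ennreal (a P i x) * (\<integral>\<^sup>+y\<in>P. ennreal (b P i y * g y) \<partial>M))"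
        by (subst nn_integral_sum) (auto simp: nn_integral_cmult)
      also have "\<dots> = (\<Sum>i\<in>UNIV. ennreal (a P i x * (measure M P * T P i)))"
        unfolding T_eq[OF P] using T0 by (intro sum.cong refl) (simp add: ennreal_mult a_def)
      also have "\<dots> = ennreal (\<Sum>i\<in>UNIV. a P i x * (measure M P * T P i))"
        using T0 by (intro sum_ennreal) (auto simp: a_def)
      finally have "mass P e \<le> (\<Sum>i\<in>UNIV. a P i x * (measure M P * T P i))"
        using T0 by (subst (asm) ennreal_le_iff) (auto intro!: sum_nonneg simp: a_def)
      also have "\<dots> = measure M P * (\<Sum>i\<in>UNIV. a P i x * T P i)"
        by (simp add: sum_distrib_left mult_ac)
      finally show ?thesis using m(1)[OF P] by (simp add: e_def field_simps)
    qed
    define Z where "Z x = (\<Sum>P\<in>{P\<in>S. x \<in> P}. (\<Sum>i\<in>UNIV. a P i x * T P i)\<^sup>2)" for x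
    have Z0: "0 \<le> Z x" for x by (auto simp: Z_def intro!: sum_nonneg)
    have sq: "(\<Sum>k\<in>UNIV. osc_sum n 0 x (row k (V x))) \<le> d * \<Lambda> * Z x" if x: "x \<in> Q0" for x
    proof -
      have "(\<Sum>k\<in>UNIV. osc_sum n 0 x (row k (V x))) \<le> (\<Sum>k\<in>(UNIV::'d set). \<Lambda> * Z x)"
      proof (rule sum_mono)
        fix k :: 'd
        have "osc_sum n 0 x (row k (V x)) \<le> \<Lambda> * (\<Sum>P\<in>{P\<in>S. x \<in> P}. (mass P (row k (V x)) / measure M P)\<^sup>2)"
          by (rule dom[OF x])
        also have "\<dots> \<le> \<Lambda> * Z x"
          unfolding Z_def using \<Lambda> mass_le mass_nonneg
          by (intro mult_left_mono sum_mono power_mono divide_nonneg_nonneg) auto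
        finally show "osc_sum n 0 x (row k (V x)) \<le> \<Lambda> * Z x" .
      qed
      then show ?thesis by (simp add: d_def mult.assoc)
    qed
    have "(\<integral>\<^sup>+x\<in>Q0. ennreal ((\<Sum>i\<in>UNIV. osc_sum n 0 x (row i (V x))) powr (p/2)) \<partial>M)
        \<le> (\<integral>\<^sup>+x. ennreal ((d * \<Lambda>) powr (p/2)) * ennreal (Z x powr (p/2)) \<partial>M)"
    proof (rule nn_integral_mono)
      fix x
      show "ennreal ((\<Sum>i\<in>UNIV. osc_sum n 0 x (row i (V x))) powr (p/2)) * indicator Q0 x
          \<le> ennreal ((d * \<Lambda>) powr (p/2)) * ennreal (Z x powr (p/2))"
      proof (cases "x \<in> Q0")
        case True
        have "(\<Sum>i\<in>UNIV. osc_sum n 0 x (row i (V x))) powr (p/2) \<le> (d * \<Lambda> * Z x) powr (p/2)"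
          using sq[OF True] p osc_nonneg by (intro powr_mono2) (auto intro!: sum_nonneg)
        also have "\<dots> = (d * \<Lambda>) powr (p/2) * Z x powr (p/2)" by (rule powr_mult)
        finally have "ennreal ((\<Sum>i\<in>UNIV. osc_sum n 0 x (row i (V x))) powr (p/2))
            \<le> ennreal ((d * \<Lambda>) powr (p/2) * Z x powr (p/2))" by (rule ennreal_leI)
        then show ?thesis using True by (simp add: ennreal_mult)
      qed simp
    qed
    also have "\<dots> = ennreal ((d * \<Lambda>) powr (p/2)) * (\<integral>\<^sup>+x. ennreal (Z x powr (p/2)) \<partial>M)"
    proof (rule nn_integral_cmult)
      have eq: "Z = (\<lambda>x. \<Sum>P\<in>S. indicator P x * (\<Sum>i\<in>UNIV. a P i x * T P i)\<^sup>2)"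
      proof
        fix x
        show "Z x = (\<Sum>P\<in>S. indicator P x * (\<Sum>i\<in>UNIV. a P i x * T P i)\<^sup>2)"
          unfolding Z_def sum.inter_filter[OF finS] by (intro sum.cong refl) (auto simp: indicator_def)
      qed
      have [measurable]: "Z \<in> borel_measurable M" unfolding eq by measurable
      show "(\<lambda>x. ennreal (Z x powr (p/2))) \<in> borel_measurable M" by measurable
    qed
    also have "(\<integral>\<^sup>+x. ennreal (Z x powr (p/2)) \<partial>M)
        \<le> ennreal (Ca * A powr (p * gamma_exp p - 1 / (p - 1))) * (\<Sum>i\<in>UNIV. \<Sum>P\<in>S. ennreal (measure M P * T P i powr p))"
    proof (cases "p \<le> 2")
      case True
      have "(\<integral>\<^sup>+x. ennreal (Z x powr (p/2)) \<partial>M)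
        \<le> ennreal (real CARD('d) powr p * A) * (\<Sum>i\<in>UNIV. \<Sum>P\<in>S. ennreal (measure M P * T P i powr p))"
        unfolding Z_def
        by (rule sp.sparse_sum_small_exponent[OF p True])
          (use A T0 a_int in \<open>auto simp: a_def\<close>)
      moreover have "real CARD('d) powr p * A = Ca * A powr (p * gamma_exp p - 1 / (p - 1))"
        using True A by (simp add: gamma_exp_cases(1)[OF p True] Ca_def d_def)
      ultimately show ?thesis by simp
    next
      case False
      have "(\<integral>\<^sup>+x. ennreal (Z x powr (p/2)) \<partial>M)
        \<le> ennreal (real CARD('d) powr p * (2 * A) * ((2 * p - 3) / \<kappa>2) powr (p/2 - 1))
          * (\<Sum>i\<in>UNIV. \<Sum>P\<in>S. ennreal (measure M P * T P i powr p))"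
        unfolding Z_def
        by (rule sp.sparse_sum_large_exponent)
          (use False A T0 a_int core_a \<kappa> in \<open>auto simp: a_def\<close>)
      moreover have "real CARD('d) powr p * (2 * A) * ((2 * p - 3) / \<kappa>2) powr (p/2 - 1)
          = Ca * A powr (p * gamma_exp p - 1 / (p - 1))"
      proof -
        have "p * gamma_exp p - 1 / (p - 1) = 1 + (p/2 - 1)" using gamma_exp_cases(2)[OF p] False by simp
        then have "A powr (p * gamma_exp p - 1 / (p - 1)) = A * A powr (p/2 - 1)"
          using A by (simp only: powr_add) simp
        moreover have "(2 * p - 3) / \<kappa>2 = (2 * p - 3) / decay_const d p * A" by (simp add: \<kappa>2_def)
        then have "((2 * p - 3) / \<kappa>2) powr (p/2 - 1) = ((2 * p - 3) / decay_const d p) powr (p/2 - 1) * A powr (p/2 - 1)"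
          by (simp only: powr_mult)
        ultimately show ?thesis using False by (simp add: Ca_def d_def mult_ac)
      qed
      ultimately show ?thesis by simp
    qed
    also have "(\<Sum>i\<in>UNIV. \<Sum>P\<in>S. ennreal (measure M P * T P i powr p))
        \<le> (\<Sum>i\<in>(UNIV::'d set). ennreal (Cb * A powr (1 / (p - 1))) * (\<integral>\<^sup>+y\<in>Q0. ennreal (g y powr p) \<partial>M))"
    proof (rule sum_mono)
      fix i :: 'd
      have "(\<Sum>P\<in>S. ennreal (measure M P * T P i powr p))
          \<le> ennreal (2 powr (p - 1) * ((3 + p) / ((p - 1) * \<kappa>1))) * (\<integral>\<^sup>+y\<in>\<Union>S. ennreal (g y powr p) \<partial>M)"
        by (rule sp.carleson_sum[where b = "\<lambda>P. b P i" and q = q])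
          (use p \<kappa> g0 T0 b_int core_b T_eq in \<open>auto simp: b_def q_def conj_exp_def\<close>)
      also have "2 powr (p - 1) * ((3 + p) / ((p - 1) * \<kappa>1)) = Cb * A powr (1 / (p - 1))"
        using powr_minus_divide[of A "1 / (p - 1)"] by (simp add: Cb_def \<kappa>1_def)
      also have "\<Union>S = Q0" using S(2) SQ(2) by blast
      finally show "(\<Sum>P\<in>S. ennreal (measure M P * T P i powr p))
          \<le> ennreal (Cb * A powr (1 / (p - 1))) * (\<integral>\<^sup>+y\<in>Q0. ennreal (g y powr p) \<partial>M)" .
    qed
    also have "\<dots> = ennreal (d * (Cb * A powr (1 / (p - 1)))) * (\<integral>\<^sup>+y\<in>Q0. ennreal (g y powr p) \<partial>M)"
      using C0 by (simp add: d_def ennreal_mult mult.assoc ennreal_of_nat_eq_real_of_nat)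
    finally have "(\<integral>\<^sup>+x\<in>Q0. ennreal ((\<Sum>i\<in>UNIV. osc_sum n 0 x (row i (V x))) powr (p/2)) \<partial>M)
        \<le> ennreal ((d * \<Lambda>) powr (p/2)) * (ennreal (Ca * A powr (p * gamma_exp p - 1 / (p - 1))) *
          (ennreal (d * (Cb * A powr (1 / (p - 1)))) * (\<integral>\<^sup>+y\<in>Q0. ennreal (g y powr p) \<partial>M)))"
      by (simp add: mult_left_mono)
    also have "\<dots> = ennreal (C * A powr (p * gamma_exp p)) * (\<integral>\<^sup>+y\<in>Q0. ennreal (g y powr p) \<partial>M)"
    proof -
      have "A powr (p * gamma_exp p) = A powr (p * gamma_exp p - 1 / (p - 1)) * A powr (1 / (p - 1))"
        by (simp add: powr_add[symmetric])
      then have "C * A powr (p * gamma_exp p) = (d * \<Lambda>) powr (p/2) *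
          (Ca * A powr (p * gamma_exp p - 1 / (p - 1)) * (d * (Cb * A powr (1 / (p - 1)))))"
        by (simp only: C_def mult_ac)
      then show ?thesis
        using C0 d by (simp add: ennreal_mult mult.assoc)
    qed
    finally show "(\<integral>\<^sup>+x\<in>Q0. ennreal ((\<Sum>i\<in>UNIV. osc_sum n 0 x (row i (V x))) powr (p/2)) \<partial>M)
      \<le> ennreal (C * A powr (p * gamma_exp p)) * (\<integral>\<^sup>+x\<in>Q0. ennreal (g x powr p) \<partial>M)" .
  qed
qed

end

section \<open>Powers of positive definite matrices\<close>

text \<open>
  The Hermitian inner product, conjugate linear in the first argument.
\<close>

abbreviation cip :: "complex^'d \<Rightarrow> complex^'d \<Rightarrow> complex"
  where "cip v w \<equiv> pairing (conj_vec v) w"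

lemma conj_vec_linear: "conj_vec (v + w) = conj_vec v + conj_vec w" "conj_vec (c *s v) = cnj c *s conj_vec v"
  "conj_vec (v - w) = conj_vec v - conj_vec w"
  by (simp_all add: conj_vec_def vec_eq_iff)

lemma cip_commute: "cip w v = cnj (cip v w)"
  by (simp add: pairing_def conj_vec_def mult.commute)

lemma cip_hermitian:
  assumes "cadjoint A = A" shows "cip (A *v v) w = cip v (A *v w)"
proof -
  have "cnj (A $ i $ j) = A $ j $ i" for i j
  proof -
    have "cadjoint A $ j $ i = A $ j $ i" by (simp only: assms)
    then show ?thesis by (simp add: cadjoint_def)
  qed
  then have "conj_vec (A *v v) = conj_vec v v* A"
    by (simp add: vec_eq_iff conj_vec_def matrix_vector_mult_def vector_matrix_mult_def mult.commute)
  then show ?thesis by (simp add: pairing_vector_matrix)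
qed

lemma posdef_cip: "posdef A \<longleftrightarrow> cadjoint A = A \<and> (\<forall>v. v \<noteq> 0 \<longrightarrow> 0 < Re (cip v (A *v v)))"
  by (simp add: posdef_def pairing_def conj_vec_def)

lemma continuous_cip_form: "continuous_on S (\<lambda>v. Re (cip v ((A::complex^'d^'d) *v v)))"
proof -
  have "Re (cip v (A *v v)) = Re (\<Sum>i\<in>UNIV. cnj (v $ i) * (\<Sum>j\<in>UNIV. A $ i $ j * v $ j))" for v
    by (simp add: pairing_def conj_vec_def matrix_vector_mult_def)
  then show ?thesis by (simp only:) (intro continuous_intros)
qed

lemma continuous_cip: "continuous_on S (\<lambda>v. cip u v)"
  unfolding pairing_def by (intro continuous_intros)

text \<open>
  An extremal point of the quadratic form on the unit sphere of the orthogonal complement of the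
  eigenvectors found so far is a further eigenvector.
\<close>

lemma eigenvector_step:
  fixes A :: "complex^'d^'d" and v :: "'d \<Rightarrow> complex^'d"
  assumes herm: "cadjoint A = A" and I: "I \<noteq> UNIV"
    and eig: "\<And>i. i \<in> I \<Longrightarrow> A *v v i = of_real (l i) *s v i"
  obtains w \<mu> where "norm w = 1" "\<And>i. i \<in> I \<Longrightarrow> cip (v i) w = 0" "A *v w = of_real \<mu> *s w"
proof -
  define W where "W = {w. \<forall>i\<in>I. cip (v i) w = 0}"
  have W_lin: "w + w' \<in> W" "c *s w \<in> W" if "w \<in> W" "w' \<in> W" for w w' c
    using that by (auto simp: W_def pairing_linear)
  have AW: "A *v w \<in> W" if "w \<in> W" for w
  proof -
    have "cip (v i) (A *v w) = 0" if i: "i \<in> I" for i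
      using \<open>w \<in> W\<close> i by (simp add: cip_hermitian[OF herm, symmetric] eig conj_vec_linear pairing_linear W_def)
    then show ?thesis by (simp add: W_def)
  qed
  obtain i0 where i0: "i0 \<notin> I" using I by blast
  define N :: "complex^'d^'d" where "N = (\<chi> i. if i \<in> I then conj_vec (v i) else 0)"
  have "row i0 N = 0" using i0 by (simp add: N_def row_def vec_eq_iff)
  then have "det N = 0" by (rule det_zero_row)
  then have "\<not> (\<exists>B. B ** N = mat 1)"
    using invertible_det_nz[of N] by (auto simp: invertible_left_inverse)
  then obtain w1 where w1: "w1 \<noteq> 0" "N *v w1 = 0"
    using matrix_left_invertible_ker[of N] by blast
  have "w1 \<in> W"
  proof -
    have "cip (v i) w1 = (N *v w1) $ i" if "i \<in> I" for i
      using that by (simp add: N_def matrix_vector_mult_def pairing_def)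
    then show ?thesis using w1 by (simp add: W_def)
  qed
  define w2 where "w2 = of_real (1 / norm w1) *s w1"
  have w2: "w2 \<in> W" "norm w2 = 1"
    using W_lin(2)[OF \<open>w1 \<in> W\<close> \<open>w1 \<in> W\<close>] w1 by (auto simp: w2_def norm_smult_vec norm_divide)
  define q where "q w = Re (cip w (A *v w))" for w
  have "W = (\<Inter>i\<in>I. {w. cip (v i) w = 0})" by (auto simp: W_def)
  then have "closed W"
    by (simp only:) (intro closed_INT ballI closed_Collect_eq continuous_cip continuous_intros)
  then have "compact (W \<inter> sphere 0 1)" by (intro closed_Int_compact) auto
  moreover have "W \<inter> sphere 0 1 \<noteq> {}" using w2 by auto
  moreover have "continuous_on (W \<inter> sphere 0 1) q" unfolding q_def by (rule continuous_cip_form)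
  ultimately obtain w where w': "w \<in> W \<inter> sphere 0 1" "\<forall>u\<in>W \<inter> sphere 0 1. q u \<le> q w"
    using continuous_attains_sup by blast
  then have w: "w \<in> W" "norm w = 1" and max: "\<And>u. u \<in> W \<Longrightarrow> norm u = 1 \<Longrightarrow> q u \<le> q w"
    by auto
  define \<mu> where "\<mu> = q w"
  have q_le: "q u \<le> \<mu> * (norm u)\<^sup>2" if "u \<in> W" for u
  proof (cases "u = 0")
    case True
    then show ?thesis by (simp add: q_def pairing_linear)
  next
    case False
    define u' where "u' = of_real (1 / norm u) *s u"
    have "q u' \<le> \<mu>" unfolding \<mu>_def
      using W_lin(2)[OF that that] False by (intro max) (auto simp: u'_def norm_smult_vec norm_divide)
    moreover have "q u' = q u / (norm u)\<^sup>2"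
      by (simp add: q_def u'_def conj_vec_linear pairing_linear matrix_vector_mult_scaleR vec.scale
          power2_eq_square Re_divide_of_real flip: of_real_mult)
    ultimately show ?thesis using False by (simp add: field_simps)
  qed
  define r where "r = A *v w - of_real \<mu> *s w"
  have rW: "r \<in> W" using AW[OF w(1)] w(1) by (auto simp: r_def W_def pairing_linear)
  define c where "c = \<mu> * (norm r)\<^sup>2 - q r"
  have quad: "2 * (norm r)\<^sup>2 \<le> t * c" if t: "0 < t" for t :: real
  proof -
    define u where "u = w + of_real t *s r"
    have uW: "u \<in> W" using W_lin(1)[OF w(1) W_lin(2)[OF rW rW]] by (simp add: u_def)
    have "cip w (A *v r) = cnj (cip r (A *v w))"
      using cip_hermitian[OF herm, of w r] cip_commute[of "A *v w" r] by simp
    then have qu: "q u = q w + 2 * t * Re (cip r (A *v w)) + t\<^sup>2 * q r"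
      by (simp add: q_def u_def conj_vec_linear pairing_linear matrix_vector_right_distrib vec.scale
          power2_eq_square algebra_simps)
    have "(norm u)\<^sup>2 = Re (cip u u)" by (simp add: pairing_conj_vec)
    also have "\<dots> = Re (cip w w) + 2 * t * Re (cip r w) + t\<^sup>2 * Re (cip r r)"
      using cip_commute[of w r]
      by (simp add: u_def conj_vec_linear pairing_linear power2_eq_square algebra_simps)
    finally have nu: "(norm u)\<^sup>2 = 1 + 2 * t * Re (cip r w) + t\<^sup>2 * (norm r)\<^sup>2"
      by (simp add: pairing_conj_vec w)
    have "cip r r = cip r (A *v w) - of_real \<mu> * cip r w"
      by (subst (2) r_def) (simp add: pairing_linear)
    then have rr: "(norm r)\<^sup>2 = Re (cip r (A *v w)) - \<mu> * Re (cip r w)"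
    proof -
      have "Re (of_real ((norm r)\<^sup>2)) = Re (cip r (A *v w) - of_real \<mu> * cip r w)"
        using \<open>cip r r = cip r (A *v w) - of_real \<mu> * cip r w\<close> unfolding pairing_conj_vec by (rule arg_cong)
      then show ?thesis by simp
    qed
    from q_le[OF uW] have "2 * t * (norm r)\<^sup>2 \<le> t\<^sup>2 * c"
      unfolding qu nu by (simp add: \<mu>_def[symmetric] rr c_def algebra_simps)
    then have "t * (2 * (norm r)\<^sup>2) \<le> t * (t * c)" by (simp add: power2_eq_square mult_ac)
    then show ?thesis using t by simp
  qed
  have "2 * (norm r)\<^sup>2 \<le> 0"
  proof (rule tendsto_lowerbound[where F = "at_right (0::real)"])
    show "((\<lambda>t. t * c) \<longlongrightarrow> 0) (at_right 0)" by (auto intro!: tendsto_eq_intros)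
    show "\<forall>\<^sub>F t in at_right 0. 2 * (norm r)\<^sup>2 \<le> t * c"
      using quad by (simp add: eventually_at_filter)
  qed simp
  then have "r = 0" by simp
  then have "A *v w = of_real \<mu> *s w" by (simp add: r_def)
  then show ?thesis using that[of w \<mu>] w unfolding W_def by blast
qed

lemma spectral_posdef:
  fixes A :: "complex^'d^'d"
  assumes "posdef A"
  obtains U l where "unitary_mat U" "\<And>i. 0 < l i" "A = U ** rdiag l ** cadjoint U"
proof -
  have herm: "cadjoint A = A" and pos: "\<And>v. v \<noteq> 0 \<Longrightarrow> 0 < Re (cip v (A *v v))"
    using assms by (auto simp: posdef_cip)
  have "\<exists>(v :: 'd \<Rightarrow> complex^'d) (l :: 'd \<Rightarrow> real). (\<forall>i\<in>I. \<forall>j\<in>I. cip (v i) (v j) = (if i = j then 1 else 0)) \<and> (\<forall>i\<in>I. A *v v i = of_real (l i) *s v i)"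
    for I :: "'d set"
  proof (induction I rule: finite_induct[OF finite])
    case (2 i I)
    then obtain v l where v: "\<And>i j. i \<in> I \<Longrightarrow> j \<in> I \<Longrightarrow> cip (v i) (v j) = (if i = j then 1 else 0)"
      "\<And>i. i \<in> I \<Longrightarrow> A *v v i = of_real (l i) *s v i" by blast
    have "I \<noteq> UNIV" using 2 by blast
    obtain w \<mu> where w: "norm w = 1" "\<And>i. i \<in> I \<Longrightarrow> cip (v i) w = 0" "A *v w = of_real \<mu> *s w"
      by (rule eigenvector_step[OF herm \<open>I \<noteq> UNIV\<close>, of v l]) (use v(2) that in auto)
    have w': "cip w w = 1" "\<And>i. i \<in> I \<Longrightarrow> cip w (v i) = 0"
      using w cip_commute[of w] by (auto simp: pairing_conj_vec)
    have "\<forall>j\<in>insert i I. \<forall>k\<in>insert i I. cip ((v(i := w)) j) ((v(i := w)) k) = (if j = k then 1 else 0)"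
      using v(1) w(2) w' 2(2) by auto
    moreover have "\<forall>j\<in>insert i I. A *v (v(i := w)) j = of_real ((l(i := \<mu>)) j) *s (v(i := w)) j"
      using v(2) w(3) 2(2) by auto
    ultimately show ?case by blast
  qed auto
  from this[of UNIV] obtain v :: "'d \<Rightarrow> complex^'d" and l :: "'d \<Rightarrow> real" where on: "\<And>i j. cip (v i) (v j) = (if i = j then 1 else 0)"
    and eig: "\<And>i. A *v v i = of_real (l i) *s v i" by blast
  define U :: "complex^'d^'d" where "U = (\<chi> i j. v j $ i)"
  have "(cadjoint U ** U) $ i $ j = cip (v i) (v j)" for i j
    by (simp add: matrix_matrix_mult_def cadjoint_def U_def pairing_def conj_vec_def)
  then have left: "cadjoint U ** U = mat 1" by (simp add: vec_eq_iff mat_def on)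
  then have right: "U ** cadjoint U = mat 1" by (rule matrix_left_right_inverse1)
  have "A ** U = U ** rdiag l"
  proof -
    have "(A ** U) $ i $ j = (A *v v j) $ i" for i j
      by (simp add: matrix_matrix_mult_def matrix_vector_mult_def U_def)
    moreover have "(U ** rdiag l) $ i $ j = v j $ i * of_real (l j)" for i j
      by (simp add: matrix_matrix_mult_def rdiag_def U_def if_distrib cong: if_cong)
    ultimately show ?thesis by (simp add: vec_eq_iff eig mult.commute)
  qed
  then have "A ** (U ** cadjoint U) = U ** rdiag l ** cadjoint U" by (simp add: matrix_mul_assoc)
  then have A_eq: "A = U ** rdiag l ** cadjoint U" by (simp add: right)
  have l: "0 < l i" for i
  proof -
    have "v i \<noteq> 0" using on[of i i] by (auto simp: pairing_linear)
    from pos[OF this] show ?thesis by (simp add: eig pairing_linear on)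
  qed
  have "unitary_mat U" using left right by (simp add: unitary_mat_def)
  from that[OF this l A_eq] show ?thesis .
qed

lemma mat_powr_inverse:
  assumes "posdef A"
  shows "mat_powr A s ** mat_powr A (- s) = mat 1"
proof -
  obtain U l where U: "unitary_mat U" "\<And>i. 0 < l i" "A = U ** rdiag l ** cadjoint U"
    using spectral_posdef[OF assms] by blast
  have uu: "cadjoint U ** U = mat 1" "U ** cadjoint U = mat 1" using U(1) by (auto simp: unitary_mat_def)
  have ne: "l i \<noteq> 0" for i using U(2)[of i] by simp
  have "rdiag (\<lambda>i. l i powr s) ** rdiag (\<lambda>i. l i powr - s) = (mat 1 :: complex^'a^'a)"
  proof -
    have "l i powr s * l i powr - s = 1" for i using ne by (simp add: powr_add[symmetric])
    moreover have "(rdiag f ** rdiag g) $ i $ j = (rdiag f $ i $ j :: complex) * of_real (g j)"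
      for f g :: "'a \<Rightarrow> real" and i j
      by (simp add: matrix_matrix_mult_def rdiag_def[of g] if_distrib cong: if_cong)
    ultimately show ?thesis
      by (simp add: vec_eq_iff rdiag_def mat_def of_real_mult[symmetric] del: of_real_mult)
  qed
  then have "rdiag (\<lambda>i. l i powr s) ** (cadjoint U ** U) ** rdiag (\<lambda>i. l i powr - s) = (mat 1 :: complex^'a^'a)"
    by (simp add: uu)
  then have "U ** (rdiag (\<lambda>i. l i powr s) ** (cadjoint U ** U) ** rdiag (\<lambda>i. l i powr - s)) ** cadjoint U = mat 1"
    by (simp add: uu)
  then show ?thesis
    unfolding U(3) mat_powr_eq[OF U(1,2)] by (simp add: matrix_mul_assoc)
qed

lemma tendsto_matrix_mult:
  fixes X Y :: "'n \<Rightarrow> complex^'d^'d"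
  assumes "(X \<longlongrightarrow> A) F" "(Y \<longlongrightarrow> B) F"
  shows "((\<lambda>n. X n ** Y n) \<longlongrightarrow> A ** B) F"
  unfolding matrix_matrix_mult_def
  by (intro vec_tendstoI) (simp, intro tendsto_intros tendsto_vec_nth assms)

lemma tendsto_cadjoint:
  fixes X :: "'n \<Rightarrow> complex^'d^'d"
  assumes "(X \<longlongrightarrow> A) F" shows "((\<lambda>n. cadjoint (X n)) \<longlongrightarrow> cadjoint A) F"
  unfolding cadjoint_def
  by (intro vec_tendstoI) (simp, intro tendsto_intros tendsto_vec_nth assms)

lemma compact_unitary: "compact {U::complex^'d^'d. unitary_mat U}"
proof (rule compact_eq_bounded_closed[THEN iffD2], rule conjI)
  show "bounded {U::complex^'d^'d. unitary_mat U}"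
  proof (rule boundedI)
    fix U :: "complex^'d^'d" assume "U \<in> {U. unitary_mat U}"
    then have u: "(cadjoint U ** U) $ j $ j = 1" for j by (simp add: unitary_mat_def mat_def)
    have entry: "norm (U $ i $ j) \<le> 1" for i j
    proof -
      have "complex_of_real (\<Sum>i\<in>UNIV. (norm (U $ i $ j))\<^sup>2) = 1"
        using u[of j] by (simp add: matrix_matrix_mult_def cadjoint_def complex_norm_square mult.commute del: of_real_power)
      then have "(\<Sum>i\<in>UNIV. (norm (U $ i $ j))\<^sup>2) = 1" using of_real_eq_1_iff by blast
      moreover have "(norm (U $ i $ j))\<^sup>2 \<le> (\<Sum>i\<in>UNIV. (norm (U $ i $ j))\<^sup>2)" by (rule member_le_sum) auto
      ultimately show ?thesis by (simp add: power2_le_iff_abs_le abs_le_square_iff power_le_one_iff)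
    qed
    have "norm U \<le> (\<Sum>i\<in>UNIV. norm (U $ i))" unfolding norm_vec_def by (rule L2_set_le_sum) simp
    also have "\<dots> \<le> (\<Sum>i\<in>UNIV. \<Sum>j\<in>UNIV. norm (U $ i $ j))"
      unfolding norm_vec_def by (intro sum_mono L2_set_le_sum) simp
    also have "\<dots> \<le> (\<Sum>i\<in>(UNIV::'d set). \<Sum>j\<in>(UNIV::'d set). 1)" by (intro sum_mono entry)
    finally show "norm U \<le> (\<Sum>i\<in>(UNIV::'d set). \<Sum>j\<in>(UNIV::'d set). 1)" .
  qed
  show "closed {U::complex^'d^'d. unitary_mat U}"
    unfolding closed_sequential_limits
  proof (intro allI impI, elim conjE)
    fix X :: "nat \<Rightarrow> complex^'d^'d" and A assume X: "\<forall>n. X n \<in> {U. unitary_mat U}" "X \<longlonglongrightarrow> A"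
    have "(\<lambda>n. cadjoint (X n) ** X n) \<longlonglongrightarrow> cadjoint A ** A" "(\<lambda>n. X n ** cadjoint (X n)) \<longlonglongrightarrow> A ** cadjoint A"
      by (intro tendsto_matrix_mult tendsto_cadjoint X(2))+
    moreover have "cadjoint (X n) ** X n = mat 1" "X n ** cadjoint (X n) = mat 1" for n
      using X(1) by (auto simp: unitary_mat_def)
    ultimately show "A \<in> {U. unitary_mat U}"
      by (simp add: unitary_mat_def LIMSEQ_const_iff)
  qed
qed

lemma rdiag_entry: "rdiag l $ i $ i = of_real (l i)" by (simp add: rdiag_def)

text \<open>
  Spectral decompositions are not continuous, but they live in a compact set: along a subsequence
  the unitary factors converge, the eigenvalues then follow, and the limit is a decomposition of the
  limit matrix. Since \<open>mat_powr\<close> does not depend on the decomposition, the limit is the right one.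
\<close>

lemma continuous_mat_powr: "continuous_on {A. posdef A} (\<lambda>A. mat_powr A s)"
proof (rule continuous_on_sequentiallyI)
  fix X :: "nat \<Rightarrow> complex^'d^'d" and A assume X: "\<forall>n. X n \<in> {A. posdef A}" and A: "A \<in> {A. posdef A}"
    and lim: "X \<longlonglongrightarrow> A"
  have sub: "\<exists>r. strict_mono r \<and> (\<lambda>n. mat_powr (Y (r n)) s) \<longlonglongrightarrow> mat_powr A s"
    if Y: "\<And>n. posdef (Y n)" "Y \<longlonglongrightarrow> A" for Y
  proof -
    have "\<exists>U l. unitary_mat U \<and> (\<forall>i. 0 < l i) \<and> Y n = U ** rdiag l ** cadjoint U" for n
      using spectral_posdef[OF Y(1)[of n]] by metis
    then obtain U l where Ul: "\<And>n. unitary_mat (U n)" "\<And>n i. 0 < l n i"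
      "\<And>n. Y n = U n ** rdiag (l n) ** cadjoint (U n)" by metis
    obtain V r where r: "V \<in> {U. unitary_mat U}" "strict_mono (r :: nat \<Rightarrow> nat)" "(U \<circ> r) \<longlonglongrightarrow> V"
      using compact_unitary Ul(1) unfolding compact_def by (metis mem_Collect_eq)
    have V: "unitary_mat V" using r(1) by simp
    have vv: "cadjoint V ** V = mat 1" "V ** cadjoint V = mat 1" using V by (auto simp: unitary_mat_def)
    have Ur: "(\<lambda>n. U (r n)) \<longlonglongrightarrow> V" using r(3) by (simp add: o_def)
    have Yr: "(\<lambda>n. Y (r n)) \<longlonglongrightarrow> A" using LIMSEQ_subseq_LIMSEQ[OF Y(2) r(2)] by (simp add: o_def)
    have D: "rdiag (l n) = cadjoint (U n) ** Y n ** U n" for n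
    proof -
      have "cadjoint (U n) ** U n = mat 1" using Ul(1) by (simp add: unitary_mat_def)
      then show ?thesis
        unfolding Ul(3) by (metis matrix_mul_assoc matrix_mul_lid matrix_mul_rid)
    qed
    define E where "E = cadjoint V ** A ** V"
    have lim_D: "(\<lambda>n. rdiag (l (r n))) \<longlonglongrightarrow> E"
      unfolding D E_def by (intro tendsto_matrix_mult tendsto_cadjoint Ur Yr)
    define k where "k i = Re (E $ i $ i)" for i
    have lim_l: "(\<lambda>n. l (r n) i) \<longlonglongrightarrow> k i" for i
    proof -
      have "(\<lambda>n. Re (rdiag (l (r n)) $ i $ i)) \<longlonglongrightarrow> k i"
        unfolding k_def by (intro tendsto_intros tendsto_vec_nth lim_D)
      then show ?thesis by (simp add: rdiag_entry)
    qed
    have E: "E = rdiag k"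
    proof -
      have "(\<lambda>n. rdiag (l (r n))) \<longlonglongrightarrow> rdiag k"
        unfolding rdiag_def by (intro vec_tendstoI) (auto intro!: tendsto_intros lim_l)
      then show ?thesis using lim_D LIMSEQ_unique by blast
    qed
    have A_eq: "A = V ** rdiag k ** cadjoint V"
      unfolding E[symmetric] E_def using vv by (metis matrix_mul_assoc matrix_mul_lid matrix_mul_rid)
    have k: "0 < k i" for i
    proof -
      have c: "column i V \<noteq> 0"
      proof
        assume "column i V = 0"
        then have "V $ j $ i = 0" for j by (simp add: column_def vec_eq_iff)
        then have "(cadjoint V ** V) $ i $ i = 0" by (simp add: matrix_matrix_mult_def)
        then show False by (simp add: vv mat_def)
      qed
      have "E $ i $ i = cip (column i V) (A *v column i V)"
        by (simp add: E_def matrix_matrix_mult_def cadjoint_def pairing_def conj_vec_def column_def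
            matrix_vector_mult_def sum_distrib_left sum_distrib_right mult.assoc) (rule sum.swap)
      then show ?thesis using A c unfolding k_def by (simp add: posdef_cip)
    qed
    have "(\<lambda>n. U (r n) ** rdiag (\<lambda>i. l (r n) i powr s) ** cadjoint (U (r n)))
        \<longlonglongrightarrow> V ** rdiag (\<lambda>i. k i powr s) ** cadjoint V"
    proof (intro tendsto_matrix_mult tendsto_cadjoint Ur)
      have pw: "(\<lambda>n. l (r n) i powr s) \<longlonglongrightarrow> k i powr s" for i
        using k[of i] by (intro tendsto_powr lim_l tendsto_const) auto
      show "(\<lambda>n. rdiag (\<lambda>i. l (r n) i powr s)) \<longlonglongrightarrow> rdiag (\<lambda>i. k i powr s)"
        unfolding rdiag_def by (intro vec_tendstoI) (auto intro!: tendsto_of_real pw)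
    qed
    then have "(\<lambda>n. mat_powr (Y (r n)) s) \<longlonglongrightarrow> mat_powr A s"
      by (simp add: Ul(3) A_eq mat_powr_eq[OF Ul(1,2)] mat_powr_eq[OF V k])
    then show ?thesis using r(2) by blast
  qed
  show "(\<lambda>n. mat_powr (X n) s) \<longlonglongrightarrow> mat_powr A s"
  proof (rule ccontr)
    assume "\<not> ?thesis"
    then obtain e where e: "e > 0" "\<And>N. \<exists>n\<ge>N. \<not> dist (mat_powr (X n) s) (mat_powr A s) < e"
      unfolding lim_sequentially by blast
    define f where "f N = (SOME n. n \<ge> N \<and> \<not> dist (mat_powr (X n) s) (mat_powr A s) < e)" for N
    have f: "f N \<ge> N" "\<not> dist (mat_powr (X (f N)) s) (mat_powr A s) < e" for N
      unfolding f_def using someI_ex[OF e(2)[of N, unfolded Bex_def, simplified]] by auto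
    have "filterlim f at_top sequentially"
      unfolding filterlim_at_top using f(1) eventually_sequentially order_trans by metis
    then have "(\<lambda>n. X (f n)) \<longlonglongrightarrow> A" by (rule filterlim_compose[OF lim])
    then obtain r where "(\<lambda>n. mat_powr (X (f (r n))) s) \<longlonglongrightarrow> mat_powr A s"
      using sub[of "\<lambda>n. X (f n)"] X by auto
    then obtain N where "dist (mat_powr (X (f (r N))) s) (mat_powr A s) < e"
      using e(1) unfolding lim_sequentially by blast
    then show False using f(2) by blast
  qed
qed

text \<open>
  Compactness of the sphere gives a uniform lower bound; taking it among the numbers \<open>1 / (n + 1)\<close>
  exhibits the positive definite matrices as a countable union of closed sets.
\<close>

lemma posdef_iff_bounded_below:
  fixes A :: "complex^'d^'d"
  shows "posdef A \<longleftrightarrow> cadjoint A = A \<and> (\<exists>n::nat. \<forall>v\<in>sphere 0 1. 1 / real (Suc n) \<le> Re (cip v (A *v v)))"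
proof
  assume p: "posdef A"
  have "axis undefined 1 \<in> sphere (0::complex^'d) 1" by simp
  then have "sphere (0::complex^'d) 1 \<noteq> {}" by blast
  from continuous_attains_inf[OF compact_sphere this continuous_cip_form[of _ A]]
  obtain v0 where v0: "v0 \<in> sphere 0 1" "\<forall>v\<in>sphere 0 1. Re (cip v0 (A *v v0)) \<le> Re (cip v (A *v v))"
    by blast
  have "v0 \<noteq> 0" using v0(1) by auto
  then have "0 < Re (cip v0 (A *v v0))" using p by (simp add: posdef_cip)
  then obtain n where n: "1 / real (Suc n) < Re (cip v0 (A *v v0))" by (rule nat_approx_posE)
  have "1 / real (Suc n) \<le> Re (cip v (A *v v))" if "v \<in> sphere 0 1" for v
    using bspec[OF v0(2) that] n by linarith
  then show "cadjoint A = A \<and> (\<exists>n::nat. \<forall>v\<in>sphere 0 1. 1 / real (Suc n) \<le> Re (cip v (A *v v)))"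
    using p unfolding posdef_cip by blast
next
  assume *: "cadjoint A = A \<and> (\<exists>n::nat. \<forall>v\<in>sphere 0 1. 1 / real (Suc n) \<le> Re (cip v (A *v v)))"
  then obtain n where n: "\<And>v. v \<in> sphere 0 1 \<Longrightarrow> 1 / real (Suc n) \<le> Re (cip v (A *v v))" by blast
  have "0 < Re (cip v (A *v v))" if "v \<noteq> 0" for v
  proof -
    define u where "u = of_real (1 / norm v) *s v"
    have "norm u = 1" using that by (simp add: u_def norm_smult_vec norm_divide)
    then have "1 / real (Suc n) \<le> Re (cip u (A *v u))" by (intro n) simp
    then have "0 < Re (cip u (A *v u))" by (rule less_le_trans[rotated]) simp
    moreover have "cip u (A *v u) = cip v (A *v v) / of_real ((norm v)\<^sup>2)"
      by (simp add: u_def conj_vec_linear pairing_linear vec.scale power2_eq_square)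
    then have "Re (cip u (A *v u)) = Re (cip v (A *v v)) / (norm v)\<^sup>2"
      by (simp only: Re_divide_of_real)
    ultimately show ?thesis using that by (simp add: zero_less_divide_iff)
  qed
  then show "posdef A" using * by (simp add: posdef_cip)
qed

lemma posdef_borel [measurable]: "{A::complex^'d^'d. posdef A} \<in> sets borel"
proof -
  have eq: "{A::complex^'d^'d. posdef A}
      = {A. cadjoint A = A} \<inter> (\<Union>n::nat. \<Inter>v\<in>sphere 0 1. {A. 1 / real (Suc n) \<le> Re (cip v (A *v v))})"
    by (auto simp: posdef_iff_bounded_below)
  have "closed {A::complex^'d^'d. cadjoint A = A}"
    unfolding cadjoint_def by (intro closed_Collect_eq continuous_intros)
  moreover have "closed (\<Inter>v\<in>sphere 0 1. {A::complex^'d^'d. 1 / real (Suc n) \<le> Re (cip v (A *v v))})" for n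
    unfolding pairing_def matrix_vector_mult_def
    by (intro closed_INT ballI closed_Collect_le continuous_intros)
  ultimately show ?thesis unfolding eq by (intro sets.Int sets.countable_UN' borel_closed) auto
qed

text \<open>
  The value off the positive definite matrices is chosen so that the powers \<open>s\<close> and \<open>- s\<close> are inverse
  at every point, not only almost everywhere.
\<close>

definition weight_power :: "('a \<Rightarrow> complex^'d^'d) \<Rightarrow> real \<Rightarrow> 'a \<Rightarrow> complex^'d^'d"
  where "weight_power W s x = (if posdef (W x) then mat_powr (W x) s else mat 1)"

lemma weight_power_measurable [measurable]:
  fixes W :: "'a \<Rightarrow> complex^'d^'d"
  assumes [measurable]: "W \<in> borel_measurable M"
  shows "weight_power W s \<in> borel_measurable M"
proof -
  define X where "X = {A::complex^'d^'d. posdef A}"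
  define h where "h A = indicator X A *\<^sub>R mat_powr A s" for A
  have [measurable]: "X \<in> sets borel" unfolding X_def by (rule posdef_borel)
  have [measurable]: "h \<in> borel_measurable borel"
    unfolding h_def X_def by (rule borel_measurable_continuous_on_indicator[OF posdef_borel continuous_mat_powr])
  have "weight_power W s = (\<lambda>x. if W x \<in> X then h (W x) else mat 1)"
    by (auto simp: weight_power_def X_def h_def)
  then show ?thesis by (simp only:) measurable
qed

lemma weight_power_inverse: "weight_power W s x ** weight_power W (- s) x = mat 1"
  "weight_power W (- s) x ** weight_power W s x = mat 1"
  using mat_powr_inverse[of "W x" s] mat_powr_inverse[of "W x" "- s"] by (auto simp: weight_power_def)

section \<open>Slices of biparameter weights\<close>

text \<open>
  The \<open>A\<^sub>p\<close> condition as a comparison of two norms of one vector: if \<open>\<psi>\<close> lies in the dual unit ball of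
  the averaged norm \<open>e \<mapsto> |e Vi|\<close>, the average of \<open>|V \<psi>|\<close> is bounded. In this form it can be tested on
  one vector at a time, and so passes from rectangles to slices.
\<close>

definition dual_Ap ::
    "'a measure \<Rightarrow> real \<Rightarrow> real \<Rightarrow> ('a \<Rightarrow> complex^'d^'d) \<Rightarrow> ('a \<Rightarrow> complex^'d^'d) \<Rightarrow> 'a set \<Rightarrow> bool"
  where "dual_Ap M p A V Vi R \<longleftrightarrow> (\<forall>\<psi>.
    (\<forall>e. ennreal (norm (pairing e \<psi>) powr conj_exp p * measure M R)
        \<le> (\<integral>\<^sup>+y\<in>R. ennreal (norm (e v* Vi y) powr conj_exp p) \<partial>M)) \<longrightarrow>
    (\<integral>\<^sup>+x\<in>R. ennreal (norm (V x *v \<psi>) powr p) \<partial>M) \<le> ennreal (A * measure M R))"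

lemma opnorm_bounds:
  fixes A :: "complex^'d^'d"
  shows "norm (A *v v) \<le> opnorm A * norm v" "0 \<le> opnorm A" "norm (u v* A) \<le> norm u * opnorm A"
proof -
  show *: "norm (A *v v) \<le> opnorm A * norm v" for v
    unfolding opnorm_def by (rule onorm[OF matrix_vector_mul_bounded_linear])
  show nn: "0 \<le> opnorm A"
    unfolding opnorm_def by (rule onorm_pos_le[OF matrix_vector_mul_bounded_linear])
  show "norm (u v* A) \<le> norm u * opnorm A"
  proof (cases "u v* A = 0")
    case False
    define c where "c = conj_vec (u v* A)"
    have "(norm (u v* A))\<^sup>2 = norm (pairing c (u v* A))" by (simp add: c_def pairing_conj_vec norm_power)
    also have "pairing c (u v* A) = pairing (u v* A) c" by (simp add: pairing_def mult.commute)
    also have "norm \<dots> \<le> norm u * norm (A *v c)" by (simp add: pairing_vector_matrix norm_pairing_le)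
    also have "\<dots> \<le> norm u * (opnorm A * norm c)" by (intro mult_left_mono *) auto
    finally have "norm (u v* A) * norm (u v* A) \<le> norm (u v* A) * (norm u * opnorm A)"
      by (simp add: c_def power2_eq_square mult_ac)
    then show ?thesis using False by simp
  qed (use nn in simp)
qed

lemma continuous_opnorm: "continuous_on UNIV (opnorm :: complex^'d^'d \<Rightarrow> real)"
proof -
  have bound: "opnorm A \<le> real CARD('d) * norm A" for A :: "complex^'d^'d"
    unfolding opnorm_def
  proof (rule onorm_le)
    fix v :: "complex^'d"
    have "norm (A *v v) \<le> (\<Sum>i\<in>UNIV. norm ((A *v v) $ i))" unfolding norm_vec_def by (rule L2_set_le_sum) simp
    also have "\<dots> \<le> (\<Sum>i\<in>(UNIV::'d set). norm A * norm v)"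
    proof (rule sum_mono)
      fix i :: 'd
      have "norm ((A *v v) $ i) \<le> norm (A $ i) * norm v"
        using norm_pairing_le[of "row i A" v] by (simp add: matrix_vector_component row_def vec_lambda_eta)
      also have "\<dots> \<le> norm A * norm v" by (intro mult_right_mono Finite_Cartesian_Product.norm_nth_le) simp
      finally show "norm ((A *v v) $ i) \<le> norm A * norm v" .
    qed
    finally show "norm (A *v v) \<le> real CARD('d) * norm A * norm v" by simp
  qed
  have tri: "opnorm A \<le> opnorm B + opnorm (A - B)" for A B :: "complex^'d^'d"
  proof -
    have "opnorm A = onorm (\<lambda>v. B *v v + (A - B) *v v)"
      unfolding opnorm_def by (simp add: matrix_vector_mult_diff_rdistrib)
    also have "\<dots> \<le> opnorm B + opnorm (A - B)"
      unfolding opnorm_def by (rule onorm_triangle[OF matrix_vector_mul_bounded_linear matrix_vector_mul_bounded_linear])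
    finally show ?thesis .
  qed
  have "\<bar>opnorm A - opnorm B\<bar> \<le> real CARD('d) * norm (A - B)" for A B :: "complex^'d^'d"
    using tri[of A B] tri[of B A] bound[of "A - B"] bound[of "B - A"] by (simp add: norm_minus_commute)
  then have "(real CARD('d))-lipschitz_on UNIV (opnorm :: complex^'d^'d \<Rightarrow> real)"
    by (intro lipschitz_onI) (auto simp: dist_norm)
  then show ?thesis by (rule lipschitz_on_continuous_on)
qed

lemma measurable_matrix_mult [measurable]:
  fixes X Y :: "'a \<Rightarrow> complex^'d^'d"
  assumes "X \<in> borel_measurable M" "Y \<in> borel_measurable M"
  shows "(\<lambda>x. X x ** Y x) \<in> borel_measurable M"
proof -
  have "continuous_on UNIV (\<lambda>z::(complex^'d^'d) \<times> (complex^'d^'d). fst z ** snd z)"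
    unfolding matrix_matrix_mult_def by (intro continuous_intros)
  from borel_measurable_continuous_on[OF this, of "\<lambda>x. (X x, Y x)"] assms show ?thesis by simp
qed

lemma measurable_opnorm [measurable]:
  assumes "X \<in> borel_measurable M" shows "(\<lambda>x. opnorm (X x :: complex^'d^'d)) \<in> borel_measurable M"
  by (rule borel_measurable_continuous_on[OF continuous_opnorm assms])

text \<open>
  Testing the duality between \<open>V\<close> and its inverse on one vector \<open>\<psi>\<close> at a time: for fixed \<open>x\<close> the
  functional \<open>e = conj (V x \<psi>) V x\<close> norms \<open>\<psi>\<close>, and its dual norm is controlled by the inner average
  of the \<open>A\<^sub>p\<close> condition.
\<close>

lemma dual_Ap_of_average:
  fixes V Vi :: "'a \<Rightarrow> complex^'d^'d"
  assumes p: "1 < p" and R: "0 < measure M R" "emeasure M R = ennreal (measure M R)"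
    and [measurable]: "R \<in> sets M" "Vi \<in> borel_measurable M"
    and avg: "(\<integral>\<^sup>+x\<in>R. enn_powr ((\<integral>\<^sup>+y\<in>R. ennreal (opnorm (V x ** Vi y) powr conj_exp p) \<partial>M) / emeasure M R)
        (p / conj_exp p) \<partial>M) \<le> ennreal (A * measure M R)"
  shows "dual_Ap M p A V Vi R"
  unfolding dual_Ap_def
proof (intro allI impI)
  fix \<psi>
  assume hyp: "\<forall>e. ennreal (norm (pairing e \<psi>) powr conj_exp p * measure M R)
        \<le> (\<integral>\<^sup>+y\<in>R. ennreal (norm (e v* Vi y) powr conj_exp p) \<partial>M)"
  define q where "q = conj_exp p"
  define m where "m = measure M R"
  have q: "1 < q" "0 < p / q" using conj_exp_props[OF p] p by (auto simp: q_def)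
  have "(\<integral>\<^sup>+x\<in>R. ennreal (norm (V x *v \<psi>) powr p) \<partial>M)
      \<le> (\<integral>\<^sup>+x\<in>R. enn_powr ((\<integral>\<^sup>+y\<in>R. ennreal (opnorm (V x ** Vi y) powr q) \<partial>M) / emeasure M R) (p / q) \<partial>M)"
  proof (intro nn_integral_mono mult_right_mono)
    fix x
    define J where "J = (\<integral>\<^sup>+y\<in>R. ennreal (opnorm (V x ** Vi y) powr q) \<partial>M)"
    define t where "t = norm (V x *v \<psi>)"
    have t0: "0 \<le> t" by (simp add: t_def)
    have main: "ennreal (t powr q * m) \<le> J" if "t \<noteq> 0"
    proof -
      define z where "z = conj_vec (V x *v \<psi>)"
      have z: "norm z = t" by (simp add: z_def t_def)
      have "norm (pairing (z v* V x) \<psi>) = t\<^sup>2"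
        by (simp add: pairing_vector_matrix z_def pairing_conj_vec t_def norm_power)
      then have "norm (pairing (z v* V x) \<psi>) = t * t" by (simp only: power2_eq_square)
      then have "ennreal ((t * t) powr q * m) \<le> (\<integral>\<^sup>+y\<in>R. ennreal (norm ((z v* V x) v* Vi y) powr q) \<partial>M)"
        using hyp[rule_format, of "z v* V x"] by (simp add: q_def m_def)
      also have "\<dots> \<le> (\<integral>\<^sup>+y. ennreal (t powr q) * (ennreal (opnorm (V x ** Vi y) powr q) * indicator R y) \<partial>M)"
      proof (rule nn_integral_mono)
        fix y
        have "norm ((z v* V x) v* Vi y) \<le> t * opnorm (V x ** Vi y)"
          using opnorm_bounds(3)[of z "V x ** Vi y"] by (simp add: vector_matrix_mul_assoc z)
        then have "norm ((z v* V x) v* Vi y) powr q \<le> (t * opnorm (V x ** Vi y)) powr q"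
          using q by (intro powr_mono2) auto
        then have "ennreal (norm ((z v* V x) v* Vi y) powr q) \<le> ennreal (t powr q * opnorm (V x ** Vi y) powr q)"
          by (intro ennreal_leI) (simp add: powr_mult)
        then show "ennreal (norm ((z v* V x) v* Vi y) powr q) * indicator R y
            \<le> ennreal (t powr q) * (ennreal (opnorm (V x ** Vi y) powr q) * indicator R y)"
          by (cases "y \<in> R") (auto simp: ennreal_mult)
      qed
      also have "\<dots> \<le> ennreal (t powr q) * J"
        unfolding J_def by (intro eq_refl nn_integral_cmult) measurable
      finally have "ennreal (t powr q) * ennreal (t powr q * m) \<le> ennreal (t powr q) * J"
        using t0 by (simp add: powr_mult ennreal_mult' m_def mult.assoc)
      then show ?thesis using that t0 by (subst (asm) ennreal_mult_le_mult_iff) auto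
    qed
    have le: "ennreal (t powr q) \<le> J / emeasure M R"
    proof (cases "t = 0")
      case False
      have "ennreal (t powr q) = ennreal (t powr q * m) / ennreal m"
        using R(1) by (simp add: divide_ennreal m_def)
      also have "\<dots> \<le> J / emeasure M R"
        unfolding R(2) m_def[symmetric] by (rule divide_right_mono_ennreal[OF main[OF False]])
      finally show ?thesis .
    qed (use q in simp)
    show "ennreal (norm (V x *v \<psi>) powr p) \<le> enn_powr (J / emeasure M R) (p / q)"
    proof (cases "J / emeasure M R = \<infinity>")
      case False
      define r where "r = enn2real (J / emeasure M R)"
      have r: "J / emeasure M R = ennreal r" using False by (simp add: r_def ennreal_enn2real_if)
      have "t powr q \<le> r" using le unfolding r by (simp add: ennreal_le_iff r_def)
      then have "(t powr q) powr (p / q) \<le> r powr (p / q)" using q by (intro powr_mono2) auto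
      then have "t powr p \<le> r powr (p / q)" using q by (simp add: powr_powr)
      then show ?thesis using False by (simp add: enn_powr_def r_def[symmetric] t_def ennreal_leI)
    qed (simp add: enn_powr_def)
  qed simp
  also have "\<dots> \<le> ennreal (A * measure M R)" using avg unfolding q_def .
  finally show "(\<integral>\<^sup>+x\<in>R. ennreal (norm (V x *v \<psi>) powr p) \<partial>M) \<le> ennreal (A * measure M R)" .
qed

lemma dual_norm_continuous:
  fixes Vi :: "'a \<Rightarrow> complex^'d^'d"
  assumes q: "1 < q" and [measurable]: "Vi \<in> borel_measurable M" "Q \<in> sets M"
    and fin: "\<And>k. (\<integral>\<^sup>+y\<in>Q. ennreal (norm (row k (Vi y)) powr q) \<partial>M) < \<infinity>"
  shows "(\<integral>\<^sup>+y\<in>Q. ennreal (norm (e v* Vi y) powr q) \<partial>M) < \<infinity>" (is ?fin)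
    and "continuous_on UNIV (\<lambda>e. enn2real (\<integral>\<^sup>+y\<in>Q. ennreal (norm (e v* Vi y) powr q) \<partial>M))" (is ?cont)
proof -
  define d where "d = real CARD('d)"
  have [measurable]: "(\<lambda>y. row k (Vi y)) \<in> borel_measurable M" for k
    unfolding vector_matrix_axis[symmetric] by measurable
  define w where "w c y = (\<Sum>k\<in>UNIV. ennreal ((d * c) powr q) * (ennreal (norm (row k (Vi y)) powr q) * indicator Q y))" for c y
  have w_meas [measurable]: "w c \<in> borel_measurable M" for c unfolding w_def by measurable
  have w_fin: "(\<integral>\<^sup>+y. w c y \<partial>M) < \<infinity>" for c
  proof -
    have "(\<integral>\<^sup>+y. w c y \<partial>M) = (\<Sum>k\<in>UNIV. ennreal ((d * c) powr q) * (\<integral>\<^sup>+y\<in>Q. ennreal (norm (row k (Vi y)) powr q) \<partial>M))"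
      unfolding w_def by (subst nn_integral_sum) (auto simp: nn_integral_cmult)
    also have "\<dots> < \<infinity>" using fin by (auto simp: ennreal_mult_less_top)
    finally show ?thesis .
  qed
  have bound: "ennreal (norm (e v* Vi y) powr q) * indicator Q y \<le> w c y" if "norm e \<le> c" for e c y
  proof (cases "y \<in> Q")
    case True
    have c0: "0 \<le> c" by (rule order_trans[OF norm_ge_zero that])
    have "norm (e v* Vi y) \<le> (\<Sum>k\<in>UNIV. norm (e $ k) * norm (row k (Vi y)))"
      unfolding vector_matrix_sum_rows by (rule norm_sum_smult_le)
    also have "\<dots> \<le> (\<Sum>k\<in>UNIV. c * norm (row k (Vi y)))"
      by (intro sum_mono mult_right_mono order_trans[OF Finite_Cartesian_Product.norm_nth_le that]) simp
    finally have "norm (e v* Vi y) powr q \<le> (\<Sum>k\<in>UNIV. c * norm (row k (Vi y))) powr q"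
      using q by (intro powr_mono2) auto
    also have "\<dots> \<le> d powr q * (\<Sum>k\<in>UNIV. (c * norm (row k (Vi y))) powr q)"
      unfolding d_def using q c0 by (intro sum_powr_le) auto
    also have "\<dots> = (\<Sum>k\<in>UNIV. (d * c) powr q * norm (row k (Vi y)) powr q)"
      by (simp add: powr_mult sum_distrib_left mult_ac)
    finally have "ennreal (norm (e v* Vi y) powr q) \<le> ennreal (\<Sum>k\<in>UNIV. (d * c) powr q * norm (row k (Vi y)) powr q)"
      by (rule ennreal_leI)
    also have "\<dots> = w c y"
      unfolding w_def using True by (subst sum_ennreal[symmetric]) (auto intro!: sum.cong simp: ennreal_mult)
    finally show ?thesis using True by simp
  qed simp
  have fin_e: "(\<integral>\<^sup>+y\<in>Q. ennreal (norm (e v* Vi y) powr q) \<partial>M) < \<infinity>" for e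
    by (rule le_less_trans[OF nn_integral_mono[OF bound[OF order_refl]] w_fin])
  then show ?fin .
  show ?cont
  proof (rule continuous_on_sequentiallyI)
    fix X :: "nat \<Rightarrow> complex^'d" and e assume X: "X \<longlonglongrightarrow> e"
    obtain c where c: "\<And>n. norm (X n) \<le> c"
      using convergent_imp_bounded[OF X] unfolding bounded_iff by blast
    have "(\<lambda>n. \<integral>\<^sup>+y\<in>Q. ennreal (norm (X n v* Vi y) powr q) \<partial>M) \<longlonglongrightarrow> (\<integral>\<^sup>+y\<in>Q. ennreal (norm (e v* Vi y) powr q) \<partial>M)"
    proof (rule nn_integral_dominated_convergence[where w = "w c"])
      show "AE y in M. (\<lambda>n. ennreal (norm (X n v* Vi y) powr q) * indicator Q y)
          \<longlonglongrightarrow> ennreal (norm (e v* Vi y) powr q) * indicator Q y"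
      proof (rule AE_I2)
        fix y
        have lim: "(\<lambda>n. X n v* Vi y) \<longlonglongrightarrow> e v* Vi y"
          unfolding vector_matrix_mult_def
          by (intro vec_tendstoI) (simp, intro tendsto_intros tendsto_vec_nth X)
        have "(\<lambda>n. norm (X n v* Vi y) powr q) \<longlonglongrightarrow> norm (e v* Vi y) powr q"
          using q by (intro tendsto_powr' tendsto_norm lim tendsto_const) auto
        then show "(\<lambda>n. ennreal (norm (X n v* Vi y) powr q) * indicator Q y)
          \<longlonglongrightarrow> ennreal (norm (e v* Vi y) powr q) * indicator Q y"
          by (cases "y \<in> Q") (auto intro: tendsto_ennrealI)
      qed
    qed (use bound[OF c] w_fin in \<open>auto\<close>)
    then show "(\<lambda>n. enn2real (\<integral>\<^sup>+y\<in>Q. ennreal (norm (X n v* Vi y) powr q) \<partial>M))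
        \<longlonglongrightarrow> enn2real (\<integral>\<^sup>+y\<in>Q. ennreal (norm (e v* Vi y) powr q) \<partial>M)"
      using fin_e[of e] by (intro tendsto_enn2real) auto
  qed
qed

text \<open>
  An almost extremal basis for the averaged norm \<open>e \<mapsto> |e Vi|\<close> has dual vectors of dual norm at most 2;
  these are the columns on which the assumption is tested.
\<close>

lemma factored_Ap_of_tests:
  fixes V Vi :: "'a \<Rightarrow> complex^'d^'d" and X :: "(complex^'d^'d) set"
  assumes p: "1 < p" and [measurable]: "Vi \<in> borel_measurable M" "Q \<in> sets M"
    and Q: "0 < measure M Q" "emeasure M Q = ennreal (measure M Q)"
    and inv: "\<And>y. V y ** Vi y = mat 1"  "\<And>y. Vi y ** V y = mat 1"
    and dense: "\<And>S. open S \<Longrightarrow> S \<noteq> {} \<Longrightarrow> \<exists>U\<in>X. U \<in> S"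
    and fin: "\<And>k. (\<integral>\<^sup>+y\<in>Q. ennreal (norm (row k (Vi y)) powr conj_exp p) \<partial>M) < \<infinity>"
    and test: "\<And>U U' i. U \<in> X \<Longrightarrow> U ** U' = mat 1 \<Longrightarrow>
      (\<And>e. ennreal (norm (pairing e (column i U')) powr conj_exp p * measure M Q)
        \<le> ennreal (2 powr conj_exp p) * (\<integral>\<^sup>+y\<in>Q. ennreal (norm (e v* Vi y) powr conj_exp p) \<partial>M)) \<Longrightarrow>
      (\<integral>\<^sup>+x\<in>Q. ennreal (norm (V x *v column i U') powr p) \<partial>M) \<le> ennreal (A * measure M Q)"
  shows "factored_Ap M p A V Vi Q"
proof -
  define q where "q = conj_exp p"
  have q: "1 < q" using conj_exp_props[OF p] by (simp add: q_def)
  define m where "m = measure M Q"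
  have m: "0 < m" using Q by (simp add: m_def)
  define I where "I e = (\<integral>\<^sup>+y\<in>Q. ennreal (norm (e v* Vi y) powr q) \<partial>M)" for e
  define N where "N e = (enn2real (I e) / m) powr (1 / q)" for e
  note dn = dual_norm_continuous[of q Vi M Q, OF q _ _ fin[folded q_def]]
  have I_fin: "I e < \<infinity>" for e unfolding I_def by (rule dn) measurable
  have I_eq: "I e = ennreal (m * N e powr q)" for e
  proof -
    have "I e = ennreal (enn2real (I e))" using I_fin[of e] by (simp add: ennreal_enn2real_if)
    also have "enn2real (I e) = m * N e powr q" using m q by (simp add: N_def powr_powr)
    finally show ?thesis .
  qed
  have hom: "N (c *s x) = norm c * N x" for c x
  proof -
    have "norm ((c *s x) v* Vi y) powr q = norm c powr q * norm (x v* Vi y) powr q" for y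
    proof -
      have "(c *s x) v* Vi y = c *s (x v* Vi y)"
        by (simp add: vec_eq_iff vector_matrix_mult_def sum_distrib_left mult_ac)
      then show ?thesis by (simp add: norm_smult_vec powr_mult)
    qed
    then have "I (c *s x) = (\<integral>\<^sup>+y. ennreal (norm c powr q) * (ennreal (norm (x v* Vi y) powr q) * indicator Q y) \<partial>M)"
      unfolding I_def by (simp add: ennreal_mult mult.assoc)
    also have "\<dots> = ennreal (norm c powr q) * I x" unfolding I_def by (rule nn_integral_cmult) measurable
    finally show ?thesis using q by (simp add: N_def enn2real_mult powr_mult powr_divide powr_powr)
  qed
  have pos: "0 < N x" if x: "x \<noteq> 0" for x
  proof (rule ccontr)
    assume "\<not> 0 < N x"
    then have "N x = 0" by (simp add: N_def)
    then have "I x = 0" using q by (simp add: I_eq)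
    then have "AE y in M. ennreal (norm (x v* Vi y) powr q) * indicator Q y = 0"
      unfolding I_def by (subst (asm) nn_integral_0_iff_AE) measurable
    moreover have "x v* Vi y \<noteq> 0" for y
    proof
      assume "x v* Vi y = 0"
      then have "(x v* Vi y) v* V y = 0" by simp
      then show False using x by (simp add: vector_matrix_mul_assoc inv)
    qed
    then have "\<not> ennreal (norm (x v* Vi y) powr q) * indicator Q y = 0" if "y \<in> Q" for y
      using that by simp
    ultimately have "AE y in M. y \<notin> Q" by (auto elim!: eventually_mono)
    then have "Q \<in> null_sets M" by (subst AE_iff_null_sets) measurable
    then have "emeasure M Q = 0" by (rule null_setsD1)
    then show False using Q m by simp
  qed
  have cont: "continuous_on UNIV N"
    unfolding N_def
  proof (rule continuous_on_powr')
    show "continuous_on UNIV (\<lambda>e. enn2real (I e) / m)"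
      unfolding I_def using m by (intro continuous_intros dn(2)) auto
  qed (use q m in auto)
  obtain U U' :: "complex^'d^'d" where U: "U \<in> X" "U ** U' = mat 1" "U' ** U = mat 1"
    "\<And>i. N (row i U) \<le> 1" "\<And>e i. norm ((e v* U') $ i) \<le> 2 * N e"
  proof (rule almost_extremal_basis[of N X, OF cont hom])
    show "0 < N x" if "x \<noteq> 0" for x using that by (rule pos)
    show "\<exists>U\<in>X. U \<in> S" if "open S" "S \<noteq> {}" for S using that by (rule dense)
  next
    fix U U' :: "complex^'d^'d"
    assume "U \<in> X" "U ** U' = mat 1" "U' ** U = mat 1"
      "\<And>i. N (row i U) \<le> 1" "\<And>e i. norm ((e v* U') $ i) \<le> 2 * N e"
    then show thesis by (rule that)
  qed
  have "I (row i U) \<le> ennreal m" for i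
  proof -
    have "N (row i U) powr q \<le> 1 powr q" using U(4)[of i] q by (intro powr_mono2) (auto simp: N_def)
    then show ?thesis unfolding I_eq using m by (intro ennreal_leI) simp
  qed
  moreover have "(\<integral>\<^sup>+x\<in>Q. ennreal (norm (V x *v column i U') powr p) \<partial>M) \<le> ennreal (A * m)" for i
    unfolding m_def
  proof (rule test[OF U(1,2)])
    fix e
    have "norm (pairing e (column i U')) powr q \<le> (2 * N e) powr q"
      using U(5)[of e i] q by (intro powr_mono2) (auto simp: vector_matrix_component)
    also have "\<dots> = 2 powr q * N e powr q" by (simp add: powr_mult)
    finally have "norm (pairing e (column i U')) powr q * m \<le> 2 powr q * (m * N e powr q)"
      using m by (simp add: mult_ac)
    then have "ennreal (norm (pairing e (column i U')) powr q * m) \<le> ennreal (2 powr q) * I e"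
      unfolding I_eq using m by (simp add: ennreal_mult[symmetric] ennreal_leI)
    then show "ennreal (norm (pairing e (column i U')) powr conj_exp p * measure M Q)
        \<le> ennreal (2 powr conj_exp p) * (\<integral>\<^sup>+y\<in>Q. ennreal (norm (e v* Vi y) powr conj_exp p) \<partial>M)"
      by (simp only: q_def m_def I_def)
  qed
  ultimately show ?thesis
    unfolding factored_Ap_def I_def q_def m_def
    by (intro exI[of _ U] exI[of _ U'] conjI allI U(2,3))
qed

lemma nn_integral_rectangle:
  fixes f :: "'a::euclidean_space \<times> 'b::euclidean_space \<Rightarrow> ennreal"
  assumes f: "f \<in> borel_measurable borel" and Q: "Q1 \<in> sets borel" "Q2 \<in> sets borel"
  shows "(\<integral>\<^sup>+z\<in>Q1 \<times> Q2. f z \<partial>lborel) = (\<integral>\<^sup>+y\<in>Q2. (\<integral>\<^sup>+x\<in>Q1. f (x, y) \<partial>lborel) \<partial>lborel)"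
    and "(\<integral>\<^sup>+z\<in>Q1 \<times> Q2. f z \<partial>lborel) = (\<integral>\<^sup>+x\<in>Q1. (\<integral>\<^sup>+y\<in>Q2. f (x, y) \<partial>lborel) \<partial>lborel)"
proof -
  have [measurable]: "f \<in> borel_measurable (lborel \<Otimes>\<^sub>M lborel)" using f by (simp add: lborel_prod)
  have [measurable]: "Q1 \<in> sets lborel" "Q2 \<in> sets lborel" using Q by auto
  have ind: "indicator (Q1 \<times> Q2) (x, y) = (indicator Q1 x * indicator Q2 y :: ennreal)" for x y
    by (simp add: indicator_def)
  have [measurable]: "(\<lambda>z. f z * indicator (Q1 \<times> Q2) z) \<in> borel_measurable (lborel \<Otimes>\<^sub>M lborel)" by measurable
  have "(\<integral>\<^sup>+z\<in>Q1 \<times> Q2. f z \<partial>lborel) = (\<integral>\<^sup>+z. f z * indicator (Q1 \<times> Q2) z \<partial>(lborel \<Otimes>\<^sub>M lborel))"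
    by (simp add: lborel_prod)
  also have "\<dots> = (\<integral>\<^sup>+y. (\<integral>\<^sup>+x. f (x, y) * indicator (Q1 \<times> Q2) (x, y) \<partial>lborel) \<partial>lborel)"
    by (rule lborel_pair.nn_integral_snd[symmetric]) measurable
  also have "\<dots> = (\<integral>\<^sup>+y. (\<integral>\<^sup>+x. indicator Q2 y * (f (x, y) * indicator Q1 x) \<partial>lborel) \<partial>lborel)"
    by (simp add: ind mult_ac)
  also have "\<dots> = (\<integral>\<^sup>+y\<in>Q2. (\<integral>\<^sup>+x\<in>Q1. f (x, y) \<partial>lborel) \<partial>lborel)"
    by (intro nn_integral_cong) (subst nn_integral_cmult, auto simp: mult.commute)
  finally show "(\<integral>\<^sup>+z\<in>Q1 \<times> Q2. f z \<partial>lborel) = (\<integral>\<^sup>+y\<in>Q2. (\<integral>\<^sup>+x\<in>Q1. f (x, y) \<partial>lborel) \<partial>lborel)" .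
  have "(\<integral>\<^sup>+z\<in>Q1 \<times> Q2. f z \<partial>lborel) = (\<integral>\<^sup>+z. f z * indicator (Q1 \<times> Q2) z \<partial>(lborel \<Otimes>\<^sub>M lborel))"
    by (simp add: lborel_prod)
  also have "\<dots> = (\<integral>\<^sup>+x. (\<integral>\<^sup>+y. f (x, y) * indicator (Q1 \<times> Q2) (x, y) \<partial>lborel) \<partial>lborel)"
    by (rule lborel.nn_integral_fst[symmetric]) measurable
  also have "\<dots> = (\<integral>\<^sup>+x. (\<integral>\<^sup>+y. indicator Q1 x * (f (x, y) * indicator Q2 y) \<partial>lborel) \<partial>lborel)"
    by (simp add: ind mult_ac)
  also have "\<dots> = (\<integral>\<^sup>+x\<in>Q1. (\<integral>\<^sup>+y\<in>Q2. f (x, y) \<partial>lborel) \<partial>lborel)"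
    by (intro nn_integral_cong) (subst nn_integral_cmult, auto simp: mult.commute)
  finally show "(\<integral>\<^sup>+z\<in>Q1 \<times> Q2. f z \<partial>lborel) = (\<integral>\<^sup>+x\<in>Q1. (\<integral>\<^sup>+y\<in>Q2. f (x, y) \<partial>lborel) \<partial>lborel)" .
qed

lemma measure_rectangle:
  fixes Q1 :: "'a::euclidean_space set" and Q2 :: "'b::euclidean_space set"
  assumes "Q1 \<in> sets borel" "Q2 \<in> sets borel"
    "emeasure lborel Q1 = ennreal (measure lborel Q1)" "emeasure lborel Q2 = ennreal (measure lborel Q2)"
  shows "emeasure lborel (Q1 \<times> Q2) = ennreal (measure lborel Q1 * measure lborel Q2)"
    "measure lborel (Q1 \<times> Q2) = measure lborel Q1 * measure lborel Q2"
proof -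
  have "emeasure lborel (Q1 \<times> Q2) = emeasure (lborel \<Otimes>\<^sub>M lborel) (Q1 \<times> Q2)" by (simp add: lborel_prod)
  also have "\<dots> = emeasure lborel Q1 * emeasure lborel Q2"
    using assms by (intro lborel.emeasure_pair_measure_Times) auto
  finally show e: "emeasure lborel (Q1 \<times> Q2) = ennreal (measure lborel Q1 * measure lborel Q2)"
    using assms(3,4) by (simp add: ennreal_mult)
  show "measure lborel (Q1 \<times> Q2) = measure lborel Q1 * measure lborel Q2"
    unfolding measure_def[of lborel "Q1 \<times> Q2"] e by simp
qed

lemma slice_measurable:
  fixes f :: "'a::euclidean_space \<times> 'b::euclidean_space \<Rightarrow> 'c::topological_space"
  assumes "f \<in> borel_measurable borel"
  shows "(\<lambda>x. f (x, y)) \<in> borel_measurable borel" "(\<lambda>y. f (x, y)) \<in> borel_measurable borel"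
proof -
  have [measurable]: "f \<in> borel_measurable (borel \<Otimes>\<^sub>M borel)" using assms by (simp add: borel_prod)
  show "(\<lambda>x. f (x, y)) \<in> borel_measurable borel" "(\<lambda>y. f (x, y)) \<in> borel_measurable borel" by measurable
qed

lemma slice_integral_measurable:
  fixes f :: "'a::euclidean_space \<times> 'b::euclidean_space \<Rightarrow> ennreal"
  assumes "f \<in> borel_measurable borel" "Q \<in> sets borel"
  shows "(\<lambda>y. \<integral>\<^sup>+x\<in>Q. f (x, y) \<partial>lborel) \<in> borel_measurable borel"
proof -
  have [measurable]: "f \<in> borel_measurable (borel \<Otimes>\<^sub>M borel)" using assms by (simp add: borel_prod)
  have [measurable]: "Q \<in> sets borel" by fact
  have "(\<lambda>(y, x). f (x, y) * indicator Q x) \<in> borel_measurable (borel \<Otimes>\<^sub>M lborel)" by measurable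
  then show ?thesis by (rule lborel.borel_measurable_nn_integral)
qed

text \<open>
  A set of parameters \<open>y\<close> for which the test on \<open>\<psi>\<close> fails would, if it had positive measure, fill
  half of some cube; then the test would fail on the product with that cube as well. Integrating the
  hypothesis over half of the cube loses a factor 2 and the test allows \<open>2 powr q\<close>; rescaling \<open>\<psi>\<close>
  to absorb both costs \<open>2 powr (2 * p - 1)\<close>, and the conclusion loses another factor 2 over half of
  the cube, which leaves room below \<open>2 powr (2 * p + 1)\<close>.
\<close>

lemma slice_test_null:
  fixes V Vi :: "'a::euclidean_space \<times> 'b::euclidean_space \<Rightarrow> complex^'d^'d" and E :: "(complex^'d) set"
  assumes p: "1 < p" and A: "0 < A"
    and V [measurable]: "V \<in> borel_measurable borel" "Vi \<in> borel_measurable borel"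
    and Q1 [measurable]: "Q1 \<in> sets borel" and m1: "0 < measure lborel Q1" "emeasure lborel Q1 = ennreal (measure lborel Q1)"
    and C2: "\<And>Q. Q \<in> C2 \<Longrightarrow> Q \<in> sets borel" "\<And>Q. Q \<in> C2 \<Longrightarrow> 0 < measure lborel Q"
      "\<And>Q. Q \<in> C2 \<Longrightarrow> emeasure lborel Q = ennreal (measure lborel Q)"
    and dens: "\<And>Z. Z \<in> sets borel \<Longrightarrow> 0 < emeasure lborel Z \<Longrightarrow>
      \<exists>Q\<in>C2. emeasure lborel Q \<le> 2 * emeasure lborel (Z \<inter> Q)"
    and dual: "\<And>Q2. Q2 \<in> C2 \<Longrightarrow> dual_Ap lborel p A V Vi (Q1 \<times> Q2)"
    and fin: "\<And>Q2 k. Q2 \<in> C2 \<Longrightarrow> (\<integral>\<^sup>+z\<in>Q1 \<times> Q2. ennreal (norm (row k (Vi z)) powr conj_exp p) \<partial>lborel) < \<infinity>"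
    and E: "countable E" "closure E = UNIV"
  shows "AE y in lborel.
    (\<forall>e\<in>E. ennreal (norm (pairing e \<psi>) powr conj_exp p * measure lborel Q1)
        \<le> ennreal (2 powr conj_exp p) * (\<integral>\<^sup>+x\<in>Q1. ennreal (norm (e v* Vi (x, y)) powr conj_exp p) \<partial>lborel)) \<longrightarrow>
    (\<integral>\<^sup>+x\<in>Q1. ennreal (norm (V (x, y) *v \<psi>) powr p) \<partial>lborel) \<le> ennreal (2 powr (2 * p + 1) * A * measure lborel Q1)"
proof -
  define q where "q = conj_exp p"
  have q: "1 < q" "p / q = p - 1" using conj_exp_props[OF p] by (auto simp: q_def)
  define m1 where "m1 = measure lborel Q1"
  have m1': "0 < m1" using m1 by (simp add: m1_def)
  define A' where "A' = 2 powr (2 * p + 1) * A"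
  have A': "0 < A'" using A by (simp add: A'_def)
  define n where "n y = (\<integral>\<^sup>+x\<in>Q1. ennreal (norm (V (x, y) *v \<psi>) powr p) \<partial>lborel)" for y
  define n' where "n' e y = (\<integral>\<^sup>+x\<in>Q1. ennreal (norm (e v* Vi (x, y)) powr q) \<partial>lborel)" for e y
  have n_meas [measurable]: "n \<in> borel_measurable borel"
    unfolding n_def by (rule slice_integral_measurable[where f = "\<lambda>z. ennreal (norm (V z *v \<psi>) powr p)"]) measurable
  have n'_meas [measurable]: "n' e \<in> borel_measurable borel" for e
    unfolding n'_def by (rule slice_integral_measurable[where f = "\<lambda>z. ennreal (norm (e v* Vi z) powr q)"]) measurable
  define Z where "Z = {y. ennreal (A' * m1) < n y} \<inter>
    (\<Inter>e\<in>E. {y. ennreal (norm (pairing e \<psi>) powr q * m1) \<le> ennreal (2 powr q) * n' e y})"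
  have E_ne: "E \<noteq> {}" using E(2) by auto
  have Z_sets [measurable]: "Z \<in> sets borel"
    unfolding Z_def using E(1) E_ne by (intro sets.Int sets.countable_INT') auto
  have "emeasure lborel Z = 0"
  proof (rule ccontr)
    assume "emeasure lborel Z \<noteq> 0"
    then have "0 < emeasure lborel Z" by (simp add: zero_less_iff_neq_zero)
    from dens[OF Z_sets this] obtain Q2 where Q2: "Q2 \<in> C2" "emeasure lborel Q2 \<le> 2 * emeasure lborel (Z \<inter> Q2)"
      by blast
    have [measurable]: "Q2 \<in> sets borel" using C2(1)[OF Q2(1)] .
    define m2 where "m2 = measure lborel Q2"
    have m2: "0 < m2" "emeasure lborel Q2 = ennreal m2" using C2(2,3)[OF Q2(1)] by (auto simp: m2_def)
    have "emeasure lborel (Z \<inter> Q2) \<le> emeasure lborel Q2" by (intro emeasure_mono) auto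
    then have "emeasure lborel (Z \<inter> Q2) < \<infinity>" using m2 by (simp add: le_less_trans)
    then obtain mz where mz: "emeasure lborel (Z \<inter> Q2) = ennreal mz" "0 \<le> mz"
      by (cases "emeasure lborel (Z \<inter> Q2)") auto
    have "ennreal m2 \<le> ennreal (2 * mz)" using Q2(2) m2 mz by (simp add: ennreal_mult)
    then have half: "m2 \<le> 2 * mz" using mz by (subst (asm) ennreal_le_iff) auto
    define I where "I e = (\<integral>\<^sup>+z\<in>Q1 \<times> Q2. ennreal (norm (e v* Vi z) powr q) \<partial>lborel)" for e
    note R = measure_rectangle[OF Q1 \<open>Q2 \<in> sets borel\<close> m1(2) m2(2)[unfolded m2_def], folded m1_def m2_def]
    have R_sets: "Q1 \<times> Q2 \<in> sets lborel"
      using pair_measureI[OF Q1 \<open>Q2 \<in> sets borel\<close>] unfolding borel_prod sets_lborel .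
    have Vi_l: "Vi \<in> borel_measurable lborel" using V(2) by simp
    note dn = dual_norm_continuous[of q Vi lborel "Q1 \<times> Q2", OF q(1) Vi_l R_sets fin[OF Q2(1), folded q_def]]
    have I_eq: "I e = ennreal (enn2real (I e))" for e
      using dn(1)[of e] unfolding I_def by (simp add: ennreal_enn2real_if)
    have I_iter: "I e = (\<integral>\<^sup>+y\<in>Q2. n' e y \<partial>lborel)" for e
      unfolding I_def n'_def by (rule nn_integral_rectangle) measurable
    have on_E: "norm (pairing e \<psi>) powr q * (m1 * m2) \<le> 2 * 2 powr q * enn2real (I e)" if e: "e \<in> E" for e
    proof -
      define c where "c = norm (pairing e \<psi>) powr q * m1"
      have c0: "0 \<le> c" using m1' by (simp add: c_def)
      have "ennreal c * ennreal mz = (\<integral>\<^sup>+y. ennreal c * indicator (Z \<inter> Q2) y \<partial>lborel)"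
        by (simp add: nn_integral_cmult_indicator mz)
      also have "\<dots> \<le> (\<integral>\<^sup>+y. ennreal (2 powr q) * (n' e y * indicator Q2 y) \<partial>lborel)"
        using e by (intro nn_integral_mono) (auto simp: Z_def c_def indicator_def)
      also have "\<dots> = ennreal (2 powr q) * I e"
        unfolding I_iter by (rule nn_integral_cmult) measurable
      also have "\<dots> = ennreal (2 powr q * enn2real (I e))"
        by (subst I_eq) (simp add: ennreal_mult)
      finally have "c * mz \<le> 2 powr q * enn2real (I e)"
        using c0 mz by (simp add: ennreal_mult[symmetric])
      moreover have "c * m2 \<le> c * (2 * mz)" using half c0 by (rule mult_left_mono)
      ultimately show ?thesis by (simp add: c_def mult_ac)
    qed
    have all_e: "norm (pairing e \<psi>) powr q * (m1 * m2) \<le> 2 * 2 powr q * enn2real (I e)" for e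
    proof -
      define S where "S = {e. norm (pairing e \<psi>) powr q * (m1 * m2) \<le> 2 * 2 powr q * enn2real (I e)}"
      have cp: "continuous_on UNIV (\<lambda>e. pairing e \<psi>)" unfolding pairing_def by (intro continuous_intros)
      have c1: "continuous_on UNIV (\<lambda>e. norm (pairing e \<psi>) powr q)"
        by (rule continuous_on_powr') (use q cp in \<open>auto intro!: continuous_intros\<close>)
      have c2: "continuous_on UNIV (\<lambda>e. enn2real (I e))" unfolding I_def by (rule dn(2))
      have "closed S" unfolding S_def
        by (intro closed_Collect_le continuous_on_mult continuous_on_const c1 c2)
      moreover have "E \<subseteq> S" using on_E by (auto simp: S_def)
      ultimately have "closure E \<subseteq> S" by (rule closure_minimal[rotated])
      then show ?thesis using E(2) by (auto simp: S_def)
    qed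
    \<comment> \<open>Scaled by \<open>s\<close>, the vector \<open>\<psi>\<close> is an admissible test on the whole rectangle.\<close>
    define s where "s = 2 powr (- (q + 1) / q)"
    have s: "0 < s" "s powr q * (2 * 2 powr q) = 1"
    proof -
      show "0 < s" by (simp add: s_def)
      have "s powr q = 2 powr (- (q + 1))" using q by (simp add: s_def powr_powr)
      moreover have "2 * 2 powr q = (2::real) powr (q + 1)" by (simp add: powr_add)
      ultimately show "s powr q * (2 * 2 powr q) = 1" by (simp add: powr_add[symmetric])
    qed
    have sp: "s powr p = 2 powr (- (2 * p - 1))"
    proof -
      have "- (q + 1) / q * p = - (p + p / q)" using q by (simp add: field_simps)
      also have "\<dots> = - (2 * p - 1)" by (simp add: q(2))
      finally show ?thesis by (simp add: s_def powr_powr)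
    qed
    define \<psi>' where "\<psi>' = of_real s *s \<psi>"
    have "(\<integral>\<^sup>+z\<in>Q1 \<times> Q2. ennreal (norm (V z *v \<psi>') powr p) \<partial>lborel) \<le> ennreal (A * (m1 * m2))"
    proof -
      have "ennreal (norm (pairing e \<psi>') powr q * (m1 * m2)) \<le> I e" for e
      proof -
        have "norm (pairing e \<psi>') = s * norm (pairing e \<psi>)"
          using s by (simp add: \<psi>'_def pairing_linear norm_mult)
        then have "norm (pairing e \<psi>') powr q * (m1 * m2) = s powr q * (norm (pairing e \<psi>) powr q * (m1 * m2))"
          by (simp add: powr_mult mult_ac)
        also have "\<dots> \<le> s powr q * (2 * 2 powr q * enn2real (I e))" by (intro mult_left_mono all_e) simp
        also have "\<dots> = enn2real (I e)" using s(2) by (simp add: mult.assoc[symmetric])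
        finally show ?thesis by (subst I_eq) (rule ennreal_leI)
      qed
      then show ?thesis
        using dual[OF Q2(1)] unfolding dual_Ap_def R(2) q_def[symmetric] I_def by blast
    qed
    moreover have "ennreal (s powr p * (A' * m1) * mz) \<le> (\<integral>\<^sup>+z\<in>Q1 \<times> Q2. ennreal (norm (V z *v \<psi>') powr p) \<partial>lborel)"
    proof -
      have inner: "(\<integral>\<^sup>+x\<in>Q1. ennreal (norm (V (x, y) *v \<psi>') powr p) \<partial>lborel) = ennreal (s powr p) * n y" for y
      proof -
        have [measurable]: "(\<lambda>x. V (x, y)) \<in> borel_measurable borel" by (rule slice_measurable[OF V(1)])
        have "norm (V (x, y) *v \<psi>') powr p = s powr p * norm (V (x, y) *v \<psi>) powr p" for x
          using s by (simp add: \<psi>'_def vec.scale norm_smult_vec powr_mult)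
        then show ?thesis
          unfolding n_def by (simp add: ennreal_mult mult.assoc nn_integral_cmult)
      qed
      have "ennreal (s powr p * (A' * m1) * mz) = (\<integral>\<^sup>+y. ennreal (s powr p * (A' * m1)) * indicator (Z \<inter> Q2) y \<partial>lborel)"
        using mz A' m1' by (simp add: nn_integral_cmult_indicator ennreal_mult)
      also have "\<dots> \<le> (\<integral>\<^sup>+y\<in>Q2. (ennreal (s powr p) * n y) \<partial>lborel)"
      proof (rule nn_integral_mono)
        fix y
        show "ennreal (s powr p * (A' * m1)) * indicator (Z \<inter> Q2) y \<le> ennreal (s powr p) * n y * indicator Q2 y"
        proof (cases "y \<in> Z \<inter> Q2")
          case True
          then have "ennreal (A' * m1) \<le> n y" by (auto simp: Z_def)
          then have "ennreal (s powr p) * ennreal (A' * m1) \<le> ennreal (s powr p) * n y" by (rule mult_left_mono) simp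
          then show ?thesis using True A' m1' by (simp add: ennreal_mult)
        qed simp
      qed
      also have "\<dots> = (\<integral>\<^sup>+y\<in>Q2. (\<integral>\<^sup>+x\<in>Q1. ennreal (norm (V (x, y) *v \<psi>') powr p) \<partial>lborel) \<partial>lborel)"
        by (simp only: inner)
      also have "\<dots> = (\<integral>\<^sup>+z\<in>Q1 \<times> Q2. ennreal (norm (V z *v \<psi>') powr p) \<partial>lborel)"
        by (rule nn_integral_rectangle(1)[symmetric]) measurable
      finally show ?thesis .
    qed
    ultimately have "ennreal (s powr p * (A' * m1) * mz) \<le> ennreal (A * (m1 * m2))" by (rule order_trans[rotated])
    then have "s powr p * (A' * m1) * mz \<le> A * (m1 * m2)"
      using A m1' m2 by (subst (asm) ennreal_le_iff) auto
    moreover have "s powr p * A' = 4 * A"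
    proof -
      have "2 powr (- (2 * p - 1)) * 2 powr (2 * p + 1) = (2::real) powr 2" by (simp add: powr_add[symmetric])
      then show ?thesis unfolding sp A'_def by (simp add: mult.assoc[symmetric])
    qed
    moreover have "s powr p * (A' * m1) * mz = (s powr p * A') * (m1 * mz)" by (simp only: mult_ac)
    ultimately have "4 * A * (m1 * mz) \<le> A * (m1 * m2)" by (simp only:)
    then have "A * m1 * (4 * mz) \<le> A * m1 * m2" by (simp add: mult_ac)
    then have "4 * mz \<le> m2" using A m1' by (simp add: mult_le_cancel_left)
    then show False using half m2 by linarith
  qed
  then have "Z \<in> null_sets lborel" by (intro null_setsI) auto
  from AE_not_in[OF this] show ?thesis
  proof (rule eventually_mono, intro impI)
    fix y
    assume y: "y \<notin> Z" and e: "\<forall>e\<in>E. ennreal (norm (pairing e \<psi>) powr conj_exp p * measure lborel Q1)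
        \<le> ennreal (2 powr conj_exp p) * (\<integral>\<^sup>+x\<in>Q1. ennreal (norm (e v* Vi (x, y)) powr conj_exp p) \<partial>lborel)"
    then have "\<not> ennreal (A' * m1) < n y"
      unfolding Z_def n'_def q_def m1_def by blast
    then show "(\<integral>\<^sup>+x\<in>Q1. ennreal (norm (V (x, y) *v \<psi>) powr p) \<partial>lborel)
        \<le> ennreal (2 powr (2 * p + 1) * A * measure lborel Q1)"
      by (simp add: n_def A'_def m1_def not_less)
  qed
qed

text \<open>
  A countable union of null sets suffices: there are countably many cubes, and the almost extremal
  matrices, hence their dual columns \<open>\<psi>\<close>, can be taken from a countable dense set.
\<close>

theorem slices_factored_Ap:
  fixes V Vi :: "'a::euclidean_space \<times> 'b::euclidean_space \<Rightarrow> complex^'d^'d"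
  assumes p: "1 < p" and A: "0 < A"
    and V [measurable]: "V \<in> borel_measurable borel" "Vi \<in> borel_measurable borel"
    and inv: "\<And>z. V z ** Vi z = mat 1" "\<And>z. Vi z ** V z = mat 1"
    and C1: "countable C1" "\<And>Q. Q \<in> C1 \<Longrightarrow> Q \<in> sets borel" "\<And>Q. Q \<in> C1 \<Longrightarrow> 0 < measure lborel Q"
      "\<And>Q. Q \<in> C1 \<Longrightarrow> emeasure lborel Q = ennreal (measure lborel Q)"
    and C2: "countable C2" "\<And>Q. Q \<in> C2 \<Longrightarrow> Q \<in> sets borel" "\<And>Q. Q \<in> C2 \<Longrightarrow> 0 < measure lborel Q"
      "\<And>Q. Q \<in> C2 \<Longrightarrow> emeasure lborel Q = ennreal (measure lborel Q)" "\<Union>C2 = UNIV"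
    and dens: "\<And>Z. Z \<in> sets borel \<Longrightarrow> 0 < emeasure lborel Z \<Longrightarrow>
      \<exists>Q\<in>C2. emeasure lborel Q \<le> 2 * emeasure lborel (Z \<inter> Q)"
    and dual: "\<And>Q1 Q2. Q1 \<in> C1 \<Longrightarrow> Q2 \<in> C2 \<Longrightarrow> dual_Ap lborel p A V Vi (Q1 \<times> Q2)"
    and fin: "\<And>Q1 Q2 k. Q1 \<in> C1 \<Longrightarrow> Q2 \<in> C2 \<Longrightarrow>
      (\<integral>\<^sup>+z\<in>Q1 \<times> Q2. ennreal (norm (row k (Vi z)) powr conj_exp p) \<partial>lborel) < \<infinity>"
  shows "AE y in lborel. \<forall>Q1\<in>C1.
    factored_Ap lborel p (2 powr (2 * p + 1) * A) (\<lambda>x. V (x, y)) (\<lambda>x. Vi (x, y)) Q1"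
proof -
  define q where "q = conj_exp p"
  obtain E :: "(complex^'d) set" where E: "countable E" "\<And>S. open S \<Longrightarrow> S \<noteq> {} \<Longrightarrow> \<exists>e\<in>E. e \<in> S"
  proof (rule countable_dense_setE)
    fix D :: "(complex^'d) set" assume "countable D" "\<And>S. open S \<Longrightarrow> S \<noteq> {} \<Longrightarrow> \<exists>e\<in>D. e \<in> S"
    then show thesis by (rule that)
  qed
  have clE: "closure E = UNIV"
  proof -
    have "- closure E = {}"
    proof (rule ccontr)
      assume "- closure E \<noteq> {}"
      from E(2)[OF _ this] obtain e where "e \<in> E" "e \<in> - closure E" by (auto simp: open_Compl)
      then show False using closure_subset by blast
    qed
    then show ?thesis by blast
  qed
  obtain X :: "(complex^'d^'d) set" where X: "countable X" "\<And>S. open S \<Longrightarrow> S \<noteq> {} \<Longrightarrow> \<exists>e\<in>X. e \<in> S"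
  proof (rule countable_dense_setE)
    fix D :: "(complex^'d^'d) set" assume "countable D" "\<And>S. open S \<Longrightarrow> S \<noteq> {} \<Longrightarrow> \<exists>e\<in>D. e \<in> S"
    then show thesis by (rule that)
  qed
  define \<Psi> where "\<Psi> = (\<lambda>(U :: complex^'d^'d, i). column i (SOME U'. U ** U' = mat 1)) ` (X \<times> UNIV)"
  have \<Psi>: "countable \<Psi>" unfolding \<Psi>_def using X(1) by (intro countable_image countable_SIGMA) auto
  have in\<Psi>: "column i U' \<in> \<Psi>" if "U \<in> X" "U ** U' = mat 1" for U U' i
  proof -
    have "(SOME U'. U ** U' = mat 1) = U'"
    proof (rule some_equality[where P = "\<lambda>U'. U ** U' = mat 1"])
      show "U ** U' = mat 1" by fact
      fix U'' assume "U ** U'' = mat 1"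
      have "U'' = (U' ** U) ** U''" using matrix_left_right_inverse1[OF that(2)] by simp
      also have "\<dots> = U' ** (U ** U'')" by (simp only: matrix_mul_assoc)
      also have "\<dots> = U'" by (simp add: \<open>U ** U'' = mat 1\<close>)
      finally show "U'' = U'" .
    qed
    then show ?thesis unfolding \<Psi>_def using that(1) by (intro image_eqI[where x = "(U, i)"]) auto
  qed
  have test: "AE y in lborel. \<forall>\<psi>\<in>\<Psi>.
    (\<forall>e\<in>E. ennreal (norm (pairing e \<psi>) powr conj_exp p * measure lborel Q1)
        \<le> ennreal (2 powr conj_exp p) * (\<integral>\<^sup>+x\<in>Q1. ennreal (norm (e v* Vi (x, y)) powr conj_exp p) \<partial>lborel)) \<longrightarrow>
    (\<integral>\<^sup>+x\<in>Q1. ennreal (norm (V (x, y) *v \<psi>) powr p) \<partial>lborel) \<le> ennreal (2 powr (2 * p + 1) * A * measure lborel Q1)"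
    if Q1: "Q1 \<in> C1" for Q1
    unfolding AE_ball_countable[OF \<Psi>]
  proof (rule ballI, rule slice_test_null[where ?C2.0 = C2])
    show "\<exists>Q\<in>C2. emeasure lborel Q \<le> 2 * emeasure lborel (Z \<inter> Q)"
      if "Z \<in> sets borel" "0 < emeasure lborel Z" for Z using that by (rule dens)
  qed (rule p A V C1(2-4)[OF Q1] C2(2-4) dual[OF Q1] fin[OF Q1] E(1) clE, assumption?)+
  have finite_slice: "AE y in lborel. \<forall>k. (\<integral>\<^sup>+x\<in>Q1. ennreal (norm (row k (Vi (x, y))) powr conj_exp p) \<partial>lborel) < \<infinity>"
    if Q1: "Q1 \<in> C1" for Q1
  proof -
    have [measurable]: "Q1 \<in> sets borel" using C1(2)[OF Q1] .
    have row_meas [measurable]: "(\<lambda>z. row k (Vi z)) \<in> borel_measurable borel" for k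
      unfolding vector_matrix_axis[symmetric] by measurable
    have fk: "AE y in lborel. \<forall>Q2\<in>C2. y \<in> Q2 \<longrightarrow> (\<integral>\<^sup>+x\<in>Q1. ennreal (norm (row k (Vi (x, y))) powr conj_exp p) \<partial>lborel) < \<infinity>" for k
      unfolding AE_ball_countable[OF C2(1)]
    proof
      fix Q2 assume Q2: "Q2 \<in> C2"
      have [measurable]: "Q2 \<in> sets borel" using C2(2)[OF Q2] .
      define h where "h y = (\<integral>\<^sup>+x\<in>Q1. ennreal (norm (row k (Vi (x, y))) powr conj_exp p) \<partial>lborel)" for y
      have [measurable]: "h \<in> borel_measurable borel"
        unfolding h_def
        by (rule slice_integral_measurable[where f = "\<lambda>z. ennreal (norm (row k (Vi z)) powr conj_exp p)"]) measurable
      have "(\<integral>\<^sup>+y. h y * indicator Q2 y \<partial>lborel) < \<infinity>"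
        using fin[OF Q1 Q2, of k] unfolding h_def
        by (subst (asm) nn_integral_rectangle(1)) measurable
      then have "AE y in lborel. h y * indicator Q2 y \<noteq> \<infinity>"
        by (intro nn_integral_PInf_AE) auto
      then show "AE y in lborel. y \<in> Q2 \<longrightarrow> (\<integral>\<^sup>+x\<in>Q1. ennreal (norm (row k (Vi (x, y))) powr conj_exp p) \<partial>lborel) < \<infinity>"
      proof (rule eventually_mono, intro impI)
        fix y assume "h y * indicator Q2 y \<noteq> \<infinity>" "y \<in> Q2"
        then show "(\<integral>\<^sup>+x\<in>Q1. ennreal (norm (row k (Vi (x, y))) powr conj_exp p) \<partial>lborel) < \<infinity>"
          by (simp add: h_def less_top)
      qed
    qed
    have "AE y in lborel. \<forall>k\<in>UNIV. \<forall>Q2\<in>C2. y \<in> Q2 \<longrightarrow> (\<integral>\<^sup>+x\<in>Q1. ennreal (norm (row k (Vi (x, y))) powr conj_exp p) \<partial>lborel) < \<infinity>"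
      by (rule AE_finite_allI[OF finite]) (rule fk)
    then show ?thesis
    proof (rule eventually_mono, intro allI)
      fix y k
      assume *: "\<forall>k\<in>UNIV. \<forall>Q2\<in>C2. y \<in> Q2 \<longrightarrow> (\<integral>\<^sup>+x\<in>Q1. ennreal (norm (row k (Vi (x, y))) powr conj_exp p) \<partial>lborel) < \<infinity>"
      have "y \<in> \<Union>C2" by (simp add: C2(5))
      then obtain Q2 where Q2: "Q2 \<in> C2" "y \<in> Q2" by (rule UnionE)
      show "(\<integral>\<^sup>+x\<in>Q1. ennreal (norm (row k (Vi (x, y))) powr conj_exp p) \<partial>lborel) < \<infinity>"
        by (rule mp[OF bspec[OF bspec[OF * UNIV_I] Q2(1)] Q2(2)])
    qed
  qed
  show ?thesis
    unfolding AE_ball_countable[OF C1(1)]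
  proof
    fix Q1 assume Q1: "Q1 \<in> C1"
    show "AE y in lborel. factored_Ap lborel p (2 powr (2 * p + 1) * A) (\<lambda>x. V (x, y)) (\<lambda>x. Vi (x, y)) Q1"
      using test[OF Q1] finite_slice[OF Q1]
    proof eventually_elim
      case (elim y)
      show ?case
      proof (rule factored_Ap_of_tests[where X = X, OF p])
        show "(\<lambda>x. Vi (x, y)) \<in> borel_measurable lborel" using slice_measurable(1)[OF V(2)] by simp
        show "\<exists>U\<in>X. U \<in> S" if "open S" "S \<noteq> {}" for S using that by (rule X(2))
        show "(\<integral>\<^sup>+x\<in>Q1. ennreal (norm (V (x, y) *v column i U') powr p) \<partial>lborel)
            \<le> ennreal (2 powr (2 * p + 1) * A * measure lborel Q1)"
          if "U \<in> X" "U ** U' = mat 1"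
            "\<And>e. ennreal (norm (pairing e (column i U')) powr conj_exp p * measure lborel Q1)
              \<le> ennreal (2 powr conj_exp p) * (\<integral>\<^sup>+x\<in>Q1. ennreal (norm (e v* Vi (x, y)) powr conj_exp p) \<partial>lborel)"
          for U U' i
          by (rule mp[OF bspec[OF elim(1) in\<Psi>[OF that(1,2)]]]) (use that(3) in blast)
      qed (use C1(2-4)[OF Q1] inv elim(2) in auto)
    qed
  qed
qed

section \<open>Dyadic cubes and Haar functions\<close>

definition icube :: "('n \<Rightarrow> real set) \<Rightarrow> (real^'n) set"
  where "icube I = {x. \<forall>i. x $ i \<in> I i}"

text \<open>
  A dyadic grid with the levels of the partitions in each coordinate made explicit.
\<close>

locale dyadic_levels =
  fixes G :: "'n::finite \<Rightarrow> int \<Rightarrow> real set set"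
  assumes G_part: "partition_on UNIV (G i k)"
    and G_shape: "I \<in> G i k \<Longrightarrow> \<exists>a. I = {a ..< a + 2 powi (- k)}"
    and G_halves: "I \<in> G i k \<Longrightarrow> \<exists>J\<in>G i (k + 1). \<exists>K\<in>G i (k + 1). J \<noteq> K \<and> I = J \<union> K"
begin

definition cubes :: "int \<Rightarrow> (real^'n) set set"
  where "cubes k = {icube I | I. \<forall>i. I i \<in> G i k}"

definition vol :: "int \<Rightarrow> real"
  where "vol k = (2 powi (- k)) ^ CARD('n)"

definition the_cube :: "int \<Rightarrow> real^'n \<Rightarrow> (real^'n) set"
  where "the_cube k x = (THE Q. Q \<in> cubes k \<and> x \<in> Q)"

lemma G_disjoint: "I \<in> G i k \<Longrightarrow> J \<in> G i k \<Longrightarrow> t \<in> I \<Longrightarrow> t \<in> J \<Longrightarrow> I = J"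
  using G_part[of i k] by (auto simp: partition_on_def disjoint_def)

lemma G_nonempty: "I \<in> G i k \<Longrightarrow> I \<noteq> {}"
  using G_part[of i k] by (auto simp: partition_on_def)

text \<open>
  Two intervals of half the length can only cover \<open>{a ..< a + h}\<close> as its left and right half.
\<close>

lemma halves:
  assumes "{a ..< a + h} \<in> G i k" "h = 2 powi (- k)"
  shows "{a ..< a + h/2} \<in> G i (k + 1)" "{a + h/2 ..< a + h} \<in> G i (k + 1)"
    and "J \<in> G i (k + 1) \<Longrightarrow> J \<subseteq> {a ..< a + h} \<Longrightarrow> J = {a ..< a + h/2} \<or> J = {a + h/2 ..< a + h}"
proof -
  have h: "0 < h" using assms by simp
  have h2: "2 powi (- (k + 1)) = h / 2"
    unfolding assms(2) by (simp add: power_int_diff)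
  have main: "b = a \<and> c = a + h/2"
    if G: "{b ..< b + h/2} \<in> G i (k + 1)" "{c ..< c + h/2} \<in> G i (k + 1)" and bc: "b < c"
      and eq: "{a ..< a + h} = {b ..< b + h/2} \<union> {c ..< c + h/2}" for b c
  proof -
    have eq': "a \<le> t \<and> t < a + h \<longleftrightarrow> b \<le> t \<and> t < b + h/2 \<or> c \<le> t \<and> t < c + h/2" for t
      using arg_cong[OF eq, of "\<lambda>S. t \<in> S"] by simp
    have ba: "b = a" using eq'[of a] eq'[of b] h bc by linarith
    have "\<not> c < b + h/2"
    proof
      assume "c < b + h/2"
      then have "{b ..< b + h/2} = {c ..< c + h/2}"
        using bc h by (intro G_disjoint[OF G, of c]) auto
      then have "b \<in> {b ..< b + h/2} \<longleftrightarrow> b \<in> {c ..< c + h/2}" by (rule arg_cong)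
      then show False using bc h by simp
    qed
    then show ?thesis using eq'[of "a + h/2"] ba h by linarith
  qed
  obtain J K where JK: "J \<in> G i (k + 1)" "K \<in> G i (k + 1)" "J \<noteq> K" "{a ..< a + h} = J \<union> K"
    using G_halves[OF assms(1)] by (elim bexE conjE) (rule that)
  obtain b where b: "J = {b ..< b + h/2}"
    using G_shape[OF JK(1)] unfolding h2 by (elim exE) (rule that)
  obtain c where c: "K = {c ..< c + h/2}"
    using G_shape[OF JK(2)] unfolding h2 by (elim exE) (rule that)
  note G' = JK(1)[unfolded b] JK(2)[unfolded c]
  note eq = JK(4)[unfolded b c]
  have "b < c \<or> c < b" using JK(3) b c by auto
  then have two: "{a ..< a + h/2} \<in> G i (k + 1) \<and> {a + h/2 ..< a + h} \<in> G i (k + 1)"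
  proof
    assume "b < c"
    from main[OF G' this eq] G' show ?thesis by (simp add: add.assoc)
  next
    assume "c < b"
    from main[OF G'(2,1) this eq[unfolded Un_commute[of "{b ..< b + h/2}"]]] G' show ?thesis by (simp add: add.assoc)
  qed
  then show 1: "{a ..< a + h/2} \<in> G i (k + 1)" and 2: "{a + h/2 ..< a + h} \<in> G i (k + 1)" by auto
  show "J = {a ..< a + h/2} \<or> J = {a + h/2 ..< a + h}" if "J \<in> G i (k + 1)" "J \<subseteq> {a ..< a + h}" for J
  proof -
    have "J \<noteq> {}" using that(1) by (rule G_nonempty)
    then obtain t where t: "t \<in> J" by blast
    then have "t \<in> {a ..< a + h/2} \<or> t \<in> {a + h/2 ..< a + h}" using that(2) by auto
    then show ?thesis using G_disjoint[OF that(1) 1 t] G_disjoint[OF that(1) 2 t] by auto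
  qed
qed

lemma cell_ex: "\<exists>I. (\<forall>i. I i \<in> G i k \<and> x i \<in> I i)"
proof -
  have "\<exists>J. J \<in> G i k \<and> x i \<in> J" for i
    using G_part[of i k] by (auto simp: partition_on_def)
  then have "\<forall>i. \<exists>J. J \<in> G i k \<and> x i \<in> J" ..
  then show ?thesis by (rule choice)
qed

lemma cubes_ex:
  assumes "Q \<in> cubes k"
  shows "\<exists>a. (\<forall>i. {a i ..< a i + 2 powi (- k)} \<in> G i k) \<and> Q = icube (\<lambda>i. {a i ..< a i + 2 powi (- k)})"
proof -
  obtain I where I: "Q = icube I" "\<forall>i. I i \<in> G i k" using assms by (auto simp: cubes_def)
  have "\<exists>a. I i = {a ..< a + 2 powi (- k)}" for i using G_shape[of "I i" i k] I(2) by simp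
  then have "\<exists>a. \<forall>i. I i = {a i ..< a i + 2 powi (- k)}" by (intro choice) simp
  then obtain a where a: "\<forall>i. I i = {a i ..< a i + 2 powi (- k)}" ..
  then have "I = (\<lambda>i. {a i ..< a i + 2 powi (- k)})" by (simp add: fun_eq_iff)
  with a I show ?thesis by (intro exI[of _ a]) simp
qed

lemma cubesE:
  assumes "Q \<in> cubes k"
  obtains a where "Q = icube (\<lambda>i. {a i ..< a i + 2 powi (- k)})"
  using cubes_ex[OF assms] by (elim exE conjE) (rule that)

lemma cubesE2:
  assumes "Q \<in> cubes k" "h = 2 powi (- k)"
  obtains a where "\<forall>i. {a i ..< a i + h} \<in> G i k" "Q = icube (\<lambda>i. {a i ..< a i + h})"
  using cubes_ex[OF assms(1), folded assms(2)] by (elim exE conjE) (rule that)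

lemma icube_nonempty: "(\<And>i. I i \<noteq> {}) \<Longrightarrow> icube I \<noteq> {}"
proof -
  assume "\<And>i. I i \<noteq> {}"
  then have "\<exists>t. t \<in> I i" for i by blast
  then have "\<exists>f. \<forall>i. f i \<in> I i" by (intro choice) simp
  then obtain f where "\<forall>i. f i \<in> I i" ..
  then have "(\<chi> i. f i) \<in> icube I" by (simp add: icube_def)
  then show ?thesis by blast
qed

lemma icube_mono_iff:
  assumes "\<And>i. I' i \<noteq> {}" "icube I' \<subseteq> icube I" shows "I' i \<subseteq> I i"
proof
  fix t assume t: "t \<in> I' i"
  obtain y where y: "y \<in> icube I'" using icube_nonempty[of I'] assms(1) by blast
  define x where "x = (\<chi> j. if j = i then t else y $ j)"
  have "x \<in> icube I'" using y t by (simp add: x_def icube_def)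
  then have "x \<in> icube I" using assms(2) by blast
  then have "x $ i \<in> I i" unfolding icube_def by blast
  then show "t \<in> I i" by (simp add: x_def)
qed

lemma side_icube:
  assumes "\<And>i. I i \<noteq> {}" shows "side (icube I) i = I i"
proof
  show "side (icube I) i \<subseteq> I i" by (auto simp: side_def icube_def)
  show "I i \<subseteq> side (icube I) i"
  proof
    fix t assume t: "t \<in> I i"
    obtain y where y: "y \<in> icube I" using icube_nonempty[of I] assms by blast
    define x where "x = (\<chi> j. if j = i then t else y $ j)"
    have "x \<in> icube I" "x $ i = t" using y t by (auto simp: x_def icube_def)
    then show "t \<in> side (icube I) i" unfolding side_def by (intro image_eqI[where x = x]) auto
  qed
qed

lemma vol_pos: "0 < vol k" by (simp add: vol_def)

lemma vol_Suc: "vol k = 2 ^ CARD('n) * vol (k + 1)"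
proof -
  have "2 powi (- k) = 2 * (2::real) powi (- (k + 1))"
    using power_int_add[of "2::real" 1 "- (k + 1)"] by simp
  then show ?thesis by (simp add: vol_def power_mult_distrib)
qed

lemma icube_measurable: "icube (\<lambda>i. {a i ..< a i + h}) \<in> sets borel"
proof -
  have "icube (\<lambda>i. {a i ..< a i + h}) = (\<Inter>i. {x. a i \<le> x $ i} \<inter> {x. x $ i < a i + h})"
    by (auto simp: icube_def)
  also have "\<dots> \<in> sets borel"
    by (intro sets.countable_INT'' sets.Int borel_closed borel_open closed_Collect_le open_Collect_less continuous_intros) auto
  finally show ?thesis .
qed

lemma icube_box:
  assumes "0 < h"
  shows "box (\<chi> i. a i) (\<chi> i. a i + h) \<subseteq> icube (\<lambda>i. {a i ..< a i + h})"
    "icube (\<lambda>i. {a i ..< a i + h}) \<subseteq> cbox (\<chi> i. a i) (\<chi> i. a i + h)"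
    "box (\<chi> i. a i) (\<chi> i. a i + h) \<noteq> {}"
proof -
  show "box (\<chi> i. a i) (\<chi> i. a i + h) \<subseteq> icube (\<lambda>i. {a i ..< a i + h})"
    by (auto simp: icube_def mem_box_cart less_imp_le)
  show "icube (\<lambda>i. {a i ..< a i + h}) \<subseteq> cbox (\<chi> i. a i) (\<chi> i. a i + h)"
    by (auto simp: icube_def mem_box_cart less_imp_le)
  have "(\<chi> i. a i + h/2) \<in> box (\<chi> i. a i) (\<chi> i. a i + h)"
    using assms by (simp add: mem_box_cart)
  then show "box (\<chi> i. a i) (\<chi> i. a i + h) \<noteq> {}" by blast
qed

lemma cubes_measure:
  assumes Q: "Q \<in> cubes k"
  shows "Q \<in> sets borel" "emeasure lborel Q = ennreal (vol k)" "measure lborel Q = vol k"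
proof -
  define h :: real where "h = 2 powi (- k)"
  have h: "0 < h" by (simp add: h_def)
  obtain a where a: "Q = icube (\<lambda>i. {a i ..< a i + h})" by (rule cubesE2[OF Q h_def])
  show Qs: "Q \<in> sets borel" unfolding a by (rule icube_measurable)
  define l u :: "real^'n" where "l = (\<chi> i. a i)" and "u = (\<chi> i. a i + h)"
  have diff: "(u - l) \<bullet> b = h" if "b \<in> Basis" for b
  proof -
    obtain i where i: "b = axis i 1" using \<open>b \<in> Basis\<close> by (auto simp: Basis_vec_def)
    have "(u - l) $ i = h" by (simp add: u_def l_def)
    then show ?thesis unfolding i by (simp add: inner_axis)
  qed
  then have le: "l \<bullet> b \<le> u \<bullet> b" if "b \<in> Basis" for b
    using h diff[OF that] unfolding inner_diff_left by linarith
  have vol: "(\<Prod>b\<in>Basis. (u - l) \<bullet> b) = vol k"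
    using diff by (simp add: vol_def h_def[symmetric])
  have "emeasure lborel (box l u) \<le> emeasure lborel Q"
    unfolding a l_def u_def using icube_measurable[of a h] icube_box(1)[OF h] by (intro emeasure_mono) auto
  moreover have "emeasure lborel Q \<le> emeasure lborel (cbox l u)"
    unfolding a l_def u_def using icube_box(2)[OF h] by (intro emeasure_mono) auto
  ultimately show e: "emeasure lborel Q = ennreal (vol k)"
    using le by (simp add: emeasure_lborel_cbox_eq vol)
  show "measure lborel Q = vol k" using vol_pos[of k] by (simp add: measure_def e)
qed

lemma cubes_partition: "partition_on UNIV (cubes k)"
proof (rule partition_onI)
  show "\<Union>(cubes k) = UNIV"
  proof (intro equalityI subset_UNIV subsetI)
    fix x :: "real^'n"
    obtain I where I: "\<forall>i. I i \<in> G i k \<and> x $ i \<in> I i" using cell_ex[of k "\<lambda>i. x $ i"] ..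
    then have "icube I \<in> cubes k" "x \<in> icube I" by (auto simp: cubes_def icube_def)
    then show "x \<in> \<Union>(cubes k)" by blast
  qed
  show "{} \<notin> cubes k"
  proof
    assume "{} \<in> cubes k"
    then show False using cubes_measure(3)[of "{}" k] vol_pos[of k] by simp
  qed
  show "disjnt Q Q'" if Q: "Q \<in> cubes k" and Q': "Q' \<in> cubes k" and ne: "Q \<noteq> Q'" for Q Q'
  proof (rule ccontr)
    assume "\<not> disjnt Q Q'"
    then obtain x where x: "x \<in> Q" "x \<in> Q'" by (auto simp: disjnt_def)
    obtain I where I1: "Q = icube I" "\<forall>i. I i \<in> G i k" using Q by (auto simp: cubes_def)
    obtain I' where I2: "Q' = icube I'" "\<forall>i. I' i \<in> G i k" using Q' by (auto simp: cubes_def)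
    note I = I1 I2
    have "I i = I' i" for i
      using G_disjoint[of "I i" i k "I' i" "x $ i"] I x by (simp add: icube_def)
    then have "I = I'" by (simp add: fun_eq_iff)
    then show False using I ne by simp
  qed
qed

lemma cubes_countable: "countable (cubes k)"
proof (rule countable_disjoint_nonempty_interior_subsets)
  show "pairwise disjnt (cubes k)" using cubes_partition[of k] by (simp add: partition_on_def disjoint_def pairwise_def disjnt_def)
  fix Q assume Q: "Q \<in> cubes k" "interior Q = {}"
  obtain a where "Q = icube (\<lambda>i. {a i ..< a i + 2 powi (- k)})" by (rule cubesE[OF Q(1)])
  then have "box (\<chi> i. a i) (\<chi> i. a i + 2 powi (- k)) \<subseteq> interior Q"
    using icube_box(1)[of "2 powi (- k)" a] by (intro interior_maximal) auto
  then show "Q = {}" using Q(2) icube_box(3)[of "2 powi (- k)" a] by simp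
qed

lemma cubes_form_tree: "cube_tree lborel (\<lambda>j. cubes (m + int j)) (2 ^ CARD('n))"
proof
  fix Q and k :: nat assume Q: "Q \<in> cubes (m + int k)"
  define K where "K = m + int k"
  have K1: "m + int (Suc k) = K + 1" by (simp add: K_def)
  define h :: real where "h = 2 powi (- K)"
  obtain a where a: "\<forall>i. {a i ..< a i + h} \<in> G i K" "Q = icube (\<lambda>i. {a i ..< a i + h})"
    by (rule cubesE2[OF Q[folded K_def] h_def])
  have h0: "0 < h" by (simp add: h_def)
  note hv = halves[OF a(1)[rule_format] h_def]
  show "finite {P \<in> cubes (m + int (Suc k)). P \<subseteq> Q}"
  proof (rule finite_subset)
    show "{P \<in> cubes (m + int (Suc k)). P \<subseteq> Q}
        \<subseteq> icube ` (PiE UNIV (\<lambda>i. {{a i ..< a i + h/2}, {a i + h/2 ..< a i + h}}))"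
    proof
      fix P assume "P \<in> {P \<in> cubes (m + int (Suc k)). P \<subseteq> Q}"
      then obtain I where I: "P = icube I" "\<forall>i. I i \<in> G i (K + 1)" "P \<subseteq> Q"
        unfolding K1 cubes_def by blast
      have "I i \<subseteq> {a i ..< a i + h}" for i
        by (rule icube_mono_iff[of I]) (use I(1,3) I(2)[rule_format, THEN G_nonempty] a(2) in simp_all)
      then have "I i = {a i ..< a i + h/2} \<or> I i = {a i + h/2 ..< a i + h}" for i
        using hv(3)[of "I i" i] I(2) by simp
      then show "P \<in> icube ` (PiE UNIV (\<lambda>i. {{a i ..< a i + h/2}, {a i + h/2 ..< a i + h}}))"
        using I(1) by (intro image_eqI[where x = I]) auto
    qed
  qed (intro finite_imageI finite_PiE; simp)
  show "\<Union>{P \<in> cubes (m + int (Suc k)). P \<subseteq> Q} = Q"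
  proof
    show "\<Union>{P \<in> cubes (m + int (Suc k)). P \<subseteq> Q} \<subseteq> Q" by blast
    show "Q \<subseteq> \<Union>{P \<in> cubes (m + int (Suc k)). P \<subseteq> Q}"
    proof
      fix x assume x: "x \<in> Q"
      define I where "I i = (if x $ i < a i + h/2 then {a i ..< a i + h/2} else {a i + h/2 ..< a i + h})" for i
      have xi: "a i \<le> x $ i" "x $ i < a i + h" for i using x by (auto simp: a(2) icube_def)
      have "icube I \<in> cubes (K + 1)" using hv(1,2) by (auto simp: cubes_def I_def)
      moreover have "I i \<subseteq> {a i ..< a i + h}" for i using h0 by (auto simp: I_def)
      then have "icube I \<subseteq> Q" unfolding a(2) icube_def by blast
      moreover have "x \<in> icube I" using xi by (auto simp: icube_def I_def not_less)
      ultimately show "x \<in> \<Union>{P \<in> cubes (m + int (Suc k)). P \<subseteq> Q}" unfolding K1 by blast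
    qed
  qed
  fix P assume P: "P \<in> cubes (m + int (Suc k))"
  show "measure lborel Q \<le> 2 ^ CARD('n) * measure lborel P"
    using cubes_measure(3)[OF P] cubes_measure(3)[OF Q] vol_Suc[of K] unfolding K1 K_def by simp
qed (simp_all add: cubes_measure cubes_partition cubes_countable vol_pos)

lemma haar1_value:
  assumes "0 < h"
  shows "haar1 e {a ..< a + h} t =
    (if a \<le> t \<and> t < a + h then (if e \<or> a + h/2 \<le> t then 1 else - 1) else 0) / sqrt h"
proof -
  have "Inf {a ..< a + h} = a" "Sup {a ..< a + h} = a + h"
    using assms by (auto intro: cInf_atLeastLessThan cSup_atLeastLessThan)
  then have mid: "(Inf {a ..< a + h} + Sup {a ..< a + h}) / 2 = a + h/2" by simp
  have "measure lborel {a ..< a + h} = h" using assms by simp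
  then show ?thesis
    using assms by (auto simp: haar1_def left_half_def right_half_def mid indicator_def)
qed

lemma haar_cube_value:
  assumes "0 < h"
  shows "haar_cube e (icube (\<lambda>i. {a i ..< a i + h})) x = (\<Prod>i\<in>UNIV. haar1 (e i) {a i ..< a i + h} (x $ i))"
  using assms by (simp add: haar_cube_def side_icube)

lemma haar_cube_measurable: "Q \<in> cubes k \<Longrightarrow> haar_cube e Q \<in> borel_measurable borel"
proof -
  assume Q: "Q \<in> cubes k"
  obtain a where a: "Q = icube (\<lambda>i. {a i ..< a i + 2 powi (- k)})" by (rule cubesE[OF Q])
  have "haar_cube e Q = (\<lambda>x. \<Prod>i\<in>UNIV. haar1 (e i) {a i ..< a i + 2 powi (- k)} (x $ i))"
    unfolding a by (rule ext) (rule haar_cube_value, simp)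
  also have "\<dots> \<in> borel_measurable borel"
    by (intro borel_measurable_prod) (simp add: haar1_value)
  finally show ?thesis .
qed

lemma haar_cube_outside: assumes Q: "Q \<in> cubes k" and x: "x \<notin> Q" shows "haar_cube e Q x = 0"
proof -
  obtain a where a: "Q = icube (\<lambda>i. {a i ..< a i + 2 powi (- k)})" by (rule cubesE[OF Q])
  obtain i where "x $ i \<notin> {a i ..< a i + 2 powi (- k)}" using x by (auto simp: a icube_def)
  then have "haar1 (e i) {a i ..< a i + 2 powi (- k)} (x $ i) = 0" by (simp add: haar1_value)
  then show ?thesis unfolding a by (subst haar_cube_value) (auto intro!: prod_zero)
qed

lemma haar_cube_bound: assumes Q: "Q \<in> cubes k" shows "\<bar>haar_cube e Q x\<bar> \<le> 1 / sqrt (vol k)"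
proof -
  obtain a where a: "Q = icube (\<lambda>i. {a i ..< a i + 2 powi (- k)})" by (rule cubesE[OF Q])
  have "\<bar>haar_cube e Q x\<bar> = (\<Prod>i\<in>UNIV. \<bar>haar1 (e i) {a i ..< a i + 2 powi (- k)} (x $ i)\<bar>)"
    unfolding a by (subst haar_cube_value) (auto simp: abs_prod)
  also have "\<dots> \<le> (\<Prod>i\<in>(UNIV::'n set). 1 / sqrt (2 powi (- k)))"
    by (intro prod_mono) (simp add: haar1_value abs_divide)
  also have "\<dots> = 1 / sqrt (vol k)" by (simp add: vol_def real_sqrt_power power_one_over)
  finally show ?thesis .
qed

lemma haar_cube_const:
  assumes Q: "Q \<in> cubes k" and P: "P \<in> cubes (k + 1)" "P \<subseteq> Q" and xy: "x \<in> P" "y \<in> P"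
  shows "haar_cube e Q x = haar_cube e Q y"
proof -
  define h :: real where "h = 2 powi (- k)"
  have h: "0 < h" by (simp add: h_def)
  obtain a where a: "\<forall>i. {a i ..< a i + h} \<in> G i k" "Q = icube (\<lambda>i. {a i ..< a i + h})"
    by (rule cubesE2[OF Q h_def])
  obtain I where I: "P = icube I" "\<forall>i. I i \<in> G i (k + 1)" using P by (auto simp: cubes_def)
  have "haar1 (e i) {a i ..< a i + h} (x $ i) = haar1 (e i) {a i ..< a i + h} (y $ i)" for i
  proof -
    have "I i \<subseteq> {a i ..< a i + h}"
      by (rule icube_mono_iff[of I]) (use I(1) I(2)[rule_format, THEN G_nonempty] a(2) P(2) in simp_all)
    then have "I i = {a i ..< a i + h/2} \<or> I i = {a i + h/2 ..< a i + h}"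
      using halves(3)[OF a(1)[rule_format] h_def, of "I i"] I(2) by simp
    moreover have "x $ i \<in> I i" "y $ i \<in> I i" using xy by (auto simp: I(1) icube_def)
    ultimately show ?thesis using h by (auto simp: haar1_value)
  qed
  then show ?thesis unfolding a(2) using h by (simp add: haar_cube_value)
qed

lemma haar_cube_integrable: assumes Q: "Q \<in> cubes k" shows "integrable lborel (haar_cube e Q)"
proof (rule Bochner_Integration.integrable_bound)
  show "integrable lborel (\<lambda>x. 1 / sqrt (vol k) * indicator Q x)"
    using cubes_measure[OF Q] by (intro integrable_mult_right integrable_real_indicator) auto
  show "haar_cube e Q \<in> borel_measurable lborel" using haar_cube_measurable[OF Q] by simp
  show "AE x in lborel. norm (haar_cube e Q x) \<le> norm (1 / sqrt (vol k) * indicator Q x)"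
  proof (rule AE_I2)
    fix x
    show "norm (haar_cube e Q x) \<le> norm (1 / sqrt (vol k) * indicator Q x)"
      using haar_cube_bound[OF Q, of e x] haar_cube_outside[OF Q, of x e] by (cases "x \<in> Q") (auto simp: vol_pos less_imp_le)
  qed
qed

text \<open>Translation by half a side in a cancellative direction exchanges the two halves and flips the sign.\<close>

lemma haar_cube_integral_0:
  assumes Q: "Q \<in> cubes k" and e: "e \<noteq> (\<lambda>_. True)"
  shows "(\<integral>x. haar_cube e Q x \<partial>lborel) = 0"
proof -
  define h :: real where "h = 2 powi (- k)"
  have h: "0 < h" by (simp add: h_def)
  obtain a where a: "Q = icube (\<lambda>i. {a i ..< a i + h})" by (rule cubesE2[OF Q h_def])
  obtain j where j: "e j = False" using e by (auto simp: fun_eq_iff)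
  define s :: "real^'n" where "s = axis j (h/2)"
  define U where "U = {x::real^'n. a j + h/2 \<le> x $ j}"
  have [measurable]: "U \<in> sets borel"
    unfolding U_def by (intro borel_closed closed_Collect_le continuous_intros)
  define f where "f = haar_cube e Q"
  have f_eq: "f x = (\<Prod>i\<in>UNIV. haar1 (e i) {a i ..< a i + h} (x $ i))" for x
    unfolding f_def a by (rule haar_cube_value[OF h])
  have f_int: "integrable lborel f" unfolding f_def by (rule haar_cube_integrable[OF Q])
  have flip: "indicator U (s + x) * f (s + x) = - (indicator (- U) x * f x)" for x
  proof -
    have "f (s + x) = haar1 False {a j ..< a j + h} (x $ j + h/2) * (\<Prod>i\<in>UNIV - {j}. haar1 (e i) {a i ..< a i + h} (x $ i))"
      unfolding f_eq by (subst prod.remove[of _ j]) (auto simp: s_def axis_def j add.commute intro!: prod.cong)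
    moreover have "f x = haar1 False {a j ..< a j + h} (x $ j) * (\<Prod>i\<in>UNIV - {j}. haar1 (e i) {a i ..< a i + h} (x $ i))"
      unfolding f_eq by (subst prod.remove[of _ j]) (auto simp: j)
    moreover have "indicator U (s + x) * haar1 False {a j ..< a j + h} (x $ j + h/2)
        = - (indicator (- U) x * haar1 False {a j ..< a j + h} (x $ j))"
      using h by (auto simp: haar1_value indicator_def U_def s_def axis_def)
    ultimately show ?thesis by (simp only: mult.assoc[symmetric] minus_mult_left[symmetric])
  qed
  have iU: "integrable lborel (\<lambda>x. indicator U x * f x)" "integrable lborel (\<lambda>x. indicator (- U) x * f x)"
    using integrable_mult_indicator[OF _ f_int, of U] integrable_mult_indicator[OF _ f_int, of "- U"] by auto
  have "(\<integral>x. f x \<partial>lborel) = (\<integral>x. indicator U x * f x + indicator (- U) x * f x \<partial>lborel)"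
    by (intro Bochner_Integration.integral_cong) (auto simp: indicator_def)
  also have "\<dots> = (\<integral>x. indicator U x * f x \<partial>lborel) + (\<integral>x. indicator (- U) x * f x \<partial>lborel)"
    by (rule Bochner_Integration.integral_add[OF iU])
  also have "(\<integral>x. indicator U x * f x \<partial>lborel) = (\<integral>x. indicator U x * f x \<partial>distr lborel borel ((+) s))"
    by (simp only: lborel_distr_plus)
  also have "\<dots> = (\<integral>x. indicator U (s + x) * f (s + x) \<partial>lborel)"
    using borel_measurable_integrable[OF iU(1)] by (intro integral_distr) auto
  also have "\<dots> = - (\<integral>x. indicator (- U) x * f x \<partial>lborel)"
    unfolding flip by simp
  finally show ?thesis by (simp add: f_def)
qed

end

text \<open>
  The length of an interval determines its level, so the cubes of the grid are the products of
  intervals of one common level.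
\<close>

lemma dyadic_grid_levels:
  assumes "dyadic_grid (\<Q> :: (real^'n::finite) set set)"
  obtains G :: "'n::finite \<Rightarrow> int \<Rightarrow> real set set" where "dyadic_levels G" "\<Q> = (\<Union>k. dyadic_levels.cubes G k)"
proof -
  obtain H :: "'n::finite \<Rightarrow> real set set" where H: "\<forall>i. dyadic_grid1 (H i)"
    and Q: "\<Q> = {Q. \<exists>I. (\<forall>i. I i \<in> H i) \<and> (\<forall>i j. measure lborel (I i) = measure lborel (I j)) \<and> Q = {x. \<forall>i. x $ i \<in> I i}}"
    using assms unfolding dyadic_grid_def by (elim exE conjE) (rule that)
  define ok where "ok i D \<longleftrightarrow> H i = (\<Union>k. D k) \<and> (\<forall>k. partition_on UNIV (D k) \<and>
         (\<forall>I\<in>D k. \<exists>a. I = {a ..< a + 2 powi (- k)}) \<and>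
         (\<forall>I\<in>D k. \<exists>J\<in>D (k + 1). \<exists>K\<in>D (k + 1). J \<noteq> K \<and> I = J \<union> K))" for i and D :: "int \<Rightarrow> real set set"
  have "\<exists>D. ok i D" for i using H[rule_format, of i] unfolding dyadic_grid1_def ok_def .
  then have "\<exists>G. \<forall>i. ok i (G i)" by (intro choice) simp
  then obtain G where G: "\<forall>i. ok i (G i)" ..
  have Gi: "H i = (\<Union>k. G i k)" "partition_on UNIV (G i k)"
    "I \<in> G i k \<Longrightarrow> \<exists>a. I = {a ..< a + 2 powi (- k)}"
    "I \<in> G i k \<Longrightarrow> \<exists>J\<in>G i (k + 1). \<exists>K\<in>G i (k + 1). J \<noteq> K \<and> I = J \<union> K" for i k I
    using G[rule_format, of i] unfolding ok_def by blast+
  interpret dyadic_levels G by (rule dyadic_levels.intro) (rule Gi, assumption?)+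
  have len: "measure lborel I = 2 powi (- k)" if "I \<in> G i k" for I i k
    using Gi(3)[OF that] by auto
  have "\<Q> = (\<Union>k. cubes k)"
  proof (intro equalityI subsetI)
    fix X assume "X \<in> \<Q>"
    then obtain I where I: "\<forall>i. I i \<in> H i" "\<forall>i j. measure lborel (I i) = measure lborel (I j)" "X = {x. \<forall>i. x $ i \<in> I i}"
      unfolding Q by (elim CollectE exE conjE) (rule that)
    have "\<exists>k. I i \<in> G i k" for i using I(1) Gi(1) by auto
    then have "\<exists>\<kappa>. \<forall>i. I i \<in> G i (\<kappa> i)" by (intro choice) simp
    then obtain \<kappa> where \<kappa>: "\<forall>i. I i \<in> G i (\<kappa> i)" ..
    have "\<kappa> i = \<kappa> j" for i j
    proof -
      have "(2::real) powi (- \<kappa> i) = 2 powi (- \<kappa> j)"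
        using I(2)[rule_format, of i j] len[OF \<kappa>[rule_format, of i]] len[OF \<kappa>[rule_format, of j]] by simp
      then show ?thesis by (metis neg_equal_iff_equal one_less_numeral_iff power_int_strict_increasing linorder_neqE order_less_irrefl semiring_norm(76))
    qed
    then have eq: "\<kappa> i = \<kappa> undefined" for i .
    \<comment> \<open>Any fixed coordinate serves as a reference for the common level.\<close>
    have "I i \<in> G i (\<kappa> undefined)" for i using \<kappa>[rule_format, of i] unfolding eq[of i] .
    then have "\<forall>i. I i \<in> G i (\<kappa> undefined)" ..
    then show "X \<in> (\<Union>k. cubes k)" using I(3) by (auto simp: cubes_def icube_def)
  next
    fix X assume "X \<in> (\<Union>k. cubes k)"
    then obtain k I where I: "X = icube I" "\<forall>i. I i \<in> G i k" by (auto simp: cubes_def)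
    have "measure lborel (I i) = measure lborel (I j)" for i j using len[OF I(2)[rule_format]] by simp
    moreover have "I i \<in> H i" for i using I(2) Gi(1) by auto
    ultimately show "X \<in> \<Q>" unfolding Q using I(1) by (auto simp: icube_def)
  qed
  with dyadic_levels_axioms show thesis by (rule that)
qed

section \<open>The square function in one parameter\<close>

context dyadic_levels
begin

lemma the_cube_eq: assumes "Q \<in> cubes k" "x \<in> Q" shows "the_cube k x = Q"
  using cube_tree.cube_eq[OF cubes_form_tree[of k], where k = 0 and Q = Q and x = x] assms
  unfolding cube_tree.cube_def[OF cubes_form_tree] the_cube_def by simp

lemma the_cube_in: "the_cube k x \<in> cubes k" "x \<in> the_cube k x"
  using cube_tree.cube_in[OF cubes_form_tree[of k], where k = 0 and x = x]
  unfolding cube_tree.cube_def[OF cubes_form_tree] the_cube_def by simp_all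

lemma the_cube_measurable:
  assumes [measurable]: "g \<in> borel_measurable M"
  shows "(\<lambda>x. the_cube k (g x)) \<in> measurable M (count_space (cubes k))"
  unfolding measurable_count_space_eq_countable[OF cubes_countable]
proof (intro conjI ballI)
  show "(\<lambda>x. the_cube k (g x)) \<in> space M \<rightarrow> cubes k" using the_cube_in by auto
  fix Q assume Q: "Q \<in> cubes k"
  have "(\<lambda>x. the_cube k (g x)) -` {Q} \<inter> space M = g -` Q \<inter> space M"
    using the_cube_in(2)[of _ k] the_cube_eq[OF Q] by blast
  also have "\<dots> \<in> sets M" using cubes_measure(1)[OF Q] by (intro measurable_sets[OF assms])
  finally show "(\<lambda>x. the_cube k (g x)) -` {Q} \<inter> space M \<in> sets M" .
qed

lemma cubes_diameter:
  assumes Q: "Q \<in> cubes k" and xy: "x \<in> Q" "y \<in> Q"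
  shows "dist x y \<le> real CARD('n) * 2 powi (- k)"
proof -
  obtain a where a: "Q = icube (\<lambda>i. {a i ..< a i + 2 powi (- k)})" by (rule cubesE[OF Q])
  have "\<bar>(x - y) $ i\<bar> \<le> 2 powi (- k)" for i
    using xy unfolding a icube_def by (auto simp: abs_le_iff dest!: spec[of _ i])
  then have "(\<Sum>i\<in>UNIV. \<bar>(x - y) $ i\<bar>) \<le> of_nat (card (UNIV :: 'n set)) * 2 powi (- k)"
    by (intro sum_bounded_above)
  then show ?thesis
    unfolding dist_norm using norm_le_l1_cart[of "x - y"] by linarith
qed

text \<open>An open set is the increasing union of the finite-level unions of cubes inside it. Hence a set
  of positive measure, compared with an open superset of less than twice its measure, fills at least
  half of some cube.\<close>

lemma cube_density:
  assumes Z: "Z \<in> sets borel" "0 < emeasure lborel Z"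
  shows "\<exists>Q\<in>(\<Union>k. cubes k). emeasure lborel Q \<le> 2 * emeasure lborel (Z \<inter> Q)"
proof (rule ccontr)
  assume no: "\<not> ?thesis"
  have "\<exists>n::nat. emeasure lborel (Z \<inter> cball 0 (real n)) \<noteq> 0"
  proof (rule ccontr)
    assume "\<not> ?thesis"
    then have "emeasure lborel (\<Union>n::nat. Z \<inter> cball 0 (real n)) = 0"
      using Z(1) by (intro emeasure_UN_eq_0) auto
    moreover have "(\<Union>n::nat. Z \<inter> cball 0 (real n)) = Z" using real_arch_simple by auto
    ultimately show False using Z(2) by simp
  qed
  then obtain n :: nat where n: "emeasure lborel (Z \<inter> cball 0 (real n)) \<noteq> 0" ..
  define Z' where "Z' = Z \<inter> cball 0 (real n)"
  have Z' [measurable]: "Z' \<in> sets borel" using Z(1) by (auto simp: Z'_def)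
  have "emeasure lborel Z' \<le> emeasure lborel (cball (0::real^'n) (real n))"
    unfolding Z'_def by (intro emeasure_mono) auto
  then have "emeasure lborel Z' < \<infinity>" using emeasure_lborel_cball_finite by (rule le_less_trans)
  then obtain z where z: "emeasure lborel Z' = ennreal z" "0 \<le> z" by (cases "emeasure lborel Z'") auto
  have z0: "0 < z" using n z by (cases "z = 0") (auto simp: Z'_def)
  obtain U where U: "open U" "Z' \<subseteq> U" "emeasure lborel (U - Z') < z"
    by (rule outer_regular_lborel[OF Z' z0])
  have [measurable]: "U \<in> sets borel" using U(1) by simp
  have "emeasure lborel U = emeasure lborel Z' + emeasure lborel (U - Z')"
    using U(2) by (subst plus_emeasure) (auto simp: Un_absorb1)
  also have "\<dots> < ennreal z + ennreal z"
    unfolding z(1) using U(3) by (intro ennreal_add_left_cancel_less[THEN iffD2]) auto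
  finally have Uz: "emeasure lborel U < ennreal z + ennreal z" .
  define C where "C j = {Q \<in> cubes (int j). Q \<subseteq> U}" for j
  have sub: "P \<subseteq> the_cube (int j) x" if "P \<in> cubes (int (Suc j))" "x \<in> P" for P j x
    using cube_tree.parent[OF cubes_form_tree[of 0], where P = P and k = j and j = 1 and x = x] that
    unfolding cube_tree.cube_def[OF cubes_form_tree] the_cube_def by (simp add: add.commute)
  have C_mem: "x \<in> \<Union>(C j) \<longleftrightarrow> the_cube (int j) x \<subseteq> U" for x j
  proof
    assume "x \<in> \<Union>(C j)"
    then obtain Q where Q: "Q \<in> cubes (int j)" "Q \<subseteq> U" "x \<in> Q" by (auto simp: C_def)
    then show "the_cube (int j) x \<subseteq> U" using the_cube_eq[OF Q(1,3)] by simp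
  next
    assume "the_cube (int j) x \<subseteq> U"
    then have "the_cube (int j) x \<in> C j" by (simp add: C_def the_cube_in)
    then show "x \<in> \<Union>(C j)" using the_cube_in(2) by blast
  qed
  have inc: "incseq (\<lambda>j. \<Union>(C j))"
  proof (rule incseq_SucI, rule subsetI)
    fix j x assume "x \<in> \<Union>(C j)"
    then have "the_cube (int j) x \<subseteq> U" by (simp only: C_mem)
    then show "x \<in> \<Union>(C (Suc j))"
      unfolding C_mem using sub[OF the_cube_in] by (rule subset_trans[rotated])
  qed
  have U_un: "(\<Union>j. \<Union>(C j)) = U"
  proof (intro equalityI subsetI)
    fix x assume "x \<in> (\<Union>j. \<Union>(C j))" then show "x \<in> U" by (auto simp: C_def)
  next
    fix x assume "x \<in> U"
    then obtain \<epsilon> where \<epsilon>: "0 < \<epsilon>" "ball x \<epsilon> \<subseteq> U" using U(1) by (auto simp: open_contains_ball)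
    obtain j :: nat where j: "(1/2) ^ j < \<epsilon> / real CARD('n)"
      using real_arch_pow_inv[of "\<epsilon> / real CARD('n)" "1/2"] \<epsilon>(1) by auto
    have "2 powi (- int j) = (1/2::real) ^ j" by (simp add: power_int_minus power_one_over inverse_eq_divide)
    then have "2 powi (- int j) < \<epsilon> / real CARD('n)" using j by simp
    then have "real CARD('n) * 2 powi (- int j) < \<epsilon>" by (simp add: pos_less_divide_eq mult.commute)
    then have "the_cube (int j) x \<subseteq> ball x \<epsilon>"
      using cubes_diameter[OF the_cube_in(1), of x "int j" x] the_cube_in(2)[of x "int j"]
      by (auto simp: subset_iff) (meson le_less_trans)
    then have "x \<in> \<Union>(C j)" unfolding C_mem using \<epsilon>(2) by (rule subset_trans)
    then show "x \<in> (\<Union>j. \<Union>(C j))" by blast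
  qed
  have C_sets: "Q \<in> sets borel" if "Q \<in> C j" for Q j using that cubes_measure(1) by (auto simp: C_def)
  have cC: "countable (C j)" for j unfolding C_def by (rule countable_subset[OF _ cubes_countable]) auto
  have dC: "disjoint_family_on (\<lambda>Q. Q) (C j)" for j
    unfolding disjoint_family_on_def
  proof (intro ballI impI)
    fix P Q assume PQ: "P \<in> C j" "Q \<in> C j" "P \<noteq> Q"
    show "P \<inter> Q = {}"
    proof (rule ccontr)
      assume "P \<inter> Q \<noteq> {}"
      then obtain x where x: "x \<in> P" "x \<in> Q" by blast
      have "the_cube (int j) x = P" "the_cube (int j) x = Q"
        using PQ by (simp_all add: C_def the_cube_eq x)
      then show False using PQ(3) by simp
    qed
  qed
  have half: "2 * emeasure lborel (Z' \<inter> \<Union>(C j)) \<le> emeasure lborel U" for j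
  proof -
    have "Z' \<inter> \<Union>(C j) = \<Union>((\<lambda>Q. Z' \<inter> Q) ` C j)" by blast
    moreover have "disjoint_family_on (\<lambda>Q. Z' \<inter> Q) (C j)" using dC[of j] by (auto simp: disjoint_family_on_def)
    ultimately have "2 * emeasure lborel (Z' \<inter> \<Union>(C j)) = 2 * (\<integral>\<^sup>+Q. emeasure lborel (Z' \<inter> Q) \<partial>count_space (C j))"
      using C_sets cC by (subst emeasure_UN_countable[symmetric]) auto
    also have "\<dots> = (\<integral>\<^sup>+Q. 2 * emeasure lborel (Z' \<inter> Q) \<partial>count_space (C j))"
      by (simp add: nn_integral_cmult)
    also have "\<dots> \<le> (\<integral>\<^sup>+Q. emeasure lborel Q \<partial>count_space (C j))"
    proof (rule nn_integral_mono)
      fix Q assume "Q \<in> space (count_space (C j))"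
      then have Q: "Q \<in> C j" by simp
      then have "\<not> emeasure lborel Q \<le> 2 * emeasure lborel (Z \<inter> Q)" using no by (auto simp: C_def)
      moreover have "emeasure lborel (Z' \<inter> Q) \<le> emeasure lborel (Z \<inter> Q)"
        using Z(1) C_sets[OF Q] by (intro emeasure_mono) (auto simp: Z'_def)
      then have "2 * emeasure lborel (Z' \<inter> Q) \<le> 2 * emeasure lborel (Z \<inter> Q)" by (intro mult_left_mono) auto
      ultimately show "2 * emeasure lborel (Z' \<inter> Q) \<le> emeasure lborel Q" by (simp add: not_le)
    qed
    also have "\<dots> = emeasure lborel (\<Union>((\<lambda>Q. Q) ` C j))"
      using C_sets cC dC by (intro emeasure_UN_countable[symmetric]) auto
    also have "\<dots> \<le> emeasure lborel U" by (intro emeasure_mono) (auto simp: C_def)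
    finally show ?thesis .
  qed
  have UC: "\<Union>(C j) \<in> sets borel" for j using C_sets cC by (intro sets.countable_Union) auto
  have "emeasure lborel Z' = emeasure lborel (\<Union>j. Z' \<inter> \<Union>(C j))" using U_un U(2) by (intro arg_cong[of _ _ "emeasure lborel"]) blast
  also have "\<dots> = (SUP j. emeasure lborel (Z' \<inter> \<Union>(C j)))"
  proof (rule SUP_emeasure_incseq[symmetric])
    show "range (\<lambda>j. Z' \<inter> \<Union>(C j)) \<subseteq> sets lborel" using UC by auto
    show "incseq (\<lambda>j. Z' \<inter> \<Union>(C j))"
      using inc unfolding incseq_def by (intro allI impI Int_mono order_refl) simp
  qed
  finally have "2 * emeasure lborel Z' = (SUP j. 2 * emeasure lborel (Z' \<inter> \<Union>(C j)))"
    by (simp add: SUP_mult_left_ennreal)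
  also have "\<dots> \<le> emeasure lborel U" by (rule SUP_least) (rule half)
  finally show False using Uz z(2) unfolding z(1) by (simp add: mult_2 leD)
qed

end

text \<open>A function that is constant on the children of \<open>Q\<close>, has mean zero and at most the size of a
  normalized indicator only sees the differences of the averages over children from the average over
  \<open>Q\<close>; Cauchy--Schwarz with the weights \<open>|P|\<close> bounds its coefficient by the conditional oscillation.\<close>

lemma (in cube_tree_family) coefficient_le_osc:
  fixes h :: "'a \<Rightarrow> real"
  assumes Q: "Q \<in> D k" and h_meas [measurable]: "h \<in> borel_measurable M"
    and out: "\<And>x. x \<notin> Q \<Longrightarrow> h x = 0" and bound: "\<And>x. \<bar>h x\<bar> \<le> 1 / sqrt (measure M Q)"
    and const: "\<And>P x y. P \<in> D (Suc k) \<Longrightarrow> P \<subseteq> Q \<Longrightarrow> x \<in> P \<Longrightarrow> y \<in> P \<Longrightarrow> h x = h y"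
    and zero: "(\<integral>x. h x \<partial>M) = 0"
  shows "(\<Sum>\<kappa>\<in>K. (norm (pairing r (\<integral>x. h x *\<^sub>R F \<kappa> x \<partial>M)))\<^sup>2) / measure M Q \<le> osc k Q r"
proof -
  define m where "m = measure M Q"
  have m: "0 < m" using cube_pos[OF Q] by (simp add: m_def)
  define c where "c P = h (SOME x. x \<in> P)" for P
  have cP: "h x = c P" if P: "P \<in> children k Q" and x: "x \<in> P" for P x
    unfolding c_def by (rule const[OF children_D(1)[OF P] children_D(2)[OF P] x]) (rule someI[of _ x], rule x)
  have P_sets [measurable]: "P \<in> sets M" if "P \<in> children k Q" for P using children_D(1)[OF that] by (rule cube_sets)
  have [measurable]: "Q \<in> sets M" using Q by (rule cube_sets)
  have int: "(\<integral>x. h x *\<^sub>R g x \<partial>M) = (\<Sum>P\<in>children k Q. c P *\<^sub>R (LINT x:P|M. g x))"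
    if g: "set_integrable M Q g" for g :: "'a \<Rightarrow> 'b::{banach,second_countable_topology}"
  proof -
    have gm [measurable]: "(\<lambda>x. indicator Q x *\<^sub>R g x) \<in> borel_measurable M"
      using g unfolding set_integrable_def by (rule borel_measurable_integrable)
    have eq: "indicator Q x *\<^sub>R (h x *\<^sub>R g x) = h x *\<^sub>R (indicator Q x *\<^sub>R g x)" for x by simp
    have "set_integrable M Q (\<lambda>x. h x *\<^sub>R g x)"
      unfolding set_integrable_def
    proof (rule Bochner_Integration.integrable_bound)
      show "integrable M (\<lambda>x. (1 / sqrt m) *\<^sub>R (indicator Q x *\<^sub>R g x))"
        using g unfolding set_integrable_def by (rule integrable_scaleR_right)
      show "(\<lambda>x. indicator Q x *\<^sub>R (h x *\<^sub>R g x)) \<in> borel_measurable M" unfolding eq by measurable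
      show "AE x in M. norm (indicator Q x *\<^sub>R (h x *\<^sub>R g x)) \<le> norm ((1 / sqrt m) *\<^sub>R (indicator Q x *\<^sub>R g x))"
      proof (rule AE_I2)
        fix x
        have "\<bar>h x\<bar> * norm (indicator Q x *\<^sub>R g x) \<le> (1 / sqrt m) * norm (indicator Q x *\<^sub>R g x)"
          using bound[of x] by (intro mult_right_mono) (auto simp: m_def)
        then show "norm (indicator Q x *\<^sub>R (h x *\<^sub>R g x)) \<le> norm ((1 / sqrt m) *\<^sub>R (indicator Q x *\<^sub>R g x))"
          using m unfolding eq by (simp only: norm_scaleR) simp
      qed
    qed
    then have "(\<Sum>P\<in>children k Q. (LINT x:P|M. h x *\<^sub>R g x)) = (LINT x:Q|M. h x *\<^sub>R g x)"
      by (rule set_integral_children[OF Q])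
    moreover have "(LINT x:P|M. h x *\<^sub>R g x) = c P *\<^sub>R (LINT x:P|M. g x)" if P: "P \<in> children k Q" for P
    proof -
      have "(LINT x:P|M. h x *\<^sub>R g x) = (LINT x:P|M. c P *\<^sub>R g x)"
        using P_sets[OF P] cP[OF P] by (intro set_lebesgue_integral_cong) auto
      then show ?thesis by (simp add: set_lebesgue_integral_def scaleR_left_commute)
    qed
    moreover have "(\<integral>x. h x *\<^sub>R g x \<partial>M) = (LINT x:Q|M. h x *\<^sub>R g x)"
      unfolding set_lebesgue_integral_def using out
      by (intro Bochner_Integration.integral_cong) (auto simp: indicator_def)
    ultimately show ?thesis by simp
  qed
  have one: "set_integrable M Q (\<lambda>x. 1::real)"
    using cube_finite[OF Q] by (simp add: set_integrable_def)
  have "0 = (\<Sum>P\<in>children k Q. c P * measure M P)"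
  proof -
    have "(\<integral>x. h x *\<^sub>R (1::real) \<partial>M) = (\<Sum>P\<in>children k Q. c P *\<^sub>R (LINT x:P|M. (1::real)))" by (rule int[OF one])
    moreover have "(LINT x:P|M. (1::real)) = measure M P" if "P \<in> children k Q" for P
      using sets.sets_into_space[OF P_sets[OF that]] by (simp add: set_lebesgue_integral_def Int_absorb2)
    ultimately show ?thesis using zero by simp
  qed
  note mean0 = this
  define w where "w \<kappa> P = norm (pairing r (avg P \<kappa> - avg Q \<kappa>))" for \<kappa> P
  have c_bound: "\<bar>c P\<bar> \<le> 1 / sqrt m" for P unfolding c_def m_def by (rule bound)
  have est: "(norm (pairing r (\<integral>x. h x *\<^sub>R F \<kappa> x \<partial>M)))\<^sup>2 \<le> (\<Sum>P\<in>children k Q. measure M P * (w \<kappa> P)\<^sup>2)"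
    if \<kappa>: "\<kappa> \<in> K" for \<kappa>
  proof -
    have "(\<integral>x. h x *\<^sub>R F \<kappa> x \<partial>M) = (\<Sum>P\<in>children k Q. c P *\<^sub>R (LINT x:P|M. F \<kappa> x))"
      by (rule int[OF F_integrable[OF \<kappa> Q]])
    also have "\<dots> = (\<Sum>P\<in>children k Q. (c P * measure M P) *\<^sub>R avg P \<kappa>)"
    proof (rule sum.cong[OF refl])
      fix P assume "P \<in> children k Q"
      then have "P \<in> D (Suc k)" by (rule children_D(1))
      then have "0 < measure M P" by (rule cube_pos)
      then show "c P *\<^sub>R (LINT x:P|M. F \<kappa> x) = (c P * measure M P) *\<^sub>R avg P \<kappa>" by (simp add: avg_def)
    qed
    also have "\<dots> = (\<Sum>P\<in>children k Q. (c P * measure M P) *\<^sub>R (avg P \<kappa> - avg Q \<kappa>))"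
      using mean0 by (simp add: scaleR_diff_right sum_subtractf scaleR_sum_left[symmetric])
    finally have "pairing r (\<integral>x. h x *\<^sub>R F \<kappa> x \<partial>M) = (\<Sum>P\<in>children k Q. (c P * measure M P) *\<^sub>R pairing r (avg P \<kappa> - avg Q \<kappa>))"
      by (simp add: linear_sum[OF bounded_linear.linear[OF bounded_linear_pairing]] pairing_linear(7))
    then have "norm (pairing r (\<integral>x. h x *\<^sub>R F \<kappa> x \<partial>M)) \<le> (\<Sum>P\<in>children k Q. norm ((c P * measure M P) *\<^sub>R pairing r (avg P \<kappa> - avg Q \<kappa>)))"
      by (simp only: norm_sum)
    also have "\<dots> \<le> (\<Sum>P\<in>children k Q. (1 / sqrt m) * (measure M P * w \<kappa> P))"
    proof (rule sum_mono)
      fix P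
      have "norm ((c P * measure M P) *\<^sub>R pairing r (avg P \<kappa> - avg Q \<kappa>)) = \<bar>c P\<bar> * (measure M P * w \<kappa> P)"
        by (simp add: w_def abs_mult)
      also have "\<dots> \<le> (1 / sqrt m) * (measure M P * w \<kappa> P)" by (intro mult_right_mono c_bound) (simp add: w_def)
      finally show "norm ((c P * measure M P) *\<^sub>R pairing r (avg P \<kappa> - avg Q \<kappa>)) \<le> (1 / sqrt m) * (measure M P * w \<kappa> P)" .
    qed
    also have "\<dots> = (\<Sum>P\<in>children k Q. measure M P * w \<kappa> P) / sqrt m" by (simp add: sum_divide_distrib)
    finally have "(norm (pairing r (\<integral>x. h x *\<^sub>R F \<kappa> x \<partial>M)))\<^sup>2 \<le> ((\<Sum>P\<in>children k Q. measure M P * w \<kappa> P) / sqrt m)\<^sup>2"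
      by (intro power_mono) auto
    also have "\<dots> = (\<Sum>P\<in>children k Q. sqrt (measure M P) * (sqrt (measure M P) * w \<kappa> P))\<^sup>2 / m"
      using m by (simp add: power_divide mult.assoc[symmetric])
    also have "\<dots> \<le> ((\<Sum>P\<in>children k Q. (sqrt (measure M P))\<^sup>2) * (\<Sum>P\<in>children k Q. (sqrt (measure M P) * w \<kappa> P)\<^sup>2)) / m"
      using m by (intro divide_right_mono Cauchy_Schwarz_ineq_sum) auto
    also have "\<dots> = (\<Sum>P\<in>children k Q. measure M P * (w \<kappa> P)\<^sup>2)"
      using m measure_children[OF Q] by (simp add: power_mult_distrib m_def)
    finally show ?thesis .
  qed
  have "(\<Sum>\<kappa>\<in>K. (norm (pairing r (\<integral>x. h x *\<^sub>R F \<kappa> x \<partial>M)))\<^sup>2) / m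
      \<le> (\<Sum>\<kappa>\<in>K. \<Sum>P\<in>children k Q. measure M P * (w \<kappa> P)\<^sup>2) / m"
    using m by (intro divide_right_mono sum_mono est) auto
  also have "\<dots> = osc k Q r" by (simp add: osc_def w_def m_def sum_divide_distrib)
  finally show ?thesis by (simp add: m_def)
qed

text \<open>
  For an arbitrary integrand: scaling maps the simple functions below \<open>f\<close> onto those below the
  multiple of \<open>f\<close>.
\<close>

lemma nn_integral_cmult_le:
  assumes c: "0 < c" shows "(\<integral>\<^sup>+x. ennreal c * f x \<partial>M) \<le> ennreal c * (\<integral>\<^sup>+x. f x \<partial>M)"
  unfolding nn_integral_def[of M "\<lambda>x. ennreal c * f x"]
proof (rule SUP_least)
  fix s assume "s \<in> {s. simple_function M s \<and> s \<le> (\<lambda>x. ennreal c * f x)}"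
  then have s: "simple_function M s" "\<And>x. s x \<le> ennreal c * f x" by (auto simp: le_fun_def)
  have [measurable]: "s \<in> borel_measurable M" using s(1) by (rule borel_measurable_simple_function)
  have inv: "ennreal (1 / c) * (ennreal c * t) = t" "ennreal c * (ennreal (1 / c) * t) = t" for t
    using c by (simp_all add: mult.assoc[symmetric] ennreal_mult[symmetric])
  have "integral\<^sup>S M s = (\<integral>\<^sup>+x. ennreal c * (ennreal (1 / c) * s x) \<partial>M)"
    unfolding inv by (rule nn_integral_eq_simple_integral[OF s(1), symmetric])
  also have "\<dots> = ennreal c * (\<integral>\<^sup>+x. ennreal (1 / c) * s x \<partial>M)" by (intro nn_integral_cmult) measurable
  also have "\<dots> \<le> ennreal c * (\<integral>\<^sup>+x. f x \<partial>M)"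
  proof (intro mult_left_mono nn_integral_mono)
    fix x
    have "ennreal (1 / c) * s x \<le> ennreal (1 / c) * (ennreal c * f x)" by (intro mult_left_mono s(2)) simp
    then show "ennreal (1 / c) * s x \<le> f x" unfolding inv .
  qed simp
  finally show "integral\<^sup>S M s \<le> ennreal c * (\<integral>\<^sup>+x. f x \<partial>M)" .
qed

lemma nn_integral_partition_mono:
  assumes \<Q>: "countable \<Q>" "disjoint \<Q>" "\<Union>\<Q> = UNIV" "\<And>Q. Q \<in> \<Q> \<Longrightarrow> Q \<in> sets M" and [measurable]: "g \<in> borel_measurable M"
    and le: "\<And>Q. Q \<in> \<Q> \<Longrightarrow> (\<integral>\<^sup>+x\<in>Q. f x \<partial>M) \<le> c * (\<integral>\<^sup>+x\<in>Q. g x \<partial>M)"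
  shows "(\<integral>\<^sup>+x. f x \<partial>M) \<le> c * (\<integral>\<^sup>+x. g x \<partial>M)"
proof -
  have split: "(\<integral>\<^sup>+x. u x \<partial>M) = (\<integral>\<^sup>+Q. (\<integral>\<^sup>+x\<in>Q. u x \<partial>M) \<partial>count_space \<Q>)"
    if u [measurable]: "u \<in> borel_measurable M" for u
  proof -
    have "space M = \<Union>((\<lambda>Q. Q) ` \<Q>)" using \<Q>(3) \<Q>(4) sets.sets_into_space by (auto simp: set_eq_iff) blast
    then have "emeasure (density M u) (\<Union>((\<lambda>Q. Q) ` \<Q>)) = emeasure (density M u) (space M)" by simp
    also have "\<dots> = (\<integral>\<^sup>+x. u x \<partial>M)"
      by (subst emeasure_density) (auto intro!: nn_integral_cong simp: indicator_def)
    finally have "(\<integral>\<^sup>+x. u x \<partial>M) = emeasure (density M u) (\<Union>((\<lambda>Q. Q) ` \<Q>))" by (rule sym)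
    also have "\<dots> = (\<integral>\<^sup>+Q. emeasure (density M u) Q \<partial>count_space \<Q>)"
      using \<Q> by (intro emeasure_UN_countable) (auto simp: disjoint_family_on_def disjoint_def)
    also have "\<dots> = (\<integral>\<^sup>+Q. (\<integral>\<^sup>+x\<in>Q. u x \<partial>M) \<partial>count_space \<Q>)"
      using \<Q>(4) by (intro nn_integral_cong) (simp add: emeasure_density)
    finally show ?thesis .
  qed
  \<comment> \<open>The integral of \<open>f\<close> is a supremum over simple functions, and these split over the partition.\<close>
  show ?thesis
    unfolding nn_integral_def[of M f]
  proof (rule SUP_least)
    fix s assume "s \<in> {s. simple_function M s \<and> s \<le> f}"
    then have s: "simple_function M s" "\<And>x. s x \<le> f x" by (auto simp: le_fun_def)
    have "integral\<^sup>S M s = (\<integral>\<^sup>+Q. (\<integral>\<^sup>+x\<in>Q. s x \<partial>M) \<partial>count_space \<Q>)"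
      using split[OF borel_measurable_simple_function[OF s(1)]] by (simp add: nn_integral_eq_simple_integral[OF s(1)])
    also have "\<dots> \<le> (\<integral>\<^sup>+Q. c * (\<integral>\<^sup>+x\<in>Q. g x \<partial>M) \<partial>count_space \<Q>)"
    proof (rule nn_integral_mono)
      fix Q assume "Q \<in> space (count_space \<Q>)"
      then have "Q \<in> \<Q>" by simp
      have "(\<integral>\<^sup>+x\<in>Q. s x \<partial>M) \<le> (\<integral>\<^sup>+x\<in>Q. f x \<partial>M)" by (intro nn_integral_mono mult_right_mono s(2)) auto
      also have "\<dots> \<le> c * (\<integral>\<^sup>+x\<in>Q. g x \<partial>M)" by (rule le) fact
      finally show "(\<integral>\<^sup>+x\<in>Q. s x \<partial>M) \<le> c * (\<integral>\<^sup>+x\<in>Q. g x \<partial>M)" .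
    qed
    also have "\<dots> = c * (\<integral>\<^sup>+x. g x \<partial>M)" by (simp add: nn_integral_cmult split)
    finally show "integral\<^sup>S M s \<le> c * (\<integral>\<^sup>+x. g x \<partial>M)" .
  qed
qed

text \<open>
  A diagonal entry of \<open>U ** Vi y ** V y ** U'\<close> is 1 and is bounded by the product of the two factors,
  which is integrated by Hoelder's inequality. As a consequence constant multiples of the \<open>A\<^sub>p\<close>
  constant can be used where a number \<open>\<ge> 1\<close> is required.
\<close>

lemma factored_Ap_ge_1:
  fixes V Vi :: "'a \<Rightarrow> complex^'d^'d"
  assumes p: "1 < p" and A: "0 \<le> A" and Q [measurable]: "Q \<in> sets M" and Qm: "0 < measure M Q" "emeasure M Q = ennreal (measure M Q)"
    and [measurable]: "V \<in> borel_measurable M" "Vi \<in> borel_measurable M"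
    and inv: "\<And>y. Vi y ** V y = mat 1" and Ap: "factored_Ap M p A V Vi Q"
  shows "1 \<le> A"
proof -
  define q where "q = conj_exp p"
  define m where "m = measure M Q"
  have pq: "1 < q" "1/q + 1/p = 1" using conj_exp_props[OF p] by (auto simp: q_def)
  obtain U U' :: "complex^'d^'d" where U: "U ** U' = mat 1"
    and a: "\<forall>i. (\<integral>\<^sup>+y\<in>Q. ennreal (norm (row i U v* Vi y) powr q) \<partial>M) \<le> ennreal m"
    and b: "\<forall>i. (\<integral>\<^sup>+x\<in>Q. ennreal (norm (V x *v column i U') powr p) \<partial>M) \<le> ennreal (A * m)"
    using Ap[unfolded factored_Ap_def, folded q_def m_def] by (elim exE conjE) (rule that)
  fix i :: 'd
  define f where "f y = norm (row i U v* Vi y) * indicator Q y" for y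
  define g where "g y = norm (V y *v column i U') * indicator Q y" for y
  have fm [measurable]: "f \<in> borel_measurable M" "g \<in> borel_measurable M"
    unfolding f_def g_def by (intro borel_measurable_times borel_measurable_norm measurable_matrix_vector borel_measurable_indicator Q; simp)+
  have ind: "ennreal ((t * indicator Q y) powr s) = ennreal (t powr s) * indicator Q y" if "0 < s" for s t :: real and y
    using that by (auto simp: indicator_def)
  have one: "ennreal (indicator Q y) \<le> ennreal (f y * g y)" for y
  proof -
    have "pairing (row i U v* Vi y) (V y *v column i U') = pairing (row i U) ((Vi y ** V y) *v column i U')"
      by (simp add: pairing_vector_matrix matrix_vector_mul_assoc)
    also have "\<dots> = (U ** U') $ i $ i"
      unfolding inv by (simp add: pairing_def row_def column_def matrix_matrix_mult_def)
    finally have "1 = norm (pairing (row i U v* Vi y) (V y *v column i U'))" by (simp add: U mat_def)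
    also have "\<dots> \<le> norm (row i U v* Vi y) * norm (V y *v column i U')" by (rule norm_pairing_le)
    finally show ?thesis by (auto simp: f_def g_def indicator_def)
  qed
  have fq: "(\<integral>\<^sup>+x. ennreal (f x powr q) \<partial>M) \<le> ennreal m"
    using a[rule_format, of i] pq(1) unfolding f_def by (simp add: ind)
  have gp: "(\<integral>\<^sup>+x. ennreal (g x powr p) \<partial>M) \<le> ennreal (A * m)"
    using b[rule_format, of i] p unfolding g_def by (simp add: ind)
  have m: "0 < m" using Qm by (simp add: m_def)
  have "ennreal m = (\<integral>\<^sup>+y. ennreal (indicator Q y) \<partial>M)"
    using Qm(2) by (simp add: m_def ennreal_indicator)
  also have "\<dots> \<le> (\<integral>\<^sup>+y. ennreal (f y * g y) \<partial>M)" by (rule nn_integral_mono) (rule one)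
  also have "\<dots> \<le> ennreal (m powr (1/q) * (A * m) powr (1/p))"
    using m A by (intro nn_integral_Hoelder p pq fm fq gp) (auto simp: f_def g_def)
  finally have "m \<le> m powr (1/q) * (A * m) powr (1/p)" by (simp add: ennreal_le_iff)
  also have "\<dots> = A powr (1/p) * m"
    using A m pq(2) by (simp add: powr_mult powr_add[symmetric])
  finally have "1 \<le> A powr (1/p)" using m by simp
  then have "1 powr p \<le> (A powr (1/p)) powr p" using p by (intro powr_mono2) auto
  then show ?thesis using p A by (simp add: powr_powr)
qed

lemma measurable_matrix_vector_mult [measurable]:
  fixes X :: "'a \<Rightarrow> complex^'d^'d" and v :: "'a \<Rightarrow> complex^'d"
  assumes "X \<in> borel_measurable M" "v \<in> borel_measurable M"
  shows "(\<lambda>x. X x *v v x) \<in> borel_measurable M"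
proof -
  have "continuous_on UNIV (\<lambda>z::(complex^'d^'d) \<times> (complex^'d). fst z *v snd z)"
    unfolding matrix_vector_mult_def by (intro continuous_intros)
  from borel_measurable_continuous_on[OF this, of "\<lambda>x. (X x, v x)"] assms show ?thesis by simp
qed

definition param_const :: "real \<Rightarrow> nat \<Rightarrow> real \<Rightarrow> real"
  where "param_const d n p = (2 ^ n) powr (p/2) * tree_const d (2 ^ n) p"

context dyadic_levels
begin

text \<open>
  The at most \<open>2 ^ n\<close> Haar coefficients of a cube are each bounded by the oscillation on it, and the
  estimates on the cubes of the coarsest level \<open>m\<close> add up.
\<close>

theorem square_function_one_parameter:
  fixes V Vi :: "real^'n \<Rightarrow> complex^'d^'d" and F :: "'k \<Rightarrow> real^'n \<Rightarrow> complex^'d"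
  assumes p: "1 < p" and A: "1 \<le> A" and K: "finite K"
    and V [measurable]: "V \<in> borel_measurable borel" "Vi \<in> borel_measurable borel"
    and F: "\<And>\<kappa>. \<kappa> \<in> K \<Longrightarrow> integrable lborel (F \<kappa>)"
    and inv: "\<And>x. V x ** Vi x = mat 1" "\<And>x. Vi x ** V x = mat 1"
    and Ap: "\<And>k Q. Q \<in> cubes k \<Longrightarrow> factored_Ap lborel p A V Vi Q"
  shows "(\<integral>\<^sup>+x. ennreal ((\<Sum>l<N. \<Sum>e\<in>UNIV - {\<lambda>_. True}. \<Sum>\<kappa>\<in>K.
        (norm (V x *v (\<integral>y. haar_cube e (the_cube (m + int l) x) y *\<^sub>R F \<kappa> y \<partial>lborel)))\<^sup>2 / vol (m + int l)) powr (p/2)) \<partial>lborel)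
    \<le> ennreal (param_const (real CARD('d)) CARD('n) p * A powr (p * gamma_exp p)) *
      (\<integral>\<^sup>+x. ennreal (L2_set (\<lambda>\<kappa>. norm (V x *v F \<kappa> x)) K powr p) \<partial>lborel)"
    (is "(\<integral>\<^sup>+x. ennreal (?S x powr (p/2)) \<partial>lborel) \<le> _")
proof -
  have [measurable]: "F \<kappa> \<in> borel_measurable borel" if "\<kappa> \<in> K" for \<kappa>
    using borel_measurable_integrable[OF F[OF that]] by simp
  interpret T: cube_tree_family lborel "\<lambda>j. cubes (m + int j)" "2 ^ CARD('n)" K F
  proof (intro cube_tree_family.intro cube_tree_family_axioms.intro cubes_form_tree K)
    fix \<kappa> Q k assume "\<kappa> \<in> K" "Q \<in> cubes (m + int k)"
    then show "set_integrable lborel Q (F \<kappa>)"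
      unfolding set_integrable_def by (intro integrable_mult_indicator F) (auto simp: cubes_measure)
  qed
  have cube: "T.cube l x = the_cube (m + int l) x" for l x by (simp add: T.cube_def the_cube_def)
  have pointwise: "?S x \<le> 2 ^ CARD('n) * (\<Sum>i\<in>UNIV. T.osc_sum N 0 x (row i (V x)))" for x
  proof -
    have level: "(\<Sum>\<kappa>\<in>K. (norm (V x *v (\<integral>y. haar_cube e (the_cube (m + int l) x) y *\<^sub>R F \<kappa> y \<partial>lborel)))\<^sup>2 / vol (m + int l))
        \<le> (\<Sum>i\<in>UNIV. T.osc l (T.cube l x) (row i (V x)))" if e: "e \<noteq> (\<lambda>_. True)" for e l
    proof -
      define Q where "Q = the_cube (m + int l) x"
      have Q: "Q \<in> cubes (m + int l)" by (simp add: Q_def the_cube_in)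
      have Qv: "measure lborel Q = vol (m + int l)" by (rule cubes_measure(3)[OF Q])
      have S: "m + int (Suc l) = m + int l + 1" by simp
      have "(\<Sum>\<kappa>\<in>K. (norm (V x *v (\<integral>y. haar_cube e Q y *\<^sub>R F \<kappa> y \<partial>lborel)))\<^sup>2 / vol (m + int l))
          = (\<Sum>i\<in>UNIV. (\<Sum>\<kappa>\<in>K. (norm (pairing (row i (V x)) (\<integral>y. haar_cube e Q y *\<^sub>R F \<kappa> y \<partial>lborel)))\<^sup>2) / measure lborel Q)"
        unfolding norm_vec_squared[of "V x *v _"] matrix_vector_component Qv sum_divide_distrib by (rule sum.swap)
      also have "\<dots> \<le> (\<Sum>i\<in>UNIV. T.osc l Q (row i (V x)))"
      proof (rule sum_mono)
        fix i
        show "(\<Sum>\<kappa>\<in>K. (norm (pairing (row i (V x)) (\<integral>y. haar_cube e Q y *\<^sub>R F \<kappa> y \<partial>lborel)))\<^sup>2) / measure lborel Q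
            \<le> T.osc l Q (row i (V x))"
        proof (rule T.coefficient_le_osc[OF Q])
          show "haar_cube e Q \<in> borel_measurable lborel" using haar_cube_measurable[OF Q] by simp
          show "haar_cube e Q y = 0" if "y \<notin> Q" for y by (rule haar_cube_outside[OF Q that])
          show "\<bar>haar_cube e Q y\<bar> \<le> 1 / sqrt (measure lborel Q)" for y unfolding Qv by (rule haar_cube_bound[OF Q])
          show "haar_cube e Q y = haar_cube e Q z" if "P \<in> cubes (m + int (Suc l))" "P \<subseteq> Q" "y \<in> P" "z \<in> P" for P y z
            using haar_cube_const[OF Q that(1)[unfolded S] that(2-4)] .
          show "(\<integral>y. haar_cube e Q y \<partial>lborel) = 0" by (rule haar_cube_integral_0[OF Q e])
        qed
      qed
      finally show ?thesis by (simp add: Q_def cube)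
    qed
    have "?S x \<le> (\<Sum>l<N. \<Sum>e\<in>UNIV - {\<lambda>_::'n. True}. \<Sum>i\<in>UNIV. T.osc l (T.cube l x) (row i (V x)))"
      by (intro sum_mono level) auto
    also have "\<dots> \<le> (\<Sum>l<N. 2 ^ CARD('n) * (\<Sum>i\<in>UNIV. T.osc l (T.cube l x) (row i (V x))))"
    proof (rule sum_mono)
      fix l
      have "card (UNIV - {\<lambda>_::'n. True}) \<le> card (UNIV :: ('n \<Rightarrow> bool) set)" by (rule card_mono) auto
      also have "\<dots> = 2 ^ CARD('n)" by (simp add: card_fun)
      finally have "real (card (UNIV - {\<lambda>_::'n. True})) \<le> 2 ^ CARD('n)"
        by (metis of_nat_le_iff of_nat_numeral of_nat_power)
      then show "(\<Sum>e\<in>UNIV - {\<lambda>_::'n. True}. \<Sum>i\<in>UNIV. T.osc l (T.cube l x) (row i (V x)))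
          \<le> 2 ^ CARD('n) * (\<Sum>i\<in>UNIV. T.osc l (T.cube l x) (row i (V x)))"
        unfolding sum_constant by (intro mult_right_mono sum_nonneg T.osc_nonneg)
    qed
    also have "\<dots> = 2 ^ CARD('n) * (\<Sum>i\<in>UNIV. T.osc_sum N 0 x (row i (V x)))"
      by (subst sum.swap) (simp add: sum_distrib_left)
    finally show ?thesis .
  qed
  define C where "C = tree_const (real CARD('d)) (2 ^ CARD('n)) p"
  have S0: "0 \<le> ?S x" for x using vol_pos by (intro sum_nonneg divide_nonneg_nonneg) (auto simp: less_imp_le)
  show ?thesis
  proof (rule nn_integral_partition_mono[where \<Q> = "cubes m"])
    show "countable (cubes m)" by (rule cubes_countable)
    show "disjoint (cubes m)" "\<Union>(cubes m) = UNIV" using cubes_partition[of m] by (auto simp: partition_on_def)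
    show "Q \<in> sets lborel" if "Q \<in> cubes m" for Q using cubes_measure(1)[OF that] by simp
    show "(\<lambda>x. ennreal (L2_set (\<lambda>\<kappa>. norm (V x *v F \<kappa> x)) K powr p)) \<in> borel_measurable lborel"
      unfolding L2_set_def by measurable
    fix Q assume Q: "Q \<in> cubes m"
    have "(\<integral>\<^sup>+x\<in>Q. ennreal (?S x powr (p/2)) \<partial>lborel)
        \<le> (\<integral>\<^sup>+x\<in>Q. ennreal ((2 ^ CARD('n)) powr (p/2)) * ennreal ((\<Sum>i\<in>UNIV. T.osc_sum N 0 x (row i (V x))) powr (p/2)) \<partial>lborel)"
    proof (intro nn_integral_mono mult_right_mono)
      fix x
      have "?S x powr (p/2) \<le> (2 ^ CARD('n) * (\<Sum>i\<in>UNIV. T.osc_sum N 0 x (row i (V x)))) powr (p/2)"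
        using p by (intro powr_mono2 pointwise S0) auto
      also have "\<dots> = (2 ^ CARD('n)) powr (p/2) * (\<Sum>i\<in>UNIV. T.osc_sum N 0 x (row i (V x))) powr (p/2)"
        by (intro powr_mult)
      finally show "ennreal (?S x powr (p/2)) \<le> ennreal ((2 ^ CARD('n)) powr (p/2)) * ennreal ((\<Sum>i\<in>UNIV. T.osc_sum N 0 x (row i (V x))) powr (p/2))"
        by (simp add: ennreal_mult[symmetric])
    qed simp
    also have "\<dots> \<le> ennreal ((2 ^ CARD('n)) powr (p/2)) * (\<integral>\<^sup>+x\<in>Q. ennreal ((\<Sum>i\<in>UNIV. T.osc_sum N 0 x (row i (V x))) powr (p/2)) \<partial>lborel)"
      unfolding mult.assoc using nn_integral_cmult_le[of "(2 ^ CARD('n)) powr (p/2)"] by simp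
    also have "\<dots> \<le> ennreal ((2 ^ CARD('n)) powr (p/2)) * (ennreal (C * A powr (p * gamma_exp p)) *
        (\<integral>\<^sup>+x\<in>Q. ennreal (L2_set (\<lambda>\<kappa>. norm (V x *v F \<kappa> x)) K powr p) \<partial>lborel))"
    proof (rule mult_left_mono)
      show "(\<integral>\<^sup>+x\<in>Q. ennreal ((\<Sum>i\<in>UNIV. T.osc_sum N 0 x (row i (V x))) powr (p/2)) \<partial>lborel)
        \<le> ennreal (C * A powr (p * gamma_exp p)) *
          (\<integral>\<^sup>+x\<in>Q. ennreal (L2_set (\<lambda>\<kappa>. norm (V x *v F \<kappa> x)) K powr p) \<partial>lborel)"
        unfolding C_def
      proof (rule T.square_function_cube[where Vi = Vi])
        show "factored_Ap lborel p A V Vi P" if "P \<in> cubes (m + int k)" for k P using that by (rule Ap)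
      qed (use p A inv Q in simp_all)
    qed simp
    also have "\<dots> = ennreal (param_const (real CARD('d)) CARD('n) p * A powr (p * gamma_exp p)) *
        (\<integral>\<^sup>+x\<in>Q. ennreal (L2_set (\<lambda>\<kappa>. norm (V x *v F \<kappa> x)) K powr p) \<partial>lborel)"
      by (simp add: param_const_def C_def ennreal_mult'' ennreal_mult' mult.assoc)
    finally show "(\<integral>\<^sup>+x\<in>Q. ennreal (?S x powr (p/2)) \<partial>lborel)
        \<le> ennreal (param_const (real CARD('d)) CARD('n) p * A powr (p * gamma_exp p)) *
        (\<integral>\<^sup>+x\<in>Q. ennreal (L2_set (\<lambda>\<kappa>. norm (V x *v F \<kappa> x)) K powr p) \<partial>lborel)" .
  qed
qed

end

section \<open>Two parameters\<close>

lemma fst_snd_borel: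
  "fst \<in> borel_measurable (borel :: ('a::euclidean_space \<times> 'b::euclidean_space) measure)"
  "snd \<in> borel_measurable (borel :: ('a::euclidean_space \<times> 'b::euclidean_space) measure)"
  by (rule borel_measurable_continuous_onI, intro continuous_intros)+

locale dyadic_rectangles = X: dyadic_levels G1 + Y: dyadic_levels G2
  for G1 :: "'n::finite \<Rightarrow> int \<Rightarrow> real set set" and G2 :: "'m::finite \<Rightarrow> int \<Rightarrow> real set set"
begin

definition coef :: "((real^'n) \<times> (real^'m) \<Rightarrow> complex^'d) \<Rightarrow> ('n \<Rightarrow> bool) \<Rightarrow> (real^'n) set \<Rightarrow> ('m \<Rightarrow> bool) \<Rightarrow> (real^'m) set \<Rightarrow> complex^'d"
  where "coef f e1 Q1 e2 Q2 = (\<integral>z. (haar_cube e1 Q1 (fst z) * haar_cube e2 Q2 (snd z)) *\<^sub>R f z \<partial>lborel)"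

text \<open>
  Evaluated at \<open>z\<close>, only the rectangle of each pair of levels that contains \<open>z\<close> contributes; the sum runs
  over levels instead of rectangles. The inner index pair is the index set of the family to which
  \<open>square_function_one_parameter\<close> is applied in the first variable.
\<close>

definition truncated_square ::
    "((real^'n) \<times> (real^'m) \<Rightarrow> complex^'d^'d) \<Rightarrow> ((real^'n) \<times> (real^'m) \<Rightarrow> complex^'d) \<Rightarrow> int \<Rightarrow> nat \<Rightarrow> (real^'n) \<times> (real^'m) \<Rightarrow> real"
  where "truncated_square V f m N z = (\<Sum>l1<N. \<Sum>e1\<in>UNIV - {\<lambda>_. True}. \<Sum>(l2, e2)\<in>{..<N} \<times> (UNIV - {\<lambda>_. True}).
    (norm (V z *v coef f e1 (X.the_cube (m + int l1) (fst z)) e2 (Y.the_cube (m + int l2) (snd z))))\<^sup>2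
      / (X.vol (m + int l1) * Y.vol (m + int l2)))"

lemma partial_coef:
  fixes f :: "(real^'n) \<times> (real^'m) \<Rightarrow> complex^'d"
  assumes f: "integrable lborel f" and Q2: "Q2 \<in> Y.cubes k2"
  shows "integrable lborel (\<lambda>x. \<integral>y. haar_cube e2 Q2 y *\<^sub>R f (x, y) \<partial>lborel)"
    and "Q1 \<in> X.cubes k1 \<Longrightarrow>
      (\<integral>x. haar_cube e1 Q1 x *\<^sub>R (\<integral>y. haar_cube e2 Q2 y *\<^sub>R f (x, y) \<partial>lborel) \<partial>lborel) = coef f e1 Q1 e2 Q2"
proof -
  have [measurable]: "(\<lambda>z. haar_cube e2 Q2 (snd z)) \<in> borel_measurable (borel :: ((real^'n) \<times> (real^'m)) measure)"
    by (rule measurable_compose[OF fst_snd_borel(2) Y.haar_cube_measurable[OF Q2]])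
  have [measurable]: "f \<in> borel_measurable borel" using borel_measurable_integrable[OF f] by simp
  have mult: "integrable lborel (\<lambda>z. b z *\<^sub>R g z)"
    if [measurable]: "b \<in> borel_measurable borel" and b: "\<And>z. \<bar>b z\<bar> \<le> c" and g: "integrable lborel g"
    for b :: "(real^'n) \<times> (real^'m) \<Rightarrow> real" and c and g :: "(real^'n) \<times> (real^'m) \<Rightarrow> complex^'d"
  proof (rule Bochner_Integration.integrable_bound)
    have [measurable]: "g \<in> borel_measurable borel" using borel_measurable_integrable[OF g] by simp
    show "(\<lambda>z. b z *\<^sub>R g z) \<in> borel_measurable lborel" by measurable
    show "integrable lborel (\<lambda>z. c *\<^sub>R g z)" using g by (rule integrable_scaleR_right)
    show "AE z in lborel. norm (b z *\<^sub>R g z) \<le> norm (c *\<^sub>R g z)"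
      by (rule AE_I2) (use b in \<open>auto intro!: mult_right_mono intro: order_trans[OF _ abs_ge_self]\<close>)
  qed
  have "integrable lborel (\<lambda>z. haar_cube e2 Q2 (snd z) *\<^sub>R f z)"
    by (rule mult[OF _ _ f]) (auto intro: Y.haar_cube_bound[OF Q2])
  then have "integrable (lborel \<Otimes>\<^sub>M lborel) (\<lambda>z. haar_cube e2 Q2 (snd z) *\<^sub>R f z)" by (simp add: lborel_prod)
  from lborel_pair.integrable_fst'[OF this] show "integrable lborel (\<lambda>x. \<integral>y. haar_cube e2 Q2 y *\<^sub>R f (x, y) \<partial>lborel)" by simp
  assume Q1: "Q1 \<in> X.cubes k1"
  have [measurable]: "(\<lambda>z. haar_cube e1 Q1 (fst z)) \<in> borel_measurable (borel :: ((real^'n) \<times> (real^'m)) measure)"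
    by (rule measurable_compose[OF fst_snd_borel(1) X.haar_cube_measurable[OF Q1]])
  have "integrable lborel (\<lambda>z. (haar_cube e1 Q1 (fst z) * haar_cube e2 Q2 (snd z)) *\<^sub>R f z)"
  proof (rule mult[OF _ _ f])
    show "(\<lambda>z. haar_cube e1 Q1 (fst z) * haar_cube e2 Q2 (snd z)) \<in> borel_measurable (borel :: ((real^'n) \<times> (real^'m)) measure)" by measurable
    fix z
    show "\<bar>haar_cube e1 Q1 (fst z) * haar_cube e2 Q2 (snd z)\<bar> \<le> 1 / sqrt (X.vol k1) * (1 / sqrt (Y.vol k2))"
      unfolding abs_mult using X.haar_cube_bound[OF Q1] Y.haar_cube_bound[OF Q2] X.vol_pos by (intro mult_mono) (auto simp: less_imp_le)
  qed
  then have "integrable (lborel \<Otimes>\<^sub>M lborel) (\<lambda>z. (haar_cube e1 Q1 (fst z) * haar_cube e2 Q2 (snd z)) *\<^sub>R f z)" by (simp add: lborel_prod)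
  from lborel_pair.integral_fst'[OF this]
  show "(\<integral>x. haar_cube e1 Q1 x *\<^sub>R (\<integral>y. haar_cube e2 Q2 y *\<^sub>R f (x, y) \<partial>lborel) \<partial>lborel) = coef f e1 Q1 e2 Q2"
    unfolding coef_def lborel_prod by (simp add: scaleR_scaleR[symmetric] del: scaleR_scaleR)
qed

text \<open>
  The cube of a given level through a point takes countably many values.
\<close>

lemma measurable_on_rectangles:
  fixes c :: "(real^'n) set \<Rightarrow> (real^'m) set \<Rightarrow> (real^'n) \<times> (real^'m) \<Rightarrow> 'b::topological_space"
  assumes c: "\<And>Q1 Q2. Q1 \<in> X.cubes k1 \<Longrightarrow> Q2 \<in> Y.cubes k2 \<Longrightarrow> c Q1 Q2 \<in> borel_measurable borel"
  shows "(\<lambda>z. c (X.the_cube k1 (fst z)) (Y.the_cube k2 (snd z)) z) \<in> borel_measurable borel"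
proof (rule measurable_compose_countable'[where f = "\<lambda>Q1 z. c Q1 (Y.the_cube k2 (snd z)) z"])
  show "(\<lambda>z. X.the_cube k1 (fst z)) \<in> (borel :: ((real^'n) \<times> (real^'m)) measure) \<rightarrow>\<^sub>M count_space (X.cubes k1)"
    by (rule X.the_cube_measurable) (rule fst_snd_borel)
  show "countable (X.cubes k1)" by (rule X.cubes_countable)
  fix Q1 assume Q1: "Q1 \<in> X.cubes k1"
  show "(\<lambda>z. c Q1 (Y.the_cube k2 (snd z)) z) \<in> borel_measurable borel"
  proof (rule measurable_compose_countable'[where f = "\<lambda>Q2 z. c Q1 Q2 z"])
    show "(\<lambda>z. Y.the_cube k2 (snd z)) \<in> (borel :: ((real^'n) \<times> (real^'m)) measure) \<rightarrow>\<^sub>M count_space (Y.cubes k2)"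
      by (rule Y.the_cube_measurable) (rule fst_snd_borel)
    show "countable (Y.cubes k2)" by (rule Y.cubes_countable)
  qed (rule c[OF Q1])
qed

lemma truncated_square_measurable:
  assumes [measurable]: "V \<in> borel_measurable borel"
  shows "truncated_square V f m N \<in> borel_measurable borel"
proof -
  have "(\<lambda>z. norm (V z *v coef f e1 (X.the_cube k1 (fst z)) e2 (Y.the_cube k2 (snd z)))) \<in> borel_measurable borel" for e1 e2 k1 k2
    by (rule measurable_on_rectangles) measurable
  note [measurable] = this
  show ?thesis unfolding truncated_square_def[abs_def] case_prod_beta
    by (intro borel_measurable_sum borel_measurable_divide borel_measurable_power borel_measurable_const) simp_all
qed

lemma truncated_square_nonneg: "0 \<le> truncated_square V f m N z"
  unfolding truncated_square_def using X.vol_pos Y.vol_pos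
  by (intro sum_nonneg) (auto simp: less_imp_le split: prod.split)

text \<open>
  The \<open>l\<^sup>2\<close> norm \<open>\<Phi>\<close> of the partial Haar coefficients in the second variable is the right-hand side of
  the estimate in the first variable and the square function in the second.
\<close>

theorem square_function_two_parameters:
  fixes V Vi :: "(real^'n) \<times> (real^'m) \<Rightarrow> complex^'d^'d" and f :: "(real^'n) \<times> (real^'m) \<Rightarrow> complex^'d"
  assumes p: "1 < p" and A: "1 \<le> A" and V [measurable]: "V \<in> borel_measurable borel" "Vi \<in> borel_measurable borel"
    and f: "integrable lborel f" and inv: "\<And>x. V x ** Vi x = mat 1" "\<And>x. Vi x ** V x = mat 1"
    and Ap1: "AE y in lborel. \<forall>k. \<forall>Q\<in>X.cubes k. factored_Ap lborel p A (\<lambda>x. V (x, y)) (\<lambda>x. Vi (x, y)) Q"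
    and Ap2: "AE x in lborel. \<forall>k. \<forall>Q\<in>Y.cubes k. factored_Ap lborel p A (\<lambda>y. V (x, y)) (\<lambda>y. Vi (x, y)) Q"
  shows "(\<integral>\<^sup>+z. ennreal (truncated_square V f m N z powr (p/2)) \<partial>lborel)
    \<le> ennreal (param_const (real CARD('d)) CARD('n) p * A powr (p * gamma_exp p)) *
      (ennreal (param_const (real CARD('d)) CARD('m) p * A powr (p * gamma_exp p)) *
       (\<integral>\<^sup>+z. ennreal (norm (V z *v f z) powr p) \<partial>lborel))"
proof -
  define E where "E = (UNIV - {\<lambda>_. True} :: ('m \<Rightarrow> bool) set)"
  define K where "K = {..<N} \<times> E"
  have K: "finite K" by (simp add: K_def E_def)
  define g where "g \<kappa> y x = (1 / sqrt (Y.vol (m + int (fst \<kappa>)))) *\<^sub>R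
      (\<integral>y'. haar_cube (snd \<kappa>) (Y.the_cube (m + int (fst \<kappa>)) y) y' *\<^sub>R f (x, y') \<partial>lborel)"
    for \<kappa> :: "nat \<times> ('m \<Rightarrow> bool)" and y x
  define \<Phi> where "\<Phi> z = L2_set (\<lambda>\<kappa>. norm (V z *v g \<kappa> (snd z) (fst z))) K" for z
  have [measurable]: "f \<in> borel_measurable borel" using borel_measurable_integrable[OF f] by simp
  have g_int: "integrable lborel (g \<kappa> y)" for \<kappa> y
    unfolding g_def by (intro integrable_scaleR_right partial_coef(1)[OF f Y.the_cube_in(1)])
  have g_meas [measurable]: "(\<lambda>z. g \<kappa> (snd z) (fst z)) \<in> borel_measurable borel" for \<kappa>
    unfolding g_def
    \<comment> \<open>Only the cube in the second variable occurs, so the level in the first one is arbitrary.\<close>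
  proof (rule measurable_on_rectangles[where ?k1.0 = 0 and
      c = "\<lambda>_ Q z. (1 / sqrt (Y.vol (m + int (fst \<kappa>)))) *\<^sub>R (\<integral>y'. haar_cube (snd \<kappa>) Q y' *\<^sub>R f (fst z, y') \<partial>lborel)"])
    fix Q assume "Q \<in> Y.cubes (m + int (fst \<kappa>))"
    from borel_measurable_integrable[OF partial_coef(1)[OF f this]]
    have [measurable]: "(\<lambda>x. \<integral>y'. haar_cube (snd \<kappa>) Q y' *\<^sub>R f (x, y') \<partial>lborel) \<in> borel_measurable borel" by simp
    show "(\<lambda>z. (1 / sqrt (Y.vol (m + int (fst \<kappa>)))) *\<^sub>R (\<integral>y'. haar_cube (snd \<kappa>) Q y' *\<^sub>R f (fst z, y') \<partial>lborel))
        \<in> borel_measurable (borel :: ((real^'n) \<times> (real^'m)) measure)"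
      by (rule measurable_compose[OF fst_snd_borel(1)]) measurable
  qed
  have \<Phi>_meas [measurable]: "\<Phi> \<in> borel_measurable borel"
    unfolding \<Phi>_def[abs_def] L2_set_def by measurable
  have scale: "(norm (M *v (a *\<^sub>R v)))\<^sup>2 = a\<^sup>2 * (norm (M *v v))\<^sup>2" for M :: "complex^'d^'d" and a and v
    by (simp add: linear_cmul[OF bounded_linear.linear[OF matrix_vector_mul_bounded_linear]] power_mult_distrib)
  have coef1: "(norm (V (x, y) *v (\<integral>x'. haar_cube e1 (X.the_cube k1 x) x' *\<^sub>R g \<kappa> y x' \<partial>lborel)))\<^sup>2 / X.vol k1
      = (norm (V (x, y) *v coef f e1 (X.the_cube k1 x) (snd \<kappa>) (Y.the_cube (m + int (fst \<kappa>)) y)))\<^sup>2 / (X.vol k1 * Y.vol (m + int (fst \<kappa>)))"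
    for x y e1 k1 \<kappa>
  proof -
    define a where "a = 1 / sqrt (Y.vol (m + int (fst \<kappa>)))"
    define u where "u x' = haar_cube e1 (X.the_cube k1 x) x' *\<^sub>R (\<integral>y'. haar_cube (snd \<kappa>) (Y.the_cube (m + int (fst \<kappa>)) y) y' *\<^sub>R f (x', y') \<partial>lborel)" for x'
    have "(\<integral>x'. haar_cube e1 (X.the_cube k1 x) x' *\<^sub>R g \<kappa> y x' \<partial>lborel) = (\<integral>x'. a *\<^sub>R u x' \<partial>lborel)"
      unfolding g_def a_def u_def by (intro Bochner_Integration.integral_cong refl scaleR_left_commute)
    also have "\<dots> = a *\<^sub>R (\<integral>x'. u x' \<partial>lborel)" by (rule integral_scaleR_right)
    also have "(\<integral>x'. u x' \<partial>lborel) = coef f e1 (X.the_cube k1 x) (snd \<kappa>) (Y.the_cube (m + int (fst \<kappa>)) y)"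
      unfolding u_def by (rule partial_coef(2)[OF f Y.the_cube_in(1) X.the_cube_in(1)])
    finally have "(\<integral>x'. haar_cube e1 (X.the_cube k1 x) x' *\<^sub>R g \<kappa> y x' \<partial>lborel)
        = a *\<^sub>R coef f e1 (X.the_cube k1 x) (snd \<kappa>) (Y.the_cube (m + int (fst \<kappa>)) y)" .
    then show ?thesis using Y.vol_pos[of "m + int (fst \<kappa>)"] by (simp add: scale a_def power_divide field_simps)
  qed
  have S_eq: "truncated_square V f m N (x, y) = (\<Sum>l<N. \<Sum>e\<in>UNIV - {\<lambda>_. True}. \<Sum>\<kappa>\<in>K.
      (norm (V (x, y) *v (\<integral>x'. haar_cube e (X.the_cube (m + int l) x) x' *\<^sub>R g \<kappa> y x' \<partial>lborel)))\<^sup>2 / X.vol (m + int l))" for x y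
    unfolding coef1 truncated_square_def by (simp add: K_def E_def case_prod_beta)
  have sq: "ennreal (\<Phi> (x, y) powr p) = ennreal ((\<Sum>l<N. \<Sum>e\<in>E. \<Sum>\<kappa>\<in>{()}.
      (norm (V (x, y) *v (\<integral>y'. haar_cube e (Y.the_cube (m + int l) y) y' *\<^sub>R f (x, y') \<partial>lborel)))\<^sup>2 / Y.vol (m + int l)) powr (p/2))" for x y
  proof -
    have "\<Phi> (x, y) powr p = (\<Sum>\<kappa>\<in>K. (norm (V (x, y) *v g \<kappa> y x))\<^sup>2) powr (p/2)"
      by (simp add: \<Phi>_def L2_set_def powr_half_sqrt[symmetric] sum_nonneg powr_powr)
    also have "(\<Sum>\<kappa>\<in>K. (norm (V (x, y) *v g \<kappa> y x))\<^sup>2) = (\<Sum>l<N. \<Sum>e\<in>E. (norm (V (x, y) *v g (l, e) y x))\<^sup>2)"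
      by (simp add: K_def sum.cartesian_product case_prod_beta)
    finally show ?thesis
      using Y.vol_pos by (simp add: g_def scale power_divide less_imp_le)
  qed
  define c1 where "c1 = ennreal (param_const (real CARD('d)) CARD('n) p * A powr (p * gamma_exp p))"
  define c2 where "c2 = ennreal (param_const (real CARD('d)) CARD('m) p * A powr (p * gamma_exp p))"
  note slice = slice_measurable[OF V(1)] slice_measurable[OF V(2)]
  have first: "AE y in lborel. (\<integral>\<^sup>+x. ennreal (truncated_square V f m N (x, y) powr (p/2)) \<partial>lborel)
      \<le> c1 * (\<integral>\<^sup>+x. ennreal (\<Phi> (x, y) powr p) \<partial>lborel)"
    using Ap1
  proof (rule AE_mp, intro AE_I2 impI)
    fix y assume ap: "\<forall>k. \<forall>Q\<in>X.cubes k. factored_Ap lborel p A (\<lambda>x. V (x, y)) (\<lambda>x. Vi (x, y)) Q"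
    show "(\<integral>\<^sup>+x. ennreal (truncated_square V f m N (x, y) powr (p/2)) \<partial>lborel)
      \<le> c1 * (\<integral>\<^sup>+x. ennreal (\<Phi> (x, y) powr p) \<partial>lborel)"
      unfolding S_eq \<Phi>_def c1_def fst_conv snd_conv
      by (rule X.square_function_one_parameter[where Vi = "\<lambda>x. Vi (x, y)" and V = "\<lambda>x. V (x, y)"])
        (use p A K slice g_int inv ap in auto)
  qed
  have f_slices: "AE x in lborel. integrable lborel (\<lambda>y. f (x, y))"
    using lborel_pair.AE_integrable_fst'[of f] f by (simp add: lborel_prod)
  have second: "AE x in lborel. (\<integral>\<^sup>+y. ennreal (\<Phi> (x, y) powr p) \<partial>lborel)
      \<le> c2 * (\<integral>\<^sup>+y. ennreal (norm (V (x, y) *v f (x, y)) powr p) \<partial>lborel)"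
    using AE_conjI[OF Ap2 f_slices]
  proof (rule AE_mp, intro AE_I2 impI)
    fix x assume ap: "(\<forall>k. \<forall>Q\<in>Y.cubes k. factored_Ap lborel p A (\<lambda>y. V (x, y)) (\<lambda>y. Vi (x, y)) Q) \<and> integrable lborel (\<lambda>y. f (x, y))"
    have "(\<integral>\<^sup>+y. ennreal (\<Phi> (x, y) powr p) \<partial>lborel)
      \<le> c2 * (\<integral>\<^sup>+y. ennreal (L2_set (\<lambda>_. norm (V (x, y) *v f (x, y))) {()} powr p) \<partial>lborel)"
      unfolding sq c2_def E_def
      by (rule Y.square_function_one_parameter[where Vi = "\<lambda>y. Vi (x, y)" and V = "\<lambda>y. V (x, y)" and F = "\<lambda>_ y. f (x, y)"])
        (use p A slice inv ap in auto)
    then show "(\<integral>\<^sup>+y. ennreal (\<Phi> (x, y) powr p) \<partial>lborel)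
      \<le> c2 * (\<integral>\<^sup>+y. ennreal (norm (V (x, y) *v f (x, y)) powr p) \<partial>lborel)" by (simp add: L2_set_def)
  qed
  have nn: "h \<in> borel_measurable borel \<Longrightarrow> (\<integral>\<^sup>+z. h z \<partial>lborel) = (\<integral>\<^sup>+y. (\<integral>\<^sup>+x. h (x, y) \<partial>lborel) \<partial>lborel)"
    "h \<in> borel_measurable borel \<Longrightarrow> (\<integral>\<^sup>+z. h z \<partial>lborel) = (\<integral>\<^sup>+x. (\<integral>\<^sup>+y. h (x, y) \<partial>lborel) \<partial>lborel)"
    for h :: "(real^'n) \<times> (real^'m) \<Rightarrow> ennreal"
    using nn_integral_rectangle[of h UNIV UNIV] by simp_all
  have [measurable]: "truncated_square V f m N \<in> borel_measurable borel" by (rule truncated_square_measurable) simp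
  have mult: "(\<integral>\<^sup>+t. c * u t \<partial>lborel) \<le> c * (\<integral>\<^sup>+t. u t \<partial>lborel)"
    if "u \<in> borel_measurable borel" for c and u :: "'x::euclidean_space \<Rightarrow> ennreal" using that by (simp add: nn_integral_cmult)
  have meas1: "(\<lambda>y. \<integral>\<^sup>+x. h (x, y) \<partial>lborel) \<in> borel_measurable borel" "(\<lambda>x. \<integral>\<^sup>+y. h (x, y) \<partial>lborel) \<in> borel_measurable borel"
    if h: "h \<in> borel_measurable borel" for h :: "(real^'n) \<times> (real^'m) \<Rightarrow> ennreal"
  proof -
    have [measurable]: "h \<in> borel_measurable (lborel \<Otimes>\<^sub>M lborel)" using h by (simp add: lborel_prod)
    show "(\<lambda>y. \<integral>\<^sup>+x. h (x, y) \<partial>lborel) \<in> borel_measurable borel" "(\<lambda>x. \<integral>\<^sup>+y. h (x, y) \<partial>lborel) \<in> borel_measurable borel"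
      by measurable
  qed
  have "(\<integral>\<^sup>+z. ennreal (truncated_square V f m N z powr (p/2)) \<partial>lborel)
      = (\<integral>\<^sup>+y. (\<integral>\<^sup>+x. ennreal (truncated_square V f m N (x, y) powr (p/2)) \<partial>lborel) \<partial>lborel)" by (rule nn(1)) measurable
  also have "\<dots> \<le> (\<integral>\<^sup>+y. c1 * (\<integral>\<^sup>+x. ennreal (\<Phi> (x, y) powr p) \<partial>lborel) \<partial>lborel)" by (rule nn_integral_mono_AE[OF first])
  also have "\<dots> \<le> c1 * (\<integral>\<^sup>+y. (\<integral>\<^sup>+x. ennreal (\<Phi> (x, y) powr p) \<partial>lborel) \<partial>lborel)"
    by (intro mult meas1(1)[of "\<lambda>z. ennreal (\<Phi> z powr p)"]) measurable
  also have "(\<integral>\<^sup>+y. (\<integral>\<^sup>+x. ennreal (\<Phi> (x, y) powr p) \<partial>lborel) \<partial>lborel) = (\<integral>\<^sup>+x. (\<integral>\<^sup>+y. ennreal (\<Phi> (x, y) powr p) \<partial>lborel) \<partial>lborel)"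
    using nn[of "\<lambda>z. ennreal (\<Phi> z powr p)"] by simp
  also have "\<dots> \<le> (\<integral>\<^sup>+x. c2 * (\<integral>\<^sup>+y. ennreal (norm (V (x, y) *v f (x, y)) powr p) \<partial>lborel) \<partial>lborel)" by (rule nn_integral_mono_AE[OF second])
  also have "\<dots> \<le> c2 * (\<integral>\<^sup>+x. (\<integral>\<^sup>+y. ennreal (norm (V (x, y) *v f (x, y)) powr p) \<partial>lborel) \<partial>lborel)"
    by (intro mult meas1(2)[of "\<lambda>z. ennreal (norm (V z *v f z) powr p)"]) measurable
  also have "(\<integral>\<^sup>+x. (\<integral>\<^sup>+y. ennreal (norm (V (x, y) *v f (x, y)) powr p) \<partial>lborel) \<partial>lborel) = (\<integral>\<^sup>+z. ennreal (norm (V z *v f z) powr p) \<partial>lborel)"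
    by (rule nn(2)[symmetric]) measurable
  finally show ?thesis by (simp add: c1_def c2_def mult_left_mono)
qed

end

section \<open>Reduction to Borel functions and conclusion\<close>

lemma borel_version:
  fixes g :: "'a::euclidean_space \<Rightarrow> 'b::euclidean_space"
  assumes g: "g \<in> borel_measurable lebesgue"
  obtains g' where "g' \<in> borel_measurable borel" "AE x in lborel. g x = g' x"
proof -
  have "\<exists>h. h \<in> borel_measurable lborel \<and> (AE x in lborel. g x \<bullet> b = h x)" for b
    using completion_ex_borel_measurable_real[of "\<lambda>x. g x \<bullet> b" lborel] g by auto
  then have "\<forall>b. \<exists>h. h \<in> borel_measurable lborel \<and> (AE x in lborel. g x \<bullet> b = h x)" ..
  from choice[OF this] obtain h where h: "\<forall>b. h b \<in> borel_measurable lborel \<and> (AE x in lborel. g x \<bullet> b = h b x)" ..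
  then have hm [measurable]: "h b \<in> borel_measurable borel" for b by simp
  have "AE x in lborel. \<forall>b\<in>Basis. g x \<bullet> b = h b x" using h by (intro AE_finite_allI) auto
  then have "AE x in lborel. g x = (\<Sum>b\<in>Basis. h b x *\<^sub>R b)"
  proof (rule AE_mp, intro AE_I2 impI)
    fix x assume "\<forall>b\<in>Basis. g x \<bullet> b = h b x"
    then have "(\<Sum>b\<in>Basis. h b x *\<^sub>R b) = (\<Sum>b\<in>Basis. (g x \<bullet> b) *\<^sub>R b)" by (intro sum.cong) auto
    then show "g x = (\<Sum>b\<in>Basis. h b x *\<^sub>R b)" by (simp add: euclidean_representation)
  qed
  moreover have "(\<lambda>x. \<Sum>b\<in>Basis. h b x *\<^sub>R b) \<in> borel_measurable borel" by measurable
  ultimately show thesis by (intro that)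
qed

lemma locally_integrable_measurable:
  fixes W :: "'a::euclidean_space \<Rightarrow> 'b::euclidean_space"
  assumes "\<And>K. compact K \<Longrightarrow> W absolutely_integrable_on K"
  shows "W \<in> borel_measurable lebesgue"
proof (rule borel_measurable_LIMSEQ_metric)
  show "(\<lambda>x. indicator (cball 0 (real n)) x *\<^sub>R W x) \<in> borel_measurable lebesgue" for n :: nat
    using assms[of "cball 0 (real n)"] unfolding set_integrable_def by (intro borel_measurable_integrable) auto
  fix x :: 'a
  obtain N :: nat where N: "norm x \<le> real N" using real_arch_simple by blast
  have "\<forall>\<^sub>F n in sequentially. indicator (cball 0 (real n)) x *\<^sub>R W x = W x"
    using eventually_ge_at_top[of N]
  proof (rule eventually_mono)
    fix n :: nat assume "N \<le> n"
    then have "norm x \<le> real n" using N by simp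
    then show "indicator (cball 0 (real n)) x *\<^sub>R W x = W x" by simp
  qed
  then show "(\<lambda>n. indicator (cball 0 (real n)) x *\<^sub>R W x) \<longlonglongrightarrow> W x" by (rule tendsto_eventually)
qed

lemma enn_powr_ennreal: "0 \<le> t \<Longrightarrow> enn_powr (ennreal t) s = ennreal (t powr s)"
  by (simp add: enn_powr_def)

lemma enn_powr_mono:
  assumes "x \<le> y" "0 \<le> s" shows "enn_powr x s \<le> enn_powr y s"
proof (cases y)
  case (real t)
  then obtain r where "x = ennreal r" "0 \<le> r" "r \<le> t" using assms(1) by (cases x) (auto simp: top_unique)
  then show ?thesis using real assms(2) by (auto simp: enn_powr_ennreal intro!: ennreal_leI powr_mono2)
qed (simp add: enn_powr_def)

lemma enn_powr_enn_powr: "enn_powr (enn_powr x s) r = enn_powr x (s * r)"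
  by (cases x) (auto simp: enn_powr_def powr_powr)

lemma enn_powr_cmult:
  assumes "0 \<le> c" "0 < s" shows "enn_powr (ennreal c * x) s = ennreal (c powr s) * enn_powr x s"
proof (cases x)
  case (real t)
  then show ?thesis using assms by (simp add: enn_powr_ennreal ennreal_mult[symmetric] powr_mult)
next
  case top
  then show ?thesis using assms by (cases "c = 0") (auto simp: enn_powr_def ennreal_mult_top)
qed

lemma enn_powr_le_SUP:
  assumes X: "X \<le> (SUP n. ennreal (x n))" and x: "\<And>n. 0 \<le> x n" and s: "0 < s"
  shows "enn_powr X s \<le> (SUP n. ennreal (x n powr s))"
proof (cases "SUP n. ennreal (x n powr s)")
  case (real y)
  have "x n \<le> y powr (1/s)" for n
  proof -
    have "ennreal (x n powr s) \<le> ennreal y" unfolding real(2)[symmetric] by (rule SUP_upper) simp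
    then have "x n powr s \<le> y" using real(1) by simp
    then have "(x n powr s) powr (1/s) \<le> y powr (1/s)" using s by (intro powr_mono2) auto
    then show ?thesis using s x[of n] by (simp add: powr_powr)
  qed
  then have "X \<le> ennreal (y powr (1/s))" by (intro order_trans[OF X] SUP_least ennreal_leI)
  then have "enn_powr X s \<le> enn_powr (ennreal (y powr (1/s))) s" using s by (intro enn_powr_mono) auto
  also have "\<dots> = ennreal y" using s real(1) by (simp add: enn_powr_ennreal powr_powr)
  finally show ?thesis by (simp add: real)
next
  case top
  then show ?thesis by (simp only: top_greatest)
qed

lemma nn_integral_swap_rectangle:
  fixes h :: "'a::euclidean_space \<times> 'b::euclidean_space \<Rightarrow> ennreal"
  assumes h: "h \<in> borel_measurable borel" and Q: "Q1 \<in> sets borel" "Q2 \<in> sets borel"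
  shows "(\<integral>\<^sup>+w\<in>Q2 \<times> Q1. h (snd w, fst w) \<partial>lborel) = (\<integral>\<^sup>+z\<in>Q1 \<times> Q2. h z \<partial>lborel)"
proof -
  have "(\<lambda>w::'b \<times> 'a. (snd w, fst w)) \<in> borel_measurable borel"
    by (rule borel_measurable_continuous_onI) (intro continuous_intros)
  from measurable_compose[OF this h] have "(\<lambda>w. h (snd w, fst w)) \<in> borel_measurable borel" .
  then show ?thesis using nn_integral_rectangle(1)[of "\<lambda>w. h (snd w, fst w)" Q2 Q1] nn_integral_rectangle(2)[OF h Q] Q by simp
qed

lemma dual_Ap_swap:
  fixes V Vi :: "'a::euclidean_space \<times> 'b::euclidean_space \<Rightarrow> complex^'d^'d"
  assumes [measurable]: "V \<in> borel_measurable borel" "Vi \<in> borel_measurable borel"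
    and Q: "Q1 \<in> sets borel" "Q2 \<in> sets borel"
      "emeasure lborel Q1 = ennreal (measure lborel Q1)" "emeasure lborel Q2 = ennreal (measure lborel Q2)"
    and dual: "dual_Ap lborel p A V Vi (Q1 \<times> Q2)"
  shows "dual_Ap lborel p A (\<lambda>w. V (snd w, fst w)) (\<lambda>w. Vi (snd w, fst w)) (Q2 \<times> Q1)"
proof -
  have m: "measure lborel (Q2 \<times> Q1) = measure lborel (Q1 \<times> Q2)"
    using measure_rectangle(2)[OF Q] measure_rectangle(2)[OF Q(2,1,4,3)] by simp
  have 1: "(\<integral>\<^sup>+w\<in>Q2 \<times> Q1. ennreal (norm (V (snd w, fst w) *v \<psi>) powr p) \<partial>lborel) = (\<integral>\<^sup>+z\<in>Q1 \<times> Q2. ennreal (norm (V z *v \<psi>) powr p) \<partial>lborel)" for \<psi>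
    by (rule nn_integral_swap_rectangle[OF _ Q(1,2), of "\<lambda>z. ennreal (norm (V z *v \<psi>) powr p)"]) measurable
  have 2: "(\<integral>\<^sup>+w\<in>Q2 \<times> Q1. ennreal (norm (e v* Vi (snd w, fst w)) powr conj_exp p) \<partial>lborel) = (\<integral>\<^sup>+z\<in>Q1 \<times> Q2. ennreal (norm (e v* Vi z) powr conj_exp p) \<partial>lborel)" for e
    by (rule nn_integral_swap_rectangle[OF _ Q(1,2), of "\<lambda>z. ennreal (norm (e v* Vi z) powr conj_exp p)"]) measurable
  show ?thesis using dual unfolding dual_Ap_def m 1 2 .
qed

context dyadic_rectangles
begin

lemma truncated_square_eq:
  "truncated_square V f (- int N) (2 * N) z = (\<Sum>(k1, k2)\<in>{- int N..<int N} \<times> {- int N..<int N}. \<Sum>e\<in>signatures.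
    (norm (V z *v coef f (fst e) (X.the_cube k1 (fst z)) (snd e) (Y.the_cube k2 (snd z))))\<^sup>2 / (X.vol k1 * Y.vol k2))"
proof -
  have shift: "(\<Sum>l<2 * N. g (- int N + int l)) = (\<Sum>k\<in>{- int N..<int N}. g k)" for g :: "int \<Rightarrow> real"
    by (rule sum.reindex_bij_witness[where i = "\<lambda>k. nat (k + int N)" and j = "\<lambda>l. - int N + int l"]) auto
  define u where "u k1 e1 k2 e2 = (norm (V z *v coef f e1 (X.the_cube k1 (fst z)) e2 (Y.the_cube k2 (snd z))))\<^sup>2 / (X.vol k1 * Y.vol k2)" for k1 e1 k2 e2
  have "truncated_square V f (- int N) (2 * N) z
      = (\<Sum>l1<2 * N. \<Sum>e1\<in>UNIV - {\<lambda>_. True}. \<Sum>l2<2 * N. \<Sum>e2\<in>UNIV - {\<lambda>_. True}. u (- int N + int l1) e1 (- int N + int l2) e2)"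
    unfolding truncated_square_def u_def sum.cartesian_product by simp
  also have "\<dots> = (\<Sum>k1\<in>{- int N..<int N}. \<Sum>e1\<in>UNIV - {\<lambda>_. True}. \<Sum>k2\<in>{- int N..<int N}. \<Sum>e2\<in>UNIV - {\<lambda>_. True}. u k1 e1 k2 e2)"
    unfolding shift[of "\<lambda>k. \<Sum>e2\<in>UNIV - {\<lambda>_. True}. u _ _ k e2"]
    by (rule shift[of "\<lambda>k1. \<Sum>e1\<in>UNIV - {\<lambda>_. True}. \<Sum>k2\<in>{- int N..<int N}. \<Sum>e2\<in>UNIV - {\<lambda>_. True}. u k1 e1 k2 e2"])
  also have "\<dots> = (\<Sum>k1\<in>{- int N..<int N}. \<Sum>k2\<in>{- int N..<int N}. \<Sum>e1\<in>UNIV - {\<lambda>_. True}. \<Sum>e2\<in>UNIV - {\<lambda>_. True}. u k1 e1 k2 e2)"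
    by (intro sum.cong refl sum.swap)
  also have "\<dots> = (\<Sum>(k1, k2)\<in>{- int N..<int N} \<times> {- int N..<int N}. \<Sum>e\<in>signatures. u k1 (fst e) k2 (snd e))"
  proof -
    have "(\<Sum>e\<in>signatures. u k1 (fst e) k2 (snd e)) = (\<Sum>e1\<in>UNIV - {\<lambda>_. True}. \<Sum>e2\<in>UNIV - {\<lambda>_. True}. u k1 e1 k2 e2)" for k1 k2
      by (simp add: signatures_def sum.cartesian_product case_prod_beta)
    then show ?thesis by (simp only:) (rule sum.cartesian_product)
  qed
  finally show ?thesis by (simp add: u_def)
qed

text \<open>
  Finitely many rectangles use finitely many levels, and a point lies in only one rectangle of each
  pair of levels.
\<close>

lemma square_sum_le_SUP:
  assumes \<D>: "\<D>1 = (\<Union>k. X.cubes k)" "\<D>2 = (\<Union>k. Y.cubes k)"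
  shows "(\<Sum>\<^sub>\<infinity>R\<in>\<D>1 \<times> \<D>2. \<Sum>e\<in>signatures.
      ennreal ((norm (V z *v coef f (fst e) (fst R) (snd e) (snd R)))\<^sup>2 * indicator (rect R) z / measure lebesgue (rect R)))
    \<le> (SUP N. ennreal (truncated_square V f (- int N) (2 * N) z))"
proof -
  define t where "t R = (\<Sum>e\<in>signatures.
      ennreal ((norm (V z *v coef f (fst e) (fst R) (snd e) (snd R)))\<^sup>2 * indicator (rect R) z / measure lebesgue (rect R)))" for R
  define \<phi> where "\<phi> k = (X.the_cube (fst k) (fst z), Y.the_cube (snd k) (snd z))" for k
  have t\<phi>: "t (\<phi> k) = ennreal (\<Sum>e\<in>signatures. (norm (V z *v coef f (fst e) (X.the_cube (fst k) (fst z)) (snd e) (Y.the_cube (snd k) (snd z))))\<^sup>2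
      / (X.vol (fst k) * Y.vol (snd k)))" for k
  proof -
    have Q: "X.the_cube (fst k) (fst z) \<in> X.cubes (fst k)" "Y.the_cube (snd k) (snd z) \<in> Y.cubes (snd k)"
      by (auto intro: X.the_cube_in Y.the_cube_in)
    note X = X.cubes_measure[OF Q(1)] and Y = Y.cubes_measure[OF Q(2)]
    have "measure lebesgue (rect (\<phi> k)) = X.vol (fst k) * Y.vol (snd k)"
      using measure_rectangle(2)[of "X.the_cube (fst k) (fst z)" "Y.the_cube (snd k) (snd z)"] X Y
      by (simp add: rect_def \<phi>_def measure_completion borel_Times)
    moreover have "z \<in> rect (\<phi> k)" by (simp add: rect_def \<phi>_def mem_Times_iff X.the_cube_in Y.the_cube_in)
    ultimately show ?thesis
      using X.vol_pos[of "fst k"] Y.vol_pos[of "snd k"] by (subst sum_ennreal[symmetric]) (auto simp: t_def \<phi>_def less_imp_le)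
  qed
  have T: "ennreal (truncated_square V f (- int N) (2 * N) z) = (\<Sum>k\<in>{- int N..<int N} \<times> {- int N..<int N}. t (\<phi> k))" for N
    unfolding truncated_square_eq t\<phi> using X.vol_pos Y.vol_pos
    by (subst sum_ennreal) (auto simp: case_prod_beta less_imp_le intro!: sum_nonneg)
  have "(\<Sum>\<^sub>\<infinity>R\<in>\<D>1 \<times> \<D>2. t R) = (SUP F\<in>{F. finite F \<and> F \<subseteq> \<D>1 \<times> \<D>2}. sum t F)" by (rule nonneg_infsum_complete) simp
  also have "\<dots> \<le> (SUP N. ennreal (truncated_square V f (- int N) (2 * N) z))"
  proof (rule SUP_least)
    fix F assume "F \<in> {F. finite F \<and> F \<subseteq> \<D>1 \<times> \<D>2}"
    then have F: "finite F" "F \<subseteq> \<D>1 \<times> \<D>2" by auto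
    have "\<forall>R. \<exists>k. R \<in> F \<longrightarrow> fst R \<in> X.cubes (fst k) \<and> snd R \<in> Y.cubes (snd k)"
    proof
      fix R show "\<exists>k. R \<in> F \<longrightarrow> fst R \<in> X.cubes (fst k) \<and> snd R \<in> Y.cubes (snd k)"
      proof (cases "R \<in> F")
        case True
        then have "fst R \<in> \<D>1" "snd R \<in> \<D>2" using F(2) by auto
        then obtain k1 k2 where "fst R \<in> X.cubes k1" "snd R \<in> Y.cubes k2" by (auto simp: \<D>)
        then show ?thesis by (intro exI[of _ "(k1, k2)"]) simp
      qed simp
    qed
    from choice[OF this] obtain \<kappa> where \<kappa>: "\<forall>R. R \<in> F \<longrightarrow> fst R \<in> X.cubes (fst (\<kappa> R)) \<and> snd R \<in> Y.cubes (snd (\<kappa> R))" ..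
    have "finite ((\<lambda>R. nat \<bar>fst (\<kappa> R)\<bar>) ` F \<union> (\<lambda>R. nat \<bar>snd (\<kappa> R)\<bar>) ` F)" using F(1) by simp
    then obtain N where N: "\<forall>n\<in>(\<lambda>R. nat \<bar>fst (\<kappa> R)\<bar>) ` F \<union> (\<lambda>R. nat \<bar>snd (\<kappa> R)\<bar>) ` F. n < N"
      unfolding finite_nat_set_iff_bounded ..
    define B where "B = {- int N..<int N} \<times> {- int N..<int N}"
    have sub: "{R \<in> F. z \<in> rect R} \<subseteq> \<phi> ` B"
    proof
      fix R assume "R \<in> {R \<in> F. z \<in> rect R}"
      then have R: "R \<in> F" "fst z \<in> fst R" "snd z \<in> snd R" by (auto simp: rect_def)
      have "nat \<bar>fst (\<kappa> R)\<bar> < N" "nat \<bar>snd (\<kappa> R)\<bar> < N" using N R(1) by auto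
      then have "\<kappa> R \<in> B" by (auto simp: B_def mem_Times_iff)
      moreover have "X.the_cube (fst (\<kappa> R)) (fst z) = fst R" "Y.the_cube (snd (\<kappa> R)) (snd z) = snd R"
        using \<kappa>[rule_format, OF R(1)] R by (simp_all add: X.the_cube_eq Y.the_cube_eq)
      then have "\<phi> (\<kappa> R) = R" by (simp add: \<phi>_def)
      ultimately show "R \<in> \<phi> ` B" by (intro image_eqI[where x = "\<kappa> R"]) simp_all
    qed
    have "sum t F = sum t {R \<in> F. z \<in> rect R}"
      by (rule sum.mono_neutral_right) (use F(1) in \<open>auto simp: t_def\<close>)
    also have "\<dots> \<le> sum t (\<phi> ` B)" by (rule sum_mono2[OF _ sub]) (auto simp: B_def)
    also have "\<dots> \<le> sum (t \<circ> \<phi>) B" by (rule sum_image_le) (auto simp: B_def)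
    also have "\<dots> = ennreal (truncated_square V f (- int N) (2 * N) z)" by (simp add: T B_def)
    also have "\<dots> \<le> (SUP N. ennreal (truncated_square V f (- int N) (2 * N) z))" by (rule SUP_upper) simp
    finally show "sum t F \<le> (SUP N. ennreal (truncated_square V f (- int N) (2 * N) z))" .
  qed
  finally show ?thesis by (simp add: t_def)
qed

lemma truncated_square_incseq: "incseq (\<lambda>N. truncated_square V f (- int N) (2 * N) z)"
  unfolding truncated_square_eq
proof (rule monoI, rule sum_mono2)
  fix M N :: nat assume "M \<le> N"
  then show "{- int M..<int M} \<times> {- int M..<int M} \<subseteq> {- int N..<int N} \<times> {- int N..<int N}" by auto
qed (use X.vol_pos Y.vol_pos in \<open>auto intro!: sum_nonneg simp: less_imp_le\<close>)

end

lemma Ap_inner_average: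
  fixes W V Vi :: "(real^'n::finite) \<times> (real^'m::finite) \<Rightarrow> complex^'d^'d"
  assumes V: "AE z in lborel. mat_powr (W z) (1 / p) = V z \<and> mat_powr (W z) (- (1 / p)) = Vi z"
    and R: "R \<in> \<D>" "rect R \<in> sets borel" "emeasure lborel (rect R) = ennreal m" "0 < m"
    and a: "Ap_const p \<D> W \<le> ennreal a" "0 \<le> a"
  shows "(\<integral>\<^sup>+x\<in>rect R. enn_powr ((\<integral>\<^sup>+y\<in>rect R. ennreal (opnorm (V x ** Vi y) powr conj_exp p) \<partial>lborel) / emeasure lborel (rect R))
        (p / conj_exp p) \<partial>lborel) \<le> ennreal (a * m)"
proof -
  have inner: "(\<integral>\<^sup>+y\<in>rect R. ennreal (opnorm (M ** Vi y) powr conj_exp p) \<partial>lborel)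
      = (\<integral>\<^sup>+y\<in>rect R. ennreal (opnorm (M ** mat_powr (W y) (- (1 / p))) powr conj_exp p) \<partial>lebesgue)" for M
    unfolding nn_integral_completion using V by (intro nn_integral_cong_AE) auto
  have eR: "emeasure lebesgue (rect R) = ennreal m" using R(2,3) by simp
  define I where "I = (\<integral>\<^sup>+x\<in>rect R. enn_powr ((\<integral>\<^sup>+y\<in>rect R. ennreal (opnorm (mat_powr (W x) (1 / p) ** mat_powr (W y) (- (1 / p))) powr conj_exp p) \<partial>lebesgue) / emeasure lebesgue (rect R))
        (p / conj_exp p) \<partial>lebesgue)"
  have "(\<integral>\<^sup>+x\<in>rect R. enn_powr ((\<integral>\<^sup>+y\<in>rect R. ennreal (opnorm (V x ** Vi y) powr conj_exp p) \<partial>lborel) / emeasure lborel (rect R))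
        (p / conj_exp p) \<partial>lborel) = I"
    unfolding I_def inner R(3) eR nn_integral_completion[of lborel "\<lambda>x. _ x * indicator (rect R) x"]
    using V by (intro nn_integral_cong_AE) auto
  also have "I = I / ennreal m * ennreal m"
    using R(4) by (simp add: ennreal_divide_times divide_ennreal)
  also have "I / ennreal m \<le> Ap_const p \<D> W"
    unfolding I_def Ap_const_def eR[symmetric] by (rule SUP_upper[OF R(1)])
  also have "Ap_const p \<D> W \<le> ennreal a" by (rule a)
  finally show ?thesis using a(2) R(4) by (simp add: ennreal_mult mult_right_mono)
qed

text \<open>
  The inner average is finite at some \<open>x\<close>, and \<open>row k (Vi y) = row k (Vi x) v* (V x ** Vi y)\<close>.
\<close>

lemma dual_weight_integrable:
  fixes V Vi :: "'a::euclidean_space \<Rightarrow> complex^'d^'d"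
  assumes p: "1 < p" and R: "R \<in> sets borel" "emeasure lborel R = ennreal m" "0 < m"
    and inv: "\<And>x. Vi x ** V x = mat 1"
    and avg: "(\<integral>\<^sup>+x\<in>R. enn_powr ((\<integral>\<^sup>+y\<in>R. ennreal (opnorm (V x ** Vi y) powr conj_exp p) \<partial>lborel) / emeasure lborel R)
        (p / conj_exp p) \<partial>lborel) < \<infinity>"
    and Vi [measurable]: "Vi \<in> borel_measurable borel"
  shows "(\<integral>\<^sup>+y\<in>R. ennreal (norm (row k (Vi y)) powr conj_exp p) \<partial>lborel) < \<infinity>"
proof -
  define q where "q = conj_exp p"
  have q: "1 < q" using conj_exp_props[OF p] by (simp add: q_def)
  define J where "J x = (\<integral>\<^sup>+y\<in>R. ennreal (opnorm (V x ** Vi y) powr q) \<partial>lborel)" for x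
  have "\<exists>x\<in>R. J x \<noteq> \<infinity>"
  proof (rule ccontr)
    assume "\<not> ?thesis"
    then have "enn_powr (J x / emeasure lborel R) (p / q) * indicator R x = \<infinity> * indicator R x" for x
      using R(2) by (auto simp: indicator_def enn_powr_def ennreal_top_divide)
    then have "(\<integral>\<^sup>+x\<in>R. enn_powr (J x / emeasure lborel R) (p / q) \<partial>lborel) = \<infinity> * emeasure lborel R"
      using R(1) by (simp add: nn_integral_cmult_indicator)
    then show False using avg R(2,3) unfolding J_def q_def by (simp add: ennreal_top_mult)
  qed
  then obtain x where x: "x \<in> R" "J x \<noteq> \<infinity>" ..
  define c where "c = norm (axis k 1 v* Vi x)"
  have "(\<integral>\<^sup>+y\<in>R. ennreal (norm (row k (Vi y)) powr q) \<partial>lborel) \<le> (\<integral>\<^sup>+y. ennreal (c powr q) * (ennreal (opnorm (V x ** Vi y) powr q) * indicator R y) \<partial>lborel)"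
    unfolding mult.assoc[symmetric]
  proof (intro nn_integral_mono mult_right_mono)
    fix y
    have "row k (Vi y) = (axis k 1 v* Vi x) v* (V x ** Vi y)"
      by (simp add: vector_matrix_axis[symmetric] vector_matrix_mul_assoc matrix_mul_assoc inv del: vector_matrix_axis)
    then have "norm (row k (Vi y)) \<le> c * opnorm (V x ** Vi y)" unfolding c_def by (simp only: opnorm_bounds)
    then have "norm (row k (Vi y)) powr q \<le> (c * opnorm (V x ** Vi y)) powr q" using q by (intro powr_mono2) auto
    then show "ennreal (norm (row k (Vi y)) powr q) \<le> ennreal (c powr q) * ennreal (opnorm (V x ** Vi y) powr q)"
      by (simp add: ennreal_mult[symmetric] powr_mult c_def opnorm_bounds)
  qed simp
  also have "\<dots> = ennreal (c powr q) * J x"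
  proof -
    have [measurable]: "R \<in> sets borel" by (rule R(1))
    show ?thesis unfolding J_def by (intro nn_integral_cmult) measurable
  qed
  also have "\<dots> < \<infinity>" using x(2) by (simp add: ennreal_mult_less_top top.not_eq_extremum)
  finally show ?thesis by (simp add: q_def)
qed

context dyadic_rectangles
begin

text \<open>
  The second assertion is the first one after exchanging the variables.
\<close>

lemma slices_of_biparameter_weight:
  fixes V Vi :: "(real^'n) \<times> (real^'m) \<Rightarrow> complex^'d^'d"
  assumes p: "1 < p" and V: "V \<in> borel_measurable borel" "Vi \<in> borel_measurable borel"
    and inv: "\<And>z. V z ** Vi z = mat 1" "\<And>z. Vi z ** V z = mat 1" and A: "0 < A"
    and avg: "\<And>k1 k2 Q1 Q2. Q1 \<in> X.cubes k1 \<Longrightarrow> Q2 \<in> Y.cubes k2 \<Longrightarrow>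
      (\<integral>\<^sup>+x\<in>Q1 \<times> Q2. enn_powr ((\<integral>\<^sup>+y\<in>Q1 \<times> Q2. ennreal (opnorm (V x ** Vi y) powr conj_exp p) \<partial>lborel) / emeasure lborel (Q1 \<times> Q2))
        (p / conj_exp p) \<partial>lborel) \<le> ennreal (A * measure lborel (Q1 \<times> Q2))"
  shows "AE y in lborel. \<forall>k. \<forall>Q\<in>X.cubes k. factored_Ap lborel p (2 powr (2 * p + 1) * A) (\<lambda>x. V (x, y)) (\<lambda>x. Vi (x, y)) Q"
    and "AE x in lborel. \<forall>k. \<forall>Q\<in>Y.cubes k. factored_Ap lborel p (2 powr (2 * p + 1) * A) (\<lambda>y. V (x, y)) (\<lambda>y. Vi (x, y)) Q"
proof -
  define C1 where "C1 = (\<Union>k. X.cubes k)"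
  define C2 where "C2 = (\<Union>k. Y.cubes k)"
  have C1: "countable C1" "\<And>Q. Q \<in> C1 \<Longrightarrow> Q \<in> sets borel" "\<And>Q. Q \<in> C1 \<Longrightarrow> 0 < measure lborel Q"
      "\<And>Q. Q \<in> C1 \<Longrightarrow> emeasure lborel Q = ennreal (measure lborel Q)"
    using X.cubes_countable X.cubes_measure X.vol_pos by (auto simp: C1_def)
  have C1_UN: "\<Union>C1 = UNIV"
  proof (intro equalityI subset_UNIV subsetI)
    fix x
    have "X.the_cube 0 x \<in> C1" unfolding C1_def by (intro UN_I[of 0] UNIV_I X.the_cube_in)
    then show "x \<in> \<Union>C1" using X.the_cube_in(2) by (rule UnionI)
  qed
  have C2: "countable C2" "\<And>Q. Q \<in> C2 \<Longrightarrow> Q \<in> sets borel" "\<And>Q. Q \<in> C2 \<Longrightarrow> 0 < measure lborel Q"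
      "\<And>Q. Q \<in> C2 \<Longrightarrow> emeasure lborel Q = ennreal (measure lborel Q)"
    using Y.cubes_countable Y.cubes_measure Y.vol_pos by (auto simp: C2_def)
  have C2_UN: "\<Union>C2 = UNIV"
  proof (intro equalityI subset_UNIV subsetI)
    fix x
    have "Y.the_cube 0 x \<in> C2" unfolding C2_def by (intro UN_I[of 0] UNIV_I Y.the_cube_in)
    then show "x \<in> \<Union>C2" using Y.the_cube_in(2) by (rule UnionI)
  qed
  have rect: "Q1 \<times> Q2 \<in> sets borel" "emeasure lborel (Q1 \<times> Q2) = ennreal (measure lborel (Q1 \<times> Q2))" "0 < measure lborel (Q1 \<times> Q2)"
    if "Q1 \<in> C1" "Q2 \<in> C2" for Q1 Q2
    using measure_rectangle[OF C1(2)[OF that(1)] C2(2)[OF that(2)] C1(4)[OF that(1)] C2(4)[OF that(2)]] C1(2,3)[OF that(1)] C2(2,3)[OF that(2)]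
    by (simp_all add: borel_Times)
  have avg': "(\<integral>\<^sup>+x\<in>Q1 \<times> Q2. enn_powr ((\<integral>\<^sup>+y\<in>Q1 \<times> Q2. ennreal (opnorm (V x ** Vi y) powr conj_exp p) \<partial>lborel) / emeasure lborel (Q1 \<times> Q2))
        (p / conj_exp p) \<partial>lborel) \<le> ennreal (A * measure lborel (Q1 \<times> Q2))" if "Q1 \<in> C1" "Q2 \<in> C2" for Q1 Q2
    using that unfolding C1_def C2_def by (elim UN_E) (rule avg)
  have dual: "dual_Ap lborel p A V Vi (Q1 \<times> Q2)" if "Q1 \<in> C1" "Q2 \<in> C2" for Q1 Q2
    by (rule dual_Ap_of_average[OF p _ _ _ _ avg'[OF that]]) (use rect[OF that] V in auto)
  have fin: "(\<integral>\<^sup>+z\<in>Q1 \<times> Q2. ennreal (norm (row k (Vi z)) powr conj_exp p) \<partial>lborel) < \<infinity>" if "Q1 \<in> C1" "Q2 \<in> C2" for Q1 Q2 k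
    by (rule dual_weight_integrable[OF p rect[OF that] inv(2) le_less_trans[OF avg'[OF that]] V(2)]) simp
  have "AE y in lborel. \<forall>Q1\<in>C1. factored_Ap lborel p (2 powr (2 * p + 1) * A) (\<lambda>x. V (x, y)) (\<lambda>x. Vi (x, y)) Q1"
    by (rule slices_factored_Ap[OF p A V inv C1 C2 C2_UN _ dual fin]) (auto simp: C2_def intro: Y.cube_density[simplified])
  then show "AE y in lborel. \<forall>k. \<forall>Q\<in>X.cubes k. factored_Ap lborel p (2 powr (2 * p + 1) * A) (\<lambda>x. V (x, y)) (\<lambda>x. Vi (x, y)) Q"
    by (simp add: C1_def)
  define V' where "V' w = V (snd w, fst w)" for w
  define Vi' where "Vi' w = Vi (snd w, fst w)" for w
  have sw: "(\<lambda>w. (snd w, fst w)) \<in> (borel :: ((real^'m) \<times> (real^'n)) measure) \<rightarrow>\<^sub>M borel"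
    by (rule borel_measurable_continuous_onI) (intro continuous_intros)
  have V': "V' \<in> borel_measurable borel" "Vi' \<in> borel_measurable borel"
    unfolding V'_def[abs_def] Vi'_def[abs_def] by (rule measurable_compose[OF sw V(1)], rule measurable_compose[OF sw V(2)])
  have inv': "V' w ** Vi' w = mat 1" "Vi' w ** V' w = mat 1" for w by (simp_all add: V'_def Vi'_def inv)
  have dual': "dual_Ap lborel p A V' Vi' (Q2 \<times> Q1)" if "Q2 \<in> C2" "Q1 \<in> C1" for Q1 Q2
    unfolding V'_def[abs_def] Vi'_def[abs_def]
    by (rule dual_Ap_swap[OF V C1(2)[OF that(2)] C2(2)[OF that(1)] C1(4)[OF that(2)] C2(4)[OF that(1)] dual[OF that(2,1)]])
  have fin': "(\<integral>\<^sup>+w\<in>Q2 \<times> Q1. ennreal (norm (row k (Vi' w)) powr conj_exp p) \<partial>lborel) < \<infinity>" if "Q2 \<in> C2" "Q1 \<in> C1" for Q1 Q2 k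
  proof -
    have "(\<lambda>z. ennreal (norm (axis k 1 v* Vi z) powr conj_exp p)) \<in> borel_measurable borel" using V(2) by measurable
    from nn_integral_swap_rectangle[OF this C1(2)[OF that(2)] C2(2)[OF that(1)]] fin[OF that(2,1), of k]
    show ?thesis by (simp add: Vi'_def vector_matrix_axis)
  qed
  have "AE y in lborel. \<forall>Q1\<in>C2. factored_Ap lborel p (2 powr (2 * p + 1) * A) (\<lambda>x. V' (x, y)) (\<lambda>x. Vi' (x, y)) Q1"
    by (rule slices_factored_Ap[OF p A V' inv' C2 C1 C1_UN _ dual' fin']) (auto simp: C1_def intro: X.cube_density[simplified])
  then show "AE x in lborel. \<forall>k. \<forall>Q\<in>Y.cubes k. factored_Ap lborel p (2 powr (2 * p + 1) * A) (\<lambda>y. V (x, y)) (\<lambda>y. Vi (x, y)) Q"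
    by (simp add: C2_def V'_def Vi'_def)
qed

lemma haar_coeff_eq_coef:
  fixes f f' :: "(real^'n) \<times> (real^'m) \<Rightarrow> complex^'d"
  assumes f: "f \<in> borel_measurable lebesgue" and f': "f' \<in> borel_measurable borel" "AE z in lborel. f z = f' z"
    and R: "fst R \<in> X.cubes k1" "snd R \<in> Y.cubes k2"
  shows "haar_coeff f e R = coef f' (fst e) (fst R) (snd e) (snd R)"
proof -
  define h where "h z = haar_cube (fst e) (fst R) (fst z) * haar_cube (snd e) (snd R) (snd z)" for z
  have [measurable]: "(\<lambda>z. haar_cube (fst e) (fst R) (fst z)) \<in> borel_measurable (borel :: ((real^'n) \<times> (real^'m)) measure)"
    by (rule measurable_compose[OF fst_snd_borel(1) X.haar_cube_measurable[OF R(1)]])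
  have [measurable]: "(\<lambda>z. haar_cube (snd e) (snd R) (snd z)) \<in> borel_measurable (borel :: ((real^'n) \<times> (real^'m)) measure)"
    by (rule measurable_compose[OF fst_snd_borel(2) Y.haar_cube_measurable[OF R(2)]])
  have h: "h \<in> borel_measurable lborel" unfolding h_def[abs_def] by measurable
  have h': "h \<in> borel_measurable lebesgue" using h by (rule measurable_completion)
  have hf: "(\<lambda>z. h z *\<^sub>R f' z) \<in> borel_measurable lborel" using h f'(1) by simp
  have "haar_coeff f e R = (\<integral>z. h z *\<^sub>R f z \<partial>lebesgue)" by (simp add: haar_coeff_def haar_def h_def)
  also have "\<dots> = (\<integral>z. h z *\<^sub>R f' z \<partial>lebesgue)"
  proof (rule integral_cong_AE)
    show "(\<lambda>z. h z *\<^sub>R f z) \<in> borel_measurable lebesgue" using h' f by (rule borel_measurable_scaleR)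
    show "(\<lambda>z. h z *\<^sub>R f' z) \<in> borel_measurable lebesgue" using hf by (rule measurable_completion)
    show "AE z in lebesgue. h z *\<^sub>R f z = h z *\<^sub>R f' z" using AE_completion[OF f'(2)] by auto
  qed
  also have "\<dots> = (\<integral>z. h z *\<^sub>R f' z \<partial>lborel)" by (rule integral_completion[OF hf])
  finally show ?thesis by (simp add: coef_def h_def)
qed

end

lemma Linfty_c_integrable:
  assumes "f \<in> Linfty_c" shows "f \<in> borel_measurable lebesgue" "integrable lebesgue f"
proof -
  obtain B K where f [measurable]: "f \<in> borel_measurable lebesgue" and B: "AE x in lebesgue. norm (f x) \<le> B"
    and K: "compact K" "AE x in lebesgue. x \<notin> K \<longrightarrow> f x = 0"
    using assms unfolding Linfty_c_def by blast
  show "f \<in> borel_measurable lebesgue" by (rule f)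
  have "K \<in> sets borel" using K(1) by (simp add: compact_imp_closed)
  moreover have "emeasure lborel K < \<infinity>" using K(1) by (rule emeasure_compact_finite)
  ultimately have int: "integrable lebesgue (\<lambda>x. B * indicator K x :: real)"
    by (intro integrable_mult_right integrable_real_indicator) auto
  show "integrable lebesgue f"
    by (rule Bochner_Integration.integrable_bound[OF int f]) (use B K(2) in \<open>auto simp: indicator_def\<close>)
qed

text \<open>
  The \<open>p\<close>-th root of the two one-parameter constants and of the factor lost in passing to slices, once
  for each variable. The maxima make nonnegativity evident.
\<close>

definition biparameter_const :: "real \<Rightarrow> nat \<Rightarrow> nat \<Rightarrow> real \<Rightarrow> real"
  where "biparameter_const d n m p =
    (max 0 (param_const d n p) * max 0 (param_const d m p) * (2 powr (2 * p + 1)) powr (p * gamma_exp p) * (2 powr (2 * p + 1)) powr (p * gamma_exp p)) powr (1 / p)"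

lemma (in dyadic_rectangles) weighted_square_function_bound:
  fixes W :: "(real^'n) \<times> (real^'m) \<Rightarrow> complex^'d^'d" and f :: "(real^'n) \<times> (real^'m) \<Rightarrow> complex^'d"
  assumes p: "1 < p" and \<D>: "\<D>1 = (\<Union>k. X.cubes k)" "\<D>2 = (\<Union>k. Y.cubes k)"
    and W: "Ap_weight p (\<D>1 \<times> \<D>2) W" and f: "f \<in> Linfty_c"
  shows "Lp_norm p (square_function p (\<D>1 \<times> \<D>2) W f)
    \<le> ennreal (biparameter_const (real CARD('d)) CARD('n) CARD('m) p) *
      enn_powr (Ap_const p (\<D>1 \<times> \<D>2) W) (2 * gamma_exp p) * weighted_Lp_norm p W f"
proof -
  have W_meas: "W \<in> borel_measurable lebesgue"
    using W by (intro locally_integrable_measurable) (auto simp: Ap_weight_def matrix_weight_def)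
  obtain W' where W' [measurable]: "W' \<in> borel_measurable borel" and WW': "AE z in lborel. W z = W' z"
    by (rule borel_version[OF W_meas])
  have "AE z in lborel. posdef (W z)"
    using W by (simp add: Ap_weight_def matrix_weight_def AE_completion_iff)
  define V where "V = weight_power W' (1 / p)"
  define Vi where "Vi = weight_power W' (- (1 / p))"
  have V [measurable]: "V \<in> borel_measurable borel" "Vi \<in> borel_measurable borel" by (simp_all add: V_def Vi_def)
  have inv: "V z ** Vi z = mat 1" "Vi z ** V z = mat 1" for z by (simp_all add: V_def Vi_def weight_power_inverse)
  have V_eq: "AE z in lborel. mat_powr (W z) (1 / p) = V z \<and> mat_powr (W z) (- (1 / p)) = Vi z"
    using AE_conjI[OF WW' \<open>AE z in lborel. posdef (W z)\<close>] by (rule AE_mp) (auto simp: V_def Vi_def weight_power_def)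
  obtain a where a: "Ap_const p (\<D>1 \<times> \<D>2) W = ennreal a" "0 \<le> a"
    using W by (cases "Ap_const p (\<D>1 \<times> \<D>2) W") (auto simp: Ap_weight_def)
  define c where "c = 2 powr (2 * p + 1)"
  have c: "0 < c" by (simp add: c_def)
  have avg: "(\<integral>\<^sup>+x\<in>Q1 \<times> Q2. enn_powr ((\<integral>\<^sup>+y\<in>Q1 \<times> Q2. ennreal (opnorm (V x ** Vi y) powr conj_exp p) \<partial>lborel) / emeasure lborel (Q1 \<times> Q2))
        (p / conj_exp p) \<partial>lborel) \<le> ennreal (A * measure lborel (Q1 \<times> Q2))"
    if Q: "Q1 \<in> X.cubes k1" "Q2 \<in> Y.cubes k2" and A: "a \<le> A" for Q1 Q2 k1 k2 A
  proof -
    note m = measure_rectangle[OF X.cubes_measure(1)[OF Q(1)] Y.cubes_measure(1)[OF Q(2)], unfolded X.cubes_measure[OF Q(1)] Y.cubes_measure[OF Q(2)], OF refl refl]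
    have "(\<integral>\<^sup>+x\<in>rect (Q1, Q2). enn_powr ((\<integral>\<^sup>+y\<in>rect (Q1, Q2). ennreal (opnorm (V x ** Vi y) powr conj_exp p) \<partial>lborel) / emeasure lborel (rect (Q1, Q2)))
        (p / conj_exp p) \<partial>lborel) \<le> ennreal (A * (X.vol k1 * Y.vol k2))"
    proof (rule Ap_inner_average[OF V_eq])
      show "(Q1, Q2) \<in> \<D>1 \<times> \<D>2" using Q by (auto simp: \<D>)
      show "rect (Q1, Q2) \<in> sets borel" using X.cubes_measure(1)[OF Q(1)] Y.cubes_measure(1)[OF Q(2)] by (simp add: rect_def borel_Times)
      show "emeasure lborel (rect (Q1, Q2)) = ennreal (X.vol k1 * Y.vol k2)" by (simp add: rect_def m)
      show "0 < X.vol k1 * Y.vol k2" using X.vol_pos Y.vol_pos by simp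
      show "Ap_const p (\<D>1 \<times> \<D>2) W \<le> ennreal A" unfolding a using A by (rule ennreal_leI)
      show "0 \<le> A" using a(2) A by simp
    qed
    then show ?thesis by (simp add: rect_def m)
  qed
  have slices: "AE y in lborel. \<forall>k. \<forall>Q\<in>X.cubes k. factored_Ap lborel p (c * A) (\<lambda>x. V (x, y)) (\<lambda>x. Vi (x, y)) Q"
    "AE x in lborel. \<forall>k. \<forall>Q\<in>Y.cubes k. factored_Ap lborel p (c * A) (\<lambda>y. V (x, y)) (\<lambda>y. Vi (x, y)) Q"
    if A: "0 < A" "a \<le> A" for A
    unfolding c_def
    by (rule slices_of_biparameter_weight(1)[OF p V inv A(1)], rule avg[OF _ _ A(2)], assumption+)
      (rule slices_of_biparameter_weight(2)[OF p V inv A(1)], rule avg[OF _ _ A(2)], assumption+)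
  have ge1: "1 \<le> c * A" if A: "0 < A" "a \<le> A" for A
  proof -
    have "ae_filter (lborel :: (real^'m) measure) \<noteq> bot" by (simp add: ae_filter_eq_bot_iff)
    from eventually_happens'[OF this slices(1)[OF A]]
    obtain y where y: "\<forall>k. \<forall>Q\<in>X.cubes k. factored_Ap lborel p (c * A) (\<lambda>x. V (x, y)) (\<lambda>x. Vi (x, y)) Q" ..
    have Q: "X.the_cube 0 0 \<in> X.cubes 0" by (rule X.the_cube_in)
    show ?thesis
      by (rule factored_Ap_ge_1[OF p _ _ _ _ _ _ _ y[rule_format, OF Q]])
        (use A c X.cubes_measure[OF Q] X.vol_pos slice_measurable[OF V(1)] slice_measurable[OF V(2)] inv in auto)
  qed
  \<comment> \<open>If \<open>a\<close> vanished, \<open>ge1\<close> would apply to arbitrarily small \<open>A\<close>.\<close>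
  have a0: "0 < a"
  proof (rule ccontr)
    assume "\<not> 0 < a"
    then have "1 \<le> c * (1 / (2 * c))" using a(2) c by (intro ge1) auto
    then show False using c by simp
  qed
  define A where "A = c * a"
  have A: "1 \<le> A" unfolding A_def using a0 by (intro ge1) auto
  obtain f' where f' [measurable]: "f' \<in> borel_measurable borel" and ff': "AE z in lborel. f z = f' z"
    by (rule borel_version[OF Linfty_c_integrable(1)[OF f]])
  have f'_int: "integrable lborel f'"
  proof -
    have "integrable lebesgue f'"
      using Linfty_c_integrable[OF f] AE_completion[OF ff'] measurable_completion[of f' lborel borel] f'
      by (subst integrable_cong_AE[of f' lebesgue f]) auto
    then show ?thesis using f' by (subst (asm) integrable_completion) auto
  qed
  define B where "B = (\<integral>\<^sup>+z. ennreal (norm (V z *v f' z) powr p) \<partial>lborel)"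
  define G where "G = A powr (p * gamma_exp p)"
  define c1 where "c1 = max 0 (param_const (real CARD('d)) CARD('n) p)"
  define c2 where "c2 = max 0 (param_const (real CARD('d)) CARD('m) p)"
  have c12: "0 \<le> c1" "0 \<le> c2" "0 \<le> G" by (simp_all add: c1_def c2_def G_def)
  have trunc: "(\<integral>\<^sup>+z. ennreal (truncated_square V f' m N z powr (p/2)) \<partial>lborel) \<le> ennreal (c1 * G * (c2 * G)) * B" for m N
  proof -
    have "(\<integral>\<^sup>+z. ennreal (truncated_square V f' m N z powr (p/2)) \<partial>lborel)
      \<le> ennreal (param_const (real CARD('d)) CARD('n) p * G) * (ennreal (param_const (real CARD('d)) CARD('m) p * G) * B)"
      unfolding B_def G_def
      by (rule square_function_two_parameters[OF p A V f'_int inv])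
        (unfold A_def, (rule slices[OF a0 order_refl])+)
    also have "\<dots> \<le> ennreal (c1 * G) * (ennreal (c2 * G) * B)"
      using c12 by (intro mult_mono ennreal_leI mult_right_mono) (auto simp: c1_def c2_def)
    also have "\<dots> = ennreal (c1 * G * (c2 * G)) * B"
      using c12 by (simp add: ennreal_mult[symmetric] mult.assoc[symmetric])
    finally show ?thesis .
  qed
  have coef_eq: "haar_coeff f e R = coef f' (fst e) (fst R) (snd e) (snd R)" if R: "R \<in> \<D>1 \<times> \<D>2" for e R
  proof -
    obtain k1 k2 where "fst R \<in> X.cubes k1" "snd R \<in> Y.cubes k2" using R by (auto simp: \<D>)
    then show ?thesis by (rule haar_coeff_eq_coef[OF Linfty_c_integrable(1)[OF f] f' ff'])
  qed
  have pointwise: "enn_powr (square_function p (\<D>1 \<times> \<D>2) W f z) p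
      \<le> (SUP N. ennreal (truncated_square V f' (- int N) (2 * N) z powr (p/2)))"
    if z: "mat_powr (W z) (1 / p) = V z" for z
  proof -
    have "(\<Sum>\<^sub>\<infinity>R\<in>\<D>1 \<times> \<D>2. \<Sum>e\<in>signatures. ennreal ((norm (mat_powr (W z) (1 / p) *v haar_coeff f e R))\<^sup>2 * indicator (rect R) z / measure lebesgue (rect R)))
        = (\<Sum>\<^sub>\<infinity>R\<in>\<D>1 \<times> \<D>2. \<Sum>e\<in>signatures. ennreal ((norm (V z *v coef f' (fst e) (fst R) (snd e) (snd R)))\<^sup>2 * indicator (rect R) z / measure lebesgue (rect R)))"
      by (intro infsum_cong sum.cong refl) (simp only: coef_eq z)
    also have "\<dots> \<le> (SUP N. ennreal (truncated_square V f' (- int N) (2 * N) z))" by (rule square_sum_le_SUP[OF \<D>])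
    finally have le: "(\<Sum>\<^sub>\<infinity>R\<in>\<D>1 \<times> \<D>2. \<Sum>e\<in>signatures. ennreal ((norm (mat_powr (W z) (1 / p) *v haar_coeff f e R))\<^sup>2 * indicator (rect R) z / measure lebesgue (rect R)))
      \<le> (SUP N. ennreal (truncated_square V f' (- int N) (2 * N) z))" .
    have half: "1 / 2 * p = p / 2" by simp
    show ?thesis
      unfolding square_function_def enn_powr_enn_powr half
      by (rule enn_powr_le_SUP[OF le truncated_square_nonneg]) (use p in simp)
  qed
  have "(\<integral>\<^sup>+z. enn_powr (square_function p (\<D>1 \<times> \<D>2) W f z) p \<partial>lebesgue)
      \<le> (\<integral>\<^sup>+z. (SUP N. ennreal (truncated_square V f' (- int N) (2 * N) z powr (p/2))) \<partial>lborel)"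
    unfolding nn_integral_completion
  proof (rule nn_integral_mono_AE)
    show "AE z in lborel. enn_powr (square_function p (\<D>1 \<times> \<D>2) W f z) p
        \<le> (SUP N. ennreal (truncated_square V f' (- int N) (2 * N) z powr (p/2)))"
      using V_eq
    proof (rule AE_mp, intro AE_I2 impI)
      fix z assume "mat_powr (W z) (1 / p) = V z \<and> mat_powr (W z) (- (1 / p)) = Vi z"
      then show "enn_powr (square_function p (\<D>1 \<times> \<D>2) W f z) p
        \<le> (SUP N. ennreal (truncated_square V f' (- int N) (2 * N) z powr (p/2)))" by (elim conjE) (rule pointwise)
    qed
  qed
  also have "\<dots> = (SUP N. \<integral>\<^sup>+z. ennreal (truncated_square V f' (- int N) (2 * N) z powr (p/2)) \<partial>lborel)"
  proof (rule nn_integral_monotone_convergence_SUP)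
    show "incseq (\<lambda>N z. ennreal (truncated_square V f' (- int N) (2 * N) z powr (p/2)))"
    proof (rule monoI, rule le_funI)
      fix M N :: nat and z assume "M \<le> N"
      then have "truncated_square V f' (- int M) (2 * M) z \<le> truncated_square V f' (- int N) (2 * N) z"
        using truncated_square_incseq by (rule monoD[rotated])
      then show "ennreal (truncated_square V f' (- int M) (2 * M) z powr (p/2)) \<le> ennreal (truncated_square V f' (- int N) (2 * N) z powr (p/2))"
        using p by (intro ennreal_leI powr_mono2 truncated_square_nonneg) auto
    qed
    fix N
    have [measurable]: "truncated_square V f' (- int N) (2 * N) \<in> borel_measurable borel" by (rule truncated_square_measurable[OF V(1)])
    show "(\<lambda>z. ennreal (truncated_square V f' (- int N) (2 * N) z powr (p/2))) \<in> borel_measurable lborel" by measurable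
  qed
  also have "\<dots> \<le> ennreal (c1 * G * (c2 * G)) * B" by (intro SUP_least trunc)
  finally have "Lp_norm p (square_function p (\<D>1 \<times> \<D>2) W f) \<le> enn_powr (ennreal (c1 * G * (c2 * G)) * B) (1 / p)"
    unfolding Lp_norm_def using p by (intro enn_powr_mono) auto
  also have "\<dots> = ennreal ((c1 * G * (c2 * G)) powr (1 / p)) * enn_powr B (1 / p)"
    using c12 p by (intro enn_powr_cmult) auto
  also have "enn_powr B (1 / p) = weighted_Lp_norm p W f"
  proof -
    have "(\<integral>\<^sup>+z. enn_powr (ennreal (norm (mat_powr (W z) (1 / p) *v f z))) p \<partial>lebesgue) = B"
      unfolding B_def nn_integral_completion
      by (intro nn_integral_cong_AE) (use V_eq ff' in \<open>auto simp: enn_powr_ennreal\<close>)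
    then show ?thesis by (simp add: weighted_Lp_norm_def Lp_norm_def)
  qed
  also have "(c1 * G * (c2 * G)) powr (1 / p) = biparameter_const (real CARD('d)) CARD('n) CARD('m) p * a powr (2 * gamma_exp p)"
  proof -
    have G: "G = c powr (p * gamma_exp p) * a powr (p * gamma_exp p)"
      using c a0 by (simp add: G_def A_def powr_mult)
    have "c1 * G * (c2 * G) = (c1 * c2 * c powr (p * gamma_exp p) * c powr (p * gamma_exp p)) * (a powr (p * gamma_exp p) * a powr (p * gamma_exp p))"
      by (simp add: G mult_ac)
    also have "a powr (p * gamma_exp p) * a powr (p * gamma_exp p) = a powr (p * (2 * gamma_exp p))"
      by (simp add: powr_add[symmetric] algebra_simps)
    finally have "(c1 * G * (c2 * G)) powr (1 / p) = (c1 * c2 * c powr (p * gamma_exp p) * c powr (p * gamma_exp p)) powr (1 / p) * (a powr (p * (2 * gamma_exp p))) powr (1 / p)"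
      by (simp only: powr_mult)
    also have "(a powr (p * (2 * gamma_exp p))) powr (1 / p) = a powr (2 * gamma_exp p)"
      using p by (simp add: powr_powr)
    finally show ?thesis by (simp add: biparameter_const_def c1_def c2_def c_def)
  qed
  finally show ?thesis
    using a by (simp add: enn_powr_ennreal ennreal_mult biparameter_const_def)
qed

theorem lemma5p2:
  fixes p :: real
  assumes "1 < p"
  shows "\<exists>C::real. 0 \<le> C \<and>
    (\<forall>(\<D>1 :: (real^'n) set set) (\<D>2 :: (real^'m) set set)
       (W :: (real^'n) \<times> (real^'m) \<Rightarrow> complex^'d^'d).
      dyadic_grid \<D>1 \<longrightarrow> dyadic_grid \<D>2 \<longrightarrow> Ap_weight p (\<D>1 \<times> \<D>2) W \<longrightarrow>
      (\<forall>f \<in> Linfty_c.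
        Lp_norm p (square_function p (\<D>1 \<times> \<D>2) W f)
          \<le> ennreal C * enn_powr (Ap_const p (\<D>1 \<times> \<D>2) W) (2 * gamma_exp p)
              * weighted_Lp_norm p W f))"
proof (intro exI conjI allI impI ballI)
  show "0 \<le> biparameter_const (real CARD('d)) CARD('n) CARD('m) p" by (simp add: biparameter_const_def)
  fix \<D>1 :: "(real^'n) set set" and \<D>2 :: "(real^'m) set set" and W :: "(real^'n) \<times> (real^'m) \<Rightarrow> complex^'d^'d"
    and f :: "(real^'n) \<times> (real^'m) \<Rightarrow> complex^'d"
  assume grids: "dyadic_grid \<D>1" "dyadic_grid \<D>2" and W: "Ap_weight p (\<D>1 \<times> \<D>2) W" and f: "f \<in> Linfty_c"
  obtain G1 :: "'n \<Rightarrow> int \<Rightarrow> real set set" where G1: "dyadic_levels G1" "\<D>1 = (\<Union>k. dyadic_levels.cubes G1 k)"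
    by (rule dyadic_grid_levels[OF grids(1)])
  obtain G2 :: "'m \<Rightarrow> int \<Rightarrow> real set set" where G2: "dyadic_levels G2" "\<D>2 = (\<Union>k. dyadic_levels.cubes G2 k)"
    by (rule dyadic_grid_levels[OF grids(2)])
  interpret dyadic_rectangles G1 G2 using G1(1) G2(1) by (rule dyadic_rectangles.intro)
  show "Lp_norm p (square_function p (\<D>1 \<times> \<D>2) W f)
      \<le> ennreal (biparameter_const (real CARD('d)) CARD('n) CARD('m) p) * enn_powr (Ap_const p (\<D>1 \<times> \<D>2) W) (2 * gamma_exp p)
        * weighted_Lp_norm p W f"
    by (rule weighted_square_function_bound[OF assms G1(2) G2(2) W f])
qed

end
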